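(* Let $p$ be a prime and let $\mathcal M=(\mathcal M_K)_{K\in\mathcal K}$ be a $\mathcal G$-family of $\mathbb Z_p[\mathcal G]$-modules. Let $\chi$ be an irreducible rational character of $\mathcal G$, let $\mathcal A_\chi:=\mathbb Z_p[G_\chi]/(P_\chi(\sigma_\chi))$, and put $\mathcal M^{\rm alg}_\chi:=\{x\in\mathcal M_{K_\chi},\ x^{P_\chi(\sigma_\chi)}=1\}$ (an $\mathcal A_\chi$-module) and, for each irreducible $p$-adic character $\varphi\mid\chi$, $\mathcal M^{\rm alg}_\varphi:=\{x\in\mathcal M_{K_\chi},\ x^{P_\varphi(\sigma_\chi)}=1\}$. Then: (i) $\mathcal M^{\rm alg}_\chi=\bigoplus_{\varphi\mid\chi}\mathcal M^{\rm alg}_\varphi$. More generally, if $\mathcal M'_\chi$ is a sub-$\mathcal A_\chi$-module of $\mathcal M^{\rm alg}_\chi$, then $\mathcal M'_\chi=\bigoplus_{\varphi\mid\chi}\mathcal M'_\varphi$, where $\mathcal M'_\varphi=\{x'\in\mathcal M'_\chi,\ x'^{P_\varphi(\sigma_\chi)}=1\}\subseteq\mathcal M^{\rm alg}_\varphi$. (ii) For each $\varphi\mid\chi$, the sub-$\mathcal A_\chi$-module $\mathcal M^{\rm alg}_\varphi$ coincides with $(\mathcal M^{\rm alg}_\chi)^{e^{\varphi_0}}$, where $e^{\varphi_0}$ is the semi-simple idempotent associated with the $p$-adic character $\varphi_0$ above the component $\psi_0$ of prime-to-$p$ order of $\psi\mid\varphi$. (iii) The modules $\mathcal M^{\rm alg}_\varphi$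 and $\mathcal M'_\varphi$ are canonically $\mathbb Z_p[\mu_{g_\chi}]$-modules, by means of the choice of $\psi\mid\varphi$ and the action $\sigma\in G_\chi\mapsto\psi(\sigma)\in\mu_{g_\chi}$.
   Context: $\mathbb Q^{\rm ab}$ is the maximal abelian extension of $\mathbb Q$, $\mathcal G:=\mathrm{Gal}(\mathbb Q^{\rm ab}/\mathbb Q)$, and $\mathcal K$ is the set of finite extensions of $\mathbb Q$ contained in $\mathbb Q^{\rm ab}$. A $\mathcal G$-family of $\mathbb Z_p[\mathcal G]$-modules is a family of (multiplicatively written) $\mathbb Z_p[\mathcal G]$-modules $\mathcal M_K$, $K\in\mathcal K$, with $\mathrm{Gal}(\mathbb Q^{\rm ab}/K)$ acting trivially on $\mathcal M_K$. Let $\psi$ denote degree one characters of finite order of $\mathcal G$ with values in $\overline{\mathbb Q}_p$. An irreducible rational (resp. $p$-adic) character $\chi$ (resp. $\varphi$) is the sum of the conjugates over $\mathbb Q$ (resp. over $\mathbb Q_p$) of some $\psi$; $\psi\mid\varphi\mid\chi$ means that $\psi$ is a term of $\varphi$ and $\varphi$ a term of $\chi$. $g_\chi$ is the order of any $\psi\mid\chi$, $K_\chi$ is the field fixed by $\mathrm{Ker}(\psi)$, $G_\chi=\mathrm{Gal}(K_\chi/\mathbb Q)=\langle\sigma_\chi\rangle$ is cyclic of order $g_\chi$, $\mu_{g_\chi}$ is the group of $g_\chi$-th roots of unity. $P_\chi\in\mathbb Z[X]$ is the $g_\chi$-th cyclotomic polynomial and $P_\varphi(X):=\prod_{\psi\mid\varphi}(X-\psi(\sigma_\chi))\in\mathbb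 Z_p[X]$, so that $P_\chi=\prod_{\varphi\mid\chi}P_\varphi$. Write $\psi=\psi_0\,\psi_p$ with $\psi_0$ of prime-to-$p$ order and $\psi_p$ of $p$-power order, and $G_\chi=G_0\oplus H$ with $G_0$ of prime-to-$p$ order and $H$ the $p$-Sylow subgroup. With $\varphi_0$ the irreducible $p$-adic character having $\psi_0$ as a term, the semi-simple idempotent is $e^{\varphi_0}:=\frac{1}{\#G_0}\sum_{\sigma\in G_0}\varphi_0(\sigma^{-1})\,\sigma\in\mathbb Z_p[G_0]$. *)

theory Defs
  imports
    Complex_Main
    "HOL-Algebra.Algebra"
    "HOL-Algebra.Algebraic_Closure_Type"
    "Berlekamp_Zassenhaus.Finite_Field"
begin

section \<open>The p-adic integers, and an algebraic closure of their fraction field\<close>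

text \<open>The prime \<open>p\<close> is the cardinality of a type \<open>'p\<close> of class \<^class>\<open>prime_card\<close>.
  The ring of \<open>p\<close>-adic integers is the inverse limit of the rings \<open>Z/p^n\<close>, whose elements are
  represented by the integers in \<open>{0..<p^n}\<close>.\<close>

typedef (overloaded) ('p :: prime_card) padic_int =
  "{x :: nat \<Rightarrow> int. \<forall>n. x n \<in> {0..<int CARD('p) ^ n} \<and> x (Suc n) mod int CARD('p) ^ n = x n}"
proof (intro exI CollectI allI conjI)
  fix n
  have "CARD('p) > 0"
    using prime_card[where 'a='p] prime_gt_0_nat by blast
  then show "(\<lambda>_. 0) n \<in> {0..<int CARD('p) ^ n}"
    by simp
qed simp

setup_lifting type_definition_padic_int

lemma prime_card_pow_pos: "int CARD('p::prime_card) ^ n > 0"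
  using prime_card[where 'a='p] prime_gt_0_nat by fastforce

instantiation padic_int :: (prime_card) comm_ring_1
begin

lift_definition zero_padic_int :: "'a padic_int" is "\<lambda>_. 0"
  using prime_card_pow_pos by simp

lift_definition one_padic_int :: "'a padic_int" is "\<lambda>n. 1 mod int CARD('a) ^ n"
  by (auto simp: prime_card_pow_pos mod_mod_cancel)

lift_definition plus_padic_int :: "'a padic_int \<Rightarrow> 'a padic_int \<Rightarrow> 'a padic_int"
  is "\<lambda>x y n. (x n + y n) mod int CARD('a) ^ n"
  by (auto simp: prime_card_pow_pos mod_mod_cancel) (metis mod_add_eq)

lift_definition minus_padic_int :: "'a padic_int \<Rightarrow> 'a padic_int \<Rightarrow> 'a padic_int"
  is "\<lambda>x y n. (x n - y n) mod int CARD('a) ^ n"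
  by (auto simp: prime_card_pow_pos mod_mod_cancel) (metis mod_diff_eq)

lift_definition times_padic_int :: "'a padic_int \<Rightarrow> 'a padic_int \<Rightarrow> 'a padic_int"
  is "\<lambda>x y n. (x n * y n) mod int CARD('a) ^ n"
  by (auto simp: prime_card_pow_pos mod_mod_cancel) (metis mod_mult_eq)

lift_definition uminus_padic_int :: "'a padic_int \<Rightarrow> 'a padic_int"
  is "\<lambda>x n. (- x n) mod int CARD('a) ^ n"
  by (auto simp: prime_card_pow_pos mod_mod_cancel) (metis mod_minus_eq)

instance
proof
  fix a b c :: "'a padic_int"
  show "a + b + c = a + (b + c)"
    by transfer (auto simp: fun_eq_iff mod_simps algebra_simps)
  show "a + b = b + a"
    by transfer (auto simp: fun_eq_iff algebra_simps)
  show "0 + a = a"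
    by transfer (auto simp: fun_eq_iff)
  show "- a + a = 0"
    by transfer (auto simp: fun_eq_iff mod_simps)
  show "a - b = a + - b"
    by transfer (auto simp: fun_eq_iff mod_simps)
  show "a * b * c = a * (b * c)"
    by transfer (auto simp: fun_eq_iff mod_simps algebra_simps)
  show "a * b = b * a"
    by transfer (auto simp: fun_eq_iff algebra_simps)
  show "1 * a = a"
    by transfer (auto simp: fun_eq_iff mod_simps)
  show "(a + b) * c = a * c + b * c"
    by transfer (auto simp: fun_eq_iff mod_simps algebra_simps)
  show "(0 :: 'a padic_int) \<noteq> 1"
  proof transfer
    have "int CARD('a) > 1"
      using prime_card[where 'a='a] prime_gt_1_nat by fastforce
    then have "(0::int) \<noteq> 1 mod int CARD('a) ^ 1"
      by simp
    then show "(\<lambda>_::nat. 0::int) \<noteq> (\<lambda>n. 1 mod int CARD('a) ^ n)"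
      by metis
  qed
qed

end

lemma padic_int_cong:
  fixes x :: "nat \<Rightarrow> int"
  assumes "\<And>n. x (Suc n) mod q ^ n = x n" "n \<le> m" "\<And>n. x n mod q ^ n = x n"
  shows "x m mod q ^ n = x n"
  using \<open>n \<le> m\<close>
proof (induction m rule: dec_induct)
  case (step m)
  have "x (Suc m) mod q ^ n = (x (Suc m) mod q ^ m) mod q ^ n"
    using step by (simp add: mod_mod_cancel le_imp_power_dvd)
  then show ?case
    using step assms(1) by simp
qed (use assms(3) in auto)

instance padic_int :: (prime_card) idom
proof
  fix a b :: "'a padic_int"
  assume "a \<noteq> 0" "b \<noteq> 0"
  then show "a * b \<noteq> 0"
  proof transfer
    fix x y :: "nat \<Rightarrow> int"
    let ?q = "int CARD('a)"
    assume x: "\<forall>n. x n \<in> {0..<?q ^ n} \<and> x (Suc n) mod ?q ^ n = x n"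
      and y: "\<forall>n. y n \<in> {0..<?q ^ n} \<and> y (Suc n) mod ?q ^ n = y n"
      and "x \<noteq> (\<lambda>_. 0)" "y \<noteq> (\<lambda>_. 0)"
    then obtain m n where mn: "x m \<noteq> 0" "y n \<noteq> 0"
      by (auto simp: fun_eq_iff)
    have "x (m + n) mod ?q ^ m = x m"
      by (rule padic_int_cong) (use x in \<open>simp_all del: power_Suc\<close>)
    moreover have "y (m + n) mod ?q ^ n = y n"
      by (rule padic_int_cong) (use y in \<open>simp_all del: power_Suc\<close>)
    ultimately have nd: "\<not> ?q ^ m dvd x (m + n)" "\<not> ?q ^ n dvd y (m + n)"
      using mn by (auto simp: dvd_eq_mod_eq_0)
    have pr: "Factorial_Ring.prime ?q"
      using prime_card_int by blast
    have nz: "x (m + n) \<noteq> 0" "y (m + n) \<noteq> 0"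
      using nd by auto
    have "multiplicity ?q (x (m + n)) < m" "multiplicity ?q (y (m + n)) < n"
      using nd by (meson multiplicity_dvd' not_le)+
    then have "multiplicity ?q (x (m + n) * y (m + n)) < m + n"
      using prime_elem_multiplicity_mult_distrib[of ?q] pr nz by auto
    then have "\<not> ?q ^ (m + n) dvd x (m + n) * y (m + n)"
      using nz pr power_dvd_iff_le_multiplicity[of "x (m + n) * y (m + n)" ?q "m + n"]
      by (metis mult_eq_0_iff not_le not_prime_unit)
    then have "(x (m + n) * y (m + n)) mod ?q ^ (m + n) \<noteq> 0"
      by (simp add: dvd_eq_mod_eq_0)
    then show "(\<lambda>n. (x n * y n) mod ?q ^ n) \<noteq> (\<lambda>_. 0)"
      by metis
  qed
qed

lemma Rep_padic_int_of_nat: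
  "Rep_padic_int (of_nat k :: 'p::prime_card padic_int) n = int k mod int CARD('p) ^ n"
  by (induction k)
     (simp_all add: zero_padic_int.rep_eq plus_padic_int.rep_eq one_padic_int.rep_eq mod_simps)

instance padic_int :: (prime_card) ring_char_0
proof
  show "inj (of_nat :: nat \<Rightarrow> 'a padic_int)"
  proof (rule injI)
    fix j k :: nat
    assume eq: "(of_nat j :: 'a padic_int) = of_nat k"
    define n where "n = max j k"
    have q: "1 < CARD('a)"
      using prime_card[where 'a='a] prime_gt_1_nat by blast
    have "n < CARD('a) ^ n"
      using q by (intro power_gt_expt) simp
    then have n: "int n < int CARD('a) ^ n"
      by (metis of_nat_less_iff of_nat_power)
    have "int j mod int CARD('a) ^ n = int k mod int CARD('a) ^ n"
      using eq by (metis Rep_padic_int_of_nat)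
    moreover have "int j < int CARD('a) ^ n" "int k < int CARD('a) ^ n"
      using n by (auto simp: n_def)
    ultimately show "j = k"
      by simp
  qed
qed

instance fract :: ("{idom, ring_char_0}") field_char_0
proof
  show "inj (of_nat :: nat \<Rightarrow> 'a fract)"
    by (rule injI) (simp add: of_nat_fract eq_fract)
qed

type_synonym 'p padic_closure = "'p padic_int fract alg_closure"

abbreviation \<Omega> :: "'p :: prime_card padic_closure ring"
  where "\<Omega> \<equiv> ring_of_type_algebra"

abbreviation padic_field :: "'p :: prime_card padic_closure set"
  where "padic_field \<equiv> range to_ac"

definition of_padic_int :: "'p :: prime_card padic_int \<Rightarrow> 'p padic_closure"
  where "of_padic_int a = to_ac (Fract a 1)"

definition to_padic_int :: "'p :: prime_card padic_closure \<Rightarrow> 'p padic_int"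
  where "to_padic_int = inv_into UNIV of_padic_int"


section \<open>The maximal abelian extension of the rationals\<close>

abbreviation \<C> :: "complex ring"
  where "\<C> \<equiv> ring_of_type_algebra"

definition galois_group :: "complex set \<Rightarrow> complex set \<Rightarrow> (complex \<Rightarrow> complex) monoid"
  where "galois_group L K = (BijGroup L)
    \<lparr>carrier := {\<sigma> \<in> Bij L. \<sigma> \<in> ring_iso (\<C>\<lparr>carrier := L\<rparr>) (\<C>\<lparr>carrier := L\<rparr>) \<and> (\<forall>x\<in>K. \<sigma> x = x)}\<rparr>"

definition abelian_extension :: "complex set \<Rightarrow> bool"
  where "abelian_extension L \<longleftrightarrow>
    subfield L \<C> \<and> (\<forall>z\<in>L. algebraic z) \<and>
    {z \<in> L. \<forall>\<sigma>\<in>carrier (galois_group L \<rat>). \<sigma> z = z} = \<rat> \<and>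
    comm_group (galois_group L \<rat>)"

definition Qab :: "complex set"
  where "Qab = \<Union>{L. abelian_extension L}"

abbreviation Gab :: "(complex \<Rightarrow> complex) monoid"
  where "Gab \<equiv> galois_group Qab \<rat>"

definition abelian_number_fields :: "complex set set"
  where "abelian_number_fields = {K. subfield K \<C> \<and> K \<subseteq> Qab \<and> ring.finite_dimension \<C> \<rat> K}"

text \<open>An arbitrary prolongation of an element of \<open>Gal(K/Q)\<close> to \<^const>\<open>Qab\<close>. It is only used
  where the result does not depend on the choice, that is, modulo \<open>Gal(Qab/K)\<close>.\<close>

definition prolong :: "complex set \<Rightarrow> (complex \<Rightarrow> complex) \<Rightarrow> (complex \<Rightarrow> complex)"
  where "prolong K \<sigma> = (SOME \<tau>. \<tau> \<in> carrier Gab \<and> restrict \<tau> K = \<sigma>)"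


section \<open>Group rings and families of Galois modules\<close>

definition gr_single :: "'g \<Rightarrow> 'r \<Rightarrow> 'g \<Rightarrow> 'r :: comm_ring_1"
  where "gr_single g a = (\<lambda>x. if x = g then a else 0)"

definition group_ring :: "('g, 'b) monoid_scheme \<Rightarrow> ('g \<Rightarrow> 'r :: comm_ring_1) ring"
  where "group_ring G =
    \<lparr>carrier = {f. finite {x. f x \<noteq> 0} \<and> {x. f x \<noteq> 0} \<subseteq> carrier G},
     monoid.mult = (\<lambda>f h x. \<Sum>y | f y \<noteq> 0. \<Sum>z | h z \<noteq> 0. if y \<otimes>\<^bsub>G\<^esub> z = x then f y * h z else 0),
     monoid.one = gr_single \<one>\<^bsub>G\<^esub> 1,
     ring.zero = (\<lambda>_. 0),
     ring.add = (\<lambda>f h x. f x + h x)\<rparr>"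

lemma group_ring_mult:
  assumes "finite A" "finite B" "{x. f x \<noteq> 0} \<subseteq> A" "{x. h x \<noteq> 0} \<subseteq> B"
  shows "(f \<otimes>\<^bsub>group_ring G\<^esub> h) x =
    (\<Sum>y\<in>A. \<Sum>z\<in>B. if y \<otimes>\<^bsub>G\<^esub> z = x then f y * h z else 0)"
proof -
  have "(\<Sum>z | h z \<noteq> 0. if y \<otimes>\<^bsub>G\<^esub> z = x then f y * h z else 0) =
      (\<Sum>z\<in>B. if y \<otimes>\<^bsub>G\<^esub> z = x then f y * h z else 0)" for y
    using assms by (intro sum.mono_neutral_left) auto
  moreover have "(\<Sum>y | f y \<noteq> 0. \<Sum>z\<in>B. if y \<otimes>\<^bsub>G\<^esub> z = x then f y * h z else 0) =
      (\<Sum>y\<in>A. \<Sum>z\<in>B. if y \<otimes>\<^bsub>G\<^esub> z = x then f y * h z else 0)"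
    using assms by (intro sum.mono_neutral_left) (auto intro!: sum.neutral split: if_splits)
  ultimately show ?thesis
    by (simp add: group_ring_def)
qed

lemma group_ring_mult_supp:
  "{x. (f \<otimes>\<^bsub>group_ring G\<^esub> h) x \<noteq> 0} \<subseteq>
    (\<lambda>(y, z). y \<otimes>\<^bsub>G\<^esub> z) ` ({x. f x \<noteq> 0} \<times> {x. h x \<noteq> 0})"
proof
  fix x
  assume "x \<in> {x. (f \<otimes>\<^bsub>group_ring G\<^esub> h) x \<noteq> 0}"
  then have "(\<Sum>y | f y \<noteq> 0. \<Sum>z | h z \<noteq> 0. if y \<otimes>\<^bsub>G\<^esub> z = x then f y * h z else 0) \<noteq> 0"
    by (simp add: group_ring_def)
  then obtain y z where "f y \<noteq> 0" "h z \<noteq> 0" "y \<otimes>\<^bsub>G\<^esub> z = x"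
    by (smt (verit) mem_Collect_eq sum.not_neutral_contains_not_neutral)
  then show "x \<in> (\<lambda>(y, z). y \<otimes>\<^bsub>G\<^esub> z) ` ({x. f x \<noteq> 0} \<times> {x. h x \<noteq> 0})"
    by (auto intro!: image_eqI[where x="(y, z)"])
qed

lemma cring_group_ring:
  assumes "comm_group G"
  shows "cring (group_ring G :: ('g \<Rightarrow> 'r :: comm_ring_1) ring)"
proof -
  interpret G: comm_group G
    by fact
  let ?R = "group_ring G :: ('g \<Rightarrow> 'r) ring"
  have car: "f \<in> carrier ?R \<longleftrightarrow> finite {x. f x \<noteq> 0} \<and> {x. f x \<noteq> 0} \<subseteq> carrier G" for f
    by (simp add: group_ring_def)
  have add: "f \<oplus>\<^bsub>?R\<^esub> h = (\<lambda>x. f x + h x)" for f h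
    by (simp add: group_ring_def)
  have add_supp: "{x. f x + h x \<noteq> 0} \<subseteq> {x. f x \<noteq> 0} \<union> {x. h x \<noteq> 0}" for f h :: "'g \<Rightarrow> 'r"
    by auto
  have add_closed: "f \<oplus>\<^bsub>?R\<^esub> h \<in> carrier ?R" if "f \<in> carrier ?R" "h \<in> carrier ?R" for f h
    using that add_supp[of f h] unfolding car add
    by (meson finite_Un finite_subset le_sup_iff subset_trans)
  have mult_closed: "f \<otimes>\<^bsub>?R\<^esub> h \<in> carrier ?R" if "f \<in> carrier ?R" "h \<in> carrier ?R" for f h
  proof -
    have "finite ((\<lambda>(y, z). y \<otimes>\<^bsub>G\<^esub> z) ` ({x. f x \<noteq> 0} \<times> {x. h x \<noteq> 0}))"
      "(\<lambda>(y, z). y \<otimes>\<^bsub>G\<^esub> z) ` ({x. f x \<noteq> 0} \<times> {x. h x \<noteq> 0}) \<subseteq> carrier G"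
      using that by (auto simp: car)
    then show ?thesis
      using group_ring_mult_supp[where f=f and h=h and G=G] unfolding car by (meson finite_subset subset_trans)
  qed
  have ag: "abelian_group ?R"
  proof (rule abelian_groupI)
    fix f
    assume "f \<in> carrier ?R"
    then show "\<exists>h\<in>carrier ?R. h \<oplus>\<^bsub>?R\<^esub> f = \<zero>\<^bsub>?R\<^esub>"
      by (intro bexI[of _ "\<lambda>x. - f x"]) (auto simp: group_ring_def)
  qed (use add_closed in \<open>auto simp: group_ring_def algebra_simps\<close>)
  have cm: "comm_monoid ?R"
  proof (rule comm_monoidI)
    show "\<one>\<^bsub>?R\<^esub> \<in> carrier ?R"
      by (auto simp: group_ring_def gr_single_def)
  next
    fix f g h
    assume fgh: "f \<in> carrier ?R" "g \<in> carrier ?R" "h \<in> carrier ?R"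
    define A B C where "A = {x. f x \<noteq> 0}" and "B = {x. g x \<noteq> 0}" and "C = {x. h x \<noteq> 0}"
    have fin: "finite A" "finite B" "finite C"
      and sub: "A \<subseteq> carrier G" "B \<subseteq> carrier G" "C \<subseteq> carrier G"
      using fgh by (auto simp: car A_def B_def C_def)
    define AB BC where "AB = (\<lambda>(y, z). y \<otimes>\<^bsub>G\<^esub> z) ` (A \<times> B)" and "BC = (\<lambda>(y, z). y \<otimes>\<^bsub>G\<^esub> z) ` (B \<times> C)"
    have finABC: "finite AB" "finite BC"
      using fin by (auto simp: AB_def BC_def)
    have mem: "y \<in> A \<Longrightarrow> z \<in> B \<Longrightarrow> y \<otimes>\<^bsub>G\<^esub> z \<in> AB"
      "z \<in> B \<Longrightarrow> w \<in> C \<Longrightarrow> z \<otimes>\<^bsub>G\<^esub> w \<in> BC" for y z w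
      by (auto simp: AB_def BC_def)
    have fg: "(f \<otimes>\<^bsub>?R\<^esub> g) u = (\<Sum>y\<in>A. \<Sum>z\<in>B. if y \<otimes>\<^bsub>G\<^esub> z = u then f y * g z else 0)"
      and gh: "(g \<otimes>\<^bsub>?R\<^esub> h) u = (\<Sum>z\<in>B. \<Sum>w\<in>C. if z \<otimes>\<^bsub>G\<^esub> w = u then g z * h w else 0)" for u
      by (rule group_ring_mult; use fin in \<open>simp add: A_def B_def C_def\<close>)+
    show "f \<otimes>\<^bsub>?R\<^esub> g \<otimes>\<^bsub>?R\<^esub> h = f \<otimes>\<^bsub>?R\<^esub> (g \<otimes>\<^bsub>?R\<^esub> h)"
    proof
      fix x
      have "(f \<otimes>\<^bsub>?R\<^esub> g \<otimes>\<^bsub>?R\<^esub> h) x =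
          (\<Sum>u\<in>AB. \<Sum>w\<in>C. if u \<otimes>\<^bsub>G\<^esub> w = x then (f \<otimes>\<^bsub>?R\<^esub> g) u * h w else 0)"
        using finABC fin group_ring_mult_supp[where f=f and h=g and G=G]
        by (intro group_ring_mult) (auto simp: AB_def A_def B_def C_def)
      also have "\<dots> = (\<Sum>u\<in>AB. \<Sum>w\<in>C. \<Sum>y\<in>A. \<Sum>z\<in>B.
          if y \<otimes>\<^bsub>G\<^esub> z = u then (if u \<otimes>\<^bsub>G\<^esub> w = x then f y * g z * h w else 0) else 0)"
        by (intro sum.cong refl) (simp add: fg sum_distrib_right if_distrib[of "\<lambda>t. t * _"] cong: if_cong)
      also have "\<dots> = (\<Sum>w\<in>C. \<Sum>y\<in>A. \<Sum>z\<in>B. \<Sum>u\<in>AB.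
          if y \<otimes>\<^bsub>G\<^esub> z = u then (if u \<otimes>\<^bsub>G\<^esub> w = x then f y * g z * h w else 0) else 0)"
        by (rule trans[OF sum.swap], rule sum.cong[OF refl],
            rule trans[OF sum.swap], rule sum.cong[OF refl], rule sum.swap)
      also have "\<dots> = (\<Sum>w\<in>C. \<Sum>y\<in>A. \<Sum>z\<in>B.
          if y \<otimes>\<^bsub>G\<^esub> z \<otimes>\<^bsub>G\<^esub> w = x then f y * g z * h w else 0)"
        by (intro sum.cong refl) (simp add: sum.delta' finABC mem)
      also have "\<dots> = (\<Sum>y\<in>A. \<Sum>z\<in>B. \<Sum>w\<in>C.
          if y \<otimes>\<^bsub>G\<^esub> (z \<otimes>\<^bsub>G\<^esub> w) = x then f y * g z * h w else 0)"
        by (rule trans[OF sum.swap], rule sum.cong[OF refl],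
            rule trans[OF sum.swap], rule sum.cong[OF refl], rule sum.cong[OF refl])
           (use sub in \<open>simp add: G.m_assoc subset_iff\<close>)
      finally have L: "(f \<otimes>\<^bsub>?R\<^esub> g \<otimes>\<^bsub>?R\<^esub> h) x = \<dots>" .
      have "(f \<otimes>\<^bsub>?R\<^esub> (g \<otimes>\<^bsub>?R\<^esub> h)) x =
          (\<Sum>y\<in>A. \<Sum>v\<in>BC. if y \<otimes>\<^bsub>G\<^esub> v = x then f y * (g \<otimes>\<^bsub>?R\<^esub> h) v else 0)"
        using finABC fin group_ring_mult_supp[where f=g and h=h and G=G]
        by (intro group_ring_mult) (auto simp: BC_def A_def B_def C_def)
      also have "\<dots> = (\<Sum>y\<in>A. \<Sum>v\<in>BC. \<Sum>z\<in>B. \<Sum>w\<in>C.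
          if z \<otimes>\<^bsub>G\<^esub> w = v then (if y \<otimes>\<^bsub>G\<^esub> v = x then f y * g z * h w else 0) else 0)"
        by (intro sum.cong refl)
           (simp add: gh sum_distrib_left if_distrib[of "\<lambda>t. _ * t"] mult.assoc cong: if_cong)
      also have "\<dots> = (\<Sum>y\<in>A. \<Sum>z\<in>B. \<Sum>w\<in>C. \<Sum>v\<in>BC.
          if z \<otimes>\<^bsub>G\<^esub> w = v then (if y \<otimes>\<^bsub>G\<^esub> v = x then f y * g z * h w else 0) else 0)"
        by (rule sum.cong[OF refl], rule trans[OF sum.swap], rule sum.cong[OF refl],
            rule sum.swap)
      also have "\<dots> = (\<Sum>y\<in>A. \<Sum>z\<in>B. \<Sum>w\<in>C.
          if y \<otimes>\<^bsub>G\<^esub> (z \<otimes>\<^bsub>G\<^esub> w) = x then f y * g z * h w else 0)"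
        by (intro sum.cong refl) (simp add: sum.delta' finABC mem)
      finally show "(f \<otimes>\<^bsub>?R\<^esub> g \<otimes>\<^bsub>?R\<^esub> h) x = (f \<otimes>\<^bsub>?R\<^esub> (g \<otimes>\<^bsub>?R\<^esub> h)) x"
        using L by simp
    qed
  next
    fix f
    assume f: "f \<in> carrier ?R"
    show "\<one>\<^bsub>?R\<^esub> \<otimes>\<^bsub>?R\<^esub> f = f"
    proof
      fix x
      have "(\<one>\<^bsub>?R\<^esub> \<otimes>\<^bsub>?R\<^esub> f) x = (\<Sum>y\<in>{\<one>\<^bsub>G\<^esub>}. \<Sum>z | f z \<noteq> 0.
          if y \<otimes>\<^bsub>G\<^esub> z = x then \<one>\<^bsub>?R\<^esub> y * f z else 0)"
        using f by (intro group_ring_mult) (auto simp: car group_ring_def gr_single_def)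
      also have "\<dots> = (\<Sum>z | f z \<noteq> 0. if z = x then f z else 0)"
        using f by (auto simp: car group_ring_def gr_single_def subset_iff intro!: sum.cong)
      also have "\<dots> = f x"
        using f by (auto simp: car sum.delta)
      finally show "(\<one>\<^bsub>?R\<^esub> \<otimes>\<^bsub>?R\<^esub> f) x = f x" .
    qed
  next
    fix f h
    assume fh: "f \<in> carrier ?R" "h \<in> carrier ?R"
    show "f \<otimes>\<^bsub>?R\<^esub> h = h \<otimes>\<^bsub>?R\<^esub> f"
    proof
      fix x
      have "(\<Sum>y | f y \<noteq> 0. \<Sum>z | h z \<noteq> 0. if y \<otimes>\<^bsub>G\<^esub> z = x then f y * h z else 0) =
          (\<Sum>y | f y \<noteq> 0. \<Sum>z | h z \<noteq> 0. if z \<otimes>\<^bsub>G\<^esub> y = x then h z * f y else 0)"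
        using fh by (intro sum.cong refl) (auto simp: car subset_iff G.m_comm mult.commute)
      also have "\<dots> = (\<Sum>z | h z \<noteq> 0. \<Sum>y | f y \<noteq> 0. if z \<otimes>\<^bsub>G\<^esub> y = x then h z * f y else 0)"
        by (rule sum.swap)
      finally show "(f \<otimes>\<^bsub>?R\<^esub> h) x = (h \<otimes>\<^bsub>?R\<^esub> f) x"
        by (simp add: group_ring_def)
    qed
  qed (fact mult_closed)
  show ?thesis
  proof (rule cringI[OF ag cm])
    fix f g h
    assume fgh: "f \<in> carrier ?R" "g \<in> carrier ?R" "h \<in> carrier ?R"
    show "(f \<oplus>\<^bsub>?R\<^esub> g) \<otimes>\<^bsub>?R\<^esub> h = f \<otimes>\<^bsub>?R\<^esub> h \<oplus>\<^bsub>?R\<^esub> g \<otimes>\<^bsub>?R\<^esub> h"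
    proof
      fix x
      define A C where "A = {x. f x \<noteq> 0} \<union> {x. g x \<noteq> 0}" and "C = {x. h x \<noteq> 0}"
      have fin: "finite A" "finite C"
        using fgh by (auto simp: car A_def C_def)
      have "((f \<oplus>\<^bsub>?R\<^esub> g) \<otimes>\<^bsub>?R\<^esub> h) x =
          (\<Sum>y\<in>A. \<Sum>z\<in>C. if y \<otimes>\<^bsub>G\<^esub> z = x then (f \<oplus>\<^bsub>?R\<^esub> g) y * h z else 0)"
        using fin add_supp by (intro group_ring_mult) (auto simp: A_def C_def add)
      also have "\<dots> = (\<Sum>y\<in>A. \<Sum>z\<in>C. (if y \<otimes>\<^bsub>G\<^esub> z = x then f y * h z else 0) +
          (if y \<otimes>\<^bsub>G\<^esub> z = x then g y * h z else 0))"
        by (intro sum.cong refl) (simp add: add algebra_simps)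
      also have "\<dots> = (f \<otimes>\<^bsub>?R\<^esub> h) x + (g \<otimes>\<^bsub>?R\<^esub> h) x"
        using fin by (simp add: sum.distrib group_ring_mult[of A C] A_def C_def)
      finally show "((f \<oplus>\<^bsub>?R\<^esub> g) \<otimes>\<^bsub>?R\<^esub> h) x = (f \<otimes>\<^bsub>?R\<^esub> h \<oplus>\<^bsub>?R\<^esub> g \<otimes>\<^bsub>?R\<^esub> h) x"
        by (simp add: add)
    qed
  qed
qed

definition gr_poly ::
    "('g, 'b) monoid_scheme \<Rightarrow> 'r :: comm_ring_1 poly \<Rightarrow> 'g \<Rightarrow> 'g \<Rightarrow> 'r"
  where "gr_poly G P \<sigma> =
    (\<Oplus>\<^bsub>group_ring G\<^esub>i\<in>{..Polynomial.degree P}. gr_single (\<sigma> [^]\<^bsub>G\<^esub> i) (Polynomial.coeff P i))"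

text \<open>Modules are written additively: what is written \<open>x^a\<close> in multiplicative notation is
  \<open>a \<odot> x\<close>, and the neutral element is \<open>\<zero>\<close>.\<close>

type_synonym ('p, 'm) gal_module = "((complex \<Rightarrow> complex) \<Rightarrow> 'p padic_int, 'm) module"

definition galois_family :: "(complex set \<Rightarrow> ('p :: prime_card, 'm) gal_module) \<Rightarrow> bool"
  where "galois_family M \<longleftrightarrow>
    (\<forall>K\<in>abelian_number_fields.
       Module.module (group_ring Gab) (M K) \<and>
       (\<forall>\<tau>\<in>carrier (galois_group Qab K). \<forall>x\<in>carrier (M K). gr_single \<tau> 1 \<odot>\<^bsub>M K\<^esub> x = x))"

definition with_scalars ::
    "('a, 'm, 'z) module_scheme \<Rightarrow> 'm set \<Rightarrow> ('s \<Rightarrow> 'm \<Rightarrow> 'm) \<Rightarrow> ('s, 'm) module"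
  where "with_scalars N A s =
    \<lparr>carrier = A, monoid.mult = monoid.mult N, monoid.one = monoid.one N,
     ring.zero = ring.zero N, ring.add = ring.add N, module.smult = s\<rparr>"

text \<open>\<open>M K\<close> as a module over the group ring of \<open>Gal(K/Q)\<close>, which is meaningful because
  \<open>Gal(Qab/K)\<close> acts trivially.\<close>

definition level_module ::
    "(complex set \<Rightarrow> ('p :: prime_card, 'm) gal_module) \<Rightarrow> complex set \<Rightarrow> ('p, 'm) gal_module"
  where "level_module M K = with_scalars (M K) (carrier (M K))
    (\<lambda>a x. \<Oplus>\<^bsub>M K\<^esub>\<sigma>\<in>carrier (galois_group K \<rat>). gr_single (prolong K \<sigma>) (a \<sigma>) \<odot>\<^bsub>M K\<^esub> x)"

definition annihilated :: "('a, 'm, 'z) module_scheme \<Rightarrow> 'm set \<Rightarrow> 'a \<Rightarrow> 'm set"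
  where "annihilated N A a = {x \<in> A. a \<odot>\<^bsub>N\<^esub> x = \<zero>\<^bsub>N\<^esub>}"

text \<open>The module structure over \<open>R Quot I\<close> on a part of \<open>N\<close> killed by \<open>I\<close>:
  a residue class acts through any of its elements.\<close>

definition quot_module :: "('a, 'm, 'z) module_scheme \<Rightarrow> 'm set \<Rightarrow> ('a set, 'm) module"
  where "quot_module N A = with_scalars N A (\<lambda>c x. (SOME a. a \<in> c) \<odot>\<^bsub>N\<^esub> x)"

definition internal_direct_sum ::
    "('a, 'b) ring_scheme \<Rightarrow> ('a, 'm, 'z) module_scheme \<Rightarrow> 'i set \<Rightarrow> ('i \<Rightarrow> 'm set) \<Rightarrow> bool"
  where "internal_direct_sum R N I S \<longleftrightarrow>
    finite I \<and> (\<forall>i\<in>I. submodule (S i) R N) \<and>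
    bij_betw (\<lambda>f. \<Oplus>\<^bsub>N\<^esub>i\<in>I. f i) (\<Pi>\<^sub>E i\<in>I. S i) (carrier N)"


section \<open>Characters\<close>

type_synonym 'p gal_char = "(complex \<Rightarrow> complex) \<Rightarrow> 'p padic_closure"

text \<open>Characters of the profinite group \<^const>\<open>Gab\<close> are continuous; for a character of finite
  order this means that its kernel is open. Outside \<^const>\<open>Gab\<close> a character is undefined.\<close>

definition linear_chars :: "'p :: prime_card gal_char set"
  where "linear_chars = {\<psi> \<in> hom Gab (mult_of \<Omega>) \<inter> extensional (carrier Gab).
    (\<exists>n>0. \<forall>\<sigma>\<in>carrier Gab. \<psi> \<sigma> ^ n = 1) \<and>
    (\<exists>K\<in>abelian_number_fields. carrier (galois_group Qab K) \<subseteq> kernel Gab (mult_of \<Omega>) \<psi>)}"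

definition char_order :: "'p :: prime_card gal_char \<Rightarrow> nat"
  where "char_order \<psi> = (LEAST n. n > 0 \<and> (\<forall>\<sigma>\<in>carrier Gab. \<psi> \<sigma> ^ n = 1))"

text \<open>The conjugates of \<open>\<psi>\<close> over \<open>k\<close> are its images under the \<open>k\<close>-embeddings of the field
  \<open>k(\<psi>)\<close> of its values.\<close>

definition conjugates :: "'p :: prime_card padic_closure set \<Rightarrow> 'p gal_char \<Rightarrow> 'p gal_char set"
  where "conjugates k \<psi> = {\<psi>' \<in> linear_chars.
    \<exists>\<tau> \<in> Ring.ring_hom (\<Omega>\<lparr>carrier := generate_field \<Omega> (k \<union> \<psi> ` carrier Gab)\<rparr>) \<Omega>.
      (\<forall>a\<in>k. \<tau> a = a) \<and> (\<forall>\<sigma>\<in>carrier Gab. \<psi>' \<sigma> = \<tau> (\<psi> \<sigma>))}"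

definition conj_sum :: "'p :: prime_card padic_closure set \<Rightarrow> 'p gal_char \<Rightarrow> 'p gal_char"
  where "conj_sum k \<psi> = (\<lambda>\<sigma>\<in>carrier Gab. \<Sum>\<psi>'\<in>conjugates k \<psi>. \<psi>' \<sigma>)"

text \<open>Irreducible characters over \<open>k\<close>: rational ones for \<open>k = \<rat>\<close>, \<open>p\<close>-adic ones for
  \<open>k =\<close> \<^const>\<open>padic_field\<close>.\<close>

definition irr_chars :: "'p :: prime_card padic_closure set \<Rightarrow> 'p gal_char set"
  where "irr_chars k = conj_sum k ` linear_chars"

definition char_terms :: "'p :: prime_card padic_closure set \<Rightarrow> 'p gal_char \<Rightarrow> 'p gal_char set"
  where "char_terms k \<theta> = {\<psi> \<in> linear_chars. conj_sum k \<psi> = \<theta>}"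

definition padic_components :: "'p :: prime_card gal_char \<Rightarrow> 'p gal_char set"
  where "padic_components chi =
    {phi \<in> irr_chars padic_field. char_terms padic_field phi \<inter> char_terms \<rat> chi \<noteq> {}}"

text \<open>The order and the field of a rational character are those of any of its terms.\<close>

definition rat_order :: "'p :: prime_card gal_char \<Rightarrow> nat"
  where "rat_order chi = char_order (SOME \<psi>. \<psi> \<in> char_terms \<rat> chi)"

definition rat_field :: "'p :: prime_card gal_char \<Rightarrow> complex set"
  where "rat_field chi =
    {z \<in> Qab. \<forall>\<sigma> \<in> kernel Gab (mult_of \<Omega>) (SOME \<psi>. \<psi> \<in> char_terms \<rat> chi). \<sigma> z = z}"

abbreviation rat_group :: "'p :: prime_card gal_char \<Rightarrow> (complex \<Rightarrow> complex) monoid"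
  where "rat_group chi \<equiv> galois_group (rat_field chi) \<rat>"

text \<open>The value at \<open>\<sigma> \<in> G_chi\<close> of a character which is trivial on \<open>Gal(Qab/K_chi)\<close>.\<close>

definition value_at :: "'p :: prime_card gal_char \<Rightarrow> 'p gal_char \<Rightarrow> (complex \<Rightarrow> complex) \<Rightarrow> 'p padic_closure"
  where "value_at chi \<theta> \<sigma> = \<theta> (prolong (rat_field chi) \<sigma>)"

definition cyclotomic :: "nat \<Rightarrow> int poly"
  where "cyclotomic n = (THE P. map_poly of_int P =
    (\<Prod>\<zeta> | \<zeta> ^ n = 1 \<and> (\<forall>m. 0 < m \<and> m < n \<longrightarrow> \<zeta> ^ m \<noteq> 1). [:- \<zeta>, 1 :: complex:]))"

definition rat_poly :: "'p :: prime_card gal_char \<Rightarrow> 'p padic_int poly"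
  where "rat_poly chi = map_poly of_int (cyclotomic (rat_order chi))"

definition padic_poly ::
    "'p :: prime_card gal_char \<Rightarrow> (complex \<Rightarrow> complex) \<Rightarrow> 'p gal_char \<Rightarrow> 'p padic_int poly"
  where "padic_poly chi \<sigma> phi =
    map_poly to_padic_int (\<Prod>\<psi>\<in>char_terms padic_field phi. [:- value_at chi \<psi> \<sigma>, 1:])"

definition semisimple_idempotent ::
    "'p :: prime_card gal_char \<Rightarrow> (complex \<Rightarrow> complex) set \<Rightarrow> 'p gal_char \<Rightarrow>
      (complex \<Rightarrow> complex) \<Rightarrow> 'p padic_int"
  where "semisimple_idempotent chi G\<^sub>0 phi\<^sub>0 = (\<lambda>\<sigma>. if \<sigma> \<in> G\<^sub>0
    then to_padic_int (value_at chi phi\<^sub>0 (inv\<^bsub>rat_group chi\<^esub> \<sigma>) / of_nat (card G\<^sub>0)) else 0)"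


section \<open>The modules attached to the characters\<close>

text \<open>Below, \<open>\<sigma>\<close> is the chosen generator of \<open>G_chi\<close>.\<close>

definition A_ring :: "'p :: prime_card gal_char \<Rightarrow> (complex \<Rightarrow> complex) \<Rightarrow>
    ((complex \<Rightarrow> complex) \<Rightarrow> 'p padic_int) set ring"
  where "A_ring chi \<sigma> = group_ring (rat_group chi) Quot
    (PIdl\<^bsub>group_ring (rat_group chi)\<^esub> (gr_poly (rat_group chi) (rat_poly chi) \<sigma>))"

abbreviation char_module ::
    "(complex set \<Rightarrow> ('p :: prime_card, 'm) gal_module) \<Rightarrow> 'p gal_char \<Rightarrow> ('p, 'm) gal_module"
  where "char_module M chi \<equiv> level_module M (rat_field chi)"

definition alg_rat :: "(complex set \<Rightarrow> ('p :: prime_card, 'm) gal_module) \<Rightarrow> 'p gal_char \<Rightarrow>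
    (complex \<Rightarrow> complex) \<Rightarrow> 'm set"
  where "alg_rat M chi \<sigma> = annihilated (char_module M chi) (carrier (char_module M chi))
    (gr_poly (rat_group chi) (rat_poly chi) \<sigma>)"

text \<open>The part of \<open>A\<close> killed by \<open>P_phi(\<sigma>)\<close>; taking \<open>A = carrier (char_module M chi)\<close> yields
  \<open>M_phi^alg\<close>.\<close>

definition padic_part :: "(complex set \<Rightarrow> ('p :: prime_card, 'm) gal_module) \<Rightarrow> 'p gal_char \<Rightarrow>
    (complex \<Rightarrow> complex) \<Rightarrow> 'm set \<Rightarrow> 'p gal_char \<Rightarrow> 'm set"
  where "padic_part M chi \<sigma> A phi =
    annihilated (char_module M chi) A (gr_poly (rat_group chi) (padic_poly chi \<sigma> phi) \<sigma>)"

abbreviation alg_padic :: "(complex set \<Rightarrow> ('p :: prime_card, 'm) gal_module) \<Rightarrow> 'p gal_char \<Rightarrow>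
    (complex \<Rightarrow> complex) \<Rightarrow> 'p gal_char \<Rightarrow> 'm set"
  where "alg_padic M chi \<sigma> \<equiv> padic_part M chi \<sigma> (carrier (char_module M chi))"

text \<open>The subring of the algebraic closure generated by the \<open>p\<close>-adic integers and the \<open>g\<close>-th roots
  of unity.\<close>

definition padic_int_mu :: "nat \<Rightarrow> 'p :: prime_card padic_closure ring"
  where "padic_int_mu g = \<Omega>\<lparr>carrier := generate_ring \<Omega> (range of_padic_int \<union> {z. z ^ g = 1})\<rparr>"

text \<open>The scalar multiplication \<open>s\<close> makes \<open>A\<close> a module over \<^term>\<open>padic_int_mu (rat_order chi)\<close>,
  extends the given action of the \<open>p\<close>-adic integers, and lets \<open>\<psi>(\<tau>)\<close> act as \<open>\<tau> \<in> G_chi\<close> does.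
  It is taken undefined outside its domain, so that unique existence is meaningful.\<close>

definition mu_structure :: "(complex set \<Rightarrow> ('p :: prime_card, 'm) gal_module) \<Rightarrow> 'p gal_char \<Rightarrow>
    'p gal_char \<Rightarrow> 'm set \<Rightarrow> ('p padic_closure \<Rightarrow> 'm \<Rightarrow> 'm) \<Rightarrow> bool"
  where "mu_structure M chi \<psi> A s \<longleftrightarrow>
    s \<in> carrier (padic_int_mu (rat_order chi)) \<rightarrow>\<^sub>E (A \<rightarrow>\<^sub>E A) \<and>
    Module.module (padic_int_mu (rat_order chi)) (with_scalars (char_module M chi) A s) \<and>
    (\<forall>a. \<forall>x\<in>A. s (of_padic_int a) x = gr_single \<one>\<^bsub>rat_group chi\<^esub> a \<odot>\<^bsub>char_module M chi\<^esub> x) \<and>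
    (\<forall>\<tau>\<in>carrier (rat_group chi). \<forall>x\<in>A.
       s (value_at chi \<psi> \<tau>) x = gr_single \<tau> 1 \<odot>\<^bsub>char_module M chi\<^esub> x)"

end

theory Submission
  imports Defs "HOL-Number_Theory.Residues"
begin

text \<open>Let \<open>g\<close> be the order of \<open>chi\<close> and \<open>\<sigma>\<close> a generator of \<open>G_chi\<close>. A character of \<open>G_chi\<close> is determined by
  its value at \<open>\<sigma>\<close>. Since the \<open>g\<close>-th cyclotomic polynomial is irreducible over the rationals
  (\<open>cyclotomic_conjugates\<close>), the terms of \<open>chi\<close> are all the characters whose value at \<open>\<sigma>\<close> is a
  primitive \<open>g\<close>-th root of unity, and the components \<open>phi\<close> correspond to the orbits of the
  automorphisms over \<open>Q_p\<close> on these roots (\<open>char_terms_rat\<close>, \<open>component_terms\<close>). So \<open>P_phi\<close> is the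
  polynomial with simple roots on one orbit, and \<open>P_chi\<close> is the product of the \<open>P_phi\<close>.

  If \<open>p\<close> divides \<open>g\<close>, a factorization over \<open>Q_p\<close> into distinct irreducible factors need not
  decompose modules over \<open>Z_p\<close>: the Bezout coefficients may have denominators. What makes the theorem
  true is total ramification. Two primitive \<open>g\<close>-th roots of unity are conjugate over \<open>Q_p\<close> as soon as
  their parts of order prime to \<open>p\<close> are (\<open>padic_conj_iff_prime_to_p_part\<close>), so membership in an
  orbit is detected on roots of unity of an order \<open>m\<close> prime to \<open>p\<close>. There the indicator function
  of an orbit is a Fourier sum whose coefficients are traces divided by \<open>m\<close>, and \<open>m\<close> is a unit. Hence
  there are \<open>E_phi \<in> Z_p[X]\<close> with value 1 at the roots of \<open>P_phi\<close> and 0 at the other primitive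
  roots (\<open>idempotent_polynomial\<close>). Divisibility in \<open>Z_p[X]\<close> by a monic polynomial with simple roots is
  vanishing at those roots (\<open>vanishing_dvd\<close>), so \<open>P_phi\<close> divides \<open>E_phi - 1\<close>, and \<open>P_chi\<close> divides
  \<open>P_phi * E_phi\<close> and \<open>(\<Sum>phi. E_phi) - 1\<close>. The three parts follow.

  On a submodule killed by \<open>P_chi(\<sigma>)\<close> the operators \<open>E_phi(\<sigma>)\<close> are complementary projections
  onto the parts killed by \<open>P_phi(\<sigma>)\<close> (\<open>decomposition\<close>).

  By orthogonality on \<open>G0\<close> the semi-simple idempotent takes at a term \<open>\<psi>'\<close> of \<open>chi\<close> the value 1 if \<open>\<psi>'\<close>
  agrees on \<open>G0\<close> with a conjugate of \<open>\<psi>0\<close>, and 0 otherwise; by total ramification the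
  first case means that \<open>\<psi>'\<close> is a term of \<open>phi\<close> (\<open>semisimple_value\<close>). The idempotent is therefore
  another polynomial in \<open>\<sigma>\<close> with the values of \<open>E_phi\<close>, and any such polynomial has the same
  image (\<open>projector_image\<close>).

  Evaluation at \<open>\<psi>(\<sigma>)\<close> maps \<open>Z_p[X]\<close> onto \<open>Z_p[\<mu>_g]\<close> with kernel generated by \<open>P_phi\<close>
  (\<open>carrier_padic_int_mu\<close>, \<open>vanishing_conj\<close>), so the action of \<open>Z_p[X]\<close> through \<open>\<sigma>\<close> on a
  module killed by \<open>P_phi(\<sigma>)\<close> factors in exactly one way (\<open>unique_mu_structure\<close>).

  The arithmetic of roots of unity rests on two facts about a subring \<open>R\<close> with a prime \<open>q\<close>, applied to
  \<open>Z_p\<close> and to the localizations of the integers: the inverse of \<open>q\<close> never lies in \<open>R[z]\<close> for a root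
  of unity \<open>z\<close>, by Nakayama's lemma, and \<open>f(z)^q\<close> is congruent to \<open>f(z^q)\<close> modulo \<open>q\<close>. They
  take the place of valuations on extension fields.\<close>

section \<open>Subfields, embeddings and their extension\<close>

text \<open>Subrings and subfields as sets of elements of a type. Together with \<open>ring_hom_on\<close> below they let
  fields of different types be related by maps between the types, so that algebraic closures and
  their subfields are treated alike.\<close>

locale subring_on =
  fixes R :: "'a :: field set"
  assumes zero_in [simp, intro]: "0 \<in> R" and one_in [simp, intro]: "1 \<in> R"
    and add_in [intro]: "\<And>x y. x \<in> R \<Longrightarrow> y \<in> R \<Longrightarrow> x + y \<in> R"
    and uminus_in [intro]: "\<And>x. x \<in> R \<Longrightarrow> - x \<in> R"
    and mult_in [intro]: "\<And>x y. x \<in> R \<Longrightarrow> y \<in> R \<Longrightarrow> x * y \<in> R"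
begin

lemma diff_in [intro]: "x \<in> R \<Longrightarrow> y \<in> R \<Longrightarrow> x - y \<in> R"
  using add_in[of x "- y"] uminus_in[of y] by simp

lemma sum_in [intro]: "(\<And>i. i \<in> A \<Longrightarrow> f i \<in> R) \<Longrightarrow> sum f A \<in> R"
  by (induction A rule: infinite_finite_induct) auto

lemma prod_in [intro]: "(\<And>i. i \<in> A \<Longrightarrow> f i \<in> R) \<Longrightarrow> prod f A \<in> R"
  by (induction A rule: infinite_finite_induct) auto

lemma power_in [intro]: "x \<in> R \<Longrightarrow> x ^ n \<in> R"
  by (induction n) auto

lemma of_nat_in [simp, intro]: "of_nat n \<in> R"
  by (induction n) auto

lemma of_int_in [simp, intro]: "of_int n \<in> R"
  by (cases n) auto

end

locale subfield_on = subring_on F for F :: "'a :: field set" +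
  assumes inverse_in [intro]: "\<And>x. x \<in> F \<Longrightarrow> inverse x \<in> F"
begin

lemma divide_in [intro]: "x \<in> F \<Longrightarrow> y \<in> F \<Longrightarrow> x / y \<in> F"
  by (simp add: divide_inverse mult_in inverse_in)

end

lemma subfield_on_UNIV: "subfield_on UNIV"
  by standard auto

definition polys :: "'a :: comm_ring_1 set \<Rightarrow> 'a poly set"
  where "polys R = {p. \<forall>i. coeff p i \<in> R}"

lemma polys_UNIV [simp]: "polys UNIV = UNIV"
  by (auto simp: polys_def)

lemma polysD: "p \<in> polys R \<Longrightarrow> coeff p i \<in> R"
  by (simp add: polys_def)

lemma polys_mono: "R \<subseteq> S \<Longrightarrow> polys R \<subseteq> polys S"
  by (auto simp: polys_def)

context subring_on
begin

lemma polys_0 [simp, intro]: "0 \<in> polys R"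
  by (auto simp: polys_def)

lemma polys_pCons [intro]: "a \<in> R \<Longrightarrow> p \<in> polys R \<Longrightarrow> pCons a p \<in> polys R"
  by (auto simp: polys_def coeff_pCons split: nat.splits)

lemma polys_1 [simp, intro]: "1 \<in> polys R"
  by (auto simp: polys_def)

lemma polys_monom [intro]: "a \<in> R \<Longrightarrow> monom a n \<in> polys R"
  by (auto simp: polys_def)

lemma polys_add [intro]: "p \<in> polys R \<Longrightarrow> q \<in> polys R \<Longrightarrow> p + q \<in> polys R"
  by (auto simp: polys_def)

lemma polys_uminus [intro]: "p \<in> polys R \<Longrightarrow> - p \<in> polys R"
  by (auto simp: polys_def)

lemma polys_diff [intro]: "p \<in> polys R \<Longrightarrow> q \<in> polys R \<Longrightarrow> p - q \<in> polys R"
  by (auto simp: polys_def)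

lemma polys_mult [intro]: "p \<in> polys R \<Longrightarrow> q \<in> polys R \<Longrightarrow> p * q \<in> polys R"
  by (auto simp: polys_def coeff_mult intro!: sum_in mult_in)

lemma polys_smult [intro]: "a \<in> R \<Longrightarrow> p \<in> polys R \<Longrightarrow> smult a p \<in> polys R"
  by (auto simp: polys_def)

lemma polys_sum [intro]: "(\<And>i. i \<in> A \<Longrightarrow> f i \<in> polys R) \<Longrightarrow> sum f A \<in> polys R"
  by (induction A rule: infinite_finite_induct) auto

lemma polys_prod [intro]: "(\<And>i. i \<in> A \<Longrightarrow> f i \<in> polys R) \<Longrightarrow> prod f A \<in> polys R"
  by (induction A rule: infinite_finite_induct) auto

lemma polys_power [intro]: "p \<in> polys R \<Longrightarrow> p ^ n \<in> polys R"
  by (induction n) auto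

lemma poly_in [intro]: "p \<in> polys R \<Longrightarrow> x \<in> R \<Longrightarrow> poly p x \<in> R"
  by (auto simp: polys_def poly_altdef intro!: sum_in mult_in)

text \<open>Over a subring, where leading coefficients need not be invertible, division with remainder
  still works for a monic divisor.\<close>

lemma polys_monic_division:
  assumes "q \<in> polys R" "lead_coeff q = 1" "p \<in> polys R"
  obtains d r where "d \<in> polys R" "r \<in> polys R" "p = q * d + r" "r = 0 \<or> degree r < degree q"
proof -
  have "\<exists>d\<in>polys R. \<exists>r\<in>polys R. p = q * d + r \<and> (r = 0 \<or> degree r < degree q)"
    using assms(3)
  proof (induction "degree p" arbitrary: p rule: less_induct)
    case less
    show ?case
    proof (cases "degree p < degree q \<or> degree p = 0")
      case True
      show ?thesis
      proof (cases "degree p < degree q")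
        case True
        then show ?thesis
          using less.prems by (intro bexI[of _ 0] bexI[of _ p]) auto
      next
        case False
        with True have "degree p = 0" "degree q = 0"
          by auto
        with assms(2) have "q = 1"
          by (metis degree_eq_zeroE lead_coeff_pCons(2) one_pCons)
        then show ?thesis
          using less.prems by (intro bexI[of _ p] bexI[of _ 0]) auto
      qed
    next
      case False
      define m where "m = monom (lead_coeff p) (degree p - degree q)"
      define p' where "p' = p - q * m"
      have m: "m \<in> polys R"
        using less.prems by (auto simp: m_def polysD)
      then have p': "p' \<in> polys R"
        using less.prems assms by (auto simp: p'_def)
      have deg_qm: "degree (q * m) \<le> degree p"
        using degree_mult_le[of q m] degree_monom_le[of "lead_coeff p" "degree p - degree q"] False
        unfolding m_def by linarith
      have "coeff (q * m) (degree p) = lead_coeff p"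
        using False assms(2) by (simp add: m_def mult.commute[of q] coeff_monom_mult)
      then have c: "coeff p' (degree p) = 0"
        by (simp add: p'_def)
      have "degree p' \<le> degree p"
        using deg_qm by (simp add: p'_def degree_diff_le)
      then have "degree p' < degree p"
        using c False by (metis eq_zero_or_degree_less degree_0 not_gr_zero)
      from less.hyps[OF this p'] obtain d r
        where "d \<in> polys R" "r \<in> polys R" "p' = q * d + r" "r = 0 \<or> degree r < degree q"
        by blast
      moreover from this have "p = q * (d + m) + r"
        by (simp add: p'_def algebra_simps)
      ultimately show ?thesis
        using m by blast
    qed
  qed
  then show ?thesis
    using that by blast
qed

end

definition algebraic_over :: "'a :: field set \<Rightarrow> 'a \<Rightarrow> bool"
  where "algebraic_over F z \<longleftrightarrow> (\<exists>p\<in>polys F. p \<noteq> 0 \<and> poly p z = 0)"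

lemma algebraic_over_mono: "F \<subseteq> E \<Longrightarrow> algebraic_over F z \<Longrightarrow> algebraic_over E z"
  unfolding algebraic_over_def using polys_mono by blast

lemma (in subfield_on) minimal_poly:
  assumes "algebraic_over F z"
  obtains m where "m \<in> polys F" "lead_coeff m = 1" "poly m z = 0" "degree m > 0"
    "\<And>p. p \<in> polys F \<Longrightarrow> poly p z = 0 \<Longrightarrow> \<exists>d\<in>polys F. p = m * d"
    "\<And>p. p \<in> polys F \<Longrightarrow> p \<noteq> 0 \<Longrightarrow> degree p < degree m \<Longrightarrow> poly p z \<noteq> 0"
proof -
  define P where "P = (\<lambda>p. p \<in> polys F \<and> p \<noteq> 0 \<and> poly p z = 0)"
  obtain p0 where "P p0"
    using assms unfolding algebraic_over_def P_def by blast
  then obtain q where q: "P q" and min: "\<And>p. P p \<Longrightarrow> degree q \<le> degree p"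
    using ex_has_least_nat[of P p0 degree] by blast
  define m where "m = smult (inverse (lead_coeff q)) q"
  have lc: "lead_coeff q \<noteq> 0"
    using q by (auto simp: P_def)
  have m: "m \<in> polys F" "lead_coeff m = 1" "poly m z = 0" and deg: "degree m = degree q"
    using q lc polysD[of q F] by (auto simp: m_def P_def intro!: polys_smult)
  have nz: "poly p z \<noteq> 0" if "p \<in> polys F" "p \<noteq> 0" "degree p < degree m" for p
    using that min[of p] deg by (auto simp: P_def)
  have dm: "degree m > 0"
  proof (rule ccontr)
    assume "\<not> degree m > 0"
    then have "degree m = 0" by simp
    then obtain c where "m = [:c:]"
      using degree_eq_zeroE by blast
    then show False
      using m by simp
  qed
  show ?thesis
  proof (rule that[OF m dm _ nz])
    fix p assume p: "p \<in> polys F" "poly p z = 0"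
    obtain d r where dr: "d \<in> polys F" "r \<in> polys F" "p = m * d + r" "r = 0 \<or> degree r < degree m"
      using polys_monic_division[OF m(1,2) p(1)] .
    then have "poly r z = 0"
      using p(2) m(3) by simp
    then have "r = 0"
      using nz[of r] dr by blast
    then show "\<exists>d\<in>polys F. p = m * d"
      using dr by auto
  qed
qed

definition adjoin :: "'a :: field set \<Rightarrow> 'a \<Rightarrow> 'a set"
  where "adjoin R z = (\<lambda>p. poly p z) ` polys R"

lemma adjoin_self: "subring_on R \<Longrightarrow> z \<in> adjoin R z"
proof -
  assume "subring_on R"
  then interpret subring_on R .
  have "[:0, 1:] \<in> polys R" by auto
  then have "poly [:0, 1:] z \<in> adjoin R z"
    unfolding adjoin_def by blast
  then show ?thesis by simp
qed

lemma adjoin_base: "subring_on R \<Longrightarrow> R \<subseteq> adjoin R z"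
proof
  fix x assume "subring_on R" "x \<in> R"
  then interpret subring_on R by simp
  have "[:x:] \<in> polys R" using \<open>x \<in> R\<close> by auto
  then have "poly [:x:] z \<in> adjoin R z"
    unfolding adjoin_def by blast
  then show "x \<in> adjoin R z" by simp
qed

lemma subring_on_adjoin: "subring_on R \<Longrightarrow> subring_on (adjoin R z)"
proof -
  assume "subring_on R"
  then interpret subring_on R .
  show ?thesis
  proof
    show "0 \<in> adjoin R z" "1 \<in> adjoin R z"
      using adjoin_base[OF subring_on_axioms] by blast+
  next
    fix x y assume "x \<in> adjoin R z" "y \<in> adjoin R z"
    then obtain p q where "p \<in> polys R" "q \<in> polys R" "x = poly p z" "y = poly q z"
      by (auto simp: adjoin_def)
    then have "p + q \<in> polys R" "p * q \<in> polys R" "x + y = poly (p + q) z" "x * y = poly (p * q) z"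
      by auto
    then show "x + y \<in> adjoin R z" "x * y \<in> adjoin R z"
      unfolding adjoin_def by blast+
  next
    fix x assume "x \<in> adjoin R z"
    then obtain p where "p \<in> polys R" "x = poly p z"
      by (auto simp: adjoin_def)
    then have "- p \<in> polys R" "- x = poly (- p) z"
      by auto
    then show "- x \<in> adjoin R z"
      unfolding adjoin_def by blast
  qed
qed

text \<open>Inverses exist because the Euclidean algorithm against the minimal polynomial of \<open>z\<close>
  expresses them as polynomials in \<open>z\<close>.\<close>

lemma subfield_on_adjoin:
  assumes "subfield_on F" "algebraic_over F z"
  shows "subfield_on (adjoin F z)"
proof -
  interpret subfield_on F by fact
  interpret A: subring_on "adjoin F z"
    by (rule subring_on_adjoin) (rule subring_on_axioms)
  obtain m where m: "m \<in> polys F" "lead_coeff m = 1" "poly m z = 0" "degree m > 0"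
    "\<And>p. p \<in> polys F \<Longrightarrow> poly p z = 0 \<Longrightarrow> \<exists>d\<in>polys F. p = m * d"
    "\<And>p. p \<in> polys F \<Longrightarrow> p \<noteq> 0 \<Longrightarrow> degree p < degree m \<Longrightarrow> poly p z \<noteq> 0"
    using minimal_poly[OF assms(2)] by metis
  have inv: "\<exists>q\<in>polys F. poly p z * poly q z = 1" if "p \<in> polys F" "p \<noteq> 0" "degree p < degree m" for p
    using that
  proof (induction "degree p" arbitrary: p rule: less_induct)
    case less
    define c where "c = inverse (lead_coeff p)"
    define p' where "p' = smult c p"
    have c: "c \<noteq> 0" "c \<in> F"
      using less.prems by (auto simp: c_def polysD)
    have p': "p' \<in> polys F" "lead_coeff p' = 1" "degree p' = degree p"
      using less.prems c by (auto simp: p'_def c_def)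
    obtain d r where dr: "d \<in> polys F" "r \<in> polys F" "m = p' * d + r" "r = 0 \<or> degree r < degree p'"
      using polys_monic_division[OF p'(1,2) m(1)] .
    show ?case
    proof (cases "degree p = 0")
      case True
      then obtain a where a: "p = [:a:]"
        using degree_eq_zeroE by blast
      then have "a \<noteq> 0" "a \<in> F"
        using less.prems polysD[of p F 0] by auto
      then show ?thesis
        by (intro bexI[of _ "[:inverse a:]"]) (auto simp: a)
    next
      case False
      have "r \<noteq> 0"
      proof
        assume "r = 0"
        then have m': "m = p' * d" using dr by simp
        have "d \<noteq> 0" "p' \<noteq> 0" using m' m(4) by auto
        then have "degree m = degree p' + degree d"
          using m' degree_mult_eq by blast
        then have "degree d < degree m" using False p' by simp
        then have "poly d z \<noteq> 0" using m(6) dr(1) \<open>d \<noteq> 0\<close> by blast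
        moreover have "poly p' z \<noteq> 0"
          using m(6)[of p'] p' less.prems \<open>p' \<noteq> 0\<close> by simp
        ultimately show False using m(3) m' by simp
      qed
      then have "degree r < degree p" using dr(4) p' by simp
      moreover have "degree r < degree m" using calculation less.prems by simp
      ultimately obtain q where q: "q \<in> polys F" "poly r z * poly q z = 1"
        using less.hyps[of r] dr(2) \<open>r \<noteq> 0\<close> by blast
      have "poly r z = - (poly p' z * poly d z)"
        using m(3) dr(3) by (metis add.commute add_eq_0_iff poly_add poly_mult)
      then have "poly p z * poly (smult (- c) (d * q)) z = 1"
        using q by (simp add: p'_def algebra_simps)
      then show ?thesis
        using q dr c by (intro bexI[of _ "smult (- c) (d * q)"]) auto
    qed
  qed
  show ?thesis
  proof
    fix x assume "x \<in> adjoin F z"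
    then obtain p where p: "p \<in> polys F" "x = poly p z"
      by (auto simp: adjoin_def)
    obtain d r where dr: "d \<in> polys F" "r \<in> polys F" "p = m * d + r" "r = 0 \<or> degree r < degree m"
      using polys_monic_division[OF m(1,2) p(1)] .
    then have x: "x = poly r z"
      using p m by simp
    show "inverse x \<in> adjoin F z"
    proof (cases "x = 0")
      case True
      then show ?thesis by simp
    next
      case False
      then have "r \<noteq> 0" using x by auto
      then obtain q where "q \<in> polys F" "poly r z * poly q z = 1"
        using inv[of r] dr by blast
      then have "inverse x = poly q z"
        using x by (simp add: inverse_unique)
      then show ?thesis
        using \<open>q \<in> polys F\<close> by (auto simp: adjoin_def)
    qed
  qed
qed

definition ring_hom_on :: "'a :: field set \<Rightarrow> ('a \<Rightarrow> 'b :: field) \<Rightarrow> bool"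
  where "ring_hom_on R f \<longleftrightarrow> f 1 = 1 \<and>
    (\<forall>x\<in>R. \<forall>y\<in>R. f (x + y) = f x + f y \<and> f (x * y) = f x * f y)"

lemma ring_hom_on_cong:
  assumes "subring_on R" "\<And>x. x \<in> R \<Longrightarrow> f x = g x"
  shows "ring_hom_on R f \<longleftrightarrow> ring_hom_on R g"
proof -
  interpret subring_on R by fact
  show ?thesis
    unfolding ring_hom_on_def using assms(2) add_in mult_in one_in by metis
qed

lemma ring_hom_on_subset: "ring_hom_on S f \<Longrightarrow> R \<subseteq> S \<Longrightarrow> ring_hom_on R f"
  unfolding ring_hom_on_def by blast

locale hom_on = subring_on R for R :: "'a :: field set" +
  fixes f :: "'a \<Rightarrow> 'b :: field"
  assumes hom: "ring_hom_on R f"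
begin

lemma hom_1 [simp]: "f 1 = 1"
  and hom_add: "x \<in> R \<Longrightarrow> y \<in> R \<Longrightarrow> f (x + y) = f x + f y"
  and hom_mult: "x \<in> R \<Longrightarrow> y \<in> R \<Longrightarrow> f (x * y) = f x * f y"
  using hom by (auto simp: ring_hom_on_def)

lemma hom_0 [simp]: "f 0 = 0"
proof -
  have "f 0 + 0 = f 0 + f 0"
    using hom_add[of 0 0] by simp
  then show ?thesis
    by (simp only: add_left_cancel)
qed

lemma hom_uminus: "x \<in> R \<Longrightarrow> f (- x) = - f x"
  using hom_add[of x "- x"] uminus_in[of x] by (simp add: eq_neg_iff_add_eq_0 add.commute)

lemma hom_diff: "x \<in> R \<Longrightarrow> y \<in> R \<Longrightarrow> f (x - y) = f x - f y"
  using hom_add[of x "- y"] hom_uminus[of y] uminus_in[of y] by simp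

lemma hom_sum: "(\<And>i. i \<in> A \<Longrightarrow> g i \<in> R) \<Longrightarrow> f (sum g A) = (\<Sum>i\<in>A. f (g i))"
  by (induction A rule: infinite_finite_induct) (auto simp: hom_add sum_in)

lemma hom_prod: "(\<And>i. i \<in> A \<Longrightarrow> g i \<in> R) \<Longrightarrow> f (prod g A) = (\<Prod>i\<in>A. f (g i))"
  by (induction A rule: infinite_finite_induct) (auto simp: hom_mult prod_in)

lemma hom_power: "x \<in> R \<Longrightarrow> f (x ^ n) = f x ^ n"
  by (induction n) (auto simp: hom_mult power_in)

lemma hom_of_nat [simp]: "f (of_nat n) = of_nat n"
  by (induction n) (auto simp: hom_add)

lemma hom_of_int [simp]: "f (of_int n) = of_int n"
proof (cases n rule: int_cases2)
  case (nonpos k)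
  then show ?thesis
    using hom_uminus[of "of_nat k"] by simp
qed simp

lemma hom_poly: "p \<in> polys R \<Longrightarrow> x \<in> R \<Longrightarrow> f (poly p x) = poly (map_poly f p) (f x)"
proof (induction p)
  case (pCons a p)
  have "a \<in> R" "p \<in> polys R"
    using polysD[OF pCons.prems(1), of 0] polysD[OF pCons.prems(1), of "Suc _"]
    by (simp_all add: polys_def)
  then show ?case
    using pCons by (simp add: hom_add hom_mult mult_in poly_in map_poly_pCons)
qed simp

lemma map_poly_add: "p \<in> polys R \<Longrightarrow> q \<in> polys R \<Longrightarrow> map_poly f (p + q) = map_poly f p + map_poly f q"
  by (rule poly_eqI) (simp add: coeff_map_poly hom_add polysD)

lemma map_poly_mult: "p \<in> polys R \<Longrightarrow> q \<in> polys R \<Longrightarrow> map_poly f (p * q) = map_poly f p * map_poly f q"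
  by (rule poly_eqI) (simp add: coeff_map_poly coeff_mult hom_mult hom_sum mult_in polysD)

lemma map_poly_prod: "(\<And>i. i \<in> A \<Longrightarrow> P i \<in> polys R) \<Longrightarrow> map_poly f (prod P A) = (\<Prod>i\<in>A. map_poly f (P i))"
  by (induction A rule: infinite_finite_induct) (auto simp: map_poly_mult polys_prod)

end

locale field_hom_on = subfield_on F + hom_on F f for F :: "'a :: field set" and f :: "'a \<Rightarrow> 'b :: field"
begin

lemma hom_inverse: "x \<in> F \<Longrightarrow> f (inverse x) = inverse (f x)"
proof (cases "x = 0")
  case False
  assume x: "x \<in> F"
  then have "f x * f (inverse x) = f (x * inverse x)"
    using inverse_in by (simp add: hom_mult)
  then show ?thesis using False by (simp add: inverse_unique)
qed simp

lemma hom_divide: "x \<in> F \<Longrightarrow> y \<in> F \<Longrightarrow> f (x / y) = f x / f y"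
  by (simp add: divide_inverse hom_mult hom_inverse inverse_in)

lemma hom_eq_0_iff: "x \<in> F \<Longrightarrow> f x = 0 \<longleftrightarrow> x = 0"
proof
  assume x: "x \<in> F" "f x = 0"
  show "x = 0"
  proof (rule ccontr)
    assume nz: "x \<noteq> 0"
    have "f (x * inverse x) = f x * f (inverse x)"
      using x inverse_in by (intro hom_mult) auto
    then show False using x nz by simp
  qed
qed simp

lemma hom_inj: "inj_on f F"
proof (rule inj_onI)
  fix x y assume xy: "x \<in> F" "y \<in> F" "f x = f y"
  then have "f (x - y) = 0" by (simp add: hom_diff)
  then show "x = y" using xy hom_eq_0_iff[of "x - y"] diff_in by simp
qed

lemma degree_map: "p \<in> polys F \<Longrightarrow> degree (map_poly f p) = degree p"
  by (cases "p = 0") (auto simp: hom_eq_0_iff polysD intro: map_poly_degree_eq)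

end

text \<open>The value of the extension at \<open>p(z)\<close> is the image polynomial evaluated at \<open>w\<close>. The assumption on \<open>w\<close>
  says that this does not depend on the choice of \<open>p\<close>.\<close>

lemma simple_extension_hom:
  fixes f :: "'a :: field \<Rightarrow> 'b :: field"
  assumes "subfield_on F" "ring_hom_on F f"
    and w: "\<And>p. p \<in> polys F \<Longrightarrow> poly p z = 0 \<Longrightarrow> poly (map_poly f p) w = 0"
  obtains g where "ring_hom_on (adjoin F z) g" "\<And>x. x \<in> F \<Longrightarrow> g x = f x" "g z = w"
proof -
  interpret field_hom_on F f
    using assms by (simp add: field_hom_on_def hom_on_def hom_on_axioms_def subfield_on_def)
  define g where "g = (\<lambda>x. poly (map_poly f (SOME p. p \<in> polys F \<and> poly p z = x)) w)"
  have g: "g (poly p z) = poly (map_poly f p) w" if p: "p \<in> polys F" for p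
  proof -
    define q where "q = (SOME q. q \<in> polys F \<and> poly q z = poly p z)"
    have q: "q \<in> polys F" "poly q z = poly p z"
      unfolding q_def using someI[of "\<lambda>q. q \<in> polys F \<and> poly q z = poly p z" p] p by auto
    have "poly (map_poly f (p - q)) w = 0"
      using p q by (intro w) auto
    moreover have "map_poly f p = map_poly f (p - q) + map_poly f q"
      using map_poly_add[of "p - q" q] p q by auto
    ultimately show ?thesis
      by (simp add: g_def q_def)
  qed
  show ?thesis
  proof
    have "g 1 = 1"
      using g[of 1] polys_1 by simp
    moreover have "g (x + y) = g x + g y \<and> g (x * y) = g x * g y"
      if "x \<in> adjoin F z" "y \<in> adjoin F z" for x y
    proof -
      from that obtain p q where "p \<in> polys F" "q \<in> polys F" "x = poly p z" "y = poly q z"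
        by (auto simp: adjoin_def)
      then show ?thesis
        using g[of p] g[of q] g[of "p + q"] g[of "p * q"]
        by (simp add: polys_add polys_mult map_poly_add map_poly_mult)
    qed
    ultimately show "ring_hom_on (adjoin F z) g"
      unfolding ring_hom_on_def by blast
    show "g x = f x" if "x \<in> F" for x
      using g[of "[:x:]"] that by (cases "x = 0") (auto simp: polys_pCons map_poly_pCons)
    have "[:0, 1:] \<in> polys F" by auto
    from g[OF this] show "g z = w"
      by (simp add: map_poly_pCons)
  qed
qed

text \<open>Zorn's lemma applies to the graphs of the partial extensions. A maximal one is defined on
  all of \<open>L\<close>, because a missing element can be adjoined and sent to any root of the image of its
  minimal polynomial.\<close>

lemma extend_hom:
  fixes f :: "'a :: field \<Rightarrow> 'b :: alg_closed_field"
  assumes F: "subfield_on F" and f: "ring_hom_on F f"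
    and L: "subfield_on L" "F \<subseteq> L" "\<And>z. z \<in> L \<Longrightarrow> algebraic_over F z"
  obtains g where "ring_hom_on L g" "\<And>x. x \<in> F \<Longrightarrow> g x = f x"
proof -
  define gr where "gr = (\<lambda>(E :: 'a set) (g :: 'a \<Rightarrow> 'b). (\<lambda>x. (x, g x)) ` E)"
  define P where "P = (\<lambda>E g. subfield_on E \<and> F \<subseteq> E \<and> E \<subseteq> L \<and> ring_hom_on E g \<and> (\<forall>x\<in>F. g x = f x))"
  define A where "A = {G. \<exists>E g. P E g \<and> G = gr E g}"
  have gr_sub: "E \<subseteq> E'" "\<And>x. x \<in> E \<Longrightarrow> g' x = g x" if "gr E g \<subseteq> gr E' g'" for E g E' g'
    using that by (auto simp: gr_def)
  have "P F f"
    using F f L by (simp add: P_def)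
  then have ne: "gr F f \<in> A"
    by (auto simp: A_def)
  have "\<exists>M\<in>A. \<forall>Y\<in>A. M \<subseteq> Y \<longrightarrow> Y = M"
  proof (rule subset_Zorn_nonempty)
    show "A \<noteq> {}" using ne by auto
    fix C assume C: "C \<noteq> {}" "subset.chain A C"
    have inA: "G \<in> A" if "G \<in> C" for G
      using that C(2) by (auto simp: subset.chain_def)
    have chain: "G \<subseteq> H \<or> H \<subseteq> G" if "G \<in> C" "H \<in> C" for G H
      using that C(2) by (auto simp: subset_chain_def)
    define E where "E = Domain (\<Union>C)"
    define g where "g = (\<lambda>x. SOME y. (x, y) \<in> \<Union>C)"
    have funl: "y = y'" if "(x, y) \<in> \<Union>C" "(x, y') \<in> \<Union>C" for x y y'
    proof -
      from that obtain G H where GH: "G \<in> C" "H \<in> C" "(x, y) \<in> G" "(x, y') \<in> H" by blast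
      then obtain K where K: "K \<in> C" "(x, y) \<in> K" "(x, y') \<in> K"
        using chain[of G H] by blast
      then show ?thesis
        using inA[of K] by (auto simp: A_def gr_def)
    qed
    have g: "g x = y" if "(x, y) \<in> \<Union>C" for x y
      unfolding g_def using funl that by (metis (mono_tags, lifting) someI)
    have UC: "\<Union>C = gr E g"
      using g by (force simp: E_def gr_def)
    have two: "\<exists>E' g'. P E' g' \<and> x \<in> E' \<and> y \<in> E' \<and> E' \<subseteq> E \<and> (\<forall>z\<in>E'. g z = g' z)"
      if "x \<in> E" "y \<in> E" for x y
    proof -
      from that obtain G H where GH: "G \<in> C" "H \<in> C" "x \<in> Domain G" "y \<in> Domain H"
        by (auto simp: E_def)
      then obtain K where K: "K \<in> C" "x \<in> Domain K" "y \<in> Domain K"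
        using chain[of G H] by blast
      then obtain E' g' where E': "P E' g'" "K = gr E' g'"
        using inA[OF K(1)] unfolding A_def by blast
      have "gr E' g' \<subseteq> gr E g"
        using K E' UC by blast
      then show ?thesis
        using gr_sub[of E' g' E g] E' K by (intro exI[of _ E'] exI[of _ g']) (auto simp: gr_def)
    qed
    have FE: "F \<subseteq> E" "\<And>x. x \<in> F \<Longrightarrow> g x = f x"
    proof -
      obtain G where "G \<in> C" using C(1) by blast
      then obtain E' g' where E': "P E' g'" "G = gr E' g'"
        using inA[of G] unfolding A_def by blast
      have "gr E' g' \<subseteq> gr E g"
        using \<open>G \<in> C\<close> E' UC by blast
      from gr_sub[OF this] show "F \<subseteq> E" "\<And>x. x \<in> F \<Longrightarrow> g x = f x"
        using E' by (auto simp: P_def)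
    qed
    have "P E g"
      unfolding P_def
    proof (intro conjI ballI)
      interpret F: subfield_on F by fact
      show "subfield_on E"
      proof
        show "0 \<in> E" "1 \<in> E" using FE by auto
        fix x y assume "x \<in> E" "y \<in> E"
        from two[OF this] obtain E' g' where *: "P E' g'" "x \<in> E'" "y \<in> E'" "E' \<subseteq> E" by blast
        then interpret E': subfield_on E' by (simp add: P_def)
        show "x + y \<in> E" "x * y \<in> E" using * by blast+
      next
        fix x assume "x \<in> E"
        from two[OF this this] obtain E' g' where *: "P E' g'" "x \<in> E'" "E' \<subseteq> E" by blast
        then interpret E': subfield_on E' by (simp add: P_def)
        show "- x \<in> E" "inverse x \<in> E" using * by blast+
      qed
      show "F \<subseteq> E" by fact
      show "E \<subseteq> L"
      proof
        fix x assume "x \<in> E"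
        from two[OF this this] show "x \<in> L" by (auto simp: P_def)
      qed
      show "g x = f x" if "x \<in> F" for x using FE that by blast
      show "ring_hom_on E g"
        unfolding ring_hom_on_def
      proof (intro conjI ballI)
        show "g 1 = 1" using FE f by (auto simp: ring_hom_on_def)
        fix x y assume "x \<in> E" "y \<in> E"
        from two[OF this] obtain E' g' where *: "P E' g'" "x \<in> E'" "y \<in> E'" "E' \<subseteq> E" "\<forall>z\<in>E'. g z = g' z" by blast
        then interpret E': subfield_on E' by (simp add: P_def)
        have "x + y \<in> E'" "x * y \<in> E'" using * by blast+
        then show "g (x + y) = g x + g y" "g (x * y) = g x * g y"
          using * by (auto simp: P_def ring_hom_on_def)
      qed
    qed
    then show "\<Union>C \<in> A"
      unfolding UC A_def by blast
  qed
  then obtain M where M: "M \<in> A" "\<And>G. G \<in> A \<Longrightarrow> M \<subseteq> G \<Longrightarrow> G = M"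
    by blast
  then obtain E g where Eg: "P E g" and Meq: "M = gr E g"
    unfolding A_def by blast
  have max: "gr E' g' = gr E g" if "P E' g'" "gr E g \<subseteq> gr E' g'" for E' g'
    using M(2)[of "gr E' g'"] that unfolding A_def Meq by blast
  interpret E: field_hom_on E g
    using Eg by (simp add: P_def field_hom_on_def hom_on_def hom_on_axioms_def subfield_on_def)
  have "E = L"
  proof (rule ccontr)
    assume "E \<noteq> L"
    then obtain z where z: "z \<in> L" "z \<notin> E"
      using Eg by (auto simp: P_def)
    then have alg: "algebraic_over E z"
      using L(3) algebraic_over_mono Eg unfolding P_def by blast
    obtain m where m: "m \<in> polys E" "degree m > 0"
      "\<And>p. p \<in> polys E \<Longrightarrow> poly p z = 0 \<Longrightarrow> \<exists>d\<in>polys E. p = m * d"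
      using E.minimal_poly[OF alg] by metis
    have "degree (map_poly g m) > 0"
      using m E.degree_map by simp
    then obtain w where w: "poly (map_poly g m) w = 0"
      using alg_closed_imp_poly_has_root by blast
    have w': "poly (map_poly g p) w = 0" if p: "p \<in> polys E" "poly p z = 0" for p
    proof -
      obtain d where "d \<in> polys E" "p = m * d" using m(3) p by blast
      then show "poly (map_poly g p) w = 0"
        using E.map_poly_mult[OF m(1)] w by simp
    qed
    obtain h where h: "ring_hom_on (adjoin E z) h" "\<And>x. x \<in> E \<Longrightarrow> h x = g x"
      using simple_extension_hom[OF E.subfield_on_axioms E.hom w'] by blast
    interpret L: subfield_on L by fact
    have sub: "E \<subseteq> adjoin E z" "z \<in> adjoin E z"
      using adjoin_base adjoin_self E.subring_on_axioms by blast+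
    have "adjoin E z \<subseteq> L"
      using polys_mono[of E L] Eg z by (auto simp: adjoin_def P_def)
    moreover have "subfield_on (adjoin E z)"
      using subfield_on_adjoin[OF E.subfield_on_axioms alg] .
    ultimately have "P (adjoin E z) h"
      using h Eg sub by (auto simp: P_def)
    moreover have "gr E g \<subseteq> gr (adjoin E z) h"
      using sub h by (auto simp: gr_def image_iff)
    ultimately have "gr (adjoin E z) h = gr E g"
      using max by blast
    then have "z \<in> E"
      using sub(2) by (auto simp: gr_def)
    then show False using z by blast
  qed
  then show ?thesis
    using that[of g] Eg by (auto simp: P_def)
qed

text \<open>An algebraic self-embedding permutes the finitely many roots of each polynomial.\<close>

lemma self_embedding_surj:
  assumes "subfield_on L" "F \<subseteq> L" "\<And>z. z \<in> L \<Longrightarrow> algebraic_over F z"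
    and g: "ring_hom_on L g" "\<And>x. x \<in> F \<Longrightarrow> g x = x" "\<And>x. x \<in> L \<Longrightarrow> g x \<in> L"
  shows "bij_betw g L L"
proof -
  interpret field_hom_on L g
    using assms by (simp add: field_hom_on_def hom_on_def hom_on_axioms_def subfield_on_def)
  have "z \<in> g ` L" if z: "z \<in> L" for z
  proof -
    obtain p where p: "p \<in> polys F" "p \<noteq> 0" "poly p z = 0"
      using assms(3)[OF z] by (auto simp: algebraic_over_def)
    define S where "S = {x \<in> L. poly p x = 0}"
    have "finite S"
      unfolding S_def using poly_roots_finite[OF p(2)] by (rule finite_subset[rotated]) auto
    moreover have "inj_on g S"
      using hom_inj by (rule inj_on_subset) (auto simp: S_def)
    moreover have "g ` S \<subseteq> S"
    proof
      fix y assume "y \<in> g ` S"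
      then obtain x where x: "x \<in> L" "poly p x = 0" "y = g x" by (auto simp: S_def)
      have "map_poly g p = p"
        using p(1) g(2) by (intro poly_eqI) (simp add: coeff_map_poly polysD)
      then have "poly p y = g (poly p x)"
        using hom_poly[of p x] polys_mono[OF assms(2)] p x by auto
      then show "y \<in> S" using x g(3) by (simp add: S_def)
    qed
    ultimately have "g ` S = S"
      by (simp add: endo_inj_surj)
    then show ?thesis
      using z p by (auto simp: S_def)
  qed
  then show ?thesis
    using hom_inj g(3) by (auto simp: bij_betw_def)
qed

section \<open>Galois theory of the maximal abelian extension\<close>

lemma type_ring_simps [simp]:
  "carrier (ring_of_type_algebra :: 'a :: ring_1 ring) = UNIV"
  "monoid.mult (ring_of_type_algebra :: 'a ring) = (*)"
  "monoid.one (ring_of_type_algebra :: 'a ring) = 1"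
  "ring.zero (ring_of_type_algebra :: 'a ring) = 0"
  "ring.add (ring_of_type_algebra :: 'a ring) = (+)"
  by (auto simp: ring_of_type_algebra_def)

lemma type_ring_minus [simp]: "a_inv (ring_of_type_algebra :: 'a :: comm_ring_1 ring) x = - x"
proof -
  interpret cring "ring_of_type_algebra :: 'a ring" ..
  show ?thesis
    using minus_equality[of "- x" x] by simp
qed

lemma type_ring_inv: "x \<noteq> 0 \<Longrightarrow> m_inv (ring_of_type_algebra :: 'a :: field ring) x = inverse x"
proof -
  assume "x \<noteq> 0"
  interpret field "ring_of_type_algebra :: 'a ring" ..
  show ?thesis
    using inv_char[of x "inverse x"] \<open>x \<noteq> 0\<close> by simp
qed

lemma type_ring_pow [simp]: "x [^]\<^bsub>(ring_of_type_algebra :: 'a :: comm_ring_1 ring)\<^esub> (n :: nat) = x ^ n"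
proof -
  interpret cring "ring_of_type_algebra :: 'a ring" ..
  show ?thesis
    by (induction n) (simp_all add: mult.commute)
qed

lemma subfield_iff_subfield_on:
  "subfield F (ring_of_type_algebra :: 'a :: field ring) \<longleftrightarrow> subfield_on F"
proof
  interpret field "ring_of_type_algebra :: 'a ring" ..
  {
    assume F: "subfield F (ring_of_type_algebra :: 'a ring)"
    note r = subringE[OF subfieldE(1)[OF F]]
    show "subfield_on F"
    proof
      fix x assume "x \<in> F"
      then show "inverse x \<in> F"
        using subfield_m_inv(1)[OF F, of x] r(2) by (cases "x = 0") (auto simp: type_ring_inv)
    qed (use r in auto)
  }
  {
    assume "subfield_on F"
    then interpret F: subfield_on F .
    show "subfield F (ring_of_type_algebra :: 'a ring)"
      by (intro subfieldI' subringI) (auto simp: type_ring_inv)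
  }
qed

lemma subfield_on_Rats: "subfield_on (\<rat> :: 'a :: field_char_0 set)"
  by standard auto

lemma Rats_subset: "subfield_on F \<Longrightarrow> (\<rat> :: 'a :: field_char_0 set) \<subseteq> F"
proof
  fix x :: 'a assume "subfield_on F" "x \<in> \<rat>"
  then interpret subfield_on F by simp
  obtain a b where "x = of_int a / of_int b"
    using \<open>x \<in> \<rat>\<close> by (elim Rats_cases') auto
  then show "x \<in> F" by auto
qed

lemma ring_hom_iff_ring_hom_on:
  "f \<in> Ring.ring_hom (ring_of_type_algebra\<lparr>carrier := F\<rparr>) (ring_of_type_algebra\<lparr>carrier := L\<rparr>) \<longleftrightarrow>
    ring_hom_on F (f :: 'a :: field \<Rightarrow> 'b :: field) \<and> f ` F \<subseteq> L"
  by (auto simp: Ring.ring_hom_def ring_hom_on_def)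

lemma eval_type_ring: "ring.eval (ring_of_type_algebra :: 'a :: field ring) xs x = poly (Poly (rev xs)) x"
proof -
  interpret field "ring_of_type_algebra :: 'a ring" ..
  show ?thesis
    by (induction xs) (auto simp: Poly_append poly_monom)
qed

lemma algebraic_over_iff:
  assumes "subfield_on F"
  shows "((ring.algebraic (ring_of_type_algebra :: 'a :: field ring)) over F) x \<longleftrightarrow> algebraic_over F x"
proof
  interpret field "ring_of_type_algebra :: 'a ring" ..
  interpret F: subfield_on F by fact
  have sr: "subring F (ring_of_type_algebra :: 'a ring)"
    using assms subfieldE(1) subfield_iff_subfield_on by blast
  {
    assume "(algebraic over F) x"
    then obtain p where p: "p \<in> carrier (F[X]\<^bsub>ring_of_type_algebra\<^esub>)" "p \<noteq> []" "eval p x = 0"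
      using algebraicE[OF sr, of x] by auto
    define q where "q = Poly (rev p)"
    have "poly q x = 0"
      using p by (simp add: q_def eval_type_ring)
    moreover have p': "set p \<subseteq> F" "hd p \<noteq> 0"
      using p by (auto simp: univ_poly_def polynomial_def)
    have "Polynomial.coeff q (length p - 1) \<noteq> 0"
      using p' p(2) by (simp add: q_def nth_default_def rev_nth hd_conv_nth)
    then have "q \<noteq> 0" by auto
    moreover have "q \<in> polys F"
      using p'(1) by (auto simp: polys_def q_def nth_default_def set_rev intro!: subsetD[OF p'(1)])
       (metis length_rev nth_mem set_rev)
    ultimately show "algebraic_over F x"
      unfolding algebraic_over_def by blast
  }
  {
    assume "algebraic_over F x"
    then obtain p where p: "p \<in> polys F" "p \<noteq> 0" "poly p x = 0"
      by (auto simp: algebraic_over_def)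
    have "rev (coeffs p) \<in> carrier (F[X]\<^bsub>ring_of_type_algebra\<^esub>)"
      using p unfolding univ_poly_def polynomial_def
      by (auto simp: polysD coeffs_def hd_rev last_coeffs_eq_coeff_degree[OF p(2), unfolded coeffs_def])
    moreover have "eval (rev (coeffs p)) x = 0"
      using p by (simp add: eval_type_ring)
    ultimately show "(algebraic over F) x"
      using p by (intro algebraicI[of "rev (coeffs p)"]) auto
  }
qed

lemma subfield_on_algebraics:
  assumes "subfield_on (F :: 'a :: field set)"
  shows "subfield_on {x. algebraic_over F x}"
proof -
  interpret field "ring_of_type_algebra :: 'a ring" ..
  show ?thesis
    using subfield_of_algebraics[of F] assms
    by (simp add: subfield_iff_subfield_on algebraic_over_iff)
qed


text \<open>Spanning in the form of an induction principle: a property which holds for the entries of the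
  list and is preserved by linear operations holds on all of \<open>E\<close>.\<close>

definition spanning :: "'a :: field set \<Rightarrow> 'a list \<Rightarrow> 'a set \<Rightarrow> bool"
  where "spanning F bs E \<longleftrightarrow> set bs \<subseteq> E \<and> (\<forall>S. 0 \<in> S \<longrightarrow> set bs \<subseteq> S \<longrightarrow>
    (\<forall>x y. x \<in> S \<longrightarrow> y \<in> S \<longrightarrow> x + y \<in> S) \<longrightarrow> (\<forall>c x. c \<in> F \<longrightarrow> x \<in> S \<longrightarrow> c * x \<in> S) \<longrightarrow> E \<subseteq> S)"

lemma finite_dimension_spanning:
  assumes F: "subfield_on F"
    and "ring.finite_dimension (ring_of_type_algebra :: 'a :: field ring) F E"
  obtains bs where "spanning F bs E"
proof -
  interpret field "ring_of_type_algebra :: 'a ring" ..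
  obtain n where "dimension n F E"
    using assms by (auto simp: finite_dimension_def)
  then have "\<exists>bs. subfield_on F \<longrightarrow> (set bs \<subseteq> E \<and> 0 \<in> E \<and>
     (\<forall>S. 0 \<in> S \<longrightarrow> set bs \<subseteq> S \<longrightarrow> (\<forall>x y. x \<in> S \<longrightarrow> y \<in> S \<longrightarrow> x + y \<in> S) \<longrightarrow>
      (\<forall>c x. c \<in> F \<longrightarrow> x \<in> S \<longrightarrow> c * x \<in> S) \<longrightarrow> E \<subseteq> S))"
  proof (induction rule: dimension.induct)
    case (zero_dim K)
    show ?case by (intro exI[of _ "[]"]) auto
  next
    case (Suc_dim v E n K)
    then obtain bs where bs: "subfield_on K \<longrightarrow> (set bs \<subseteq> E \<and> 0 \<in> E \<and>
     (\<forall>S. 0 \<in> S \<longrightarrow> set bs \<subseteq> S \<longrightarrow> (\<forall>x y. x \<in> S \<longrightarrow> y \<in> S \<longrightarrow> x + y \<in> S) \<longrightarrow>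
      (\<forall>c x. c \<in> K \<longrightarrow> x \<in> S \<longrightarrow> c * x \<in> S) \<longrightarrow> E \<subseteq> S))" by blast
    have le: "line_extension K v E = {k * v + e | k e. k \<in> K \<and> e \<in> E}"
      by (auto simp: line_extension_def set_add_def' r_coset_def)
    show ?case
    proof (intro exI[of _ "v # bs"] impI conjI allI)
      assume "subfield_on K"
      then interpret K: subfield_on K .
      note bs' = mp[OF bs \<open>subfield_on K\<close>]
      have "E \<subseteq> line_extension K v E"
        unfolding le using K.zero_in by (metis (mono_tags, lifting) add_0 mem_Collect_eq mult_zero_left subsetI)
      moreover have "v \<in> line_extension K v E"
        unfolding le using bs' K.one_in by (metis (mono_tags, lifting) add_0_right mem_Collect_eq mult_1)
      ultimately show "set (v # bs) \<subseteq> line_extension K v E" "0 \<in> line_extension K v E"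
        using bs' by auto
      fix S assume S: "0 \<in> S" "set (v # bs) \<subseteq> S" "\<forall>x y. x \<in> S \<longrightarrow> y \<in> S \<longrightarrow> x + y \<in> S"
        "\<forall>c x. c \<in> K \<longrightarrow> x \<in> S \<longrightarrow> c * x \<in> S"
      then have "E \<subseteq> S" using bs' by auto
      then show "line_extension K v E \<subseteq> S"
        unfolding le using S by auto
    qed
  qed
  then show ?thesis
    using F that unfolding spanning_def by blast
qed

lemma conjugate_embedding:
  fixes F :: "'a :: alg_closed_field set"
  assumes F: "subfield_on F" and L: "subfield_on L" "F \<subseteq> L" "\<And>z. z \<in> L \<Longrightarrow> algebraic_over F z"
    and z: "z \<in> L" and w: "\<And>p. p \<in> polys F \<Longrightarrow> poly p z = 0 \<Longrightarrow> poly p w = 0"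
  obtains g where "ring_hom_on L g" "\<And>x. x \<in> F \<Longrightarrow> g x = x" "g z = w"
proof -
  interpret F: subfield_on F by fact
  interpret L: subfield_on L by fact
  have id: "ring_hom_on F (\<lambda>x. x)"
    by (simp add: ring_hom_on_def)
  obtain h where h: "ring_hom_on (adjoin F z) h" "\<And>x. x \<in> F \<Longrightarrow> h x = x" "h z = w"
    using simple_extension_hom[OF F id, of z w] w by auto
  have sub: "F \<subseteq> adjoin F z" "z \<in> adjoin F z" "adjoin F z \<subseteq> L"
    using adjoin_base[OF F.subring_on_axioms] adjoin_self[OF F.subring_on_axioms]
      polys_mono[OF L(2)] z by (auto simp: adjoin_def)
  obtain g where "ring_hom_on L g" "\<And>x. x \<in> adjoin F z \<Longrightarrow> g x = h x"
  proof (rule extend_hom[OF _ h(1) L(1) sub(3)])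
    show "subfield_on (adjoin F z)"
      using subfield_on_adjoin[OF F] L(3)[OF z] by blast
    show "algebraic_over (adjoin F z) x" if "x \<in> L" for x
      using algebraic_over_mono[OF sub(1)] L(3)[OF that] by blast
  qed blast
  then show ?thesis
    using h sub by (intro that[of g]) auto
qed

text \<open>In characteristic 0 an element outside \<open>F\<close> has a conjugate different from itself, and the map to
  that conjugate extends.\<close>

lemma embedding_moving:
  fixes F :: "'a :: {alg_closed_field, field_char_0} set"
  assumes F: "subfield_on F" and L: "subfield_on L" "F \<subseteq> L" "\<And>z. z \<in> L \<Longrightarrow> algebraic_over F z"
    and z: "z \<in> L" "z \<notin> F"
  obtains g where "ring_hom_on L g" "\<And>x. x \<in> F \<Longrightarrow> g x = x" "g z \<noteq> z"
proof -
  interpret F: subfield_on F by fact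
  obtain m where m: "m \<in> polys F" "lead_coeff m = 1" "poly m z = 0" "degree m > 0"
    "\<And>p. p \<in> polys F \<Longrightarrow> poly p z = 0 \<Longrightarrow> \<exists>d\<in>polys F. p = m * d"
    using F.minimal_poly[OF L(3)[OF z(1)]] by metis
  have "\<exists>w. poly m w = 0 \<and> w \<noteq> z"
  proof (rule ccontr)
    assume neg: "\<not> ?thesis"
    have "m \<noteq> 0" using m by auto
    then obtain A where A: "size A = degree m" "m = smult (lead_coeff m) (\<Prod>x\<in>#A. [:-x, 1:])"
      using alg_closed_imp_factorization by blast
    have "poly m x = 0" if "x \<in># A" for x
      using that by (subst A(2)) (auto simp: poly_prod_mset prod_mset_zero_iff image_image)
    then have "\<forall>x\<in>#A. x = z" using neg by blast
    then have "A = replicate_mset (degree m) z"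
      using A(1) by (metis set_mset_subset_singletonD singletonI subsetI)
    then have "m = [:-z, 1:] ^ degree m"
      using A(2) m(2) by simp
    \<comment> \<open>the coefficient after the leading one is \<open>- d z\<close> with \<open>d\<close> the degree, so \<open>z\<close> would lie in \<open>F\<close>\<close>
    then have "coeff m (degree m - 1) = coeff ([:-z, 1:] ^ degree m) (degree m - 1)"
      by simp
    also have "\<dots> = - of_nat (degree m) * z"
      using m(4) by (cases "degree m") (simp_all add: coeff_linear_poly_power algebra_simps del: power_Suc)
    finally have eq: "- of_nat (degree m) * z \<in> F"
      using m(1) by (metis polysD)
    have "z = (- of_nat (degree m) * z) / (- of_nat (degree m))"
      using m(4) by simp
    then have "z \<in> F"
      using F.divide_in[OF eq, of "- of_nat (degree m)"] F.uminus_in[OF F.of_nat_in] by metis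
    then show False using z by blast
  qed
  then obtain w where w: "poly m w = 0" "w \<noteq> z" by blast
  show ?thesis
  proof (rule conjugate_embedding[OF F L z(1), of w])
    fix p assume "p \<in> polys F" "poly p z = 0"
    then show "poly p w = 0" using m(5) w by fastforce
  next
    fix g assume "ring_hom_on L g" "\<And>x. x \<in> F \<Longrightarrow> g x = x" "g z = w"
    then show ?thesis using that w by blast
  qed
qed

lemma root_image:
  assumes "subfield_on L" "ring_hom_on L g" "F \<subseteq> L" "\<And>x. x \<in> F \<Longrightarrow> g x = x"
    "p \<in> polys F" "z \<in> L" "poly p z = 0"
  shows "poly p (g z) = 0"
proof -
  interpret field_hom_on L g
    using assms by (simp add: field_hom_on_def hom_on_def hom_on_axioms_def subfield_on_def)
  have "map_poly g p = p"
    using assms(4,5) by (intro poly_eqI) (simp add: coeff_map_poly polysD)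
  then have "poly p (g z) = g (poly p z)"
    using hom_poly[of p z] polys_mono[OF assms(3)] assms by auto
  then show ?thesis using assms by simp
qed

lemma ring_hom_on_comp:
  "ring_hom_on S g \<Longrightarrow> ring_hom_on R f \<Longrightarrow> (\<And>x. x \<in> R \<Longrightarrow> f x \<in> S) \<Longrightarrow> ring_hom_on R (\<lambda>x. g (f x))"
  unfolding ring_hom_on_def by simp

lemma ring_hom_on_Rats:
  fixes g :: "'a :: field_char_0 \<Rightarrow> 'b :: field_char_0"
  assumes "subfield_on L" "ring_hom_on L g"
  shows "g (of_rat q) = of_rat q"
proof -
  interpret field_hom_on L g
    using assms by (simp add: field_hom_on_def hom_on_def hom_on_axioms_def subfield_on_def)
  obtain a b where q: "q = of_int a / of_int b"
    by (metis Rat_cases of_int_rat Fract_of_int_quotient)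
  show ?thesis
    by (simp add: q of_rat_divide hom_divide)
qed

lemma ring_hom_on_fixes_Rats:
  fixes g :: "'a :: field_char_0 \<Rightarrow> 'a"
  assumes "subfield_on L" "ring_hom_on L g" "x \<in> \<rat>"
  shows "g x = x"
  using ring_hom_on_Rats[OF assms(1,2)] assms(3) by (auto elim: Rats_cases)

definition Qbar :: "complex set"
  where "Qbar = {z. algebraic_over \<rat> z}"

text \<open>The embeddings of the algebraic numbers into the complex numbers take the place of the absolute
  Galois group.\<close>

definition embeddings :: "(complex \<Rightarrow> complex) set"
  where "embeddings = {g. ring_hom_on Qbar g}"

lemma subfield_on_Qbar: "subfield_on Qbar"
  unfolding Qbar_def by (rule subfield_on_algebraics) (rule subfield_on_Rats)

lemma algebraic_iff_Qbar: "algebraic z \<longleftrightarrow> z \<in> Qbar"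
  by (auto simp: Qbar_def algebraic_over_def polys_def algebraic_altdef)

lemma Rats_Qbar: "\<rat> \<subseteq> Qbar"
  by (rule Rats_subset) (rule subfield_on_Qbar)

lemma embedding_fixes: "g \<in> embeddings \<Longrightarrow> x \<in> \<rat> \<Longrightarrow> g x = x"
  unfolding embeddings_def using ring_hom_on_fixes_Rats[OF subfield_on_Qbar] by blast

lemma embedding_closed: "g \<in> embeddings \<Longrightarrow> z \<in> Qbar \<Longrightarrow> g z \<in> Qbar"
proof -
  assume g: "g \<in> embeddings" and z: "z \<in> Qbar"
  then obtain p where "p \<in> polys \<rat>" "p \<noteq> 0" "poly p z = 0"
    by (auto simp: Qbar_def algebraic_over_def)
  moreover from this have "poly p (g z) = 0"
    by (intro root_image[OF subfield_on_Qbar _ Rats_Qbar, of g])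
       (use g z embedding_fixes[OF g] in \<open>auto simp: embeddings_def\<close>)
  ultimately show ?thesis
    by (auto simp: Qbar_def algebraic_over_def)
qed

lemma embedding_comp: "g \<in> embeddings \<Longrightarrow> h \<in> embeddings \<Longrightarrow> (\<lambda>x. g (h x)) \<in> embeddings"
  unfolding embeddings_def using ring_hom_on_comp embedding_closed[of h] by (auto simp: embeddings_def)

lemma Qbar_algebraic: "\<rat> \<subseteq> K \<Longrightarrow> z \<in> Qbar \<Longrightarrow> algebraic_over K z"
  unfolding Qbar_def using algebraic_over_mono by blast

lemma embedding_extend:
  assumes "subfield_on K" "K \<subseteq> Qbar" "ring_hom_on K f"
  obtains g where "g \<in> embeddings" "\<And>x. x \<in> K \<Longrightarrow> g x = f x"
  using extend_hom[OF assms(1,3) subfield_on_Qbar assms(2)] Qbar_algebraic[OF Rats_subset[OF assms(1)]]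
  by (auto simp: embeddings_def)

lemma embedding_moves:
  assumes "subfield_on K" "K \<subseteq> Qbar" "z \<in> Qbar" "z \<notin> K"
  obtains g where "g \<in> embeddings" "\<And>x. x \<in> K \<Longrightarrow> g x = x" "g z \<noteq> z"
  using embedding_moving[OF assms(1) subfield_on_Qbar assms(2) _ assms(3,4)]
    Qbar_algebraic[OF Rats_subset[OF assms(1)]]
  by (auto simp: embeddings_def)

lemma galois_group_simps:
  assumes "subfield_on L"
  shows carrier_galois_group: "carrier (galois_group L K) =
      {\<sigma> \<in> extensional L. bij_betw \<sigma> L L \<and> ring_hom_on L \<sigma> \<and> (\<forall>x\<in>K. \<sigma> x = x)}"
    and "\<sigma> \<in> carrier (galois_group L K) \<Longrightarrow> \<tau> \<in> carrier (galois_group L K) \<Longrightarrow>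
      \<sigma> \<otimes>\<^bsub>galois_group L K\<^esub> \<tau> = compose L \<sigma> \<tau>"
    and "\<one>\<^bsub>galois_group L K\<^esub> = (\<lambda>x\<in>L. x)"
proof -
  show "carrier (galois_group L K) =
      {\<sigma> \<in> extensional L. bij_betw \<sigma> L L \<and> ring_hom_on L \<sigma> \<and> (\<forall>x\<in>K. \<sigma> x = x)}"
    by (auto simp: galois_group_def Bij_def ring_iso_def ring_hom_iff_ring_hom_on bij_betw_def)
  show "\<sigma> \<in> carrier (galois_group L K) \<Longrightarrow> \<tau> \<in> carrier (galois_group L K) \<Longrightarrow>
      \<sigma> \<otimes>\<^bsub>galois_group L K\<^esub> \<tau> = compose L \<sigma> \<tau>"
    by (auto simp: galois_group_def BijGroup_def)
  show "\<one>\<^bsub>galois_group L K\<^esub> = (\<lambda>x\<in>L. x)"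
    by (auto simp: galois_group_def BijGroup_def)
qed

lemma group_galois_group:
  assumes L: "subfield_on L" and "K \<subseteq> L"
  shows "group (galois_group L K)"
proof (rule groupI)
  interpret L: subfield_on L by fact
  note car = carrier_galois_group[OF L, of K]
  note mult = galois_group_simps(2)[OF L, of _ K]
  note one = galois_group_simps(3)[OF L, of K]
  have comp: "compose L \<sigma> \<tau> \<in> carrier (galois_group L K)"
    if "\<sigma> \<in> carrier (galois_group L K)" "\<tau> \<in> carrier (galois_group L K)" for \<sigma> \<tau>
  proof -
    have \<tau>: "\<tau> x \<in> L" if "x \<in> L" for x
      using \<open>\<tau> \<in> _\<close> that by (auto simp: car bij_betw_def)
    have "ring_hom_on L (compose L \<sigma> \<tau>) \<longleftrightarrow> ring_hom_on L (\<lambda>x. \<sigma> (\<tau> x))"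
      by (rule ring_hom_on_cong) (auto simp: compose_def L.subring_on_axioms)
    then show ?thesis
      using that \<tau> assms(2) ring_hom_on_comp[of L \<sigma> L \<tau>]
      by (auto simp: car bij_betw_compose compose_eq subset_iff)
  qed
  show "\<And>\<sigma> \<tau>. \<sigma> \<in> carrier (galois_group L K) \<Longrightarrow> \<tau> \<in> carrier (galois_group L K) \<Longrightarrow>
      \<sigma> \<otimes>\<^bsub>galois_group L K\<^esub> \<tau> \<in> carrier (galois_group L K)"
    using comp mult by simp
  have "ring_hom_on L (\<lambda>x\<in>L. x)"
    by (auto simp: ring_hom_on_def)
  then show id: "\<one>\<^bsub>galois_group L K\<^esub> \<in> carrier (galois_group L K)"
    using assms(2) by (auto simp: one car bij_betw_def inj_on_def)
  fix \<sigma> assume \<sigma>: "\<sigma> \<in> carrier (galois_group L K)"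
  show "\<one>\<^bsub>galois_group L K\<^esub> \<otimes>\<^bsub>galois_group L K\<^esub> \<sigma> = \<sigma>"
    using \<sigma> id mult[OF id \<sigma>] by (auto simp: one car compose_def bij_betw_def extensional_def fun_eq_iff)
  define \<tau> where "\<tau> = (\<lambda>x\<in>L. inv_into L \<sigma> x)"
  have b: "bij_betw \<sigma> L L" and h: "ring_hom_on L \<sigma>"
    using \<sigma> by (auto simp: car)
  have inv: "inv_into L \<sigma> x \<in> L" "\<sigma> (inv_into L \<sigma> x) = x" if "x \<in> L" for x
    using b that by (auto simp: bij_betw_def inv_into_into f_inv_into_f)
  have inv': "inv_into L \<sigma> (\<sigma> x) = x" if "x \<in> L" for x
    using b that by (simp add: bij_betw_def)
  have bij: "bij_betw \<tau> L L"
    unfolding \<tau>_def using bij_betw_inv_into[OF b] by (simp add: bij_betw_restrict_eq)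
  have "ring_hom_on L (inv_into L \<sigma>)"
    unfolding ring_hom_on_def
  proof (intro conjI ballI)
    show "inv_into L \<sigma> 1 = 1"
      using inv'[of 1] h by (simp add: ring_hom_on_def)
    fix x y assume "x \<in> L" "y \<in> L"
    then show "inv_into L \<sigma> (x + y) = inv_into L \<sigma> x + inv_into L \<sigma> y"
      "inv_into L \<sigma> (x * y) = inv_into L \<sigma> x * inv_into L \<sigma> y"
      using inv[of x] inv[of y] inv'[of "inv_into L \<sigma> x + inv_into L \<sigma> y"]
        inv'[of "inv_into L \<sigma> x * inv_into L \<sigma> y"] h L.add_in L.mult_in
      unfolding ring_hom_on_def by metis+
  qed
  then have "ring_hom_on L \<tau>"
    using ring_hom_on_cong[of L \<tau> "inv_into L \<sigma>"] L.subring_on_axioms by (simp add: \<tau>_def)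
  moreover have "\<tau> x = x" if "x \<in> K" for x
    using inv'[of x] \<sigma> that assms(2) by (auto simp: car \<tau>_def)
  ultimately have "\<tau> \<in> carrier (galois_group L K)"
    using bij by (auto simp: car \<tau>_def)
  moreover have "compose L \<tau> \<sigma> = \<one>\<^bsub>galois_group L K\<^esub>"
    using inv' b by (auto simp: one compose_def \<tau>_def bij_betw_def fun_eq_iff)
  ultimately show "\<exists>\<tau>\<in>carrier (galois_group L K). \<tau> \<otimes>\<^bsub>galois_group L K\<^esub> \<sigma> = \<one>\<^bsub>galois_group L K\<^esub>"
    using mult[OF _ \<sigma>] by (intro bexI[of _ \<tau>]) auto
next
  interpret L: subfield_on L by fact
  note car = carrier_galois_group[OF L, of K]
  note mult = galois_group_simps(2)[OF L, of _ K]
  have comp: "compose L \<sigma> \<tau> \<in> carrier (galois_group L K)"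
    if "\<sigma> \<in> carrier (galois_group L K)" "\<tau> \<in> carrier (galois_group L K)" for \<sigma> \<tau>
  proof -
    have \<tau>: "\<tau> x \<in> L" if "x \<in> L" for x
      using \<open>\<tau> \<in> _\<close> that by (auto simp: car bij_betw_def)
    have "ring_hom_on L (compose L \<sigma> \<tau>) \<longleftrightarrow> ring_hom_on L (\<lambda>x. \<sigma> (\<tau> x))"
      by (rule ring_hom_on_cong) (auto simp: compose_def L.subring_on_axioms)
    then show ?thesis
      using that \<tau> assms(2) ring_hom_on_comp[of L \<sigma> L \<tau>]
      by (auto simp: car bij_betw_compose compose_eq subset_iff)
  qed
  fix \<rho> \<sigma> \<tau> assume "\<rho> \<in> carrier (galois_group L K)" "\<sigma> \<in> carrier (galois_group L K)" "\<tau> \<in> carrier (galois_group L K)"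
  then show "\<rho> \<otimes>\<^bsub>galois_group L K\<^esub> \<sigma> \<otimes>\<^bsub>galois_group L K\<^esub> \<tau> = \<rho> \<otimes>\<^bsub>galois_group L K\<^esub> (\<sigma> \<otimes>\<^bsub>galois_group L K\<^esub> \<tau>)"
    using comp by (simp add: mult) (auto simp: compose_def fun_eq_iff car bij_betw_def)
qed


lemma embedding_restrict:
  assumes L: "subfield_on L" "L \<subseteq> Qbar" and g: "g \<in> embeddings" "\<And>z. z \<in> L \<Longrightarrow> g z \<in> L" "\<And>x. x \<in> K \<Longrightarrow> g x = x"
    and "K \<subseteq> L"
  shows "restrict g L \<in> carrier (galois_group L K)"
proof -
  interpret L: subfield_on L by fact
  have h: "ring_hom_on L g"
    using g(1) L(2) ring_hom_on_subset by (auto simp: embeddings_def)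
  have "bij_betw g L L"
    by (rule self_embedding_surj[OF L(1) Rats_subset[OF L(1)] _ h])
       (use L g embedding_fixes in \<open>auto simp: Qbar_def\<close>)
  moreover have "ring_hom_on L (restrict g L)"
    using ring_hom_on_cong[OF L.subring_on_axioms, of "restrict g L" g] h by simp
  ultimately show ?thesis
    using g(3) assms(6) by (auto simp: carrier_galois_group[OF L(1)] bij_betw_restrict_eq)
qed

lemma galois_lift:
  assumes "subfield_on L" "L \<subseteq> Qbar" "\<sigma> \<in> carrier (galois_group L K)"
  obtains g where "g \<in> embeddings" "\<And>x. x \<in> L \<Longrightarrow> g x = \<sigma> x"
  using embedding_extend[OF assms(1,2), of \<sigma>] assms(3)
  by (auto simp: carrier_galois_group[OF assms(1)])

lemma finite_roots_polys: "p \<noteq> 0 \<Longrightarrow> finite {x :: 'a :: idom. poly p x = 0}"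
  by (rule poly_roots_finite)

lemma abelian_extensionD:
  assumes "abelian_extension L"
  shows "subfield_on L" "L \<subseteq> Qbar"
    "\<And>z. z \<in> L \<Longrightarrow> (\<And>\<sigma>. \<sigma> \<in> carrier (galois_group L \<rat>) \<Longrightarrow> \<sigma> z = z) \<Longrightarrow> z \<in> \<rat>"
    "comm_group (galois_group L \<rat>)"
  using assms by (auto simp: abelian_extension_def subfield_iff_subfield_on algebraic_iff_Qbar)

text \<open>An orbit of a group of automorphisms is the set of roots of a polynomial over its fixed
  field.\<close>

lemma orbit_poly_fixed:
  fixes L :: "'a :: field set"
  assumes L: "subfield_on L" and S: "finite S" "S \<subseteq> L"
    and \<sigma>: "ring_hom_on L \<sigma>" "\<sigma> ` S = S"
  shows "map_poly \<sigma> (\<Prod>s\<in>S. [:- s, 1:]) = (\<Prod>s\<in>S. [:- s, 1:])"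
proof -
  interpret field_hom_on L \<sigma>
    using assms by (simp add: field_hom_on_def hom_on_def hom_on_axioms_def subfield_on_def)
  have inj: "inj_on \<sigma> S"
    using hom_inj S inj_on_subset by blast
  have "map_poly \<sigma> (\<Prod>s\<in>S. [:- s, 1:]) = (\<Prod>s\<in>S. map_poly \<sigma> [:- s, 1:])"
    by (rule map_poly_prod) (use S in auto)
  also have "\<dots> = (\<Prod>s\<in>S. [:- \<sigma> s, 1:])"
    using S by (intro prod.cong refl) (auto simp: map_poly_pCons hom_uminus subset_iff)
  also have "\<dots> = (\<Prod>s\<in>\<sigma> ` S. [:- s, 1:])"
    by (simp add: prod.reindex[OF inj])
  finally show ?thesis using \<sigma>(2) by simp
qed

lemma poly_prod_roots:
  "finite S \<Longrightarrow> poly (\<Prod>s\<in>S. [:- s, 1 :: 'a :: idom:]) x = 0 \<longleftrightarrow> x \<in> S"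
  by (auto simp: poly_prod)

text \<open>Abelian extensions are normal: the orbit polynomial of \<open>z\<close> under the Galois group has rational
  coefficients and all its roots in \<open>L\<close>.\<close>

lemma abelian_extension_stable:
  assumes L: "abelian_extension L" and g: "g \<in> embeddings" and z: "z \<in> L"
  shows "g z \<in> L"
proof -
  note L' = abelian_extensionD[OF L]
  interpret L: subfield_on L by (rule L')
  define G where "G = galois_group L \<rat>"
  interpret G: comm_group G unfolding G_def by (rule L'(4))
  note car = carrier_galois_group[OF L'(1), of \<rat>, folded G_def]
  note mult = galois_group_simps(2)[OF L'(1), of _ \<rat>, folded G_def]
  define S where "S = (\<lambda>\<sigma>. \<sigma> z) ` carrier G"
  obtain p where p: "p \<in> polys \<rat>" "p \<noteq> 0" "poly p z = 0"
    using L'(2) z by (auto simp: Qbar_def algebraic_over_def)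
  have SL: "S \<subseteq> L"
    using z by (auto simp: S_def car bij_betw_def)
  have "poly p (\<sigma> z) = 0" if "\<sigma> \<in> carrier G" for \<sigma>
  proof -
    have h: "ring_hom_on L \<sigma>" "\<And>x. x \<in> \<rat> \<Longrightarrow> \<sigma> x = x"
      using that by (simp_all add: car)
    show ?thesis
      by (rule root_image[OF L'(1) h(1) Rats_subset[OF L'(1)] h(2) p(1) z p(3)])
  qed
  then have fin: "finite S"
    by (intro finite_subset[OF _ finite_roots_polys[OF p(2)]]) (auto simp: S_def)
  have zS: "z \<in> S"
    unfolding S_def
  proof (rule image_eqI)
    show "z = \<one>\<^bsub>G\<^esub> z"
      using galois_group_simps(3)[OF L'(1), of \<rat>] z by (simp add: G_def)
  qed simp
  define P where "P = (\<Prod>s\<in>S. [:- s, 1:])"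
  have PL: "P \<in> polys L"
    unfolding P_def using SL by auto
  have "P \<in> polys \<rat>"
    unfolding polys_def
  proof (intro CollectI allI)
    fix i
    show "poly.coeff P i \<in> \<rat>"
    proof (rule L'(3))
      show "poly.coeff P i \<in> L" using PL by (rule polysD)
      fix \<sigma> assume \<sigma>: "\<sigma> \<in> carrier (galois_group L \<rat>)"
      then have \<sigma>': "\<sigma> \<in> carrier G" by (simp add: G_def)
      have "\<sigma> ` S \<subseteq> S"
      proof
        fix x assume "x \<in> \<sigma> ` S"
        then obtain \<tau> where \<tau>: "\<tau> \<in> carrier G" "x = \<sigma> (\<tau> z)" by (auto simp: S_def)
        then have "x = (\<sigma> \<otimes>\<^bsub>G\<^esub> \<tau>) z"
          using mult[OF \<sigma>' \<tau>(1)] z by (simp add: compose_def)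
        then show "x \<in> S" using \<tau> \<sigma>' by (auto simp: S_def)
      qed
      moreover have "inj_on \<sigma> S"
        using \<sigma>' SL by (auto simp: car bij_betw_def intro: inj_on_subset)
      ultimately have "\<sigma> ` S = S"
        using fin by (simp add: endo_inj_surj)
      then have "map_poly \<sigma> P = P"
        unfolding P_def using \<sigma>' by (intro orbit_poly_fixed[OF L'(1) fin SL]) (auto simp: car)
      moreover have "\<sigma> 0 = 0"
        using \<sigma>' by (simp add: car)
      ultimately show "\<sigma> (poly.coeff P i) = poly.coeff P i"
        by (metis coeff_map_poly)
    qed
  qed
  moreover have "poly P z = 0"
    using zS fin by (simp add: P_def poly_prod_roots)
  ultimately have "poly P (g z) = 0"
    using root_image[OF subfield_on_Qbar _ Rats_Qbar embedding_fixes[OF g]] g z L'(2)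
    unfolding embeddings_def by blast
  then show ?thesis
    using fin SL by (auto simp: P_def poly_prod_roots)
qed

text \<open>An abelian extension is stable under all embeddings, which commute on it; conversely the
  numbers on which all embeddings commute form a field that is itself abelian. Describing
  \<^const>\<open>Qab\<close> by this condition shows at once that it is a field, which is not
  apparent from its definition as a union of all abelian extensions.\<close>

definition commutator_fixed :: "complex set"
  where "commutator_fixed = {z \<in> Qbar. \<forall>g\<in>embeddings. \<forall>h\<in>embeddings. g (h z) = h (g z)}"

lemma embedding_hom: "g \<in> embeddings \<Longrightarrow> field_hom_on Qbar g"
  using subfield_on_Qbar by (simp add: embeddings_def field_hom_on_def hom_on_def hom_on_axioms_def subfield_on_def)

lemma subfield_on_commutator_fixed: "subfield_on commutator_fixed"
proof -
  interpret Q: subfield_on Qbar by (rule subfield_on_Qbar)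
  have hom: "g (x + y) = g x + g y" "g (x * y) = g x * g y" "g (- x) = - g x" "g (inverse x) = inverse (g x)"
    if "g \<in> embeddings" "x \<in> Qbar" "y \<in> Qbar" for g x y
  proof -
    interpret field_hom_on Qbar g using that(1) by (rule embedding_hom)
    show "g (x + y) = g x + g y" "g (x * y) = g x * g y" "g (- x) = - g x" "g (inverse x) = inverse (g x)"
      using that by (auto simp: hom_add hom_mult hom_uminus hom_inverse)
  qed
  have 01: "g 0 = 0" "g 1 = 1" if "g \<in> embeddings" for g
    using embedding_fixes[OF that] by auto
  show ?thesis
    by standard (auto simp: commutator_fixed_def hom embedding_closed 01)
qed

lemma commutator_fixed_closed: "g \<in> embeddings \<Longrightarrow> z \<in> commutator_fixed \<Longrightarrow> g z \<in> commutator_fixed"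
proof -
  assume g: "g \<in> embeddings" and z: "z \<in> commutator_fixed"
  have "h (k (g z)) = k (h (g z))" if hk: "h \<in> embeddings" "k \<in> embeddings" for h k
  proof -
    have c: "a (b z) = b (a z)" if "a \<in> embeddings" "b \<in> embeddings" for a b
      using z that by (auto simp: commutator_fixed_def)
    have "h (k (g z)) = g (h (k z))"
      using c[OF embedding_comp[OF hk] g] by simp
    also have "\<dots> = g (k (h z))"
      using c[OF hk] by simp
    also have "\<dots> = k (h (g z))"
      using c[OF g embedding_comp[OF hk(2,1)]] by simp
    finally show ?thesis .
  qed
  then show ?thesis
    using z g by (auto simp: commutator_fixed_def embedding_closed)
qed

lemma abelian_extension_commutator_fixed: "abelian_extension commutator_fixed"
  unfolding abelian_extension_def
proof (intro conjI ballI)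
  note C = subfield_on_commutator_fixed
  have sub: "commutator_fixed \<subseteq> Qbar" by (auto simp: commutator_fixed_def)
  note car = carrier_galois_group[OF C, of \<rat>]
  show "subfield commutator_fixed \<C>"
    using C by (simp add: subfield_iff_subfield_on)
  show "algebraic z" if "z \<in> commutator_fixed" for z
    using that sub algebraic_iff_Qbar by blast
  show "{z \<in> commutator_fixed. \<forall>\<sigma>\<in>carrier (galois_group commutator_fixed \<rat>). \<sigma> z = z} = \<rat>"
  proof
    show "\<rat> \<subseteq> {z \<in> commutator_fixed. \<forall>\<sigma>\<in>carrier (galois_group commutator_fixed \<rat>). \<sigma> z = z}"
      using Rats_subset[OF C] by (auto simp: car)
    show "{z \<in> commutator_fixed. \<forall>\<sigma>\<in>carrier (galois_group commutator_fixed \<rat>). \<sigma> z = z} \<subseteq> \<rat>"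
    proof (intro subsetI, rule ccontr)
      fix z assume z: "z \<in> {z \<in> commutator_fixed. \<forall>\<sigma>\<in>carrier (galois_group commutator_fixed \<rat>). \<sigma> z = z}" and nz: "z \<notin> \<rat>"
      have zQ: "z \<in> Qbar" using z sub by blast
      obtain g where g: "g \<in> embeddings" "g z \<noteq> z"
        using embedding_moves[OF subfield_on_Rats Rats_Qbar zQ nz] by blast
      have "restrict g commutator_fixed \<in> carrier (galois_group commutator_fixed \<rat>)"
        using embedding_restrict[OF C sub g(1) commutator_fixed_closed[OF g(1)] embedding_fixes[OF g(1)] Rats_subset[OF C]] .
      then show False using z g by auto
    qed
  qed
  show "comm_group (galois_group commutator_fixed \<rat>)"
  proof (rule group.group_comm_groupI[OF group_galois_group[OF C Rats_subset[OF C]]])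
    fix \<sigma> \<tau> assume st: "\<sigma> \<in> carrier (galois_group commutator_fixed \<rat>)" "\<tau> \<in> carrier (galois_group commutator_fixed \<rat>)"
    obtain g where g: "g \<in> embeddings" "\<And>x. x \<in> commutator_fixed \<Longrightarrow> g x = \<sigma> x"
      using galois_lift[OF C sub st(1)] by blast
    obtain h where h: "h \<in> embeddings" "\<And>x. x \<in> commutator_fixed \<Longrightarrow> h x = \<tau> x"
      using galois_lift[OF C sub st(2)] by blast
    have "compose commutator_fixed \<sigma> \<tau> = compose commutator_fixed \<tau> \<sigma>"
    proof
      fix x
      show "compose commutator_fixed \<sigma> \<tau> x = compose commutator_fixed \<tau> \<sigma> x"
      proof (cases "x \<in> commutator_fixed")
        case True
        then have "\<sigma> x \<in> commutator_fixed" "\<tau> x \<in> commutator_fixed"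
          using st by (auto simp: car bij_betw_def)
        moreover have "g (h x) = h (g x)"
          using True g(1) h(1) by (auto simp: commutator_fixed_def)
        ultimately show ?thesis
          using True g(2) h(2) by (simp add: compose_def)
      qed (simp add: compose_def)
    qed
    then show "\<sigma> \<otimes>\<^bsub>galois_group commutator_fixed \<rat>\<^esub> \<tau> = \<tau> \<otimes>\<^bsub>galois_group commutator_fixed \<rat>\<^esub> \<sigma>"
      using st by (simp add: galois_group_simps(2)[OF C])
  qed
qed

lemma Qab_eq_commutator_fixed: "Qab = commutator_fixed"
proof
  show "commutator_fixed \<subseteq> Qab"
    unfolding Qab_def using abelian_extension_commutator_fixed by blast
  show "Qab \<subseteq> commutator_fixed"
  proof
    fix z assume "z \<in> Qab"
    then obtain L where L: "abelian_extension L" "z \<in> L" by (auto simp: Qab_def)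
    note L' = abelian_extensionD[OF L(1)]
    interpret G: comm_group "galois_group L \<rat>" by (rule L')
    have "g (h z) = h (g z)" if gh: "g \<in> embeddings" "h \<in> embeddings" for g h
    proof -
      have r: "restrict k L \<in> carrier (galois_group L \<rat>)" if "k \<in> embeddings" for k
        using embedding_restrict[OF L'(1,2) that abelian_extension_stable[OF L(1) that] embedding_fixes[OF that] Rats_subset[OF L'(1)]] .
      have "compose L (restrict g L) (restrict h L) = compose L (restrict h L) (restrict g L)"
        using G.m_comm[OF r[OF gh(1)] r[OF gh(2)]] r gh by (simp add: galois_group_simps(2)[OF L'(1)])
      from fun_cong[OF this, of z] show ?thesis
        using L(2) abelian_extension_stable[OF L(1)] gh by (simp add: compose_def)
    qed
    then show "z \<in> commutator_fixed"
      using L L'(2) by (auto simp: commutator_fixed_def)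
  qed
qed

lemma subfield_on_Qab: "subfield_on Qab"
  and Qab_Qbar: "Qab \<subseteq> Qbar"
  and embedding_Qab: "g \<in> embeddings \<Longrightarrow> z \<in> Qab \<Longrightarrow> g z \<in> Qab"
  and Qab_commute: "z \<in> Qab \<Longrightarrow> g \<in> embeddings \<Longrightarrow> h \<in> embeddings \<Longrightarrow> g (h z) = h (g z)"
  and comm_group_Gab: "comm_group Gab"
  using subfield_on_commutator_fixed abelian_extensionD(4)[OF abelian_extension_commutator_fixed]
  by (auto simp: Qab_eq_commutator_fixed commutator_fixed_closed) (auto simp: commutator_fixed_def)

lemma Gab_lift:
  assumes "\<tau> \<in> carrier (galois_group Qab K)"
  obtains g where "g \<in> embeddings" "\<And>x. x \<in> Qab \<Longrightarrow> g x = \<tau> x"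
  using galois_lift[OF subfield_on_Qab Qab_Qbar assms] by blast

lemma embedding_in_Gab:
  assumes "g \<in> embeddings" "\<And>x. x \<in> K \<Longrightarrow> g x = x" "K \<subseteq> Qab"
  shows "restrict g Qab \<in> carrier (galois_group Qab K)"
  using embedding_restrict[OF subfield_on_Qab Qab_Qbar assms(1) embedding_Qab[OF assms(1)] assms(2,3)] .

lemma carrier_Gab: "carrier (galois_group Qab K) =
    {\<sigma> \<in> extensional Qab. bij_betw \<sigma> Qab Qab \<and> ring_hom_on Qab \<sigma> \<and> (\<forall>x\<in>K. \<sigma> x = x)}"
  by (rule carrier_galois_group[OF subfield_on_Qab])

lemma carrier_Gab_subset: "carrier (galois_group Qab K) \<subseteq> carrier Gab"
  unfolding carrier_Gab using ring_hom_on_fixes_Rats[OF subfield_on_Qab] by blast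

lemma Gab_closed: "\<tau> \<in> carrier Gab \<Longrightarrow> x \<in> Qab \<Longrightarrow> \<tau> x \<in> Qab"
  by (auto simp: carrier_Gab bij_betw_def)

lemma Gab_mult: "\<sigma> \<in> carrier Gab \<Longrightarrow> \<tau> \<in> carrier Gab \<Longrightarrow> \<sigma> \<otimes>\<^bsub>Gab\<^esub> \<tau> = compose Qab \<sigma> \<tau>"
  by (rule galois_group_simps(2)[OF subfield_on_Qab])

lemma Gab_mult_apply:
  "\<sigma> \<in> carrier Gab \<Longrightarrow> \<tau> \<in> carrier Gab \<Longrightarrow> x \<in> Qab \<Longrightarrow> (\<sigma> \<otimes>\<^bsub>Gab\<^esub> \<tau>) x = \<sigma> (\<tau> x)"
  by (simp add: Gab_mult compose_eq)

lemma Gab_inv_apply: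
  assumes "\<sigma> \<in> carrier Gab" "x \<in> Qab"
  shows "(inv\<^bsub>Gab\<^esub> \<sigma>) (\<sigma> x) = x" "\<sigma> ((inv\<^bsub>Gab\<^esub> \<sigma>) x) = x"
proof -
  interpret comm_group Gab by (rule comm_group_Gab)
  have inv: "inv\<^bsub>Gab\<^esub> \<sigma> \<in> carrier Gab" using assms by simp
  have one: "\<one>\<^bsub>Gab\<^esub> x = x" using assms by (simp add: galois_group_simps(3)[OF subfield_on_Qab])
  show "(inv\<^bsub>Gab\<^esub> \<sigma>) (\<sigma> x) = x"
    using Gab_mult_apply[OF inv assms] l_inv[OF assms(1)] one by simp
  show "\<sigma> ((inv\<^bsub>Gab\<^esub> \<sigma>) x) = x"
    using Gab_mult_apply[OF assms(1) inv assms(2)] r_inv[OF assms(1)] one by simp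
qed

lemma Gab_moves:
  assumes "subfield_on K" "K \<subseteq> Qab" "z \<in> Qab" "z \<notin> K"
  obtains \<tau> where "\<tau> \<in> carrier (galois_group Qab K)" "\<tau> z \<noteq> z"
proof -
  have "K \<subseteq> Qbar" "z \<in> Qbar" using assms Qab_Qbar by auto
  then obtain g where g: "g \<in> embeddings" "\<And>x. x \<in> K \<Longrightarrow> g x = x" "g z \<noteq> z"
    using embedding_moves[OF assms(1) _ _ assms(4)] by blast
  then show ?thesis
    using that[OF embedding_in_Gab[OF g(1,2) assms(2)]] assms(3) by simp
qed

text \<open>Every subfield of \<^const>\<open>Qab\<close> is normal over the rationals, the Galois group being abelian: an
  automorphism over \<open>K\<close> moving \<open>\<tau> z\<close> would also move \<open>z\<close>.\<close>

lemma Gab_stable: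
  assumes K: "subfield_on K" "K \<subseteq> Qab" and \<tau>: "\<tau> \<in> carrier Gab" and z: "z \<in> K"
  shows "\<tau> z \<in> K"
proof (rule ccontr)
  assume n: "\<tau> z \<notin> K"
  interpret comm_group Gab by (rule comm_group_Gab)
  have zQ: "z \<in> Qab" "\<tau> z \<in> Qab" using K z \<tau> Gab_closed by auto
  obtain \<rho> where \<rho>: "\<rho> \<in> carrier (galois_group Qab K)" "\<rho> (\<tau> z) \<noteq> \<tau> z"
    using Gab_moves[OF K zQ(2) n] .
  then have "\<rho> \<in> carrier Gab" using carrier_Gab_subset by blast
  then have "\<rho> (\<tau> z) = \<tau> (\<rho> z)"
    using m_comm[of \<rho> \<tau>] \<tau> zQ(1) Gab_mult_apply by metis
  moreover have "\<rho> z = z" using \<rho>(1) z by (simp add: carrier_Gab)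
  ultimately show False using \<rho>(2) by simp
qed

lemma Gab_restrict:
  assumes K: "subfield_on K" "K \<subseteq> Qab" and \<tau>: "\<tau> \<in> carrier Gab"
  shows "restrict \<tau> K \<in> carrier (galois_group K \<rat>)"
proof -
  obtain g where g: "g \<in> embeddings" "\<And>x. x \<in> Qab \<Longrightarrow> g x = \<tau> x"
    using Gab_lift[OF \<tau>] by blast
  have st: "g z \<in> K" if "z \<in> K" for z
    using Gab_stable[OF K \<tau> that] g(2)[of z] K(2) that by auto
  have "K \<subseteq> Qbar" using K(2) Qab_Qbar by blast
  from embedding_restrict[OF K(1) this g(1) st embedding_fixes[OF g(1)] Rats_subset[OF K(1)]]
  have "restrict g K \<in> carrier (galois_group K \<rat>)" .
  moreover have "restrict g K = restrict \<tau> K"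
    using g(2) K(2) by (auto simp: fun_eq_iff)
  ultimately show ?thesis by simp
qed

lemma Gab_prolong:
  assumes K: "subfield_on K" "K \<subseteq> Qab" and \<sigma>: "\<sigma> \<in> carrier (galois_group K \<rat>)"
  shows "prolong K \<sigma> \<in> carrier Gab" "restrict (prolong K \<sigma>) K = \<sigma>"
proof -
  have sub: "K \<subseteq> Qbar" using K(2) Qab_Qbar by blast
  obtain g where g: "g \<in> embeddings" "\<And>x. x \<in> K \<Longrightarrow> g x = \<sigma> x"
    using galois_lift[OF K(1) sub \<sigma>] by blast
  have "restrict g Qab \<in> carrier Gab"
    using embedding_in_Gab[OF g(1) embedding_fixes[OF g(1)] Rats_subset[OF subfield_on_Qab]] .
  moreover have "restrict (restrict g Qab) K = \<sigma>"
    using g(2) K(2) \<sigma> by (auto simp: fun_eq_iff carrier_galois_group[OF K(1)] extensional_def)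
  ultimately have "\<exists>\<tau>. \<tau> \<in> carrier Gab \<and> restrict \<tau> K = \<sigma>" by blast
  from someI_ex[OF this] show "prolong K \<sigma> \<in> carrier Gab" "restrict (prolong K \<sigma>) K = \<sigma>"
    by (simp_all add: prolong_def)
qed

lemma restrict_mult:
  assumes K: "subfield_on K" "K \<subseteq> Qab" and st: "\<sigma> \<in> carrier Gab" "\<tau> \<in> carrier Gab"
  shows "restrict (\<sigma> \<otimes>\<^bsub>Gab\<^esub> \<tau>) K = restrict \<sigma> K \<otimes>\<^bsub>galois_group K \<rat>\<^esub> restrict \<tau> K"
  using Gab_restrict[OF K] st Gab_stable[OF K st(2)] K(2)
  by (auto simp: galois_group_simps(2)[OF K(1)] compose_def Gab_mult_apply fun_eq_iff)

lemma comm_group_level: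
  assumes K: "subfield_on K" "K \<subseteq> Qab"
  shows "comm_group (galois_group K \<rat>)"
proof (rule group.group_comm_groupI[OF group_galois_group[OF K(1) Rats_subset[OF K(1)]]])
  interpret comm_group Gab by (rule comm_group_Gab)
  fix \<sigma> \<tau> assume st: "\<sigma> \<in> carrier (galois_group K \<rat>)" "\<tau> \<in> carrier (galois_group K \<rat>)"
  note p = Gab_prolong[OF K st(1)] Gab_prolong[OF K st(2)]
  show "\<sigma> \<otimes>\<^bsub>galois_group K \<rat>\<^esub> \<tau> = \<tau> \<otimes>\<^bsub>galois_group K \<rat>\<^esub> \<sigma>"
    using restrict_mult[OF K p(1,3)] restrict_mult[OF K p(3,1)] m_comm[OF p(1,3)] p by simp
qed

lemma restrict_eq_imp:
  assumes K: "subfield_on K" "K \<subseteq> Qab" and st: "\<sigma> \<in> carrier Gab" "\<tau> \<in> carrier Gab"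
    and eq: "\<And>x. x \<in> K \<Longrightarrow> \<sigma> x = \<tau> x"
  shows "inv\<^bsub>Gab\<^esub> \<sigma> \<otimes>\<^bsub>Gab\<^esub> \<tau> \<in> carrier (galois_group Qab K)"
proof -
  interpret comm_group Gab by (rule comm_group_Gab)
  have "inv\<^bsub>Gab\<^esub> \<sigma> \<otimes>\<^bsub>Gab\<^esub> \<tau> \<in> carrier Gab" using st by simp
  moreover have "(inv\<^bsub>Gab\<^esub> \<sigma> \<otimes>\<^bsub>Gab\<^esub> \<tau>) x = x" if "x \<in> K" for x
    using that eq[OF that] K(2) st Gab_mult_apply[of "inv\<^bsub>Gab\<^esub> \<sigma>" \<tau> x] Gab_inv_apply(1)[of \<sigma> x] by auto
  ultimately show ?thesis
    by (simp add: carrier_Gab)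
qed

lemma abelian_number_fieldsD:
  assumes "K \<in> abelian_number_fields"
  shows "subfield_on K" "K \<subseteq> Qab" "ring.finite_dimension \<C> \<rat> K"
  using assms by (auto simp: abelian_number_fields_def subfield_iff_subfield_on)

text \<open>Automorphisms of a number field are determined by their values on a finite spanning list,
  and these values lie in finite sets of roots.\<close>

lemma finite_restrictions:
  assumes K: "subfield_on K" "K \<subseteq> Qab" and bs: "set bs \<subseteq> K"
  shows "finite ((\<lambda>\<tau>. map \<tau> bs) ` carrier Gab)"
proof -
  have "\<exists>p. p \<in> polys \<rat> \<and> p \<noteq> 0 \<and> poly p b = 0" if "b \<in> set bs" for b
  proof -
    have "b \<in> Qbar" using that bs K(2) Qab_Qbar by blast
    then show ?thesis by (auto simp: Qbar_def algebraic_over_def)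
  qed
  then obtain p where p: "\<And>b. b \<in> set bs \<Longrightarrow> p b \<in> polys \<rat> \<and> p b \<noteq> 0 \<and> poly (p b) b = 0"
    by metis
  define R where "R = (\<Union>b\<in>set bs. {x. poly (p b) x = 0})"
  have "finite R"
    unfolding R_def using p poly_roots_finite by blast
  moreover have "(\<lambda>\<tau>. map \<tau> bs) ` carrier Gab \<subseteq> {xs. set xs \<subseteq> R \<and> length xs = length bs}"
  proof (intro image_subsetI CollectI conjI subsetI)
    fix \<tau> y assume \<tau>: "\<tau> \<in> carrier Gab" and "y \<in> set (map \<tau> bs)"
    then obtain b where b: "b \<in> set bs" and y: "y = \<tau> b" by auto
    have h: "ring_hom_on Qab \<tau>" "\<And>x. x \<in> \<rat> \<Longrightarrow> \<tau> x = x" using \<tau> by (auto simp: carrier_Gab)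
    have "poly (p b) (\<tau> b) = 0"
      using root_image[OF subfield_on_Qab h(1) Rats_subset[OF subfield_on_Qab] h(2)] p[OF b] b bs K(2) by blast
    then show "y \<in> R" using b y by (auto simp: R_def)
  qed simp
  ultimately show ?thesis
    using finite_lists_length_eq finite_subset by blast
qed

text \<open>The elements on which \<open>\<sigma>\<close> and \<open>\<tau>\<close> agree are closed under linear operations, so agreement on a
  spanning list is enough.\<close>

lemma agree_on_span:
  assumes K: "subfield_on K" "K \<subseteq> Qab" and st: "\<sigma> \<in> carrier Gab" "\<tau> \<in> carrier Gab"
    and bs: "spanning \<rat> bs K"
    and eq: "map \<sigma> bs = map \<tau> bs" and x: "x \<in> K"
  shows "\<sigma> x = \<tau> x"
proof -
  interpret Q: subfield_on Qab by (rule subfield_on_Qab)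
  interpret s: field_hom_on Qab \<sigma>
    using st by (simp add: carrier_Gab field_hom_on_def hom_on_def hom_on_axioms_def subfield_on_Qab Q.subring_on_axioms)
  interpret t: field_hom_on Qab \<tau>
    using st by (simp add: carrier_Gab field_hom_on_def hom_on_def hom_on_axioms_def subfield_on_Qab Q.subring_on_axioms)
  have rat: "\<sigma> c = c" "\<tau> c = c" "c \<in> Qab" if "c \<in> \<rat>" for c
    using st that Rats_subset[OF subfield_on_Qab] by (auto simp: carrier_Gab)
  have "K \<subseteq> {x \<in> Qab. \<sigma> x = \<tau> x}"
    using bs eq K(2) rat unfolding spanning_def
    by (elim conjE allE[of _ "{x \<in> Qab. \<sigma> x = \<tau> x}"])
       (auto simp: s.hom_add t.hom_add s.hom_mult t.hom_mult)
  then show ?thesis using x by blast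
qed

lemma finite_level:
  assumes K: "K \<in> abelian_number_fields"
  shows "finite (carrier (galois_group K \<rat>))"
proof -
  note K' = abelian_number_fieldsD[OF K]
  obtain bs where "spanning \<rat> bs K"
    using finite_dimension_spanning[OF subfield_on_Rats K'(3)] .
  then have bs: "set bs \<subseteq> K" "spanning \<rat> bs K"
    by (simp_all add: spanning_def)
  have "inj_on (\<lambda>\<sigma>. map (prolong K \<sigma>) bs) (carrier (galois_group K \<rat>))"
  proof (rule inj_onI)
    fix \<sigma> \<tau> assume st: "\<sigma> \<in> carrier (galois_group K \<rat>)" "\<tau> \<in> carrier (galois_group K \<rat>)"
      and eq: "map (prolong K \<sigma>) bs = map (prolong K \<tau>) bs"
    note p = Gab_prolong[OF K'(1,2) st(1)] Gab_prolong[OF K'(1,2) st(2)]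
    have "restrict (prolong K \<sigma>) K = restrict (prolong K \<tau>) K"
    proof (rule restrict_ext)
      fix x assume "x \<in> K"
      then show "prolong K \<sigma> x = prolong K \<tau> x"
        by (rule agree_on_span[OF K'(1,2) p(1,3) bs(2) eq])
    qed
    then show "\<sigma> = \<tau>" using p by simp
  qed
  moreover have "finite ((\<lambda>\<sigma>. map (prolong K \<sigma>) bs) ` carrier (galois_group K \<rat>))"
    by (rule finite_subset[OF _ finite_restrictions[OF K'(1,2) bs(1)]]) (use Gab_prolong[OF K'(1,2)] in auto)
  ultimately show ?thesis
    using finite_imageD by blast
qed

text \<open>The polynomial with coefficients \<open>bs\<close> is mapped by the finitely many restrictions to finitely
  many polynomials, whose values at some natural number \<open>t\<close> are distinct. The automorphisms fix
  \<open>t\<close>, so its value at \<open>t\<close> separates them.\<close>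

lemma separating_element:
  assumes K: "K \<in> abelian_number_fields"
  obtains \<theta> where "\<theta> \<in> K"
    "\<And>\<sigma> \<tau> x. \<sigma> \<in> carrier Gab \<Longrightarrow> \<tau> \<in> carrier Gab \<Longrightarrow> \<sigma> \<theta> = \<tau> \<theta> \<Longrightarrow> x \<in> K \<Longrightarrow> \<sigma> x = \<tau> x"
proof -
  note K' = abelian_number_fieldsD[OF K]
  interpret K: subfield_on K by (rule K')
  interpret Q: subfield_on Qab by (rule subfield_on_Qab)
  obtain bs where "spanning \<rat> bs K"
    using finite_dimension_spanning[OF subfield_on_Rats K'(3)] .
  then have bs: "set bs \<subseteq> K" "spanning \<rat> bs K"
    by (simp_all add: spanning_def)
  define Ls where "Ls = (\<lambda>\<tau>. map \<tau> bs) ` carrier Gab"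
  have finL: "finite Ls"
    unfolding Ls_def by (rule finite_restrictions[OF K'(1,2) bs(1)])
  define D where "D = {Poly xs - Poly ys | xs ys. xs \<in> Ls \<and> ys \<in> Ls \<and> xs \<noteq> ys}"
  have "D \<subseteq> (\<lambda>(xs, ys). Poly xs - Poly ys) ` (Ls \<times> Ls)"
    by (auto simp: D_def)
  then have "finite D"
    by (rule finite_subset) (use finL in auto)
  have D0: "d \<noteq> 0" if "d \<in> D" for d
  proof -
    obtain xs ys where d: "d = Poly xs - Poly ys" "xs \<in> Ls" "ys \<in> Ls" "xs \<noteq> ys"
      using \<open>d \<in> D\<close> unfolding D_def by blast
    then have "length xs = length ys" by (auto simp: Ls_def)
    then show ?thesis
      using d(1,4) list_eq_iff_nth_eq[of xs ys] coeff_Poly_eq nth_default_nth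
      by (metis eq_iff_diff_eq_0)
  qed
  then have "finite (\<Union>d\<in>D. {x. poly d x = 0})"
    using \<open>finite D\<close> poly_roots_finite by blast
  then have "finite ((of_nat :: nat \<Rightarrow> complex) -` (\<Union>d\<in>D. {x. poly d x = 0}))"
    by (rule finite_vimageI) (simp add: inj_of_nat)
  then obtain t :: nat where t: "of_nat t \<notin> (\<Union>d\<in>D. {x :: complex. poly d x = 0})"
    using ex_new_if_finite[OF infinite_UNIV_nat] by (metis vimageI2)
  define \<theta> where "\<theta> = poly (Poly bs) (of_nat t)"
  have "Poly bs \<in> polys K"
    unfolding polys_def using bs(1) by (auto simp: nth_default_def)
  then have \<theta>K: "\<theta> \<in> K"
    unfolding \<theta>_def by (rule K.poly_in) simp
  have im: "\<tau> \<theta> = poly (Poly (map \<tau> bs)) (of_nat t)" if "\<tau> \<in> carrier Gab" for \<tau>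
  proof -
    interpret t: field_hom_on Qab \<tau>
      using that by (simp add: carrier_Gab field_hom_on_def hom_on_def hom_on_axioms_def subfield_on_Qab Q.subring_on_axioms)
    have "\<tau> \<theta> = poly (map_poly \<tau> (Poly bs)) (\<tau> (of_nat t))"
      unfolding \<theta>_def using polys_mono[OF K'(2)] \<open>Poly bs \<in> polys K\<close>
      by (intro t.hom_poly) auto
    moreover have "map_poly \<tau> (Poly bs) = Poly (map \<tau> bs)"
      by (rule poly_eqI) (auto simp: coeff_map_poly nth_default_def)
    ultimately show ?thesis by simp
  qed
  show ?thesis
  proof (rule that[OF \<theta>K])
    fix \<sigma> \<tau> x assume st: "\<sigma> \<in> carrier Gab" "\<tau> \<in> carrier Gab" "\<sigma> \<theta> = \<tau> \<theta>" and x: "x \<in> K"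
    have "map \<sigma> bs = map \<tau> bs"
    proof (rule ccontr)
      assume "map \<sigma> bs \<noteq> map \<tau> bs"
      then have "Poly (map \<sigma> bs) - Poly (map \<tau> bs) \<in> D"
        using st(1,2) unfolding D_def Ls_def by blast
      then show False using t st im by fastforce
    qed
    then show "\<sigma> x = \<tau> x"
      using agree_on_span[OF K'(1,2) st(1,2) bs(2) _ x] by blast
  qed
qed

text \<open>The Galois correspondence for open subgroups \<open>N\<close>. An automorphism \<open>\<tau>\<close> trivial on the fixed field
  \<open>K\<close> of \<open>N\<close> maps a separating element \<open>\<theta>\<close> of \<open>K0\<close> to another root of the orbit polynomial of \<open>\<theta>\<close> under
  \<open>N\<close>, which has coefficients in \<open>K\<close>. So \<open>\<tau>\<close> agrees on \<open>K0\<close> with an element of \<open>N\<close>, and \<open>N\<close> contains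
  the automorphisms trivial on \<open>K0\<close>.\<close>

lemma open_subgroup_field:
  assumes N: "subgroup N Gab" and K0: "K0 \<in> abelian_number_fields"
    and N0: "carrier (galois_group Qab K0) \<subseteq> N"
  defines "K \<equiv> {z \<in> Qab. \<forall>\<sigma>\<in>N. \<sigma> z = z}"
  shows "K \<in> abelian_number_fields" "carrier (galois_group Qab K) = N"
proof -
  interpret G: comm_group Gab by (rule comm_group_Gab)
  interpret N: subgroup N Gab by fact
  interpret Q: subfield_on Qab by (rule subfield_on_Qab)
  note K0' = abelian_number_fieldsD[OF K0]
  interpret K0: subfield_on K0 by (rule K0')
  have NG: "\<sigma> \<in> carrier Gab" if "\<sigma> \<in> N" for \<sigma> using that N.subset by blast
  have hom: "field_hom_on Qab \<tau>" if "\<tau> \<in> carrier Gab" for \<tau>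
    using that by (simp add: carrier_Gab field_hom_on_def hom_on_def hom_on_axioms_def subfield_on_Qab Q.subring_on_axioms)
  have KQ: "K \<subseteq> Qab" by (auto simp: K_def)
  have homs: "\<sigma> (x + y) = \<sigma> x + \<sigma> y" "\<sigma> (x * y) = \<sigma> x * \<sigma> y" "\<sigma> (- x) = - \<sigma> x"
    "\<sigma> (inverse x) = inverse (\<sigma> x)" if "\<sigma> \<in> N" "x \<in> Qab" "y \<in> Qab" for \<sigma> x y
  proof -
    interpret field_hom_on Qab \<sigma> using hom[OF NG[OF that(1)]] .
    show "\<sigma> (x + y) = \<sigma> x + \<sigma> y" "\<sigma> (x * y) = \<sigma> x * \<sigma> y" "\<sigma> (- x) = - \<sigma> x"
      "\<sigma> (inverse x) = inverse (\<sigma> x)"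
      using that by (auto simp: hom_add hom_mult hom_uminus hom_inverse)
  qed
  have rat: "\<sigma> x = x" if "\<sigma> \<in> N" "x \<in> \<rat>" for \<sigma> x
    using NG[OF that(1)] that(2) by (auto simp: carrier_Gab)
  have Ksub: "subfield_on K"
    by standard (auto simp: K_def homs rat)
  have KK0: "K \<subseteq> K0"
  proof (intro subsetI, rule ccontr)
    fix z assume z: "z \<in> K" "z \<notin> K0"
    then have "z \<in> Qab" using KQ by blast
    from Gab_moves[OF K0'(1,2) this z(2)] obtain \<tau> where
      "\<tau> \<in> carrier (galois_group Qab K0)" "\<tau> z \<noteq> z" .
    then show False using z N0 by (auto simp: K_def)
  qed
  interpret C: field \<C> ..
  have "subalgebra \<rat> K \<C>"
  proof -
    interpret K: subfield_on K by (rule Ksub)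
    have "subfield K \<C>" using Ksub by (simp add: subfield_iff_subfield_on)
    then have "subring K \<C>" by (rule subfieldE)
    then have "subgroup K (add_monoid \<C>)" by (simp add: subring_def)
    then show ?thesis
      using Rats_subset[OF Ksub] by (auto simp: subalgebra_def subalgebra_axioms_def)
  qed
  then have "C.finite_dimension \<rat> K"
    using C.subalbegra_incl_imp_finite_dimension[OF _ K0'(3) _ KK0] subfield_on_Rats
    by (simp add: subfield_iff_subfield_on)
  then show "K \<in> abelian_number_fields"
    using Ksub KQ by (simp add: abelian_number_fields_def subfield_iff_subfield_on)
  show "carrier (galois_group Qab K) = N"
  proof
    show "N \<subseteq> carrier (galois_group Qab K)"
      using NG by (auto simp: K_def carrier_Gab)
    show "carrier (galois_group Qab K) \<subseteq> N"
    proof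
      fix \<tau> assume \<tau>: "\<tau> \<in> carrier (galois_group Qab K)"
      then have \<tau>G: "\<tau> \<in> carrier Gab" using carrier_Gab_subset by blast
      obtain \<theta> where \<theta>: "\<theta> \<in> K0"
        "\<And>\<sigma> \<tau> x. \<sigma> \<in> carrier Gab \<Longrightarrow> \<tau> \<in> carrier Gab \<Longrightarrow> \<sigma> \<theta> = \<tau> \<theta> \<Longrightarrow> x \<in> K0 \<Longrightarrow> \<sigma> x = \<tau> x"
        using separating_element[OF K0] by metis
      have \<theta>Q: "\<theta> \<in> Qab" using \<theta> K0' by blast
      define S where "S = (\<lambda>\<sigma>. \<sigma> \<theta>) ` N"
      have SQ: "S \<subseteq> Qab" using \<theta>Q NG Gab_closed by (auto simp: S_def)
      have "(\<lambda>\<sigma>. \<sigma> \<theta>) ` carrier Gab = (\<lambda>xs. xs ! 0) ` (\<lambda>\<sigma>. map \<sigma> [\<theta>]) ` carrier Gab"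
        by (auto simp: image_image)
      then have "finite ((\<lambda>\<sigma>. \<sigma> \<theta>) ` carrier Gab)"
        using finite_restrictions[OF K0'(1,2), of "[\<theta>]"] \<theta>(1) by simp
      then have fin: "finite S"
        by (rule finite_subset[rotated]) (use NG in \<open>auto simp: S_def\<close>)
      define P where "P = (\<Prod>s\<in>S. [:- s, 1:])"
      have PQ: "P \<in> polys Qab" unfolding P_def using SQ by auto
      have fixP: "map_poly \<sigma> P = P" if \<sigma>: "\<sigma> \<in> N" for \<sigma>
      proof -
        have "\<sigma> ` S \<subseteq> S"
        proof
          fix x assume "x \<in> \<sigma> ` S"
          then obtain \<rho> where \<rho>: "\<rho> \<in> N" "x = \<sigma> (\<rho> \<theta>)" by (auto simp: S_def)
          then have "x = (\<sigma> \<otimes>\<^bsub>Gab\<^esub> \<rho>) \<theta>"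
            using Gab_mult_apply[OF NG[OF \<sigma>] NG[OF \<rho>(1)] \<theta>Q] by simp
          then show "x \<in> S" using \<sigma> \<rho> by (auto simp: S_def)
        qed
        moreover have "inj_on \<sigma> S"
          using NG[OF \<sigma>] SQ by (auto simp: carrier_Gab bij_betw_def intro: inj_on_subset)
        ultimately have "\<sigma> ` S = S" using fin by (simp add: endo_inj_surj)
        then show ?thesis
          unfolding P_def using NG[OF \<sigma>] by (intro orbit_poly_fixed[OF subfield_on_Qab fin SQ]) (auto simp: carrier_Gab)
      qed
      have PK: "P \<in> polys K"
        unfolding polys_def K_def
      proof (intro CollectI allI conjI ballI)
        fix i show "poly.coeff P i \<in> Qab" using PQ by (rule polysD)
        fix \<sigma> assume \<sigma>: "\<sigma> \<in> N"
        have "\<sigma> 0 = 0" using NG[OF \<sigma>] by (auto simp: carrier_Gab)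
        then show "\<sigma> (poly.coeff P i) = poly.coeff P i"
          using fixP[OF \<sigma>] by (metis coeff_map_poly)
      qed
      have "\<theta> \<in> S"
        unfolding S_def
      proof (rule image_eqI)
        show "\<theta> = \<one>\<^bsub>Gab\<^esub> \<theta>" using \<theta>Q by (simp add: galois_group_simps(3)[OF subfield_on_Qab])
      qed simp
      then have P0: "poly P \<theta> = 0" using fin by (simp add: P_def poly_prod_roots)
      have h: "ring_hom_on Qab \<tau>" and fx: "\<And>x. x \<in> K \<Longrightarrow> \<tau> x = x" using \<tau> by (auto simp: carrier_Gab)
      have "poly P (\<tau> \<theta>) = 0"
        by (rule root_image[OF subfield_on_Qab h KQ fx PK \<theta>Q P0])
      then have "\<tau> \<theta> \<in> S" using fin by (simp add: P_def poly_prod_roots)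
      then obtain \<sigma> where \<sigma>: "\<sigma> \<in> N" "\<tau> \<theta> = \<sigma> \<theta>" by (auto simp: S_def)
      have "inv\<^bsub>Gab\<^esub> \<sigma> \<otimes>\<^bsub>Gab\<^esub> \<tau> \<in> carrier (galois_group Qab K0)"
        by (rule restrict_eq_imp[OF K0'(1,2) NG[OF \<sigma>(1)] \<tau>G \<theta>(2)[OF NG[OF \<sigma>(1)] \<tau>G \<sigma>(2)[symmetric]]])
      then have "\<sigma> \<otimes>\<^bsub>Gab\<^esub> (inv\<^bsub>Gab\<^esub> \<sigma> \<otimes>\<^bsub>Gab\<^esub> \<tau>) \<in> N"
        using N0 \<sigma>(1) by blast
      then show "\<tau> \<in> N"
        using NG[OF \<sigma>(1)] \<tau>G by (simp add: G.m_assoc[symmetric])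
    qed
  qed
qed

section \<open>Units and divisibility in the p-adic integers\<close>

lemma prime_CARD: "Factorial_Ring.prime CARD('p :: prime_card)"
  by (rule prime_card)

lemma Rep_padic: "Rep_padic_int x n \<in> {0..<int CARD('p) ^ n}"
  "Rep_padic_int x (Suc n) mod int CARD('p) ^ n = Rep_padic_int x n"
  for x :: "'p :: prime_card padic_int"
  using Rep_padic_int[of x] by auto

lemma Rep_padic_mod: "m \<le> n \<Longrightarrow> Rep_padic_int x n mod int CARD('p) ^ m = Rep_padic_int x m"
  for x :: "'p :: prime_card padic_int"
  by (rule padic_int_cong) (use Rep_padic[of x] in \<open>simp_all del: power_Suc\<close>)

lemma Rep_padic_power:
  "Rep_padic_int (x ^ k) n = Rep_padic_int x n ^ k mod int CARD('p) ^ n" for x :: "'p :: prime_card padic_int"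
  by (induction k) (simp_all add: one_padic_int.rep_eq times_padic_int.rep_eq mod_simps)

lemma padic_eqI: "(\<And>n. Rep_padic_int x n = Rep_padic_int y n) \<Longrightarrow> x = y"
  by (simp add: Rep_padic_int_inject[symmetric] fun_eq_iff)

text \<open>The inverses modulo the powers of \<open>p\<close> are unique, hence compatible.\<close>

lemma padic_unit:
  fixes x :: "'p :: prime_card padic_int"
  assumes "Rep_padic_int x 1 \<noteq> 0"
  shows "\<exists>y. x * y = 1"
proof -
  let ?q = "int CARD('p)"
  have pr: "Factorial_Ring.prime ?q" using prime_card_int by blast
  have cop: "coprime (Rep_padic_int x n) (?q ^ n)" for n
  proof (cases "n = 0")
    case False
    have "Rep_padic_int x n mod ?q ^ 1 = Rep_padic_int x 1"
      using False by (intro Rep_padic_mod) auto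
    then have "\<not> ?q dvd Rep_padic_int x n"
      using assms by (auto simp: dvd_eq_mod_eq_0)
    then have "coprime ?q (Rep_padic_int x n)"
      by (rule prime_imp_coprime[OF pr])
    then show ?thesis
      by (simp add: coprime_commute coprime_power_right_iff)
  qed simp
  define P where "P = (\<lambda>n y. y \<in> {0..<?q ^ n} \<and> (Rep_padic_int x n * y) mod ?q ^ n = 1 mod ?q ^ n)"
  have qpos: "?q ^ n > 0" for n by (rule prime_card_pow_pos)
  have ex: "\<exists>y. P n y" for n
  proof -
    obtain y where "(Rep_padic_int x n * y) mod ?q ^ n = 1 mod ?q ^ n"
      using cop[of n] coprime_iff_invertible_int[of "Rep_padic_int x n" "?q ^ n"] by (auto simp: cong_def)
    then have "P n (y mod ?q ^ n)"
      using qpos by (auto simp: P_def mod_simps)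
    then show ?thesis by blast
  qed
  have uniq: "y = z" if "P n y" "P n z" for n y z
  proof -
    have "[Rep_padic_int x n * y = Rep_padic_int x n * z] (mod ?q ^ n)"
      using that by (simp add: P_def cong_def)
    then have "[y = z] (mod ?q ^ n)"
      using cop cong_mult_lcancel by blast
    then show ?thesis
      using that by (auto simp: P_def cong_def)
  qed
  define y where "y = (\<lambda>n. SOME z. P n z)"
  have y: "P n (y n)" for n
    unfolding y_def using someI_ex[OF ex] .
  have "y (Suc n) mod ?q ^ n = y n" for n
  proof (rule uniq[OF _ y])
    have "(Rep_padic_int x (Suc n) * y (Suc n)) mod ?q ^ Suc n mod ?q ^ n = 1 mod ?q ^ Suc n mod ?q ^ n"
      using y[of "Suc n"] by (simp only: P_def)
    then have "(Rep_padic_int x (Suc n) * y (Suc n)) mod ?q ^ n = 1 mod ?q ^ n"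
      by (simp add: mod_mod_cancel)
    then have "(Rep_padic_int x n * (y (Suc n) mod ?q ^ n)) mod ?q ^ n = 1 mod ?q ^ n"
      using Rep_padic(2)[of x n] by (metis mod_mult_eq mod_mod_trivial)
    then show "P n (y (Suc n) mod ?q ^ n)"
      using qpos by (simp add: P_def)
  qed
  then have "y \<in> {x. \<forall>n. x n \<in> {0..<?q ^ n} \<and> x (Suc n) mod ?q ^ n = x n}"
    using y by (simp add: P_def)
  then have "Rep_padic_int (Abs_padic_int y :: 'p padic_int) = y"
    by (rule Abs_padic_int_inverse)
  then have "x * Abs_padic_int y = 1"
    using y by (intro padic_eqI) (simp add: times_padic_int.rep_eq one_padic_int.rep_eq P_def)
  then show ?thesis by blast
qed

lemma padic_div_p:
  fixes x :: "'p :: prime_card padic_int"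
  assumes "Rep_padic_int x 1 = 0"
  obtains y where "x = of_nat CARD('p) * y"
proof -
  let ?q = "int CARD('p)"
  have q: "?q > 0" using prime_card_pow_pos[where 'p='p, of 1] by simp
  have dv: "?q dvd Rep_padic_int x (Suc n)" for n
    using Rep_padic_mod[of 1 "Suc n" x] assms by (auto simp: dvd_eq_mod_eq_0)
  define y where "y = (\<lambda>n. Rep_padic_int x (Suc n) div ?q)"
  have r: "Rep_padic_int x (Suc n) = ?q * y n" for n
    using dv by (simp add: y_def)
  have "y n \<in> {0..<?q ^ n} \<and> y (Suc n) mod ?q ^ n = y n" for n
  proof
    show "y n \<in> {0..<?q ^ n}"
      using Rep_padic(1)[of x "Suc n"] q unfolding r by (auto simp: zero_le_mult_iff)
    have "?q * (y (Suc n) mod ?q ^ n) = ?q * y n"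
      using Rep_padic(2)[of x "Suc n"] unfolding r by (simp add: mod_mult_mult1)
    then show "y (Suc n) mod ?q ^ n = y n" using q by simp
  qed
  then have R: "Rep_padic_int (Abs_padic_int y :: 'p padic_int) = y"
    by (intro Abs_padic_int_inverse) simp
  have "x = of_nat CARD('p) * Abs_padic_int y"
  proof (rule padic_eqI)
    fix n
    have "Rep_padic_int x n = Rep_padic_int x (Suc n) mod ?q ^ n" by (simp add: Rep_padic)
    also have "\<dots> = (?q * y n) mod ?q ^ n" by (simp add: r)
    finally show "Rep_padic_int x n = Rep_padic_int (of_nat CARD('p) * Abs_padic_int y :: 'p padic_int) n"
      by (simp add: times_padic_int.rep_eq R Rep_padic_int_of_nat mod_simps)
  qed
  then show ?thesis using that by blast
qed

lemma Rep_padic_mult_1: "Rep_padic_int (of_nat CARD('p) * (x :: 'p :: prime_card padic_int)) 1 = 0"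
  by (simp add: times_padic_int.rep_eq Rep_padic_int_of_nat)

lemma padic_factor:
  fixes x :: "'p :: prime_card padic_int"
  assumes "x \<noteq> 0"
  obtains k u v where "x = of_nat CARD('p) ^ k * u" "u * v = 1"
proof -
  have "\<exists>n. Rep_padic_int x n \<noteq> 0"
    using assms padic_eqI[of x 0] by (auto simp: zero_padic_int.rep_eq)
  then obtain n where "Rep_padic_int x n \<noteq> 0" by blast
  then have "\<exists>k u v. x = of_nat CARD('p) ^ k * u \<and> u * v = 1"
  proof (induction n arbitrary: x)
    case 0
    then show ?case using Rep_padic(1)[of x 0] by simp
  next
    case (Suc n)
    show ?case
    proof (cases "Rep_padic_int x 1 = 0")
      case True
      then obtain y where y: "x = of_nat CARD('p) * y" by (rule padic_div_p)
      have "Rep_padic_int y n \<noteq> 0"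
      proof
        assume "Rep_padic_int y n = 0"
        then have "int CARD('p) ^ n dvd Rep_padic_int y (Suc n)"
          using Rep_padic(2)[of y n] by (simp add: dvd_eq_mod_eq_0)
        then have "int CARD('p) ^ Suc n dvd int CARD('p) * Rep_padic_int y (Suc n)" by simp
        then have "(int CARD('p) * Rep_padic_int y (Suc n)) mod int CARD('p) ^ Suc n = 0"
          by (simp only: dvd_eq_mod_eq_0)
        then show False
          using Suc.prems unfolding y times_padic_int.rep_eq Rep_padic_int_of_nat
          by (metis mod_mult_left_eq)
      qed
      from Suc.IH[OF this] obtain k u v where "y = of_nat CARD('p) ^ k * u" "u * v = 1" by blast
      then show ?thesis
        using y by (intro exI[of _ "Suc k"] exI[of _ u] exI[of _ v]) (simp add: mult.assoc)
    next
      case False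
      then obtain y where "x * y = 1" using padic_unit by blast
      then show ?thesis
        by (intro exI[of _ 0] exI[of _ x] exI[of _ y]) simp
    qed
  qed
  then show ?thesis using that by blast
qed

section \<open>Local subrings and roots of unity\<close>

text \<open>The two rings to which this applies are the \<open>p\<close>-adic integers and the localization of the integers
  at a prime \<open>q\<close>, inside an algebraically closed field. The assumption \<open>unit\<close> puts \<open>q\<close> into the
  Jacobson radical, \<open>fermat\<close> forces residue fields to be prime fields, and \<open>fraction\<close> excludes proper
  overrings in \<open>K\<close> that do not contain \<open>1/q\<close>.\<close>

locale local_subring = subring_on R + K: subfield_on K
  for R K :: "'a :: {alg_closed_field, field_char_0} set" +
  fixes q :: nat
  assumes q: "Factorial_Ring.prime q"
    and RK: "R \<subseteq> K"
    and unit: "\<And>c. c \<in> R \<Longrightarrow> 1 - of_nat q * c \<noteq> 0 \<and> inverse (1 - of_nat q * c) \<in> R"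
    and fermat: "\<And>c. c \<in> R \<Longrightarrow> \<exists>d\<in>R. c ^ q = c + of_nat q * d"
    and fraction: "\<And>x. x \<in> K \<Longrightarrow> x \<notin> R \<Longrightarrow> \<exists>z\<in>R. inverse (of_nat q) = x * z"

definition span_on :: "'a :: field set \<Rightarrow> 'a set \<Rightarrow> 'a set"
  where "span_on R S = {\<Sum>s\<in>S. c s * s | c. \<forall>s\<in>S. c s \<in> R}"

lemma span_onI: "(\<And>s. s \<in> S \<Longrightarrow> c s \<in> R) \<Longrightarrow> (\<Sum>s\<in>S. c s * s) \<in> span_on R S"
  unfolding span_on_def by blast

context subring_on
begin

lemma span_0 [simp, intro]: "0 \<in> span_on R S"
  using span_onI[of S "\<lambda>_. 0" R] by simp

lemma span_add: "x \<in> span_on R S \<Longrightarrow> y \<in> span_on R S \<Longrightarrow> x + y \<in> span_on R S"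
proof -
  assume "x \<in> span_on R S" "y \<in> span_on R S"
  then obtain c d where "\<forall>s\<in>S. c s \<in> R" "\<forall>s\<in>S. d s \<in> R" "x = (\<Sum>s\<in>S. c s * s)" "y = (\<Sum>s\<in>S. d s * s)"
    by (auto simp: span_on_def)
  then show ?thesis
    using span_onI[of S "\<lambda>s. c s + d s" R] by (auto simp: sum.distrib ring_distribs)
qed

lemma span_mult: "a \<in> R \<Longrightarrow> x \<in> span_on R S \<Longrightarrow> a * x \<in> span_on R S"
proof -
  assume a: "a \<in> R" and "x \<in> span_on R S"
  then obtain c where "\<forall>s\<in>S. c s \<in> R" "x = (\<Sum>s\<in>S. c s * s)"
    by (auto simp: span_on_def)
  then show ?thesis
    using span_onI[of S "\<lambda>s. a * c s" R] a by (auto simp: sum_distrib_left mult.assoc)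
qed

lemma span_base: "finite S \<Longrightarrow> x \<in> S \<Longrightarrow> x \<in> span_on R S"
proof -
  assume S: "finite S" "x \<in> S"
  have "(\<Sum>s\<in>S. (if s = x then 1 else 0) * s) = (\<Sum>s\<in>S. if s = x then s else 0)"
    by (intro sum.cong) auto
  also have "\<dots> = x" using S by simp
  finally show ?thesis
    using span_onI[of S "\<lambda>s. if s = x then 1 else 0" R] by simp
qed

lemma span_sum: "(\<And>i. i \<in> A \<Longrightarrow> f i \<in> span_on R S) \<Longrightarrow> sum f A \<in> span_on R S"
  by (induction A rule: infinite_finite_induct) (auto intro: span_add)

lemma adjoin_span:
  assumes "z ^ n = 1" "n > 0"
  shows "adjoin R z \<subseteq> span_on R ((\<lambda>i. z ^ i) ` {..<n})"
proof
  fix x assume "x \<in> adjoin R z"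
  then obtain p where p: "p \<in> polys R" "x = poly p z" by (auto simp: adjoin_def)
  have "z ^ i \<in> (\<lambda>i. z ^ i) ` {..<n}" for i
  proof (rule image_eqI)
    have "z ^ i = z ^ (n * (i div n) + i mod n)" by simp
    also have "\<dots> = z ^ (i mod n)"
      unfolding power_add power_mult using assms by simp
    finally show "z ^ i = z ^ (i mod n)" .
  qed (use assms in auto)
  then show "x \<in> span_on R ((\<lambda>i. z ^ i) ` {..<n})"
    unfolding p(2) poly_altdef using p(1)
    by (intro span_sum span_mult span_base) (auto simp: polysD)
qed

end

context local_subring
begin

lemma q_gt_1: "q > 1" using q prime_gt_1_nat by blast

lemma q_nz: "(of_nat q :: 'a) \<noteq> 0" using q_gt_1 by simp

text \<open>Nakayama's lemma. A generator \<open>x = q * (c * x + y)\<close> can be solved for \<open>x\<close>, because \<open>1 - q * c\<close> is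
  a unit, and removed.\<close>

lemma nakayama:
  assumes "finite S" "\<And>x. x \<in> S \<Longrightarrow> \<exists>y\<in>span_on R S. x = of_nat q * y"
  shows "S \<subseteq> {0}"
  using assms
proof (induction S rule: finite_induct)
  case (insert x S)
  have ins: "\<exists>c\<in>R. \<exists>y\<in>span_on R S. z = c * x + y" if "z \<in> span_on R (insert x S)" for z
  proof -
    obtain c where c: "\<forall>s\<in>insert x S. c s \<in> R" "z = (\<Sum>s\<in>insert x S. c s * s)"
      using \<open>z \<in> span_on R (insert x S)\<close> unfolding span_on_def by blast
    have "(\<Sum>s\<in>S. c s * s) \<in> span_on R S" using c by (intro span_onI) auto
    then show ?thesis
      using insert.hyps c by (intro bexI[of _ "c x"] bexI[of _ "\<Sum>s\<in>S. c s * s"]) auto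
  qed
  have "\<exists>y\<in>span_on R (insert x S). x = of_nat q * y"
    using insert.prems[of x] by simp
  then obtain w where w: "w \<in> span_on R (insert x S)" "x = of_nat q * w" by blast
  obtain c y where cy: "c \<in> R" "y \<in> span_on R S" "w = c * x + y"
    using ins[OF w(1)] by blast
  define u where "u = 1 - of_nat q * c"
  have u: "u \<noteq> 0" "inverse u \<in> R" using unit[OF cy(1)] by (auto simp: u_def)
  have "u * x = of_nat q * y"
    using w(2) unfolding cy(3) by (simp add: u_def algebra_simps)
  then have x: "x = of_nat q * (inverse u * y)"
    using u by (simp add: field_simps)
  have xs: "inverse u * y \<in> span_on R S"
    using span_mult u cy by blast
  have "\<exists>w\<in>span_on R S. z = of_nat q * w" if z: "z \<in> S" for z
  proof -
    have "\<exists>y\<in>span_on R (insert x S). z = of_nat q * y"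
      using insert.prems[of z] z by simp
    then obtain v where v: "v \<in> span_on R (insert x S)" "z = of_nat q * v" by blast
    obtain c' y' where c': "c' \<in> R" "y' \<in> span_on R S" "v = c' * x + y'"
      using ins[OF v(1)] by blast
    have "x \<in> span_on R S"
      using x span_mult[OF of_nat_in xs] by simp
    then show ?thesis
      using c' v span_add[OF span_mult[OF c'(1)] c'(2)] by blast
  qed
  then have S0: "S \<subseteq> {0}" using insert.IH by blast
  have "span_on R S \<subseteq> {0}"
    using S0 by (auto simp: span_on_def intro!: sum.neutral)
  then have "y = 0" using cy by blast
  then show ?case using x S0 by simp
qed simp

text \<open>If \<open>1/q\<close> were in \<open>R[z]\<close>, then \<open>R[z]\<close>, which is generated by finitely many powers of \<open>z\<close>, would be
  divisible by \<open>q\<close>, and therefore zero by Nakayama's lemma.\<close>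

lemma inverse_q_notin_adjoin:
  assumes "z ^ n = 1" "n > 0"
  shows "inverse (of_nat q) \<notin> adjoin R z"
proof
  assume A: "inverse (of_nat q) \<in> adjoin R z"
  interpret A: subring_on "adjoin R z" by (rule subring_on_adjoin) (rule subring_on_axioms)
  let ?S = "(\<lambda>i. z ^ i) ` {..<n}"
  have "?S \<subseteq> {0}"
  proof (rule nakayama)
    fix x assume "x \<in> ?S"
    then have "x \<in> adjoin R z"
      using adjoin_self[OF subring_on_axioms] by auto
    then have "inverse (of_nat q) * x \<in> span_on R ?S"
      using A adjoin_span[OF assms] by blast
    then show "\<exists>y\<in>span_on R ?S. x = of_nat q * y"
      using q_nz by (intro bexI[of _ "inverse (of_nat q) * x"]) auto
  qed simp
  moreover have "z ^ 0 \<in> ?S" using assms(2) by blast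
  ultimately show False by auto
qed

text \<open>This is how integrality is proved for the coefficients of minimal polynomials and for traces: they
  are polynomials in roots of unity which lie in \<open>K\<close>.\<close>

lemma adjoin_inter:
  assumes "z ^ n = 1" "n > 0" "x \<in> K" "x \<in> adjoin R z"
  shows "x \<in> R"
proof (rule ccontr)
  assume "x \<notin> R"
  then obtain y where y: "y \<in> R" "inverse (of_nat q) = x * y"
    using fraction assms(3) by blast
  interpret A: subring_on "adjoin R z" by (rule subring_on_adjoin) (rule subring_on_axioms)
  have "x * y \<in> adjoin R z"
    using assms y adjoin_base[OF subring_on_axioms] by blast
  then show False using inverse_q_notin_adjoin[OF assms(1,2)] y by simp
qed

lemma inverse_of_nat_in:
  assumes "coprime n q"
  shows "inverse (of_nat n) \<in> R"
proof -
  have "\<exists>a. [int n * a = 1] (mod int q)"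
    using assms coprime_iff_invertible_int[of "int n" "int q"] by simp
  then obtain a where "[int n * a = 1] (mod int q)" by blast
  then have "int q dvd (1 - int n * a)"
    by (simp add: cong_iff_dvd_diff dvd_diff_commute)
  then obtain k where k: "1 - int n * a = int q * k" by (elim dvdE)
  then have "int n * a = 1 - int q * k" by simp
  then have "of_int (int n * a) = (of_int (1 - int q * k) :: 'a)" by (simp only:)
  then have e: "of_nat n * of_int a = 1 - of_nat q * (of_int k :: 'a)" by simp
  from unit[of "of_int k"] have u: "1 - of_nat q * (of_int k :: 'a) \<noteq> 0" "inverse (1 - of_nat q * (of_int k :: 'a)) \<in> R"
    by auto
  have "of_nat n * (of_int a * inverse (1 - of_nat q * of_int k)) = (1 :: 'a)"
    unfolding mult.assoc[symmetric] e using u(1) by simp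
  then have "inverse (of_nat n :: 'a) = of_int a * inverse (1 - of_nat q * of_int k)"
    by (rule inverse_unique)
  then show ?thesis using u(2) by auto
qed

lemma freshman:
  fixes x y :: "'b :: field"
  assumes "subring_on S" "x \<in> S" "y \<in> S"
  shows "\<exists>d\<in>S. (x + y) ^ q = x ^ q + y ^ q + of_nat q * d"
proof -
  interpret S: subring_on S by fact
  define d where "d = (\<Sum>i=1..<q. of_nat ((q choose i) div q) * x ^ i * y ^ (q - i))"
  have "(x + y) ^ q = (\<Sum>i\<le>q. of_nat (q choose i) * x ^ i * y ^ (q - i))"
    by (rule binomial_ring)
  also have "{..q} = insert 0 (insert q {1..<q})" using q_gt_1 by auto
  also have "(\<Sum>i\<in>insert 0 (insert q {1..<q}). of_nat (q choose i) * x ^ i * y ^ (q - i)) =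
      y ^ q + x ^ q + (\<Sum>i=1..<q. of_nat (q choose i) * x ^ i * y ^ (q - i))"
    using q_gt_1 by simp
  also have "(\<Sum>i=1..<q. of_nat (q choose i) * x ^ i * y ^ (q - i)) = of_nat q * d"
    unfolding d_def sum_distrib_left
  proof (intro sum.cong refl)
    fix i assume i: "i \<in> {1..<q}"
    have "q dvd (q choose i)" using i q by (intro Primes.dvd_choose_prime) auto
    then have e: "of_nat (q choose i) = (of_nat q * of_nat ((q choose i) div q) :: 'b)"
      by (metis dvd_mult_div_cancel of_nat_mult)
    show "of_nat (q choose i) * x ^ i * y ^ (q - i) = of_nat q * (of_nat ((q choose i) div q) * x ^ i * y ^ (q - i))"
      unfolding e by (simp only: mult.assoc)
  qed
  moreover have "d \<in> S" unfolding d_def using assms by auto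
  ultimately show ?thesis by (intro bexI[of _ d]) (auto simp: algebra_simps)
qed

lemma frobenius_poly:
  assumes S: "subring_on S" "R \<subseteq> S" "z \<in> S" and f: "f \<in> polys R"
  shows "\<exists>d\<in>S. poly f z ^ q = poly f (z ^ q) + of_nat q * d"
  using f
proof (induction f)
  case 0
  interpret S: subring_on S by fact
  show ?case using q_gt_1 by (intro bexI[of _ 0]) auto
next
  case (pCons a f)
  interpret S: subring_on S by fact
  have af: "a \<in> R" "f \<in> polys R"
    using polysD[OF pCons.prems, of 0] polysD[OF pCons.prems, of "Suc _"]
    by (simp_all add: polys_def)
  have fz: "poly f z \<in> S" using polys_mono[OF S(2)] af S(3) by blast
  obtain d where d: "d \<in> S" "poly f z ^ q = poly f (z ^ q) + of_nat q * d"
    using pCons.IH af by blast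
  obtain e where e: "e \<in> R" "a ^ q = a + of_nat q * e" using fermat af by blast
  have "z * poly f z \<in> S" "a \<in> S" using S(2,3) fz af by auto
  then obtain k where k: "k \<in> S" "(a + z * poly f z) ^ q = a ^ q + (z * poly f z) ^ q + of_nat q * k"
    using freshman[OF S(1)] by blast
  have "poly (pCons a f) z ^ q = poly (pCons a f) (z ^ q) + of_nat q * (e + z ^ q * d + k)"
    by (simp add: k e d power_mult_distrib algebra_simps)
  moreover have "e + z ^ q * d + k \<in> S" using e d k S by auto
  ultimately show ?case by blast
qed

text \<open>Iterating the Frobenius congruence keeps a single factor \<open>q\<close> in the error term, which is all
  that is needed to compare \<open>f(z)\<close> with its high powers.\<close>

lemma frobenius_iterate:
  assumes S: "subring_on S" "R \<subseteq> S" "z \<in> S" and f: "f \<in> polys R"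
  shows "\<exists>d\<in>S. poly f z ^ (q ^ r) = poly f (z ^ (q ^ r)) + of_nat q * d"
proof (induction r)
  case 0
  interpret S: subring_on S by fact
  show ?case by (intro bexI[of _ 0]) auto
next
  case (Suc r)
  interpret S: subring_on S by fact
  let ?w = "z ^ (q ^ r)"
  have w: "?w \<in> S" "poly f ?w \<in> S" using polys_mono[OF S(2)] f S(3) by blast+
  obtain d where d: "d \<in> S" "poly f z ^ (q ^ r) = poly f ?w + of_nat q * d" using Suc by blast
  obtain e where e: "e \<in> S" "poly f ?w ^ q = poly f (?w ^ q) + of_nat q * e"
    using frobenius_poly[OF S(1,2) w(1) f] by blast
  have "of_nat q * d \<in> S" using d by auto
  then obtain k where k: "k \<in> S" "(poly f ?w + of_nat q * d) ^ q = poly f ?w ^ q + (of_nat q * d) ^ q + of_nat q * k"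
    using freshman[OF S(1) w(2)] by blast
  have "(of_nat q * d) ^ q = of_nat q * ((of_nat q * d) ^ (q - 1) * d)"
    using q_gt_1 by (cases q) simp_all
  then have "(poly f z ^ (q ^ r)) ^ q = poly f (?w ^ q) + of_nat q * (e + (of_nat q * d) ^ (q - 1) * d + k)"
    by (simp only: d k e) (simp add: algebra_simps)
  moreover have "e + (of_nat q * d) ^ (q - 1) * d + k \<in> S"
    by (intro S.add_in S.mult_in S.power_in S.of_nat_in e d k)
  moreover have "(poly f z ^ (q ^ r)) ^ q = poly f z ^ (q ^ Suc r)" "?w ^ q = z ^ (q ^ Suc r)"
    by (simp_all add: power_mult[symmetric] mult.commute)
  ultimately show ?case by metis
qed

end

section \<open>Roots of unity and cyclotomic polynomials\<close>

definition prim_root :: "nat \<Rightarrow> 'a :: field \<Rightarrow> bool"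
  where "prim_root n z \<longleftrightarrow> n > 0 \<and> z ^ n = 1 \<and> (\<forall>m. 0 < m \<and> m < n \<longrightarrow> z ^ m \<noteq> 1)"

lemma prim_rootD: "prim_root n z \<Longrightarrow> n > 0" "prim_root n z \<Longrightarrow> z ^ n = 1"
  by (auto simp: prim_root_def)

lemma root_power_mod: "z ^ n = 1 \<Longrightarrow> z ^ (i mod n) = (z :: 'a :: monoid_mult) ^ i"
  using mult_div_mod_eq[of n i] by (metis mult.left_neutral power_add power_mult power_one)

lemma prim_root_eq_1_iff: "prim_root n z \<Longrightarrow> z ^ i = 1 \<longleftrightarrow> n dvd i"
proof
  assume z: "prim_root n z" and "z ^ i = 1"
  then have "z ^ (i mod n) = 1" by (simp add: root_power_mod prim_root_def)
  then have "i mod n = 0" using z by (auto simp: prim_root_def)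
  then show "n dvd i" by auto
next
  assume "prim_root n z" "n dvd i"
  then show "z ^ i = 1" by (auto simp: prim_root_def power_mult)
qed

lemma root_of_unity_nz: "z ^ n = 1 \<Longrightarrow> n > 0 \<Longrightarrow> z \<noteq> (0 :: 'a :: field)"
  by (auto simp: power_0_left)

lemma prim_root_inj: "prim_root n z \<Longrightarrow> i < n \<Longrightarrow> j < n \<Longrightarrow> z ^ i = z ^ j \<Longrightarrow> i = j"
proof -
  have *: "i = j" if z: "prim_root n z" and ij: "i \<le> j" "j < n" "z ^ i = z ^ j" for i j
  proof -
    have nz: "z \<noteq> 0" using root_of_unity_nz z by (auto simp: prim_root_def)
    have "z ^ i * z ^ (j - i) = z ^ (i + (j - i))" by (simp only: power_add)
    then have "z ^ i * z ^ (j - i) = z ^ i * 1" using ij by simp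
    then have "z ^ (j - i) = 1" using nz by (subst (asm) mult_cancel_left) auto
    then have "n dvd (j - i)" using prim_root_eq_1_iff[OF z] by blast
    then show ?thesis using ij by (auto dest: dvd_imp_le)
  qed
  assume "prim_root n z" "i < n" "j < n" "z ^ i = z ^ j"
  then show ?thesis using *[of i j] *[of j i] by (cases "i \<le> j") auto
qed

lemma roots_of_unity_poly: "{x :: 'a :: field. x ^ n = 1} = {x. poly (monom 1 n - 1) x = 0}"
  by (simp add: poly_monom)

lemma monom_minus_1_nz: "n > 0 \<Longrightarrow> monom 1 n - 1 \<noteq> (0 :: 'a :: field poly)"
proof
  assume "n > 0" "monom 1 n - 1 = (0 :: 'a poly)"
  then have "coeff (monom 1 n - 1 :: 'a poly) n = 0" by simp
  then show False using \<open>n > 0\<close> by (simp add: coeff_1)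
qed

lemma degree_monom_minus_1: "n > 0 \<Longrightarrow> degree (monom 1 n - 1 :: 'a :: field poly) = n"
proof -
  assume "n > 0"
  then have "degree (monom 1 n + (- 1) :: 'a poly) = degree (monom 1 n :: 'a poly)"
    by (intro degree_add_eq_left) (simp add: degree_monom_eq)
  then show ?thesis by (simp add: degree_monom_eq)
qed

lemma finite_roots_of_unity: "n > 0 \<Longrightarrow> finite {x :: 'a :: field. x ^ n = 1}"
  unfolding roots_of_unity_poly by (rule poly_roots_finite) (rule monom_minus_1_nz)

lemma prim_root_all:
  fixes z :: "'a :: field"
  assumes z: "prim_root n z" and x: "x ^ n = 1"
  obtains i where "i < n" "x = z ^ i"
proof -
  have n: "n > 0" using z by (auto simp: prim_root_def)
  have "(\<lambda>i. z ^ i) ` {..<n} = {x. x ^ n = 1}"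
  proof (rule card_subset_eq[OF finite_roots_of_unity[OF n]])
    have "(z ^ i) ^ n = 1" for i
      using prim_rootD(2)[OF z] by (metis mult.commute power_mult power_one)
    then show "(\<lambda>i. z ^ i) ` {..<n} \<subseteq> {x. x ^ n = 1}" by auto
    have u: "card {x :: 'a. x ^ n = 1} \<le> n"
      using card_poly_roots_bound[OF monom_minus_1_nz[OF n]]
      unfolding roots_of_unity_poly by (simp add: degree_monom_minus_1[OF n])
    have "card ((\<lambda>i. z ^ i) ` {..<n}) = n"
      using prim_root_inj[OF z] by (subst card_image) (auto simp: inj_on_def)
    then show "card ((\<lambda>i. z ^ i) ` {..<n}) = card {x :: 'a. x ^ n = 1}"
      using card_mono[OF finite_roots_of_unity[OF n] \<open>(\<lambda>i. z ^ i) ` {..<n} \<subseteq> {x. x ^ n = 1}\<close>] u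
      by linarith
  qed
  then show ?thesis using x that by blast
qed

lemma prim_root_power:
  assumes z: "prim_root n z" and "coprime i n"
  shows "prim_root n (z ^ i)"
  unfolding prim_root_def
proof (intro conjI allI impI)
  show "n > 0" using z by (rule prim_rootD)
  show "(z ^ i) ^ n = 1"
    using prim_rootD(2)[OF z] by (metis mult.commute power_mult power_one)
  fix m assume m: "0 < m \<and> m < n"
  show "(z ^ i) ^ m \<noteq> 1"
  proof
    assume "(z ^ i) ^ m = 1"
    then have "z ^ (i * m) = 1" by (simp add: power_mult)
    then have "n dvd i * m" using prim_root_eq_1_iff[OF z] by blast
    then have "n dvd m" using assms(2) by (simp add: coprime_commute coprime_dvd_mult_right_iff)
    then show False using m by (auto dest: dvd_imp_le)
  qed
qed

lemma prim_root_power_divisor: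
  assumes z: "prim_root (m * k) z"
  shows "prim_root m (z ^ k)"
  unfolding prim_root_def
proof (intro conjI allI impI)
  have mk: "m > 0" "k > 0" using prim_rootD(1)[OF z] by auto
  then show "m > 0" by simp
  show "(z ^ k) ^ m = 1" using prim_rootD(2)[OF z] by (simp add: power_mult[symmetric] mult.commute)
  fix j assume j: "0 < j \<and> j < m"
  then have "k * j < m * k" "0 < k * j" using mk by auto
  then show "(z ^ k) ^ j \<noteq> 1" using z by (simp add: prim_root_def power_mult[symmetric])
qed

lemma prim_root_coprime:
  assumes z: "prim_root n z" and w: "prim_root n w"
  obtains i where "coprime i n" "w = z ^ i" "i > 0"
proof -
  have n: "n > 0" using z by (rule prim_rootD)
  obtain i where i: "i < n" "w = z ^ i" using prim_root_all[OF z prim_rootD(2)[OF w]] .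
  define d where "d = gcd i n"
  have "d > 0" using n by (auto simp: d_def)
  have "w ^ (n div d) = z ^ (i * (n div d))" by (simp add: i power_mult)
  also have "i * (n div d) = n * (i div d)"
    using div_mult_swap[of d n i] div_mult_swap[of d i n] by (simp add: d_def mult.commute)
  also have "z ^ (n * (i div d)) = 1" using prim_rootD(2)[OF z] by (simp add: power_mult)
  finally have "n dvd (n div d)" using prim_root_eq_1_iff[OF w] by blast
  moreover have "n div d > 0" using n by (simp add: d_def div_greater_zero_iff gcd_le2_nat)
  ultimately have "n \<le> n div d" by (rule dvd_imp_le)
  then have "\<not> 1 < d" using int_div_less_self[of "int n" "int d"] n div_less_dividend[of d n]
    by (metis leD)
  then have "d = 1" using \<open>d > 0\<close> by simp
  then have c: "coprime i n" by (simp add: d_def coprime_iff_gcd_eq_1)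
  show ?thesis
  proof (cases "i = 0")
    case True
    then have "n = 1" using c by simp
    then show ?thesis using that[of 1] prim_rootD(2)[OF z] prim_rootD(2)[OF w] by simp
  next
    case False
    then show ?thesis using that c i by auto
  qed
qed

lemma monom_minus_1_factors:
  assumes n: "n > 0"
  shows "monom 1 n - 1 = (\<Prod>x | x ^ n = 1. [:- x, 1 :: 'a :: {alg_closed_field, field_char_0}:])"
proof -
  let ?p = "monom 1 n - 1 :: 'a poly"
  have lc: "lead_coeff ?p = 1"
    unfolding degree_monom_minus_1[OF n] using n by (simp add: coeff_1)
  obtain A where A: "?p = smult (lead_coeff ?p) (\<Prod>x\<in>#A. [:-x, 1:])"
    using alg_closed_imp_factorization[OF monom_minus_1_nz[OF n], where 'a = 'a] by blast
  then have A: "?p = (\<Prod>x\<in>#A. [:-x, 1:])" using lc by simp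
  have roots: "x \<in># A \<longleftrightarrow> x ^ n = 1" for x
  proof -
    have "poly ?p x = 0 \<longleftrightarrow> x \<in># A"
      by (subst A) (auto simp: poly_prod_mset prod_mset_zero_iff image_iff)
    then show ?thesis by (simp add: poly_monom)
  qed
  have "count A x \<le> 1" for x
  proof (rule ccontr)
    assume "\<not> count A x \<le> 1"
    then have "count A x \<ge> 2" by simp
    then have "replicate_mset 2 x \<subseteq># A" by (simp add: count_le_replicate_mset_subset_eq)
    then obtain B where "A = add_mset x (add_mset x B)"
      by (metis mset_subset_eq_exists_conv numeral_2_eq_2 replicate_mset_Suc replicate_mset_0
          union_mset_add_mset_left add_0)
    then have p: "?p = [:-x, 1:] * ([:-x, 1:] * (\<Prod>x\<in>#B. [:-x, 1:]))" using A by simp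
    have "poly (pderiv ?p) x = 0"
      unfolding p pderiv_mult by simp
    moreover have "pderiv ?p = monom (of_nat n) (n - 1)"
      by (simp add: pderiv_diff pderiv_monom)
    moreover have "x ^ n = 1"
      using \<open>count A x \<ge> 2\<close> roots[of x] by (metis count_greater_zero_iff less_le_trans zero_less_numeral)
    ultimately show False
      using n root_of_unity_nz[of x n] by (simp add: poly_monom)
  qed
  then have "A = mset_set {x. x ^ n = 1}"
    using roots finite_roots_of_unity[OF n, where 'a = 'a]
    by (intro multiset_eqI) (simp add: count_mset_set' le_Suc_eq, metis One_nat_def count_eq_zero_iff le_0_eq le_Suc_eq)
  then show ?thesis using A by (simp add: prod_unfold_prod_mset)
qed

text \<open>Both sides are the derivative of \<open>X^n - 1\<close> at 1.\<close>

lemma prod_one_minus_roots: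
  assumes n: "n > 0"
  shows "(\<Prod>x\<in>{x. x ^ n = 1} - {1}. 1 - x) = (of_nat n :: 'a :: {alg_closed_field, field_char_0})"
proof -
  define S where "S = {x :: 'a. x ^ n = 1}"
  have S: "finite S" "1 \<in> S" using finite_roots_of_unity[OF n] by (auto simp: S_def)
  define Q where "Q = (\<Prod>x\<in>S - {1}. [:- x, 1:])"
  have p: "monom 1 n - 1 = [:-1, 1:] * Q"
    unfolding Q_def monom_minus_1_factors[OF n] S_def[symmetric] using S by (simp add: prod.remove[of S 1])
  have "poly (pderiv (monom 1 n - 1 :: 'a poly)) 1 = of_nat n"
    by (simp add: pderiv_diff pderiv_monom poly_monom)
  then have "poly Q 1 = of_nat n"
    unfolding p pderiv_mult by (simp add: pderiv_pCons)
  then show ?thesis by (simp add: Q_def poly_prod S_def)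
qed

text \<open>The complementary factors of the preceding product show that \<open>1 - x\<close> divides \<open>n\<close>; after scaling,
  so does every difference of distinct \<open>n\<close>-th roots of unity.\<close>

lemma one_minus_root_dvd:
  fixes x :: "'a :: {alg_closed_field, field_char_0}"
  assumes n: "n > 0" and S: "subring_on S" "\<And>y. y ^ n = 1 \<Longrightarrow> y \<in> S" and x: "x ^ n = 1" "x \<noteq> 1"
  shows "\<exists>e\<in>S. (1 - x) * e = of_nat n"
proof -
  interpret S: subring_on S by fact
  have "of_nat n = (1 - x) * (\<Prod>y\<in>{y. y ^ n = 1} - {1} - {x}. 1 - y)"
    unfolding prod_one_minus_roots[OF n, symmetric]
    using x finite_roots_of_unity[OF n, where 'a = 'a] by (subst prod.remove[of _ x]) auto
  moreover have "(\<Prod>y\<in>{y. y ^ n = 1} - {1} - {x}. 1 - y) \<in> S"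
    using S(2) by (intro S.prod_in S.diff_in) auto
  ultimately show ?thesis by metis
qed

lemma (in subring_on) polys_prod_mset:
  "(\<And>x. x \<in># A \<Longrightarrow> x \<in> R) \<Longrightarrow> (\<Prod>x\<in>#A. [:- x, 1:]) \<in> polys R"
  by (induction A) auto

text \<open>Dedekind's argument for the irreducibility of cyclotomic polynomials, without reduction to a
  residue field. Let \<open>m\<close> be the minimal polynomial of \<open>z\<close>; it has coefficients in \<open>R\<close>. By the Frobenius
  congruence \<open>m(z^q)\<close> is divisible by \<open>q\<close>. If it is not zero, it is a product of differences of
  distinct \<open>n\<close>-th roots of unity, and divides a power of \<open>n\<close>, which is prime to \<open>q\<close>. Then \<open>1/q\<close> would
  lie in \<open>R[z]\<close>.\<close>

lemma (in local_subring) frobenius_conjugate: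
  assumes z: "prim_root n z" and cop: "coprime n q" and f: "f \<in> polys K" "poly f z = 0"
  shows "poly f (z ^ q) = 0"
proof -
  have n: "n > 0" "z ^ n = 1" using prim_rootD[OF z] by auto
  define S where "S = adjoin R z"
  interpret S: subring_on S unfolding S_def by (rule subring_on_adjoin) (rule subring_on_axioms)
  have RS: "R \<subseteq> S" "z \<in> S"
    unfolding S_def using adjoin_base[OF subring_on_axioms] adjoin_self[OF subring_on_axioms] by auto
  have rootS: "y \<in> S" if y: "y ^ n = 1" for y
  proof -
    obtain i where "y = z ^ i" using prim_root_all[OF z y] by blast
    then show ?thesis using RS(2) by auto
  qed
  have poly_n: "monom 1 n - 1 \<in> polys K" by auto
  have zroot: "poly (monom 1 n - 1) z = 0" using n by (simp add: poly_monom)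
  have "algebraic_over K z"
    unfolding algebraic_over_def using poly_n zroot monom_minus_1_nz[OF n(1)] by blast
  then obtain m where m: "m \<in> polys K" "lead_coeff m = 1" "poly m z = 0"
    "\<And>p. p \<in> polys K \<Longrightarrow> poly p z = 0 \<Longrightarrow> \<exists>d\<in>polys K. p = m * d"
    using K.minimal_poly by metis
  have "m \<noteq> 0" using m(2) by auto
  then obtain A where "m = smult (lead_coeff m) (\<Prod>x\<in>#A. [:-x, 1:])"
    using alg_closed_imp_factorization by blast
  then have A: "m = (\<Prod>x\<in>#A. [:-x, 1:])" using m(2) by simp
  have roots: "x ^ n = 1" if "x \<in># A" for x
  proof -
    have "poly m x = 0"
      using that by (subst A) (auto simp: poly_prod_mset prod_mset_zero_iff image_iff)
    moreover obtain d where "monom 1 n - 1 = m * d" using m(4)[OF poly_n zroot] by blast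
    ultimately have "poly (monom 1 n - 1) x = 0" by simp
    then show ?thesis by (simp add: poly_monom)
  qed
  have "m \<in> polys S"
    unfolding A using roots rootS by (intro S.polys_prod_mset) auto
  then have mR: "m \<in> polys R"
    using m(1) adjoin_inter[OF n(2,1)] unfolding polys_def S_def by blast
  obtain d where d: "d \<in> S" "poly m z ^ q = poly m (z ^ q) + of_nat q * d"
    using frobenius_poly[OF S.subring_on_axioms RS mR] by blast
  have mq: "poly m (z ^ q) = - of_nat q * d"
    using d(2) m(3) q_gt_1 by (simp add: power_0_left eq_neg_iff_add_eq_0 add.commute)
  have zq: "(z ^ q) ^ n = 1" using n by (metis mult.commute power_mult power_one)
  have "poly m (z ^ q) = 0"
  proof (rule ccontr)
    assume nz: "poly m (z ^ q) \<noteq> 0"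
    have ev: "poly m (z ^ q) = (\<Prod>x\<in>#A. z ^ q - x)"
      by (subst A) (simp add: poly_prod_mset image_mset.compositionality comp_def)
    have "\<exists>e\<in>S. (\<Prod>x\<in>#B. z ^ q - x) * e = of_nat n ^ size B"
      if "\<And>x. x \<in># B \<Longrightarrow> x ^ n = 1 \<and> x \<noteq> z ^ q" for B
      using that
    proof (induction B)
      case empty
      show ?case by (intro bexI[of _ 1]) auto
    next
      case (add x B)
      then obtain e where e: "e \<in> S" "(\<Prod>x\<in>#B. z ^ q - x) * e = of_nat n ^ size B" by auto
      define w where "w = z ^ q"
      have x: "x ^ n = 1" "x \<noteq> w" and w: "w ^ n = 1" "w \<noteq> 0"
        using add.prems[of x] zq root_of_unity_nz[OF zq n(1)] by (auto simp: w_def)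
      have "(x / w) ^ n = 1" "x / w \<noteq> 1" using x w by (auto simp: power_divide)
      then obtain e' where e': "e' \<in> S" "(1 - x / w) * e' = of_nat n"
        using one_minus_root_dvd[OF n(1) S.subring_on_axioms rootS] by blast
      have "(1 / w) ^ n = 1" using w by (simp add: power_divide)
      then have "1 / w \<in> S" by (rule rootS)
      then have "e * (e' * (1 / w)) \<in> S" using e e' by blast
      moreover have f: "(w - x) * (e' * (1 / w)) = of_nat n"
        using e'(2) w by (simp add: field_simps)
      have "(\<Prod>x\<in>#add_mset x B. z ^ q - x) * (e * (e' * (1 / w))) =
          ((w - x) * (e' * (1 / w))) * ((\<Prod>x\<in>#B. z ^ q - x) * e)"
        unfolding w_def by simp
      then have "(\<Prod>x\<in>#add_mset x B. z ^ q - x) * (e * (e' * (1 / w))) = of_nat n ^ size (add_mset x B)"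
        unfolding f e(2) by simp
      ultimately show ?case by blast
    qed
    from this[of A] obtain e where e: "e \<in> S" "poly m (z ^ q) * e = of_nat n ^ size A"
      using roots nz unfolding ev by (auto simp: prod_mset_zero_iff image_iff)
    have inv: "inverse (of_nat n) \<in> S" using inverse_of_nat_in[OF cop] RS by blast
    define k where "k = - d * e * inverse (of_nat n) ^ size A"
    have "k \<in> S" unfolding k_def using d e inv by auto
    have "of_nat q * k = (of_nat n * inverse (of_nat n)) ^ size A"
      unfolding k_def power_mult_distrib e(2)[symmetric] mq by (simp add: algebra_simps)
    then have "of_nat q * k = 1" using n(1) by simp
    then have "inverse (of_nat q) = k" by (rule inverse_unique)
    then show False
      using inverse_q_notin_adjoin[OF n(2,1)] \<open>k \<in> S\<close> by (simp add: S_def)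
  qed
  then show ?thesis using m(4)[OF f] by auto
qed

lemma fermat_int:
  assumes q: "Factorial_Ring.prime q"
  shows "[x ^ q = x] (mod int q)"
proof -
  have q0: "q > 0" using q prime_gt_0_nat by blast
  define y where "y = nat (x mod int q)"
  have y: "int y = x mod int q" using q0 by (simp add: y_def)
  have "[y ^ q = y] (mod q)"
  proof (cases "q dvd y")
    case True
    then have "q dvd y ^ q" using q0 by (meson dvd_power dvd_trans)
    then show ?thesis using True by (simp add: cong_def dvd_eq_mod_eq_0)
  next
    case False
    have "[y ^ (q - 1) * y = 1 * y] (mod q)"
      using fermat_theorem[OF q False] by (rule cong_mult) simp
    moreover have "y ^ (q - 1) * y = y ^ q" using q0 by (metis power_minus_mult)
    ultimately show ?thesis by simp
  qed
  then have "[int y ^ q = int y] (mod int q)" by (metis cong_int_iff of_nat_power)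
  then show ?thesis unfolding y cong_def by (simp add: power_mod)
qed

definition int_localization :: "nat \<Rightarrow> 'a :: field_char_0 set"
  where "int_localization q = {of_int a / of_int b | a b. \<not> int q dvd b}"

lemma local_subring_int_localization:
  assumes q: "Factorial_Ring.prime q"
  shows "local_subring (int_localization q) (\<rat> :: 'a :: {alg_closed_field, field_char_0} set) q"
proof -
  have pr: "Factorial_Ring.prime (int q)" using q by simp
  have I: "of_int a / of_int b \<in> int_localization q" if "\<not> int q dvd b" for a b
    using that unfolding int_localization_def by blast
  have nd1: "\<not> int q dvd 1" using pr not_prime_unit by blast
  have sub: "subring_on (int_localization q :: 'a set)"
  proof
    show "0 \<in> (int_localization q :: 'a set)" "1 \<in> (int_localization q :: 'a set)"
      using I[OF nd1, of 0] I[OF nd1, of 1] by simp_all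
    fix x y :: 'a assume "x \<in> int_localization q" "y \<in> int_localization q"
    then obtain a b c d where *: "\<not> int q dvd b" "\<not> int q dvd d" "x = of_int a / of_int b" "y = of_int c / of_int d"
      by (auto simp: int_localization_def)
    then have bd: "\<not> int q dvd b * d" using prime_dvd_mult_iff[OF pr] by blast
    have nz: "b \<noteq> 0" "d \<noteq> 0" using * by auto
    have "x + y = of_int (a * d + c * b) / of_int (b * d)" "x * y = of_int (a * c) / of_int (b * d)"
      using * nz by (simp_all add: field_simps)
    then show "x + y \<in> int_localization q" "x * y \<in> int_localization q"
      using I[OF bd] by metis+
  next
    fix x :: 'a assume "x \<in> int_localization q"
    then obtain a b where *: "\<not> int q dvd b" "x = of_int a / of_int b"
      by (auto simp: int_localization_def)
    then have "- x = of_int (- a) / of_int b" by simp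
    then show "- x \<in> int_localization q" using I[OF *(1), of "- a"] by metis
  qed
  have K: "subfield_on (\<rat> :: 'a set)" by (rule subfield_on_Rats)
  show ?thesis
  proof (rule local_subring.intro[OF sub K], unfold_locales)
    show "Factorial_Ring.prime q" by fact
    show "int_localization q \<subseteq> (\<rat> :: 'a set)" by (auto simp: int_localization_def)
  next
    fix c :: 'a assume "c \<in> int_localization q"
    then obtain a b where *: "\<not> int q dvd b" "c = of_int a / of_int b"
      by (auto simp: int_localization_def)
    have b: "b \<noteq> 0" using * by auto
    have nd: "\<not> int q dvd b - int q * a" using * by (simp add: dvd_diff_left_iff)
    then have nz: "b - int q * a \<noteq> 0" by auto
    have e: "1 - of_nat q * c = of_int (b - int q * a) / of_int b"
      using * b by (simp add: field_simps)
    have "inverse (1 - of_nat q * c) = of_int b / of_int (b - int q * a)"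
      unfolding e by simp
    then show "1 - of_nat q * c \<noteq> 0 \<and> inverse (1 - of_nat q * c) \<in> int_localization q"
      using I[OF nd, of b] e nz b by (metis divide_eq_0_iff of_int_eq_0_iff)
    have "[a ^ q * b = a * b ^ q] (mod int q)"
    proof -
      note F = fermat_int[OF q]
      show ?thesis using cong_mult[OF F[of a] cong_refl[of b]] cong_mult[OF cong_refl[of a] cong_sym[OF F[of b]]]
        cong_trans by blast
    qed
    then obtain k where k: "a ^ q * b - a * b ^ q = int q * k"
      by (auto simp: cong_iff_dvd_diff)
    have nd': "\<not> int q dvd b ^ q * b" using * prime_dvd_mult_iff[OF pr] prime_dvd_power[OF pr] by blast
    have "c ^ q = c + of_nat q * (of_int k / of_int (b ^ q * b))"
    proof -
      have "of_int (a ^ q * b - a * b ^ q) = (of_nat q * of_int k :: 'a)" unfolding k by simp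
      then have e: "of_nat q * of_int k = of_int a ^ q * of_int b - of_int a * (of_int b :: 'a) ^ q" by simp
      show ?thesis
        using b unfolding *(2) times_divide_eq_right e by (simp add: power_divide field_simps)
    qed
    then show "\<exists>d\<in>int_localization q. c ^ q = c + of_nat q * d" using I[OF nd'] by blast
  next
    fix x :: 'a assume x: "x \<in> \<rat>" "x \<notin> int_localization q"
    obtain a b where ab: "x = of_int a / of_int b" "b > 0" "coprime a b"
      using x(1) by (elim Rats_cases') auto
    then have "int q dvd b" using x(2) I by blast
    then obtain c where c: "b = int q * c" by (elim dvdE)
    have "\<not> int q dvd a" using ab(3) \<open>int q dvd b\<close> pr by (meson coprime_common_divisor not_prime_unit)
    moreover have "a \<noteq> 0" using calculation by auto
    moreover have "q > 0" using q prime_gt_0_nat by blast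
    ultimately show "\<exists>z\<in>int_localization q. inverse (of_nat q) = x * z"
      using ab c by (intro bexI[of _ "of_int c / of_int a"] I) (auto simp: field_simps)
  qed
qed

text \<open>Irreducibility over the rationals of the cyclotomic polynomial: the exponent \<open>i\<close> is a product of
  primes \<open>q\<close> not dividing \<open>n\<close>, each of which is treated by \<open>frobenius_conjugate\<close> in the localization at \<open>q\<close>.\<close>

theorem cyclotomic_conjugates:
  fixes z :: "'a :: {alg_closed_field, field_char_0}"
  assumes "prim_root n z" "coprime i n" "i > 0" "f \<in> polys \<rat>" "poly f z = 0"
  shows "poly f (z ^ i) = 0"
  using assms
proof (induction i arbitrary: z rule: less_induct)
  case (less i)
  show ?case
  proof (cases "i = 1")
    case False
    then obtain q where q: "Factorial_Ring.prime q" "q dvd i" using prime_factor_nat by blast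
    then obtain j where j: "i = q * j" by (elim dvdE)
    have cop: "coprime q n" "coprime j n" using less.prems(2) by (auto simp: j)
    have j0: "0 < j" "j < i" using j less.prems(3) prime_gt_1_nat[OF q(1)] by auto
    interpret local_subring "int_localization q" "\<rat> :: 'a set" q
      by (rule local_subring_int_localization) fact
    have "poly f (z ^ q) = 0"
      using frobenius_conjugate[OF less.prems(1)] cop less.prems by (simp add: coprime_commute)
    then have "poly f ((z ^ q) ^ j) = 0"
      using less.IH[OF j0(2) prim_root_power[OF less.prems(1) cop(1)] cop(2) j0(1) less.prems(4)] by blast
    then show ?thesis by (simp add: j power_mult)
  qed (use less.prems in simp)
qed


text \<open>Integrality of the cyclotomic polynomials by division of \<open>X^n - 1\<close>, which is valid in every
  algebraically closed field and therefore yields the same integer polynomial for all of them.\<close>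

definition cyc :: "nat \<Rightarrow> 'a :: field poly"
  where "cyc n = (\<Prod>x | prim_root n x. [:- x, 1:])"

lemma finite_prim_roots: "n > 0 \<Longrightarrow> finite {x :: 'a :: field. prim_root n x}"
  by (rule finite_subset[OF _ finite_roots_of_unity]) (auto simp: prim_root_def)

lemma prim_root_unique: "prim_root m z \<Longrightarrow> prim_root n z \<Longrightarrow> m = n"
  using prim_root_eq_1_iff[of m z n] prim_root_eq_1_iff[of n z m] prim_rootD[of m z] prim_rootD[of n z]
  by (simp add: dvd_antisym)

lemma prim_root_exists_order:
  assumes "z ^ n = 1" "n > 0"
  obtains d where "d dvd n" "prim_root d z"
proof -
  define d where "d = (LEAST d. d > 0 \<and> z ^ d = 1)"
  have d: "d > 0" "z ^ d = 1"
    unfolding d_def using LeastI[of "\<lambda>d. d > 0 \<and> z ^ d = 1" n] assms by auto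
  have "z ^ m \<noteq> 1" if "0 < m \<and> m < d" for m
    using not_less_Least[of m "\<lambda>d. d > 0 \<and> z ^ d = 1"] that by (auto simp: d_def)
  then have "prim_root d z" using d by (simp add: prim_root_def)
  then show ?thesis using that prim_root_eq_1_iff assms by blast
qed

lemma cyc_prod:
  assumes n: "n > 0"
  shows "monom 1 n - 1 = (\<Prod>d | d dvd n. cyc d :: 'a :: {alg_closed_field, field_char_0} poly)"
proof -
  have "{x :: 'a. x ^ n = 1} = (\<Union>d\<in>{d. d dvd n}. {x. prim_root d x})"
  proof
    show "(\<Union>d\<in>{d. d dvd n}. {x. prim_root d x}) \<subseteq> {x :: 'a. x ^ n = 1}"
      using prim_root_eq_1_iff by blast
    show "{x :: 'a. x ^ n = 1} \<subseteq> (\<Union>d\<in>{d. d dvd n}. {x. prim_root d x})"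
    proof
      fix x :: 'a assume "x \<in> {x. x ^ n = 1}"
      then obtain d where "d dvd n" "prim_root d x" using prim_root_exists_order[of x n] n by auto
      then show "x \<in> (\<Union>d\<in>{d. d dvd n}. {x. prim_root d x})" by blast
    qed
  qed
  moreover have "(\<Prod>x\<in>(\<Union>d\<in>{d. d dvd n}. {x :: 'a. prim_root d x}). [:- x, 1:]) = (\<Prod>d | d dvd n. cyc d)"
    unfolding cyc_def
  proof (rule prod.UNION_disjoint)
    show "finite {d. d dvd n}" using n by simp
    show "\<forall>i\<in>{d. d dvd n}. finite {x :: 'a. prim_root i x}"
      using n finite_prim_roots by (auto dest: dvd_pos_nat)
    show "\<forall>i\<in>{d. d dvd n}. \<forall>j\<in>{d. d dvd n}. i \<noteq> j \<longrightarrow> {x :: 'a. prim_root i x} \<inter> {x. prim_root j x} = {}"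
      using prim_root_unique by blast
  qed
  ultimately show ?thesis using monom_minus_1_factors[OF n, where 'a = 'a] by simp
qed

lemma lead_coeff_prod_linear: "lead_coeff (\<Prod>x\<in>S. [:- x, 1 :: 'a :: field:]) = 1"
  by (simp add: lead_coeff_prod)

lemma cyc_nz: "cyc n \<noteq> (0 :: 'a :: field poly)"
  using lead_coeff_prod_linear unfolding cyc_def by (metis coeff_0 zero_neq_one)

lemma subring_on_Ints: "subring_on (\<int> :: 'a :: field_char_0 set)"
  by standard auto

lemma cyc_int: "n > 0 \<Longrightarrow> (cyc n :: 'a :: {alg_closed_field, field_char_0} poly) \<in> polys \<int>"
proof (induction n rule: less_induct)
  case (less n)
  interpret Z: subring_on "\<int> :: 'a set" by (rule subring_on_Ints)
  define Q where "Q = (\<Prod>d\<in>{d. d dvd n} - {n}. cyc d :: 'a poly)"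
  have Q: "Q \<in> polys \<int>"
    unfolding Q_def using less.IH less.prems
    by (intro Z.polys_prod) (metis DiffD1 DiffD2 dvd_imp_le dvd_pos_nat insertI1 le_neq_implies_less mem_Collect_eq)
  have lc: "lead_coeff Q = 1"
    unfolding Q_def lead_coeff_prod cyc_def by (simp add: lead_coeff_prod)
  have e: "monom 1 n - 1 = Q * cyc n"
    unfolding cyc_prod[OF less.prems] Q_def using less.prems by (subst prod.remove[of _ n]) (auto simp: mult.commute)
  have "monom 1 n - 1 \<in> polys (\<int> :: 'a set)" by auto
  from Z.polys_monic_division[OF Q lc this] obtain d r where
    dr: "d \<in> polys \<int>" "r \<in> polys \<int>" "monom 1 n - 1 = Q * d + r" "r = 0 \<or> degree r < degree Q" .
  have "r = Q * (cyc n - d)" using e dr(3) by (simp add: algebra_simps)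
  moreover have "Q \<noteq> 0" using lc by auto
  ultimately have "cyc n - d = 0"
    using dr(4) by (metis degree_mult_eq leD le_add1 mult_eq_0_iff)
  then show ?case using dr(1) by simp
qed

lemma polys_Ints_lift:
  assumes "(f :: 'a :: field_char_0 poly) \<in> polys \<int>"
  obtains P :: "int poly" where "map_poly of_int P = f"
proof -
  have "map_poly of_int (map_poly (\<lambda>x. SOME k. of_int k = x) f :: int poly) = f"
  proof (rule poly_eqI)
    fix i
    have "\<exists>k :: int. of_int k = coeff f i" using polysD[OF assms, of i] by (auto simp: Ints_def)
    from someI_ex[OF this] have "of_int (SOME k. of_int k = coeff f i) = coeff f i" .
    moreover have "(SOME k :: int. of_int k = (0 :: 'a)) = 0" by (rule some_equality) auto
    ultimately show "coeff (map_poly of_int (map_poly (\<lambda>x. SOME k. of_int k = x) f :: int poly)) i = coeff f i"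
      by (simp add: coeff_map_poly)
  qed
  then show ?thesis by (rule that)
qed

lemma map_poly_of_int_mult: "map_poly of_int (p * q) = (map_poly of_int p * map_poly of_int q :: 'a :: field_char_0 poly)"
  by (rule poly_eqI) (simp add: coeff_map_poly coeff_mult)

lemma map_poly_of_int_prod: "map_poly of_int (prod f A) = (\<Prod>i\<in>A. map_poly of_int (f i) :: 'a :: field_char_0 poly)"
  by (induction A rule: infinite_finite_induct) (auto simp: map_poly_of_int_mult)

lemma map_poly_of_int_inj: "map_poly of_int p = (map_poly of_int q :: 'a :: field_char_0 poly) \<longleftrightarrow> p = q"
  by (auto simp: poly_eq_iff coeff_map_poly)

lemma map_poly_of_int_monom_minus_1:
  "map_poly of_int (monom 1 n - 1) = (monom 1 n - 1 :: 'a :: field_char_0 poly)"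
  by (rule poly_eqI) (simp add: coeff_map_poly coeff_1)

lemma cyclotomic_complex:
  assumes "n > 0"
  shows "map_poly of_int (cyclotomic n) = (cyc n :: complex poly)"
proof -
  have set: "{\<zeta> :: complex. \<zeta> ^ n = 1 \<and> (\<forall>m. 0 < m \<and> m < n \<longrightarrow> \<zeta> ^ m \<noteq> 1)} = {x. prim_root n x}"
    using assms by (auto simp: prim_root_def)
  obtain P :: "int poly" where P: "map_poly of_int P = (cyc n :: complex poly)"
    using polys_Ints_lift[OF cyc_int[OF assms]] by blast
  show ?thesis
    unfolding cyclotomic_def set cyc_def[symmetric]
  proof (rule theI)
    show "map_poly of_int P = (cyc n :: complex poly)" by fact
    fix Q assume "map_poly of_int Q = (cyc n :: complex poly)"
    then show "Q = P" using P map_poly_of_int_inj[of Q P, where 'a = complex] by simp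
  qed
qed

text \<open>The constant \<^const>\<open>cyclotomic\<close> is defined through complex roots. The factorization of \<open>X^n - 1\<close>
  into cyclotomic polynomials holds over the integers, and can be read in any other algebraically closed
  field of characteristic 0.\<close>

theorem cyclotomic_alg_closed:
  "n > 0 \<Longrightarrow> map_poly of_int (cyclotomic n) = (cyc n :: 'a :: {alg_closed_field, field_char_0} poly)"
proof (induction n rule: less_induct)
  case (less n)
  have "map_poly of_int (monom 1 n - 1) = (map_poly of_int (\<Prod>d | d dvd n. cyclotomic d) :: complex poly)"
    unfolding map_poly_of_int_prod map_poly_of_int_monom_minus_1 cyc_prod[OF less.prems]
    using less.prems by (intro prod.cong refl) (auto simp: cyclotomic_complex dvd_pos_nat)
  then have "monom 1 n - 1 = (\<Prod>d | d dvd n. cyclotomic d)"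
    by (simp only: map_poly_of_int_inj)
  then have "(monom 1 n - 1 :: 'a poly) = (\<Prod>d | d dvd n. map_poly of_int (cyclotomic d))"
    by (metis map_poly_of_int_monom_minus_1 map_poly_of_int_prod)
  also have "\<dots> = map_poly of_int (cyclotomic n) * (\<Prod>d\<in>{d. d dvd n} - {n}. map_poly of_int (cyclotomic d))"
    using less.prems by (intro prod.remove) auto
  also have "(\<Prod>d\<in>{d. d dvd n} - {n}. map_poly of_int (cyclotomic d)) = (\<Prod>d\<in>{d. d dvd n} - {n}. cyc d :: 'a poly)"
  proof (rule prod.cong[OF refl])
    fix d assume d: "d \<in> {d. d dvd n} - {n}"
    then have "d \<le> n" "d > 0" using less.prems by (auto dest: dvd_imp_le dvd_pos_nat)
    then show "map_poly of_int (cyclotomic d) = (cyc d :: 'a poly)" using less.IH[of d] d by auto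
  qed
  finally have *: "(monom 1 n - 1 :: 'a poly) = map_poly of_int (cyclotomic n) * (\<Prod>d\<in>{d. d dvd n} - {n}. cyc d)" .
  have "(monom 1 n - 1 :: 'a poly) = cyc n * (\<Prod>d\<in>{d. d dvd n} - {n}. cyc d)"
    unfolding cyc_prod[OF less.prems] using less.prems by (intro prod.remove) auto
  moreover have "(\<Prod>d\<in>{d. d dvd n} - {n}. cyc d :: 'a poly) \<noteq> 0"
    using less.prems by (simp add: cyc_nz)
  ultimately show ?case using * by simp
qed

section \<open>Conjugates over the field of p-adic numbers\<close>

abbreviation padic_ints :: "'p :: prime_card padic_closure set"
  where "padic_ints \<equiv> range of_padic_int"

lemma of_padic_simps [simp]:
  "of_padic_int 0 = 0" "of_padic_int 1 = 1"
  "of_padic_int (a + b) = of_padic_int a + of_padic_int b"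
  "of_padic_int (a * b) = of_padic_int a * of_padic_int b"
  "of_padic_int (- a) = - of_padic_int a"
  by (simp_all add: of_padic_int_def Zero_fract_def[symmetric] One_fract_def[symmetric]
      to_ac_add[symmetric] to_ac_mult[symmetric] to_ac_minus[symmetric]
      del: to_ac_add to_ac_mult to_ac_minus)

lemma of_padic_diff [simp]: "of_padic_int (a - b) = of_padic_int a - of_padic_int b"
  using of_padic_simps(3)[of a "- b"] by simp

lemma of_padic_of_nat [simp]: "of_padic_int (of_nat n) = of_nat n"
  by (induction n) simp_all

lemma of_padic_of_int [simp]: "of_padic_int (of_int n) = of_int n"
  by (cases n) simp_all

lemma of_padic_power [simp]: "of_padic_int (a ^ n) = of_padic_int a ^ n"
  by (induction n) simp_all

lemma of_padic_sum: "of_padic_int (sum f A) = (\<Sum>i\<in>A. of_padic_int (f i))"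
  by (induction A rule: infinite_finite_induct) simp_all

lemma of_padic_eq_iff [simp]: "of_padic_int a = of_padic_int b \<longleftrightarrow> a = b"
  by (simp add: of_padic_int_def eq_fract)

lemma of_padic_eq_0_iff [simp]: "of_padic_int a = 0 \<longleftrightarrow> a = 0"
  using of_padic_eq_iff[of a 0] by (simp del: of_padic_eq_iff)

lemma to_padic_of_padic [simp]: "to_padic_int (of_padic_int a) = a"
  unfolding to_padic_int_def by (rule inv_into_f_f) (auto simp: inj_on_def)

lemma of_padic_to_padic: "x \<in> padic_ints \<Longrightarrow> of_padic_int (to_padic_int x) = x"
  by auto

lemma subring_on_padic_ints: "subring_on (padic_ints :: 'p :: prime_card padic_closure set)"
proof
  show "0 \<in> (padic_ints :: 'p padic_closure set)" "1 \<in> (padic_ints :: 'p padic_closure set)"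
    by (metis of_padic_simps(1) rangeI, metis of_padic_simps(2) rangeI)
  fix x y :: "'p padic_closure" assume "x \<in> padic_ints" "y \<in> padic_ints"
  then obtain a b where "x = of_padic_int a" "y = of_padic_int b" by blast
  then have "x + y = of_padic_int (a + b)" "x * y = of_padic_int (a * b)" by simp_all
  then show "x + y \<in> padic_ints" "x * y \<in> padic_ints" by blast+
next
  fix x :: "'p padic_closure" assume "x \<in> padic_ints"
  then obtain a where "x = of_padic_int a" by blast
  then have "- x = of_padic_int (- a)" by simp
  then show "- x \<in> padic_ints" by blast
qed

lemma subfield_on_padic_field: "subfield_on (padic_field :: 'p :: prime_card padic_closure set)"
proof
  show "0 \<in> (padic_field :: 'p padic_closure set)" "1 \<in> (padic_field :: 'p padic_closure set)"
    by (metis to_ac_0 rangeI, metis to_ac_1 rangeI)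
  fix x y :: "'p padic_closure" assume "x \<in> padic_field" "y \<in> padic_field"
  then obtain a b where "x = to_ac a" "y = to_ac b" by blast
  then have "x + y = to_ac (a + b)" "x * y = to_ac (a * b)" by simp_all
  then show "x + y \<in> padic_field" "x * y \<in> padic_field" by blast+
next
  fix x :: "'p padic_closure" assume "x \<in> padic_field"
  then obtain a where "x = to_ac a" by blast
  then have "- x = to_ac (- a)" "inverse x = to_ac (inverse a)" by simp_all
  then show "- x \<in> padic_field" "inverse x \<in> padic_field" by blast+
qed

lemma padic_field_fraction:
  assumes "x \<in> (padic_field :: 'p :: prime_card padic_closure set)"
  obtains a b where "b \<noteq> 0" "x = of_padic_int a / of_padic_int b"
proof -
  obtain y where y: "x = to_ac y" using assms by blast
  obtain a b where ab: "y = Fract a b" "b \<noteq> 0" by (cases y) auto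
  then have "y = Fract a 1 / Fract b 1" by simp
  then have "x = of_padic_int a / of_padic_int b"
    unfolding y of_padic_int_def by (simp add: to_ac_divide[symmetric] del: to_ac_divide divide_fract)
  then show ?thesis using that ab by blast
qed

lemma padic_fermat: "\<exists>d :: 'p :: prime_card padic_int. c ^ CARD('p) = c + of_nat CARD('p) * d"
proof -
  have "Rep_padic_int (c ^ CARD('p) - c) 1 = (Rep_padic_int c 1 ^ CARD('p) - Rep_padic_int c 1) mod int CARD('p)"
    by (simp add: minus_padic_int.rep_eq Rep_padic_power mod_simps)
  also have "\<dots> = 0"
    using fermat_int[OF prime_CARD[where 'p = 'p], of "Rep_padic_int c 1"] by (simp add: cong_iff_dvd_diff)
  finally obtain d where "c ^ CARD('p) - c = of_nat CARD('p) * d" by (rule padic_div_p)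
  then show ?thesis by (intro exI[of _ d]) (simp add: algebra_simps)
qed

interpretation padic: local_subring "padic_ints :: 'p :: prime_card padic_closure set" padic_field "CARD('p)"
proof (rule local_subring.intro[OF subring_on_padic_ints subfield_on_padic_field], unfold_locales)
  show "Factorial_Ring.prime CARD('p)" by (rule prime_CARD)
  show "padic_ints \<subseteq> (padic_field :: 'p padic_closure set)" by (auto simp: of_padic_int_def)
next
  fix c :: "'p padic_closure" assume "c \<in> padic_ints"
  then obtain a where a: "c = of_padic_int a" by blast
  have q: "int CARD('p) > 1" using prime_CARD[where 'p = 'p] prime_gt_1_nat by fastforce
  have "Rep_padic_int (1 - of_nat CARD('p) * a) 1 = 1"
    using q Rep_padic_mult_1[of a] by (simp add: minus_padic_int.rep_eq one_padic_int.rep_eq)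
  then have "Rep_padic_int (1 - of_nat CARD('p) * a) 1 \<noteq> 0" by simp
  then obtain y where y: "(1 - of_nat CARD('p) * a) * y = 1" using padic_unit by blast
  have "of_padic_int ((1 - of_nat CARD('p) * a) * y) = of_padic_int 1" unfolding y ..
  then have e: "(1 - of_nat CARD('p) * c) * of_padic_int y = 1" by (simp add: a)
  then show "1 - of_nat CARD('p) * c \<noteq> 0 \<and> inverse (1 - of_nat CARD('p) * c) \<in> padic_ints"
    using inverse_unique[OF e] by auto
  obtain d where "a ^ CARD('p) = a + of_nat CARD('p) * d" using padic_fermat by blast
  then have "of_padic_int (a ^ CARD('p)) = of_padic_int (a + of_nat CARD('p) * d)" by (simp only:)
  then show "\<exists>d\<in>padic_ints. c ^ CARD('p) = c + of_nat CARD('p) * d" by (auto simp: a)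
next
  fix x :: "'p padic_closure" assume x: "x \<in> padic_field" "x \<notin> padic_ints"
  let ?p = "of_nat CARD('p) :: 'p padic_closure"
  have p0: "?p \<noteq> 0" using prime_CARD[where 'p = 'p] prime_gt_0_nat by fastforce
  obtain a b where ab: "b \<noteq> 0" "x = of_padic_int a / of_padic_int b" using padic_field_fraction[OF x(1)] .
  have "a \<noteq> 0" using ab x(2) subring_on.zero_in[OF subring_on_padic_ints] by auto
  obtain j u u' where u: "a = of_nat CARD('p) ^ j * u" "u * u' = 1" using padic_factor[OF \<open>a \<noteq> 0\<close>] .
  obtain k v v' where v: "b = of_nat CARD('p) ^ k * v" "v * v' = 1" using padic_factor[OF \<open>b \<noteq> 0\<close>] .
  define U where "U = of_padic_int u" define U' where "U' = of_padic_int u'"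
  define V where "V = of_padic_int v" define V' where "V' = of_padic_int v'"
  have UV: "U * U' = 1" "V * V' = 1"
    unfolding U_def U'_def V_def V'_def of_padic_simps(4)[symmetric] u(2) v(2) by simp_all
  have xe: "x = ?p ^ j * U / (?p ^ k * V)" unfolding ab u v by (simp add: U_def V_def)
  have V'V: "V' = inverse V" using inverse_unique[OF UV(2)] by simp
  have U'U: "U' = inverse U" using inverse_unique[OF UV(1)] by simp
  have nz: "U \<noteq> 0" "V \<noteq> 0" using UV by auto
  have "j < k"
  proof (rule ccontr)
    assume "\<not> j < k"
    then have "?p ^ j = ?p ^ (j - k) * ?p ^ k" by (simp add: power_add[symmetric])
    then have "x = of_padic_int (of_nat CARD('p) ^ (j - k) * u * v')"
      unfolding xe using p0 nz by (simp add: U_def[symmetric] V'_def[symmetric] V'V field_simps)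
    then show False using x(2) by blast
  qed
  then have "?p ^ k = ?p ^ j * ?p ^ (k - j - 1) * ?p"
    by (simp add: power_add[symmetric] power_Suc2[symmetric] del: power_Suc)
  then have "inverse ?p = x * of_padic_int (of_nat CARD('p) ^ (k - j - 1) * v * u')"
    unfolding xe using p0 nz by (simp add: V_def[symmetric] U'_def[symmetric] U'U field_simps)
  then show "\<exists>z\<in>padic_ints. inverse ?p = x * z" by blast
qed

lemma padic_algebraic: "algebraic_over padic_field (z :: 'p :: prime_card padic_closure)"
proof -
  obtain f where f: "f \<noteq> 0" "poly (map_poly to_ac f) z = 0" by (rule alg_closure_algebraic)
  have "map_poly to_ac f \<in> polys padic_field" by (auto simp: polys_def coeff_map_poly)
  moreover have "map_poly to_ac f \<noteq> 0" using f(1) by (auto simp: poly_eq_iff coeff_map_poly)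
  ultimately show ?thesis using f(2) unfolding algebraic_over_def by blast
qed

definition padic_auts :: "('p :: prime_card padic_closure \<Rightarrow> 'p padic_closure) set"
  where "padic_auts = {g. ring_hom_on UNIV g \<and> (\<forall>x\<in>padic_field. g x = x)}"

lemma padic_aut_hom: "g \<in> padic_auts \<Longrightarrow> field_hom_on UNIV g"
  using subfield_on_UNIV subfield_on.axioms(1)[OF subfield_on_UNIV]
  by (simp add: padic_auts_def field_hom_on_def hom_on_def hom_on_axioms_def)

lemma padic_aut_simps:
  assumes "g \<in> padic_auts"
  shows "g 0 = 0" "g 1 = 1" "g (x + y) = g x + g y" "g (x * y) = g x * g y" "g (x - y) = g x - g y"
    "g (- x) = - g x" "g (x ^ n) = g x ^ n" "g (inverse x) = inverse (g x)" "g (of_nat k) = of_nat k"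
    "g (sum f A) = (\<Sum>i\<in>A. g (f i))" "g (prod f A) = (\<Prod>i\<in>A. g (f i))" "g x = g y \<longleftrightarrow> x = y"
proof -
  interpret field_hom_on UNIV g by (rule padic_aut_hom) fact
  show "g 0 = 0" "g 1 = 1" "g (x + y) = g x + g y" "g (x * y) = g x * g y" "g (x - y) = g x - g y"
    "g (- x) = - g x" "g (x ^ n) = g x ^ n" "g (inverse x) = inverse (g x)" "g (of_nat k) = of_nat k"
    "g (sum f A) = (\<Sum>i\<in>A. g (f i))" "g (prod f A) = (\<Prod>i\<in>A. g (f i))"
    by (simp_all add: hom_add hom_mult hom_diff hom_uminus hom_power hom_inverse hom_sum hom_prod)
  show "g x = g y \<longleftrightarrow> x = y" using hom_inj by (auto simp: inj_on_def)
qed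

lemma padic_aut_fixes: "g \<in> padic_auts \<Longrightarrow> x \<in> padic_field \<Longrightarrow> g x = x"
  unfolding padic_auts_def by blast

lemma padic_aut_poly:
  assumes "g \<in> padic_auts" "f \<in> polys padic_field"
  shows "g (poly f z) = poly f (g z)"
proof -
  interpret field_hom_on UNIV g by (rule padic_aut_hom) fact
  have "map_poly g f = f"
    using padic_aut_fixes[OF assms(1) polysD[OF assms(2)]] by (intro poly_eqI) (simp add: coeff_map_poly)
  then show ?thesis using hom_poly[of f z] by simp
qed

lemma padic_aut_id: "(\<lambda>x. x) \<in> padic_auts"
  by (simp add: padic_auts_def ring_hom_on_def)

lemma padic_aut_comp: "g \<in> padic_auts \<Longrightarrow> h \<in> padic_auts \<Longrightarrow> (\<lambda>x. g (h x)) \<in> padic_auts"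
  by (simp add: padic_auts_def ring_hom_on_def)

lemma padic_aut_inverse:
  assumes g: "g \<in> padic_auts"
  obtains h where "h \<in> padic_auts" "\<And>x. h (g x) = x" "\<And>x. g (h x) = x"
proof -
  have "bij_betw g UNIV UNIV"
    by (rule self_embedding_surj[OF subfield_on_UNIV subset_UNIV padic_algebraic])
       (use g in \<open>auto simp: padic_auts_def\<close>)
  then have b: "inj g" "surj g" by (auto simp: bij_betw_def)
  define h where "h = inv_into UNIV g"
  have hg: "h (g x) = x" "g (h x) = x" for x
    using b by (simp_all add: h_def surj_f_inv_f)
  have "ring_hom_on UNIV h"
    unfolding ring_hom_on_def
  proof (intro conjI ballI)
    show "h 1 = 1" using hg(1)[of 1] padic_aut_simps(2)[OF g] by simp
    fix x y
    show "h (x + y) = h x + h y" "h (x * y) = h x * h y"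
      using hg padic_aut_simps(3,4)[OF g] by (metis, metis)
  qed
  moreover have "h x = x" if "x \<in> padic_field" for x
    using hg(1)[of x] padic_aut_fixes[OF g that] by simp
  ultimately have "h \<in> padic_auts" by (simp add: padic_auts_def)
  then show ?thesis using that hg by blast
qed

text \<open>An element not in \<open>Q_p\<close> is moved by some embedding of the closure into itself.\<close>

lemma padic_fixed: "(\<And>g. g \<in> padic_auts \<Longrightarrow> g x = x) \<Longrightarrow> x \<in> padic_field"
proof (rule ccontr)
  assume fx: "\<And>g. g \<in> padic_auts \<Longrightarrow> g x = x" and n: "x \<notin> padic_field"
  obtain g where g: "ring_hom_on UNIV g" "\<And>y. y \<in> padic_field \<Longrightarrow> g y = y" "g x \<noteq> x"
    using embedding_moving[OF subfield_on_padic_field subfield_on_UNIV subset_UNIV padic_algebraic UNIV_I n] by blast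
  then have "g \<in> padic_auts" unfolding padic_auts_def by blast
  then show False using fx g(3) by blast
qed

definition padic_conj :: "'p :: prime_card padic_closure \<Rightarrow> 'p padic_closure \<Rightarrow> bool"
  where "padic_conj x y \<longleftrightarrow> (\<exists>g\<in>padic_auts. g x = y)"

lemma padic_conj_refl: "padic_conj x x"
  unfolding padic_conj_def by (rule bexI[OF _ padic_aut_id]) simp

lemma padic_conj_prim_root: "padic_conj x y \<Longrightarrow> prim_root n x \<Longrightarrow> prim_root n y"
proof -
  assume "padic_conj x y" and x: "prim_root n x"
  then obtain g where g: "g \<in> padic_auts" "y = g x" by (auto simp: padic_conj_def)
  have "y ^ k = 1 \<longleftrightarrow> x ^ k = 1" for k
    using padic_aut_simps(2,7,12)[OF g(1)] g(2) by metis
  then show ?thesis using x by (simp add: prim_root_def)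
qed

text \<open>The integral elements needed below all lie in \<open>Z_p[z]\<close> for a root of unity \<open>z\<close>. This ring is stable
  under the automorphisms over \<open>Q_p\<close>, meets \<open>Q_p\<close> in \<open>Z_p\<close>, and does not contain \<open>1/p\<close>.\<close>

lemma adjoin_padic:
  fixes z :: "'p :: prime_card padic_closure"
  assumes z: "prim_root n z"
  shows "subring_on (adjoin padic_ints z)" "padic_ints \<subseteq> adjoin padic_ints z"
    "x ^ n = 1 \<Longrightarrow> x \<in> adjoin padic_ints z"
    "g \<in> padic_auts \<Longrightarrow> x \<in> adjoin padic_ints z \<Longrightarrow> g x \<in> adjoin padic_ints z"
    "x \<in> padic_field \<Longrightarrow> x \<in> adjoin padic_ints z \<Longrightarrow> x \<in> padic_ints"
    "inverse (of_nat CARD('p)) \<notin> adjoin padic_ints z"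
proof -
  show s: "subring_on (adjoin padic_ints z)" by (rule subring_on_adjoin) (rule subring_on_padic_ints)
  show b: "padic_ints \<subseteq> adjoin padic_ints z" by (rule adjoin_base) (rule subring_on_padic_ints)
  interpret I: subring_on "adjoin padic_ints z" by fact
  have r: "x \<in> adjoin padic_ints z" if "x ^ n = 1" for x
  proof -
    obtain i where "x = z ^ i" using prim_root_all[OF z \<open>x ^ n = 1\<close>] by blast
    then show ?thesis using adjoin_self[OF subring_on_padic_ints, of z] by (simp add: I.power_in)
  qed
  then show "x ^ n = 1 \<Longrightarrow> x \<in> adjoin padic_ints z" .
  show "g x \<in> adjoin padic_ints z" if g: "g \<in> padic_auts" and x: "x \<in> adjoin padic_ints z"
  proof -
    obtain f where f: "f \<in> polys padic_ints" "x = poly f z" using x by (auto simp: adjoin_def)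
    have "g x = poly f (g z)"
      unfolding f(2) using g f(1) polys_mono[OF padic.RK] by (intro padic_aut_poly) auto
    moreover have "g z ^ n = 1"
      using prim_rootD(2)[OF z] padic_aut_simps(7)[OF g, of z n] padic_aut_simps(2)[OF g] by simp
    then have "g z \<in> adjoin padic_ints z" by (rule r)
    ultimately show ?thesis using f(1) polys_mono[OF b] by auto
  qed
  show "x \<in> padic_field \<Longrightarrow> x \<in> adjoin padic_ints z \<Longrightarrow> x \<in> padic_ints"
    using padic.adjoin_inter prim_rootD[OF z] by blast
  show "inverse (of_nat CARD('p)) \<notin> adjoin padic_ints z"
    using padic.inverse_q_notin_adjoin prim_rootD[OF z] by blast
qed

lemma sum_powers_root:
  assumes "y ^ m = 1"
  shows "(\<Sum>j<m. y ^ j) = (if y = 1 then of_nat m else (0 :: 'a :: field))"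
proof (cases "y = 1")
  case False
  have "(y - 1) * (\<Sum>j<m. y ^ j) = y ^ m - 1" by (simp add: power_diff_1_eq)
  then show ?thesis using False assms by simp
qed simp

definition orbit :: "'p :: prime_card padic_closure \<Rightarrow> 'p padic_closure set"
  where "orbit w = {y. padic_conj w y}"

lemma orbit_image: "g \<in> padic_auts \<Longrightarrow> bij_betw g (orbit w) (orbit w)"
proof -
  assume g: "g \<in> padic_auts"
  obtain h where h: "h \<in> padic_auts" "\<And>x. h (g x) = x" "\<And>x. g (h x) = x" using padic_aut_inverse[OF g] by blast
  show ?thesis
    by (rule bij_betw_byWitness[of _ h])
       (use g h padic_aut_comp in \<open>fastforce simp: orbit_def padic_conj_def\<close>)+
qed

lemma finite_orbit: "w ^ n = 1 \<Longrightarrow> n > 0 \<Longrightarrow> finite (orbit w)" "w ^ n = 1 \<Longrightarrow> x \<in> orbit w \<Longrightarrow> x ^ n = 1"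
proof -
  have *: "w ^ n = 1 \<Longrightarrow> x \<in> orbit w \<Longrightarrow> x ^ n = 1" for x
  proof -
    assume w: "w ^ n = 1" and "x \<in> orbit w"
    then obtain g where g: "g \<in> padic_auts" "x = g w" by (auto simp: orbit_def padic_conj_def)
    then show "x ^ n = 1"
      using w padic_aut_simps(7)[OF g(1), of w n] padic_aut_simps(2)[OF g(1)] by simp
  qed
  then show "w ^ n = 1 \<Longrightarrow> x \<in> orbit w \<Longrightarrow> x ^ n = 1" .
  show "w ^ n = 1 \<Longrightarrow> n > 0 \<Longrightarrow> finite (orbit w)"
    by (rule finite_subset[OF _ finite_roots_of_unity[of n]]) (use * in auto)
qed

text \<open>An element of \<open>Z_p[z]\<close> fixed by the stabilizer of an \<open>m\<close>-th root of unity \<open>w\<close>, with \<open>m\<close> prime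
  to \<open>p\<close>, lies in \<open>Z_p[w]\<close>: it is recovered from the traces of its multiples by powers of \<open>w\<close>, as
  for a finite Fourier transform.\<close>

lemma stabilizer_fixed:
  fixes z w :: "'p :: prime_card padic_closure"
  assumes z: "prim_root n z" and w: "w ^ m = 1" "m dvd n" and cop: "coprime m CARD('p)"
    and x: "x \<in> adjoin padic_ints z" "\<forall>g\<in>padic_auts. g w = w \<longrightarrow> g x = x"
  shows "\<exists>f\<in>polys padic_ints. x = poly f w"
proof -
  note I = adjoin_padic[OF z]
  interpret I: subring_on "adjoin padic_ints z" by (rule I)
  have n0: "n > 0" using z by (rule prim_rootD)
  then have m0: "m > 0" using w(2) dvd_pos_nat by blast
  define W where "W = orbit w"
  have finW: "finite W" unfolding W_def using finite_orbit(1)[OF w(1) m0] .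
  have Wm: "y ^ m = 1" if "y \<in> W" for y using finite_orbit(2)[OF w(1)] that by (simp add: W_def)
  have Wn: "y ^ n = 1" if "y \<in> W" for y using Wm[OF that] w(2) by (auto simp: power_mult)
  have ex: "\<exists>g. g \<in> padic_auts \<and> g w = y" if "y \<in> W" for y
    using that by (auto simp: W_def orbit_def padic_conj_def)
  \<comment> \<open>\<open>G y x\<close> is the conjugate of \<open>x\<close> belonging to the conjugate \<open>y\<close> of \<open>w\<close>; it does not depend on the automorphism chosen\<close>
  define G where "G = (\<lambda>y. SOME g. g \<in> padic_auts \<and> g w = y)"
  have G: "G y \<in> padic_auts" "G y w = y" if "y \<in> W" for y
    using someI_ex[OF ex[OF that]] by (simp_all add: G_def)
  have Gx: "G (g w) x = g x" if g: "g \<in> padic_auts" for g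
  proof -
    have gw: "g w \<in> W" using g by (auto simp: W_def orbit_def padic_conj_def)
    obtain h where h: "h \<in> padic_auts" "\<And>x. h (g x) = x" "\<And>x. g (h x) = x" using padic_aut_inverse[OF g] by blast
    have "h (G (g w) w) = w" using G[OF gw] h by simp
    then have "h (G (g w) x) = x" using bspec[OF x(2) padic_aut_comp[OF h(1) G(1)[OF gw]]] by simp
    then show ?thesis using h(3) by metis
  qed
  \<comment> \<open>the trace of \<open>w^(-j) * x\<close>\<close>
  define T where "T = (\<lambda>j. \<Sum>y\<in>W. inverse y ^ j * G y x)"
  have T: "T j \<in> padic_ints" for j
  proof (rule I(5))
    show "T j \<in> adjoin padic_ints z"
      unfolding T_def
    proof (intro I.sum_in I.mult_in I.power_in)
      fix y assume y: "y \<in> W"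
      show "inverse y \<in> adjoin padic_ints z" using Wn[OF y] by (intro I(3)) (simp add: power_inverse)
      show "G y x \<in> adjoin padic_ints z" using G(1)[OF y] x(1) by (rule I(4))
    qed
    show "T j \<in> padic_field"
    proof (rule padic_fixed)
      fix g :: "'p padic_closure \<Rightarrow> 'p padic_closure" assume g: "g \<in> padic_auts"
      have "g (T j) = (\<Sum>y\<in>W. inverse (g y) ^ j * g (G y x))"
        unfolding T_def by (simp add: padic_aut_simps[OF g])
      also have "\<dots> = (\<Sum>y\<in>W. inverse (g y) ^ j * G (g y) x)"
      proof (intro sum.cong refl)
        fix y assume y: "y \<in> W"
        have "G (g (G y w)) x = g (G y x)" by (rule Gx[OF padic_aut_comp[OF g G(1)[OF y]]])
        then show "inverse (g y) ^ j * g (G y x) = inverse (g y) ^ j * G (g y) x" using G(2)[OF y] by simp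
      qed
      also have "\<dots> = T j"
        unfolding T_def using orbit_image[OF g, of w] unfolding W_def by (rule sum.reindex_bij_betw)
      finally show "g (T j) = T j" .
    qed
  qed
  define f where "f = (\<Sum>j<m. monom (inverse (of_nat m) * T j) j)"
  have "f \<in> polys padic_ints"
    unfolding f_def using padic.inverse_of_nat_in[OF cop] T by (intro padic.polys_sum padic.polys_monom) auto
  moreover have "poly f w = x"
  proof -
    have wW: "w \<in> W" using padic_conj_refl by (simp add: W_def orbit_def)
    have "poly f w = (\<Sum>j<m. inverse (of_nat m) * T j * w ^ j)"
      unfolding f_def by (simp add: poly_sum poly_monom)
    also have "\<dots> = inverse (of_nat m) * (\<Sum>j<m. \<Sum>y\<in>W. G y x * (w / y) ^ j)"
      unfolding T_def sum_distrib_left sum_distrib_right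
      by (intro sum.cong refl) (simp add: divide_inverse power_mult_distrib power_inverse mult_ac)
    also have "(\<Sum>j<m. \<Sum>y\<in>W. G y x * (w / y) ^ j) = (\<Sum>y\<in>W. G y x * (\<Sum>j<m. (w / y) ^ j))"
      by (subst sum.swap) (simp add: sum_distrib_left)
    also have "\<dots> = (\<Sum>y\<in>W. if y = w then G y x * of_nat m else 0)"
    proof (intro sum.cong refl)
      fix y assume y: "y \<in> W"
      have y0: "y \<noteq> 0" using root_of_unity_nz[OF Wm[OF y] m0] .
      have "(w / y) ^ m = 1" using Wm[OF y] w by (simp add: power_divide)
      then show "G y x * (\<Sum>j<m. (w / y) ^ j) = (if y = w then G y x * of_nat m else 0)"
        using y0 by (auto simp: sum_powers_root)
    qed
    also have "\<dots> = G w x * of_nat m" using finW wW by simp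
    also have "G w x = x" using Gx[OF padic_aut_id] by simp
    finally show ?thesis using m0 by simp
  qed
  ultimately show ?thesis by blast
qed

section \<open>Total ramification and integral idempotents\<close>

text \<open>Divisibility by \<open>p\<close> of a power passes to the element itself, for elements fixed by the
  stabilizer of a root of unity \<open>w\<close> of order prime to \<open>p\<close>: such an element is a polynomial in \<open>w\<close>,
  and is therefore congruent modulo \<open>p\<close> to its own power with exponent \<open>p^r\<close> whenever
  \<open>w^(p^r) = w\<close>.\<close>

lemma unramified:
  fixes z w :: "'p :: prime_card padic_closure"
  assumes z: "prim_root n z" and w: "w ^ m = 1" "m dvd n" and cop: "coprime m CARD('p)"
    and x: "x \<in> adjoin padic_ints z" "\<forall>g\<in>padic_auts. g w = w \<longrightarrow> g x = x"
    and dv: "x ^ N = of_nat CARD('p) * y" "y \<in> adjoin padic_ints z"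
  shows "\<exists>y\<in>adjoin padic_ints z. x = of_nat CARD('p) * y"
proof -
  let ?p = "CARD('p)"
  note I = adjoin_padic[OF z]
  interpret I: subring_on "adjoin padic_ints z" by (rule I)
  have n0: "n > 0" using z by (rule prim_rootD)
  then have m0: "m > 0" using w(2) dvd_pos_nat by blast
  obtain f where f: "f \<in> polys padic_ints" "x = poly f w"
    using stabilizer_fixed[OF z w cop x] by blast
  \<comment> \<open>a multiple of the order of \<open>p\<close> modulo \<open>m\<close>, large enough that \<open>x ^ N\<close> divides \<open>x ^ (p ^ r)\<close>\<close>
  define r where "r = totient m * N"
  have "[?p ^ totient m = 1] (mod m)" using cop by (intro euler_theorem) (simp add: coprime_commute)
  then have "[(?p ^ totient m) ^ N = 1 ^ N] (mod m)" by (rule cong_pow)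
  then have pr: "[?p ^ r = 1] (mod m)" by (simp add: r_def power_mult)
  have "w ^ (?p ^ r) = w"
    using root_power_mod[OF w(1), of "?p ^ r"] root_power_mod[OF w(1), of 1] pr by (simp add: cong_def)
  moreover have "w \<in> adjoin padic_ints z"
    using w by (intro I(3)) (auto simp: power_mult)
  ultimately obtain d where d: "d \<in> adjoin padic_ints z" "x ^ (?p ^ r) = x + of_nat ?p * d"
    using padic.frobenius_iterate[OF I(1,2) _ f(1), of w r] f(2) by auto
  have "N \<le> ?p ^ r"
  proof -
    have "totient m \<ge> 1" using m0 by (simp add: Suc_le_eq)
    then have "N \<le> r" by (simp add: r_def)
    also have "r < ?p ^ r" using padic.q_gt_1[where 'p = 'p] by (intro power_gt_expt) simp
    finally show ?thesis by simp
  qed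
  then have "x ^ (?p ^ r) = x ^ N * x ^ (?p ^ r - N)" by (simp add: power_add[symmetric])
  then have "x = of_nat ?p * (y * x ^ (?p ^ r - N) - d)"
    using d(2) dv(1) by (simp add: algebra_simps)
  moreover have "y * x ^ (?p ^ r - N) - d \<in> adjoin padic_ints z"
    using dv(2) x(1) d(1) by (intro I.diff_in I.mult_in I.power_in)
  ultimately show ?thesis by blast
qed

text \<open>The quotient of \<open>prod_one_minus_roots\<close> for two consecutive powers of \<open>p\<close>.\<close>

lemma prod_prim_roots_prime_power:
  assumes p: "Factorial_Ring.prime p" and k: "k > 0"
  shows "(\<Prod>x | prim_root (p ^ k) x. 1 - x) = (of_nat p :: 'a :: {alg_closed_field, field_char_0})"
proof -
  define A where "A = (\<lambda>j. {x :: 'a. x ^ (p ^ j) = 1} - {1})"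
  have p1: "p > 1" using p prime_gt_1_nat by blast
  have fin: "finite (A j)" for j unfolding A_def using finite_roots_of_unity[of "p ^ j"] p1 by simp
  have prod: "(\<Prod>x\<in>A j. 1 - x) = of_nat (p ^ j)" for j
    unfolding A_def using p1 by (intro prod_one_minus_roots) simp
  obtain j where j: "k = Suc j" using k by (cases k) auto
  have sub: "A j \<subseteq> A k" by (auto simp: A_def j mult.commute[of p] power_mult)
  have "{x :: 'a. prim_root (p ^ k) x} = A k - A j"
  proof (intro equalityI subsetI)
    fix x :: 'a assume "x \<in> {x. prim_root (p ^ k) x}"
    then have x: "prim_root (p ^ k) x" by simp
    have "x ^ (p ^ j) \<noteq> 1" using prim_root_eq_1_iff[OF x, of "p ^ j"] p1 by (simp add: j)
    then show "x \<in> A k - A j" using prim_rootD(2)[OF x] by (auto simp: A_def)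
  next
    fix x :: 'a assume x: "x \<in> A k - A j"
    then have "x ^ (p ^ k) = 1" by (simp add: A_def)
    then obtain d where d: "d dvd p ^ k" "prim_root d x" using prim_root_exists_order[of x "p ^ k"] p1 by auto
    then obtain i where i: "i \<le> k" "d = p ^ i" using p by (auto simp: divides_primepow_nat)
    have "i = k"
    proof (rule ccontr)
      assume "i \<noteq> k"
      then have "d dvd p ^ j" using i j by (simp add: le_imp_power_dvd)
      then have "x ^ (p ^ j) = 1" using prim_root_eq_1_iff[OF d(2)] by blast
      then show False using x by (auto simp: A_def)
    qed
    then show "x \<in> {x. prim_root (p ^ k) x}" using d i by simp
  qed
  moreover have "of_nat (p ^ k) = (\<Prod>x\<in>A k - A j. 1 - x) * (of_nat (p ^ j) :: 'a)"
    using prod.subset_diff[OF sub fin, of "\<lambda>x. 1 - x"] prod by simp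
  ultimately show ?thesis using p1 by (simp add: j)
qed

text \<open>Total ramification. With \<open>c\<close> the product of \<open>1 - y\<close> over the conjugates \<open>y\<close> of \<open>v\<close> over the
  field generated by \<open>w\<close>, the number \<open>d\<close> of conjugates satisfies \<open>c^M ~ p^d\<close> up to units, where
  \<open>M\<close> is the number of all primitive roots. Since \<open>c\<close> is divisible by \<open>p\<close>, \<open>d\<close> is at least \<open>M\<close>.\<close>

lemma ramified_transitive:
  fixes w v v' z :: "'p :: prime_card padic_closure"
  assumes w: "prim_root m w" and cop: "coprime m CARD('p)"
    and v: "prim_root (CARD('p) ^ k) v" "prim_root (CARD('p) ^ k) v'"
    and z: "prim_root (m * CARD('p) ^ k) z"
  obtains g where "g \<in> padic_auts" "g w = w" "g v = v'"
proof (cases "k = 0")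
  case True
  then have "v = 1" "v' = 1" using v by (auto simp: prim_root_def)
  then show ?thesis using that[OF padic_aut_id] by simp
next
  case False
  let ?p = "of_nat CARD('p) :: 'p padic_closure"
  define I where "I = adjoin padic_ints z"
  note I' = adjoin_padic[OF z, folded I_def]
  interpret I: subring_on I by (rule I')
  define n where "n = m * CARD('p) ^ k"
  define T where "T = {x :: 'p padic_closure. prim_root (CARD('p) ^ k) x}"
  define M where "M = card T"
  have p0: "?p \<noteq> 0" by (rule padic.q_nz)
  have pk: "CARD('p) ^ k > 0" by simp
  have finT: "finite T" unfolding T_def by (rule finite_prim_roots) simp
  have root: "x ^ n = 1" if "x \<in> T" for x
  proof -
    have "x ^ (CARD('p) ^ k) = 1" using that prim_rootD(2) by (auto simp: T_def)
    then show ?thesis unfolding n_def mult.commute[of m] by (simp only: power_mult power_one)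
  qed
  have TI: "x \<in> I" if "x \<in> T" for x using I'(3) root[OF that] by (simp add: n_def)
  have ne1: "x \<noteq> 1" if "x \<in> T" for x
  proof
    assume "x = 1"
    then have "CARD('p) ^ k = 1" using that prim_root_eq_1_iff[of "CARD('p) ^ k" x 1] by (simp add: T_def)
    then show False using False padic.q_gt_1[where 'p = 'p] by simp
  qed
  define H where "H = {g \<in> padic_auts. g w = w}"
  define S where "S = (\<lambda>g. g v) ` H"
  have ST: "S \<subseteq> T"
    using padic_conj_prim_root v(1) by (auto simp: S_def H_def T_def padic_conj_def)
  then have finS: "finite S" using finT finite_subset by blast
  have vS: "v \<in> S" unfolding S_def H_def by (rule image_eqI[of _ _ "\<lambda>x. x"]) (simp_all add: padic_aut_id)
  \<comment> \<open>the quotients \<open>(1 - x) / (1 - y)\<close> are units\<close>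
  have quot: "(1 - x) / (1 - y) \<in> I" if xy: "x \<in> T" "y \<in> T" for x y
  proof -
    obtain i where "x = y ^ i" using prim_root_coprime[of "CARD('p) ^ k" y x] xy by (auto simp: T_def)
    then have "1 - x = (1 - y) * (\<Sum>j<i. y ^ j)" by (simp add: one_diff_power_eq)
    then have "(1 - x) / (1 - y) = (\<Sum>j<i. y ^ j)" using ne1[OF xy(2)] by simp
    then show ?thesis using TI[OF xy(2)] by auto
  qed
  define e where "e = (\<lambda>y. \<Prod>x\<in>T. (1 - x) / (1 - y))"
  have e: "(1 - y) ^ M * e y = ?p" "e y \<in> I" "inverse (e y) \<in> I" "e y \<noteq> 0" if y: "y \<in> T" for y
  proof -
    have "(1 - y) ^ M * e y = (\<Prod>x\<in>T. (1 - y) * ((1 - x) / (1 - y)))"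
      unfolding e_def prod.distrib M_def by simp
    also have "\<dots> = (\<Prod>x\<in>T. 1 - x)" using ne1[OF y] by (intro prod.cong) auto
    also have "\<dots> = ?p" unfolding T_def using False by (intro prod_prim_roots_prime_power prime_CARD) simp
    finally show "(1 - y) ^ M * e y = ?p" .
    show "e y \<in> I" unfolding e_def using quot y by auto
    have "inverse (e y) = (\<Prod>x\<in>T. (1 - y) / (1 - x))"
      unfolding e_def by (simp add: prod_inversef[symmetric])
    then show "inverse (e y) \<in> I" using quot y by auto
    show "e y \<noteq> 0" unfolding e_def using ne1 y finT by auto
  qed
  define c where "c = (\<Prod>y\<in>S. 1 - y)"
  define E where "E = (\<Prod>y\<in>S. e y)"
  have cI: "c \<in> I" unfolding c_def using TI ST by (intro I.prod_in I.diff_in) auto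
  have cE: "c ^ M * E = ?p ^ card S"
  proof -
    have "c ^ M * E = (\<Prod>y\<in>S. (1 - y) ^ M * e y)"
      unfolding c_def E_def prod.distrib by (simp add: prod_power_distrib)
    also have "\<dots> = (\<Prod>y\<in>S. ?p)" using e(1) ST by (intro prod.cong) auto
    finally show ?thesis by simp
  qed
  have E: "E \<in> I" "inverse E \<in> I" "E \<noteq> 0"
  proof -
    show "E \<in> I" unfolding E_def using e(2) ST by auto
    have "inverse E = (\<Prod>y\<in>S. inverse (e y))" unfolding E_def by (simp add: prod_inversef[symmetric])
    then show "inverse E \<in> I" using e(3) ST by auto
    show "E \<noteq> 0" unfolding E_def using e(4) ST finS by auto
  qed
  have fixed: "\<forall>g\<in>padic_auts. g w = w \<longrightarrow> g c = c"
  proof (intro ballI impI)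
    fix g :: "'p padic_closure \<Rightarrow> 'p padic_closure" assume g: "g \<in> padic_auts" "g w = w"
    have "g ` S \<subseteq> S"
    proof
      fix x assume "x \<in> g ` S"
      then obtain h where h: "h \<in> padic_auts" "h w = w" "x = g (h v)" by (auto simp: S_def H_def)
      then have "(\<lambda>x. g (h x)) \<in> H" using padic_aut_comp[OF g(1)] g(2) by (simp add: H_def)
      then show "x \<in> S" unfolding S_def by (rule image_eqI[rotated]) (simp add: h)
    qed
    moreover have "inj_on g S" using padic_aut_simps(12)[OF g(1)] by (auto simp: inj_on_def)
    ultimately have b: "bij_betw g S S" using finS by (simp add: bij_betw_def endo_inj_surj)
    have "g c = (\<Prod>y\<in>S. 1 - g y)" unfolding c_def by (simp add: padic_aut_simps[OF g(1)])
    also have "\<dots> = c" unfolding c_def using b by (rule prod.reindex_bij_betw)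
    finally show "g c = c" .
  qed
  have "card S > 0" using vS finS by (auto simp: card_gt_0_iff)
  then obtain d where d: "card S = Suc d" by (cases "card S") auto
  have "c ^ M = ?p * (?p ^ d * inverse E)"
    using cE E(3) unfolding d by (simp add: field_simps)
  moreover have "?p ^ d * inverse E \<in> I" using E(2) by auto
  ultimately obtain y where y: "y \<in> I" "c = ?p * y"
    using unramified[OF z prim_rootD(2)[OF w] _ cop, folded I_def, OF _ cI fixed, of M] by auto
  have "M \<le> card S"
  proof (rule ccontr)
    assume "\<not> M \<le> card S"
    then obtain j where j: "M = card S + Suc j" by (metis less_iff_Suc_add not_le add_Suc_right)
    have "?p ^ card S = ?p ^ card S * (?p * (?p ^ j * y ^ M * E))"
      using cE unfolding y(2) power_mult_distrib by (simp add: j power_add mult_ac)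
    then have "?p * (?p ^ j * y ^ M * E) = 1" using p0 by simp
    then have "inverse ?p = ?p ^ j * y ^ M * E" by (rule inverse_unique)
    moreover have "?p ^ j * y ^ M * E \<in> I" using y E by auto
    ultimately show False using I'(6) by simp
  qed
  then have "S = T" using ST finT card_seteq by (metis M_def)
  then have "v' \<in> S" using v by (simp add: T_def)
  then show ?thesis using that by (auto simp: S_def H_def)
qed

text \<open>Conjugate the prime-to-\<open>p\<close> part of \<open>z\<close> to that of \<open>z'\<close>; total ramification then permits the parts of
  \<open>p\<close>-power order to be adjusted while the prime-to-\<open>p\<close> part stays fixed.\<close>

theorem padic_conj_iff_prime_to_p_part:
  fixes z z' :: "'p :: prime_card padic_closure"
  assumes z: "prim_root (m * CARD('p) ^ k) z" "prim_root (m * CARD('p) ^ k) z'" and cop: "coprime m CARD('p)"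
  shows "padic_conj z z' \<longleftrightarrow> padic_conj (z ^ (CARD('p) ^ k)) (z' ^ (CARD('p) ^ k))"
proof
  assume "padic_conj z z'"
  then obtain g where "g \<in> padic_auts" "g z = z'" by (auto simp: padic_conj_def)
  then show "padic_conj (z ^ (CARD('p) ^ k)) (z' ^ (CARD('p) ^ k))"
    unfolding padic_conj_def by (intro bexI[of _ g]) (simp_all add: padic_aut_simps)
next
  assume "padic_conj (z ^ (CARD('p) ^ k)) (z' ^ (CARD('p) ^ k))"
  then obtain g where g: "g \<in> padic_auts" "g (z ^ (CARD('p) ^ k)) = z' ^ (CARD('p) ^ k)"
    by (auto simp: padic_conj_def)
  let ?q = "CARD('p) ^ k"
  define y where "y = g z"
  have y: "prim_root (m * ?q) y" using padic_conj_prim_root z(1) g by (auto simp: y_def padic_conj_def)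
  have yq: "y ^ ?q = z' ^ ?q" using g by (simp add: y_def padic_aut_simps)
  have y': "prim_root (?q * m) y" "prim_root (?q * m) z'" using y z by (simp_all add: mult.commute)
  obtain h where h: "h \<in> padic_auts" "h (z' ^ ?q) = z' ^ ?q" "h (y ^ m) = z' ^ m"
    using ramified_transitive[OF prim_root_power_divisor[OF z(2)] cop prim_root_power_divisor[OF y'(1)]
      prim_root_power_divisor[OF y'(2)] z(2)] by blast
  have n0: "m * ?q > 0" using prim_rootD(1)[OF y] .
  have "coprime m ?q" using cop by simp
  then obtain a b where ab: "[m * a = 1] (mod ?q)" "[?q * b = 1] (mod m)"
    using coprime_iff_invertible_nat[of m ?q] coprime_iff_invertible_nat[of ?q m]
    by (auto simp: coprime_commute)
  \<comment> \<open>exponents by which a root of unity is recovered from its powers with exponents \<open>m\<close> and \<open>p^k\<close>\<close>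
  have "\<exists>a b. [m * a + ?q * b = 1] (mod (m * ?q))"
  proof (intro exI)
    have "[m * a + ?q * b = 1] (mod ?q)" using cong_add[OF ab(1), of "?q * b" 0] by (simp add: cong_def)
    moreover have "[m * a + ?q * b = 1] (mod m)" using cong_add[of "m * a" 0 m, OF _ ab(2)] by (simp add: cong_def)
    ultimately show "[m * a + ?q * b = 1] (mod (m * ?q))"
      using \<open>coprime m ?q\<close> by (simp add: coprime_cong_mult_nat)
  qed
  then obtain a b where ab: "[m * a + ?q * b = 1] (mod (m * ?q))" by blast
  have dec: "x = (x ^ m) ^ a * (x ^ ?q) ^ b" if "x ^ (m * ?q) = 1" for x :: "'p padic_closure"
    using root_power_mod[OF that, of "m * a + ?q * b"] root_power_mod[OF that, of 1] ab
    by (simp add: cong_def power_add power_mult)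
  have "h y = (h (y ^ m)) ^ a * (h (y ^ ?q)) ^ b"
    using dec[OF prim_rootD(2)[OF y]] padic_aut_simps(4,7)[OF h(1)] by metis
  also have "\<dots> = (z' ^ m) ^ a * (z' ^ ?q) ^ b" using h yq by simp
  also have "\<dots> = z'" using dec[OF prim_rootD(2)[OF z(2)]] by simp
  finally have "h (g z) = z'" by (simp add: y_def)
  then show "padic_conj z z'"
    unfolding padic_conj_def by (intro bexI[OF _ padic_aut_comp[OF h(1) g(1)]])
qed

lemma nat_prime_power_split:
  fixes n p :: nat
  assumes "n > 0" "Factorial_Ring.prime p"
  obtains m k where "n = m * p ^ k" "coprime m p"
proof -
  have "n \<noteq> 0" "\<not> is_unit p" using assms not_prime_unit by auto
  then obtain m where m: "n = p ^ multiplicity p n * m" "\<not> p dvd m"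
    using multiplicity_decompose' by metis
  then have "coprime m p" using assms(2) prime_imp_coprime coprime_commute by blast
  then show ?thesis using that m(1) by (simp add: mult.commute)
qed

text \<open>By orthogonality of characters of the cyclic group of order \<open>m\<close> the polynomial takes at \<open>z'\<close> the
  value 1 or 0, according to whether the prime-to-\<open>p\<close> part of \<open>z'\<close> is conjugate to that of \<open>z\<close>.
  This decides whether \<open>z'\<close> itself is conjugate to \<open>z\<close>.\<close>

theorem idempotent_polynomial:
  fixes z :: "'p :: prime_card padic_closure"
  assumes z: "prim_root n z"
  obtains f where "f \<in> polys padic_ints"
    "\<And>z'. prim_root n z' \<Longrightarrow> poly f z' = (if padic_conj z z' then 1 else 0)"
proof -
  have n: "n > 0" using z by (rule prim_rootD)
  obtain m k where mk: "n = m * CARD('p) ^ k" "coprime m CARD('p)"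
    using nat_prime_power_split[OF n prime_CARD] .
  let ?q = "CARD('p) ^ k"
  define w where "w = z ^ ?q"
  have m0: "m > 0" using n mk by simp
  have z': "prim_root (m * ?q) z" using z mk by simp
  have w: "w ^ m = 1" using prim_rootD(2)[OF prim_root_power_divisor[OF z']] by (simp add: w_def)
  define W where "W = orbit w"
  have finW: "finite W" unfolding W_def using finite_orbit(1)[OF w m0] .
  have Wm: "y ^ m = 1" if "y \<in> W" for y using finite_orbit(2)[OF w] that by (simp add: W_def)
  note I = adjoin_padic[OF z]
  interpret I: subring_on "adjoin padic_ints z" by (rule I)
  define T where "T = (\<lambda>j. \<Sum>y\<in>W. inverse y ^ j)"
  have T: "T j \<in> padic_ints" for j
  proof (rule I(5))
    have "inverse y ^ n = 1" if "y \<in> W" for y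
      using Wm[OF that] unfolding mk(1) power_mult by (simp add: power_inverse)
    then show "T j \<in> adjoin padic_ints z"
      unfolding T_def by (intro I.sum_in I.power_in I(3)) auto
    show "T j \<in> padic_field"
    proof (rule padic_fixed)
      fix g :: "'p padic_closure \<Rightarrow> 'p padic_closure" assume g: "g \<in> padic_auts"
      have "g (T j) = (\<Sum>y\<in>W. inverse (g y) ^ j)"
        unfolding T_def by (simp add: padic_aut_simps[OF g])
      also have "\<dots> = T j"
        unfolding T_def using orbit_image[OF g, of w] unfolding W_def by (rule sum.reindex_bij_betw)
      finally show "g (T j) = T j" .
    qed
  qed
  define f where "f = (\<Sum>j<m. monom (inverse (of_nat m) * T j) (?q * j))"
  show ?thesis
  proof (rule that)
    show "f \<in> polys padic_ints"
      unfolding f_def using padic.inverse_of_nat_in[OF mk(2)] T by (intro padic.polys_sum padic.polys_monom) auto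
    fix x :: "'p padic_closure" assume x: "prim_root n x"
    define u where "u = x ^ ?q"
    have u: "u ^ m = 1" using prim_rootD(2)[OF x] by (simp add: u_def mk(1) power_mult[symmetric] mult.commute)
    have "poly f x = (\<Sum>j<m. inverse (of_nat m) * T j * u ^ j)"
      unfolding f_def by (simp add: poly_sum poly_monom power_mult u_def)
    also have "\<dots> = inverse (of_nat m) * (\<Sum>j<m. \<Sum>y\<in>W. (u / y) ^ j)"
      unfolding T_def sum_distrib_left sum_distrib_right
      by (intro sum.cong refl) (simp add: divide_inverse power_mult_distrib power_inverse mult_ac)
    also have "(\<Sum>j<m. \<Sum>y\<in>W. (u / y) ^ j) = (\<Sum>y\<in>W. \<Sum>j<m. (u / y) ^ j)"
      by (rule sum.swap)
    also have "\<dots> = (\<Sum>y\<in>W. if y = u then of_nat m else 0)"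
    proof (intro sum.cong refl)
      fix y assume y: "y \<in> W"
      have y0: "y \<noteq> 0" using root_of_unity_nz[OF Wm[OF y] m0] .
      have "(u / y) ^ m = 1" using Wm[OF y] u by (simp add: power_divide)
      then show "(\<Sum>j<m. (u / y) ^ j) = (if y = u then of_nat m else 0)"
        using y0 by (auto simp: sum_powers_root)
    qed
    also have "\<dots> = (if u \<in> W then of_nat m else 0)" using finW by simp
    also have "inverse (of_nat m) * \<dots> = (if u \<in> W then 1 else 0)" using m0 by simp
    also have "u \<in> W \<longleftrightarrow> padic_conj z x"
      using padic_conj_iff_prime_to_p_part[OF z' _ mk(2)] x mk(1) by (simp add: u_def W_def orbit_def w_def)
    finally show "poly f x = (if padic_conj z x then 1 else 0)" .
  qed
qed

text \<open>The coefficients are fixed by all automorphisms and lie in \<open>Z_p[z]\<close>.\<close>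

lemma orbit_poly_integral:
  fixes z :: "'p :: prime_card padic_closure"
  assumes z: "prim_root n z"
  shows "(\<Prod>y\<in>orbit z. [:- y, 1:]) \<in> polys padic_ints"
proof -
  note I = adjoin_padic[OF z]
  interpret I: subring_on "adjoin padic_ints z" by (rule I)
  have fin: "finite (orbit z)" and root: "\<And>y. y \<in> orbit z \<Longrightarrow> y ^ n = 1"
    using finite_orbit[OF prim_rootD(2)[OF z]] prim_rootD(1)[OF z] by auto
  let ?P = "\<Prod>y\<in>orbit z. [:- y, 1:]"
  have "?P \<in> polys (adjoin padic_ints z)"
    using root I(3) by (intro I.polys_prod) auto
  moreover have "coeff ?P i \<in> padic_field" for i
  proof (rule padic_fixed)
    fix g :: "'p padic_closure \<Rightarrow> 'p padic_closure" assume g: "g \<in> padic_auts"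
    have "map_poly g ?P = ?P"
      using g orbit_image[OF g, of z] fin
      by (intro orbit_poly_fixed[OF subfield_on_UNIV]) (auto simp: padic_auts_def bij_betw_def)
    then show "g (coeff ?P i) = coeff ?P i"
      using coeff_map_poly[of g ?P i, OF padic_aut_simps(1)[OF g]] by simp
  qed
  ultimately show ?thesis using I(5) unfolding polys_def by blast
qed

section \<open>Characters\<close>

abbreviation char_kernel :: "'p :: prime_card gal_char \<Rightarrow> (complex \<Rightarrow> complex) set"
  where "char_kernel \<psi> \<equiv> kernel Gab (mult_of \<Omega>) \<psi>"

lemma char_kernel_iff: "\<sigma> \<in> char_kernel \<psi> \<longleftrightarrow> \<sigma> \<in> carrier Gab \<and> \<psi> \<sigma> = 1"
  by (simp add: kernel_def)

lemma linear_charsD: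
  assumes "\<psi> \<in> linear_chars"
  shows "\<sigma> \<in> carrier Gab \<Longrightarrow> \<tau> \<in> carrier Gab \<Longrightarrow> \<psi> (\<sigma> \<otimes>\<^bsub>Gab\<^esub> \<tau>) = \<psi> \<sigma> * \<psi> \<tau>"
    and "\<sigma> \<in> carrier Gab \<Longrightarrow> \<psi> \<sigma> \<noteq> 0"
    and "\<psi> \<in> extensional (carrier Gab)"
    and "\<exists>n>0. \<forall>\<sigma>\<in>carrier Gab. \<psi> \<sigma> ^ n = 1"
    and "\<exists>K\<in>abelian_number_fields. carrier (galois_group Qab K) \<subseteq> char_kernel \<psi>"
  using assms by (auto simp: linear_chars_def hom_def)

lemma linear_char_one:
  assumes "\<psi> \<in> linear_chars" shows "\<psi> \<one>\<^bsub>Gab\<^esub> = 1"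
proof -
  interpret G: comm_group Gab by (rule comm_group_Gab)
  have "\<psi> \<one>\<^bsub>Gab\<^esub> * \<psi> \<one>\<^bsub>Gab\<^esub> = \<psi> \<one>\<^bsub>Gab\<^esub>"
    using linear_charsD(1)[OF assms, of "\<one>\<^bsub>Gab\<^esub>" "\<one>\<^bsub>Gab\<^esub>"] by simp
  moreover have "\<psi> \<one>\<^bsub>Gab\<^esub> \<noteq> 0" using linear_charsD(2)[OF assms] by simp
  ultimately show ?thesis by simp
qed

lemma linear_char_inv:
  assumes "\<psi> \<in> linear_chars" "\<sigma> \<in> carrier Gab" shows "\<psi> (inv\<^bsub>Gab\<^esub> \<sigma>) = inverse (\<psi> \<sigma>)"
proof -
  interpret G: comm_group Gab by (rule comm_group_Gab)
  have "\<psi> \<sigma> * \<psi> (inv\<^bsub>Gab\<^esub> \<sigma>) = 1"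
    using linear_charsD(1)[OF assms(1), of \<sigma> "inv\<^bsub>Gab\<^esub> \<sigma>"] linear_char_one[OF assms(1)] assms(2) by simp
  then show ?thesis by (simp add: inverse_unique)
qed

lemma subgroup_char_kernel: "\<psi> \<in> linear_chars \<Longrightarrow> subgroup (char_kernel \<psi>) Gab"
proof -
  assume psi: "\<psi> \<in> linear_chars"
  interpret G: comm_group Gab by (rule comm_group_Gab)
  show ?thesis
    by (rule subgroup.intro)
       (auto simp: char_kernel_iff linear_charsD(1)[OF psi] linear_char_one[OF psi] linear_char_inv[OF psi])
qed

lemma linear_char_ext:
  "\<psi> \<in> linear_chars \<Longrightarrow> \<psi>' \<in> linear_chars \<Longrightarrow> (\<And>\<sigma>. \<sigma> \<in> carrier Gab \<Longrightarrow> \<psi> \<sigma> = \<psi>' \<sigma>) \<Longrightarrow> \<psi> = \<psi>'"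
  by (rule extensionalityI[of _ "carrier Gab"]) (auto intro: linear_charsD(3))

text \<open>Conjugates and powers of characters arise in this way.\<close>

lemma linear_char_image:
  assumes psi: "\<psi> \<in> linear_chars"
    and t: "\<And>\<sigma> \<tau>. \<sigma> \<in> carrier Gab \<Longrightarrow> \<tau> \<in> carrier Gab \<Longrightarrow> t (\<psi> \<sigma> * \<psi> \<tau>) = t (\<psi> \<sigma>) * t (\<psi> \<tau>)"
      "t 1 = 1"
  shows "(\<lambda>\<sigma>\<in>carrier Gab. t (\<psi> \<sigma>)) \<in> linear_chars"
proof -
  interpret G: comm_group Gab by (rule comm_group_Gab)
  obtain n where n: "n > 0" "\<And>\<sigma>. \<sigma> \<in> carrier Gab \<Longrightarrow> \<psi> \<sigma> ^ n = 1" using linear_charsD(4)[OF psi] by blast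
  obtain K where K: "K \<in> abelian_number_fields" "carrier (galois_group Qab K) \<subseteq> char_kernel \<psi>"
    using linear_charsD(5)[OF psi] by blast
  have pow: "t (\<psi> \<sigma> ^ k) = t (\<psi> \<sigma>) ^ k \<and> (\<exists>\<tau>\<in>carrier Gab. \<psi> \<tau> = \<psi> \<sigma> ^ k)" if s: "\<sigma> \<in> carrier Gab" for \<sigma> k
  proof (induction k)
    case 0
    then show ?case using t(2) linear_char_one[OF psi] by (auto intro!: bexI[of _ "\<one>\<^bsub>Gab\<^esub>"])
  next
    case (Suc k)
    then obtain \<tau> where \<tau>: "\<tau> \<in> carrier Gab" "\<psi> \<tau> = \<psi> \<sigma> ^ k" by blast
    then have "\<psi> (\<sigma> \<otimes>\<^bsub>Gab\<^esub> \<tau>) = \<psi> \<sigma> ^ Suc k" using linear_charsD(1)[OF psi s] by simp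
    moreover have "t (\<psi> \<sigma> ^ Suc k) = t (\<psi> \<sigma>) ^ Suc k"
      using t(1)[OF s \<tau>(1)] \<tau>(2) Suc by simp
    ultimately show ?case using s \<tau> by (metis G.m_closed)
  qed
  have tn: "t (\<psi> \<sigma>) ^ n = 1" if "\<sigma> \<in> carrier Gab" for \<sigma>
    using pow[OF that, of n] n(2)[OF that] t(2) by simp
  then have "t (\<psi> \<sigma>) \<noteq> 0" if "\<sigma> \<in> carrier Gab" for \<sigma>
    using that n(1) by (metis power_0_left less_numeral_extra(3) zero_neq_one)
  then show ?thesis
    unfolding linear_chars_def
    using t tn n(1) K linear_charsD(1)[OF psi]
    by (auto simp: hom_def char_kernel_iff subset_iff intro!: exI[of _ n] bexI[of _ K])
qed

text \<open>Such characters factor through the finite group \<open>Gal(K/Q)\<close> and take values in a finite set.\<close>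

lemma finite_level_chars:
  assumes K: "K \<in> abelian_number_fields" and n: "n > 0"
  shows "finite {\<psi> :: 'p :: prime_card gal_char. \<psi> \<in> linear_chars \<and> carrier (galois_group Qab K) \<subseteq> char_kernel \<psi> \<and>
    (\<forall>\<sigma>\<in>carrier Gab. \<psi> \<sigma> ^ n = 1)}" (is "finite ?A")
proof -
  note K' = abelian_number_fieldsD[OF K]
  interpret G: comm_group Gab by (rule comm_group_Gab)
  define r where "r = (\<lambda>\<psi> :: 'p gal_char. \<lambda>\<sigma>\<in>carrier (galois_group K \<rat>). \<psi> (prolong K \<sigma>))"
  have fin: "finite (PiE (carrier (galois_group K \<rat>)) (\<lambda>_. {x :: 'p padic_closure. x ^ n = 1}))"
    by (rule finite_PiE[OF finite_level[OF K]]) (rule finite_roots_of_unity[OF n])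
  have sub: "r ` ?A \<subseteq> PiE (carrier (galois_group K \<rat>)) (\<lambda>_. {x. x ^ n = 1})"
    using Gab_prolong(1)[OF K'(1,2)] by (auto simp: r_def)
  have inj: "inj_on r ?A"
  proof (rule inj_onI)
    fix \<psi> \<psi>' assume A: "\<psi> \<in> ?A" "\<psi>' \<in> ?A" and eq: "r \<psi> = r \<psi>'"
    have lev: "\<theta> \<tau> = \<theta> (prolong K (restrict \<tau> K))" if th: "\<theta> \<in> ?A" and t: "\<tau> \<in> carrier Gab" for \<theta> \<tau>
    proof -
      note p = Gab_prolong[OF K'(1,2) Gab_restrict[OF K'(1,2) t]]
      have "prolong K (restrict \<tau> K) x = \<tau> x" if "x \<in> K" for x
        using fun_cong[OF p(2), of x] that by simp
      then have "inv\<^bsub>Gab\<^esub> (prolong K (restrict \<tau> K)) \<otimes>\<^bsub>Gab\<^esub> \<tau> \<in> carrier (galois_group Qab K)"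
        by (rule restrict_eq_imp[OF K'(1,2) p(1) t])
      then have "\<theta> (inv\<^bsub>Gab\<^esub> (prolong K (restrict \<tau> K)) \<otimes>\<^bsub>Gab\<^esub> \<tau>) = 1"
        using th by (auto simp: char_kernel_iff)
      moreover have "\<theta> \<in> linear_chars" using th by simp
      ultimately have "inverse (\<theta> (prolong K (restrict \<tau> K))) * \<theta> \<tau> = 1"
        using linear_charsD(1)[of \<theta>] linear_char_inv[of \<theta>] p(1) t by simp
      then show ?thesis
        using linear_charsD(2)[OF \<open>\<theta> \<in> linear_chars\<close> p(1)] by (simp add: field_simps)
    qed
    show "\<psi> = \<psi>'"
    proof (rule linear_char_ext)
      fix \<tau> assume t: "\<tau> \<in> carrier Gab"
      have "\<psi> (prolong K (restrict \<tau> K)) = \<psi>' (prolong K (restrict \<tau> K))"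
        using fun_cong[OF eq, of "restrict \<tau> K"] Gab_restrict[OF K'(1,2) t] by (simp add: r_def)
      then show "\<psi> \<tau> = \<psi>' \<tau>" using lev[OF A(1) t] lev[OF A(2) t] by simp
    qed (use A in auto)
  qed
  show ?thesis
    using finite_imageD[OF finite_subset[OF sub fin] inj] .
qed

text \<open>Dedekind's independence of characters: if \<open>\<tau>\<close> separates \<open>\<phi>\<close> from \<open>\<psi>\<close>, subtracting \<open>\<phi> \<tau>\<close> times the
  relation from its translate by \<open>\<tau>\<close> gives a relation without \<open>\<phi>\<close>.\<close>

lemma chars_independent:
  fixes c :: "'p :: prime_card gal_char \<Rightarrow> 'p padic_closure"
  assumes "finite A" "A \<subseteq> linear_chars" "\<And>\<sigma>. \<sigma> \<in> carrier Gab \<Longrightarrow> (\<Sum>\<psi>\<in>A. c \<psi> * \<psi> \<sigma>) = 0" "\<psi> \<in> A"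
  shows "c \<psi> = 0"
  using assms
proof (induction A arbitrary: c \<psi> rule: finite_induct)
  case (insert \<phi> A)
  interpret G: comm_group Gab by (rule comm_group_Gab)
  have phi: "\<phi> \<in> linear_chars" using insert.prems by simp
  have A0: "c \<psi> = 0" if psi: "\<psi> \<in> A" for \<psi>
  proof -
    have pl: "\<psi> \<in> linear_chars" using psi insert.prems by auto
    have "\<psi> \<noteq> \<phi>" using psi insert.hyps by blast
    then obtain \<tau> where \<tau>: "\<tau> \<in> carrier Gab" "\<psi> \<tau> \<noteq> \<phi> \<tau>" using linear_char_ext[OF pl phi] by blast
    define d where "d = (\<lambda>\<theta> :: 'p gal_char. c \<theta> * (\<theta> \<tau> - \<phi> \<tau>))"
    have "d \<psi> = 0"
    proof (rule insert.IH[of d])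
      show "A \<subseteq> linear_chars" using insert.prems by simp
      fix \<sigma> assume s: "\<sigma> \<in> carrier Gab"
      have "(\<Sum>\<theta>\<in>insert \<phi> A. c \<theta> * \<theta> (\<tau> \<otimes>\<^bsub>Gab\<^esub> \<sigma>)) - \<phi> \<tau> * (\<Sum>\<theta>\<in>insert \<phi> A. c \<theta> * \<theta> \<sigma>) = 0"
        using insert.prems(2) s \<tau> by simp
      also have "(\<Sum>\<theta>\<in>insert \<phi> A. c \<theta> * \<theta> (\<tau> \<otimes>\<^bsub>Gab\<^esub> \<sigma>)) = (\<Sum>\<theta>\<in>insert \<phi> A. c \<theta> * (\<theta> \<tau> * \<theta> \<sigma>))"
      proof (intro sum.cong refl)
        fix \<theta> assume "\<theta> \<in> insert \<phi> A"
        then have "\<theta> \<in> linear_chars" using insert.prems(1) by blast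
        then show "c \<theta> * \<theta> (\<tau> \<otimes>\<^bsub>Gab\<^esub> \<sigma>) = c \<theta> * (\<theta> \<tau> * \<theta> \<sigma>)"
          by (simp only: linear_charsD(1)[OF _ \<tau>(1) s])
      qed
      also have "\<dots> - \<phi> \<tau> * (\<Sum>\<theta>\<in>insert \<phi> A. c \<theta> * \<theta> \<sigma>) = (\<Sum>\<theta>\<in>insert \<phi> A. d \<theta> * \<theta> \<sigma>)"
        unfolding sum_distrib_left sum_subtractf[symmetric] d_def
        by (intro sum.cong refl) (simp add: algebra_simps)
      finally show "(\<Sum>\<theta>\<in>A. d \<theta> * \<theta> \<sigma>) = 0"
        using insert.hyps by (simp add: d_def)
    qed (rule psi)
    then show ?thesis using \<tau> by (simp add: d_def)
  qed
  moreover have "c \<phi> = 0"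
    using insert.prems(2)[of "\<one>\<^bsub>Gab\<^esub>"] insert.hyps A0 linear_char_one[OF phi] by simp
  ultimately show ?case using insert.prems(3) by auto
qed simp

lemma sum_chars_inj:
  fixes A B :: "'p :: prime_card gal_char set"
  assumes "finite A" "finite B" "A \<subseteq> linear_chars" "B \<subseteq> linear_chars"
    and eq: "\<And>\<sigma>. \<sigma> \<in> carrier Gab \<Longrightarrow> (\<Sum>\<psi>\<in>A. \<psi> \<sigma>) = (\<Sum>\<psi>\<in>B. \<psi> \<sigma>)"
  shows "A = B"
proof -
  define c where "c = (\<lambda>\<psi>. (if \<psi> \<in> A then 1 else 0) - (if \<psi> \<in> B then 1 else 0 :: 'p padic_closure))"
  have "c \<psi> = 0" if "\<psi> \<in> A \<union> B" for \<psi>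
  proof (rule chars_independent[OF _ _ _ that])
    fix \<sigma> assume s: "\<sigma> \<in> carrier Gab"
    have "(\<Sum>\<psi>\<in>A \<union> B. c \<psi> * \<psi> \<sigma>) = (\<Sum>\<psi>\<in>A \<union> B. if \<psi> \<in> A then \<psi> \<sigma> else 0) - (\<Sum>\<psi>\<in>A \<union> B. if \<psi> \<in> B then \<psi> \<sigma> else 0)"
      unfolding sum_subtractf[symmetric] c_def by (intro sum.cong refl) (auto simp: algebra_simps)
    also have "\<dots> = (\<Sum>\<psi>\<in>A. \<psi> \<sigma>) - (\<Sum>\<psi>\<in>B. \<psi> \<sigma>)"
    proof -
      have "(A \<union> B) \<inter> A = A" "(A \<union> B) \<inter> B = B" by auto
      then show ?thesis
        using assms(1,2) by (simp add: sum.inter_restrict[symmetric])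
    qed
    finally show "(\<Sum>\<psi>\<in>A \<union> B. c \<psi> * \<psi> \<sigma>) = 0" using eq[OF s] by simp
  qed (use assms in auto)
  then show ?thesis by (fastforce simp: c_def split: if_splits)
qed

text \<open>The description of conjugates by homomorphisms of subsets, together with the minimality of the
  field generated by the values.\<close>

lemma conjugates_value_field:
  fixes k :: "'p :: prime_card padic_closure set" and \<psi> :: "'p gal_char"
  assumes "subfield_on k"
  defines "F \<equiv> generate_field \<Omega> (k \<union> \<psi> ` carrier Gab)"
  shows "subfield_on F" "k \<subseteq> F" "\<sigma> \<in> carrier Gab \<Longrightarrow> \<psi> \<sigma> \<in> F"
    "\<psi>' \<in> conjugates k \<psi> \<longleftrightarrow> \<psi>' \<in> linear_chars \<and>
      (\<exists>\<tau>. ring_hom_on F \<tau> \<and> (\<forall>a\<in>k. \<tau> a = a) \<and> (\<forall>\<sigma>\<in>carrier Gab. \<psi>' \<sigma> = \<tau> (\<psi> \<sigma>)))"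
    "\<And>E. subfield_on E \<Longrightarrow> k \<subseteq> E \<Longrightarrow> \<psi> ` carrier Gab \<subseteq> E \<Longrightarrow> F \<subseteq> E"
proof -
  interpret field "\<Omega> :: 'p padic_closure ring" ..
  have "subfield F \<Omega>" unfolding F_def by (rule generate_field_is_subfield) simp
  then show "subfield_on F" by (simp add: subfield_iff_subfield_on)
  show "k \<subseteq> F" unfolding F_def by (auto intro: generate_field.incl)
  show "\<sigma> \<in> carrier Gab \<Longrightarrow> \<psi> \<sigma> \<in> F" unfolding F_def by (auto intro: generate_field.incl)
  have "f \<in> Ring.ring_hom (\<Omega>\<lparr>carrier := F\<rparr>) \<Omega> \<longleftrightarrow> ring_hom_on F f" for f :: "'p padic_closure \<Rightarrow> 'p padic_closure"
    using ring_hom_iff_ring_hom_on[of f F UNIV] by (simp add: ring_of_type_algebra_def)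
  then show "\<psi>' \<in> conjugates k \<psi> \<longleftrightarrow> \<psi>' \<in> linear_chars \<and>
      (\<exists>\<tau>. ring_hom_on F \<tau> \<and> (\<forall>a\<in>k. \<tau> a = a) \<and> (\<forall>\<sigma>\<in>carrier Gab. \<psi>' \<sigma> = \<tau> (\<psi> \<sigma>)))"
    unfolding conjugates_def F_def[symmetric] by auto
  show "\<And>E. subfield_on E \<Longrightarrow> k \<subseteq> E \<Longrightarrow> \<psi> ` carrier Gab \<subseteq> E \<Longrightarrow> F \<subseteq> E"
    unfolding F_def by (rule generate_field_min_subfield1) (auto simp: subfield_iff_subfield_on)
qed

lemma conjugates_refl: "subfield_on k \<Longrightarrow> \<psi> \<in> linear_chars \<Longrightarrow> \<psi> \<in> conjugates k \<psi>"
  by (subst conjugates_value_field(4)) (auto simp: ring_hom_on_def intro!: exI[of _ "\<lambda>x. x"])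

lemma conjugates_kernel:
  assumes k: "subfield_on k" and psi: "\<psi> \<in> linear_chars" and conj: "\<psi>' \<in> conjugates k \<psi>"
  shows "char_kernel \<psi>' = char_kernel \<psi>" "(\<forall>\<sigma>\<in>carrier Gab. \<psi> \<sigma> ^ n = 1) \<Longrightarrow> (\<forall>\<sigma>\<in>carrier Gab. \<psi>' \<sigma> ^ n = 1)"
proof -
  note F = conjugates_value_field[OF k, where \<psi> = \<psi>]
  define F where "F = generate_field \<Omega> (k \<union> \<psi> ` carrier Gab)"
  obtain \<tau> where \<tau>: "ring_hom_on F \<tau>" "\<And>\<sigma>. \<sigma> \<in> carrier Gab \<Longrightarrow> \<psi>' \<sigma> = \<tau> (\<psi> \<sigma>)"
    using conj F(4) by (auto simp: F_def)
  interpret field_hom_on F \<tau>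
    using F(1) \<tau>(1) by (simp add: F_def field_hom_on_def hom_on_def hom_on_axioms_def subfield_on_def)
  have "\<psi>' \<sigma> ^ n = 1 \<longleftrightarrow> \<psi> \<sigma> ^ n = 1" if s: "\<sigma> \<in> carrier Gab" for \<sigma> n
  proof -
    have F': "\<psi> \<sigma> \<in> F" using F(3)[OF s] by (simp add: F_def)
    have "\<tau> (\<psi> \<sigma> ^ n) = \<psi>' \<sigma> ^ n" using hom_power[OF F'] \<tau>(2)[OF s] by simp
    moreover have "\<tau> (\<psi> \<sigma> ^ n) = \<tau> 1 \<longleftrightarrow> \<psi> \<sigma> ^ n = 1"
      using inj_on_eq_iff[OF hom_inj power_in[OF F'] one_in] .
    ultimately show ?thesis by simp
  qed
  from this[of _ 1] this show "char_kernel \<psi>' = char_kernel \<psi>" "(\<forall>\<sigma>\<in>carrier Gab. \<psi> \<sigma> ^ n = 1) \<Longrightarrow> (\<forall>\<sigma>\<in>carrier Gab. \<psi>' \<sigma> ^ n = 1)"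
    by (auto simp: char_kernel_iff)
qed

lemma finite_conjugates:
  assumes k: "subfield_on k" and psi: "\<psi> \<in> linear_chars"
  shows "finite (conjugates k \<psi>)"
proof -
  obtain n where n: "n > 0" "\<forall>\<sigma>\<in>carrier Gab. \<psi> \<sigma> ^ n = 1" using linear_charsD(4)[OF psi] by blast
  obtain K where K: "K \<in> abelian_number_fields" "carrier (galois_group Qab K) \<subseteq> char_kernel \<psi>"
    using linear_charsD(5)[OF psi] by blast
  show ?thesis
  proof (rule finite_subset[OF _ finite_level_chars[OF K(1) n(1)]], rule subsetI, intro CollectI conjI)
    fix \<psi>' assume c: "\<psi>' \<in> conjugates k \<psi>"
    then show "\<psi>' \<in> linear_chars" by (simp add: conjugates_def)
    show "carrier (galois_group Qab K) \<subseteq> char_kernel \<psi>'" using conjugates_kernel(1)[OF k psi c] K(2) by simp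
    show "\<forall>\<sigma>\<in>carrier Gab. \<psi>' \<sigma> ^ n = 1" using conjugates_kernel(2)[OF k psi c] n(2) by blast
  qed
qed

text \<open>By independence of characters a sum of conjugates determines its terms, so that
  \<^const>\<open>char_terms\<close> returns exactly the conjugates that were added.\<close>

lemma conj_sum_eq_iff:
  assumes k: "subfield_on k" and psi: "\<psi> \<in> linear_chars" "\<psi>' \<in> linear_chars"
  shows "conj_sum k \<psi> = conj_sum k \<psi>' \<longleftrightarrow> conjugates k \<psi> = conjugates k \<psi>'"
proof
  assume eq: "conj_sum k \<psi> = conj_sum k \<psi>'"
  show "conjugates k \<psi> = conjugates k \<psi>'"
  proof (rule sum_chars_inj[OF finite_conjugates[OF k psi(1)] finite_conjugates[OF k psi(2)]])
    fix \<sigma> assume "\<sigma> \<in> carrier Gab"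
    then show "(\<Sum>\<psi>\<in>conjugates k \<psi>. \<psi> \<sigma>) = (\<Sum>\<psi>\<in>conjugates k \<psi>'. \<psi> \<sigma>)"
      using fun_cong[OF eq, of \<sigma>] by (simp add: conj_sum_def)
  qed (auto simp: conjugates_def)
qed (simp add: conj_sum_def)

text \<open>Over \<open>Q_p\<close> embeddings of value fields extend to automorphisms of the closure.\<close>

lemma conjugates_padic:
  assumes psi: "\<psi> \<in> (linear_chars :: 'p :: prime_card gal_char set)"
  shows "conjugates padic_field \<psi> = {\<psi>' \<in> linear_chars. \<exists>g\<in>padic_auts. \<forall>\<sigma>\<in>carrier Gab. \<psi>' \<sigma> = g (\<psi> \<sigma>)}"
proof -
  note F = conjugates_value_field[OF subfield_on_padic_field, where \<psi> = \<psi>]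
  define F where "F = generate_field \<Omega> (padic_field \<union> \<psi> ` carrier Gab)"
  have ext: "\<exists>g\<in>padic_auts. \<forall>\<sigma>\<in>carrier Gab. \<psi>' \<sigma> = g (\<psi> \<sigma>)"
    if t: "ring_hom_on F \<tau>" "\<forall>a\<in>padic_field. \<tau> a = a" "\<forall>\<sigma>\<in>carrier Gab. \<psi>' \<sigma> = \<tau> (\<psi> \<sigma>)" for \<tau> \<psi>'
  proof -
    have alg: "algebraic_over F z" for z
      using algebraic_over_mono[OF F(2) padic_algebraic] by (simp add: F_def)
    obtain g where g: "ring_hom_on UNIV g" "\<And>x. x \<in> F \<Longrightarrow> g x = \<tau> x"
      using extend_hom[OF F(1)[folded F_def] t(1) subfield_on_UNIV subset_UNIV alg] by blast
    have "g x = x" if "x \<in> padic_field" for x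
    proof -
      have "x \<in> F" using F(2) that unfolding F_def by (rule subsetD)
      from g(2)[OF this] show ?thesis using bspec[OF t(2) that] by simp
    qed
    then have "g \<in> padic_auts" using g(1) unfolding padic_auts_def by blast
    moreover have "\<psi>' \<sigma> = g (\<psi> \<sigma>)" if "\<sigma> \<in> carrier Gab" for \<sigma>
      using t(3) g(2) F(3)[OF that] that by (simp add: F_def)
    ultimately show ?thesis by blast
  qed
  have "\<exists>\<tau>. ring_hom_on F \<tau> \<and> (\<forall>a\<in>padic_field. \<tau> a = a) \<and> (\<forall>\<sigma>\<in>carrier Gab. \<psi>' \<sigma> = \<tau> (\<psi> \<sigma>))"
    if "g \<in> padic_auts" "\<forall>\<sigma>\<in>carrier Gab. \<psi>' \<sigma> = g (\<psi> \<sigma>)" for g \<psi>'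
    using that ring_hom_on_subset[of UNIV g F] unfolding padic_auts_def by blast
  then show ?thesis
    using F(4) ext unfolding F_def by blast
qed

lemma conjugates_padic_eq_iff:
  assumes psi: "\<psi> \<in> (linear_chars :: 'p :: prime_card gal_char set)" "\<psi>' \<in> linear_chars"
  shows "conj_sum padic_field \<psi> = conj_sum padic_field \<psi>' \<longleftrightarrow> \<psi>' \<in> conjugates padic_field \<psi>"
proof
  assume "conj_sum padic_field \<psi> = conj_sum padic_field \<psi>'"
  then show "\<psi>' \<in> conjugates padic_field \<psi>"
    using conj_sum_eq_iff[OF subfield_on_padic_field psi] conjugates_refl[OF subfield_on_padic_field psi(2)] by blast
next
  assume "\<psi>' \<in> conjugates padic_field \<psi>"
  then obtain g where g: "g \<in> padic_auts" "\<And>\<sigma>. \<sigma> \<in> carrier Gab \<Longrightarrow> \<psi>' \<sigma> = g (\<psi> \<sigma>)"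
    by (auto simp: conjugates_padic[OF psi(1)])
  obtain h where h: "h \<in> padic_auts" "\<And>x. h (g x) = x" "\<And>x. g (h x) = x" using padic_aut_inverse[OF g(1)] by blast
  have "(\<exists>a\<in>padic_auts. \<forall>\<sigma>\<in>carrier Gab. \<theta> \<sigma> = a (\<psi> \<sigma>)) \<longleftrightarrow> (\<exists>a\<in>padic_auts. \<forall>\<sigma>\<in>carrier Gab. \<theta> \<sigma> = a (\<psi>' \<sigma>))"
    for \<theta> :: "'p gal_char"
  proof
    assume "\<exists>a\<in>padic_auts. \<forall>\<sigma>\<in>carrier Gab. \<theta> \<sigma> = a (\<psi> \<sigma>)"
    then obtain a where "a \<in> padic_auts" "\<forall>\<sigma>\<in>carrier Gab. \<theta> \<sigma> = a (\<psi> \<sigma>)" by blast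
    then show "\<exists>a\<in>padic_auts. \<forall>\<sigma>\<in>carrier Gab. \<theta> \<sigma> = a (\<psi>' \<sigma>)"
      using g(2) h(2) by (intro bexI[OF _ padic_aut_comp[of a, OF _ h(1)]]) auto
  next
    assume "\<exists>a\<in>padic_auts. \<forall>\<sigma>\<in>carrier Gab. \<theta> \<sigma> = a (\<psi>' \<sigma>)"
    then obtain a where "a \<in> padic_auts" "\<forall>\<sigma>\<in>carrier Gab. \<theta> \<sigma> = a (\<psi>' \<sigma>)" by blast
    then show "\<exists>a\<in>padic_auts. \<forall>\<sigma>\<in>carrier Gab. \<theta> \<sigma> = a (\<psi> \<sigma>)"
      using g by (intro bexI[OF _ padic_aut_comp[of a, OF _ g(1)]]) auto
  qed
  then have "conjugates padic_field \<psi> = conjugates padic_field \<psi>'"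
    unfolding conjugates_padic[OF psi(1)] conjugates_padic[OF psi(2)] by blast
  then show "conj_sum padic_field \<psi> = conj_sum padic_field \<psi>'" by (simp add: conj_sum_def)
qed

lemma char_terms_padic:
  assumes "\<psi> \<in> (linear_chars :: 'p :: prime_card gal_char set)"
  shows "char_terms padic_field (conj_sum padic_field \<psi>) = conjugates padic_field \<psi>"
proof (intro equalityI subsetI)
  fix \<psi>' assume "\<psi>' \<in> char_terms padic_field (conj_sum padic_field \<psi>)"
  then have "\<psi>' \<in> linear_chars" "conj_sum padic_field \<psi> = conj_sum padic_field \<psi>'"
    by (simp_all add: char_terms_def)
  then show "\<psi>' \<in> conjugates padic_field \<psi>" using conjugates_padic_eq_iff[OF assms] by blast
next
  fix \<psi>' assume c: "\<psi>' \<in> conjugates padic_field \<psi>"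
  then have "\<psi>' \<in> linear_chars" by (simp add: conjugates_def)
  moreover from this have "conj_sum padic_field \<psi> = conj_sum padic_field \<psi>'"
    using conjugates_padic_eq_iff[OF assms] c by blast
  ultimately show "\<psi>' \<in> char_terms padic_field (conj_sum padic_field \<psi>)"
    by (simp add: char_terms_def)
qed

section \<open>The terms of a rational character\<close>

lemma coprime_powers_eq_1:
  fixes x :: "'a :: field"
  assumes "x ^ a = 1" "x ^ b = 1" "coprime a b" "a > 0"
  shows "x = 1"
proof -
  obtain d where d: "d dvd a" "prim_root d x" using prim_root_exists_order[OF assms(1,4)] .
  then have "d dvd b" using prim_root_eq_1_iff assms(2) by blast
  then have "d = 1" using d(1) assms(3) by (metis coprime_common_divisor_nat nat_dvd_1_iff_1 one_dvd)
  then show ?thesis using d(2) by (simp add: prim_root_def)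
qed

text \<open>All data attached to \<open>chi\<close> are defined through a chosen term; here it is \<open>\<psi>1\<close>. They are
  described below in a way that does not depend on this choice.\<close>

locale rational_character =
  fixes chi :: "'p :: prime_card gal_char" and \<sigma> :: "complex \<Rightarrow> complex"
  assumes chi: "chi \<in> irr_chars \<rat>"
    and sigma: "\<sigma> \<in> carrier (rat_group chi)" "carrier (rat_group chi) = generate (rat_group chi) {\<sigma>}"
begin

definition \<psi>1 :: "'p gal_char" where "\<psi>1 = (SOME \<psi>. \<psi> \<in> char_terms \<rat> chi)"

abbreviation K where "K \<equiv> rat_field chi"
abbreviation G where "G \<equiv> rat_group chi"
abbreviation g where "g \<equiv> rat_order chi"

lemma psi1: "\<psi>1 \<in> linear_chars" "conj_sum \<rat> \<psi>1 = chi"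
proof -
  obtain \<psi> where "\<psi> \<in> linear_chars" "chi = conj_sum \<rat> \<psi>" using chi by (auto simp: irr_chars_def)
  then have "\<psi> \<in> char_terms \<rat> chi" by (simp add: char_terms_def)
  then have "\<psi>1 \<in> char_terms \<rat> chi" unfolding \<psi>1_def by (rule someI[of "\<lambda>\<psi>. \<psi> \<in> char_terms \<rat> chi"])
  then show "\<psi>1 \<in> linear_chars" "conj_sum \<rat> \<psi>1 = chi" by (simp_all add: char_terms_def)
qed

lemma rat_field_eq: "K = {z \<in> Qab. \<forall>\<sigma> \<in> char_kernel \<psi>1. \<sigma> z = z}"
  by (simp add: rat_field_def \<psi>1_def)

lemma rat_field: "K \<in> abelian_number_fields" "carrier (galois_group Qab K) = char_kernel \<psi>1"
proof -
  obtain K0 where K0: "K0 \<in> abelian_number_fields" "carrier (galois_group Qab K0) \<subseteq> char_kernel \<psi>1"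
    using linear_charsD(5)[OF psi1(1)] by blast
  show "K \<in> abelian_number_fields" "carrier (galois_group Qab K) = char_kernel \<psi>1"
    unfolding rat_field_eq using open_subgroup_field[OF subgroup_char_kernel[OF psi1(1)] K0] by simp_all
qed

lemmas K_sub = abelian_number_fieldsD(1,2)[OF rat_field(1)]

lemma comm_group_G: "comm_group G"
  by (rule comm_group_level[OF K_sub])

sublocale G: comm_group G by (rule comm_group_G)

lemma finite_G: "finite (carrier G)"
  by (rule finite_level[OF rat_field(1)])

lemma G_powers: "\<tau> \<in> carrier G \<Longrightarrow> \<exists>i :: nat. \<tau> = \<sigma> [^]\<^bsub>G\<^esub> i"
  using G.generate_pow_on_finite_carrier[OF finite_G sigma(1)] sigma(2) by auto

text \<open>Characters of \<open>G_chi\<close>, viewed as characters of the absolute group.\<close>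

definition level_char :: "'p gal_char \<Rightarrow> bool"
  where "level_char \<psi> \<longleftrightarrow> \<psi> \<in> linear_chars \<and> char_kernel \<psi>1 \<subseteq> char_kernel \<psi>"

abbreviation val where "val \<equiv> value_at chi"

lemma val_restrict:
  assumes psi: "level_char \<psi>" and t: "\<tau> \<in> carrier Gab"
  shows "val \<psi> (restrict \<tau> K) = \<psi> \<tau>"
proof -
  have lin: "\<psi> \<in> linear_chars" using psi by (simp add: level_char_def)
  note p = Gab_prolong[OF K_sub Gab_restrict[OF K_sub t]]
  have "prolong K (restrict \<tau> K) x = \<tau> x" if "x \<in> K" for x
    using fun_cong[OF p(2), of x] that by simp
  then have "inv\<^bsub>Gab\<^esub> (prolong K (restrict \<tau> K)) \<otimes>\<^bsub>Gab\<^esub> \<tau> \<in> char_kernel \<psi>1"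
    unfolding rat_field(2)[symmetric] by (rule restrict_eq_imp[OF K_sub p(1) t])
  then have "inv\<^bsub>Gab\<^esub> (prolong K (restrict \<tau> K)) \<otimes>\<^bsub>Gab\<^esub> \<tau> \<in> char_kernel \<psi>"
    using psi by (auto simp: level_char_def)
  then have "\<psi> (inv\<^bsub>Gab\<^esub> (prolong K (restrict \<tau> K)) \<otimes>\<^bsub>Gab\<^esub> \<tau>) = 1"
    by (simp add: char_kernel_iff)
  moreover interpret Gab: comm_group Gab by (rule comm_group_Gab)
  have "\<psi> (inv\<^bsub>Gab\<^esub> (prolong K (restrict \<tau> K)) \<otimes>\<^bsub>Gab\<^esub> \<tau>) = inverse (\<psi> (prolong K (restrict \<tau> K))) * \<psi> \<tau>"
    using linear_charsD(1)[OF lin] linear_char_inv[OF lin] p(1) t by simp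
  ultimately show ?thesis
    using linear_charsD(2)[OF lin p(1)] by (simp add: value_at_def field_simps)
qed

lemma val_mult:
  assumes psi: "level_char \<psi>" and t: "\<tau> \<in> carrier G" "\<tau>' \<in> carrier G"
  shows "val \<psi> (\<tau> \<otimes>\<^bsub>G\<^esub> \<tau>') = val \<psi> \<tau> * val \<psi> \<tau>'"
proof -
  interpret Gab: comm_group Gab by (rule comm_group_Gab)
  note p = Gab_prolong[OF K_sub t(1)] Gab_prolong[OF K_sub t(2)]
  have "val \<psi> (\<tau> \<otimes>\<^bsub>G\<^esub> \<tau>') = val \<psi> (restrict (prolong K \<tau> \<otimes>\<^bsub>Gab\<^esub> prolong K \<tau>') K)"
    using restrict_mult[OF K_sub p(1,3)] p by simp
  also have "\<dots> = \<psi> (prolong K \<tau> \<otimes>\<^bsub>Gab\<^esub> prolong K \<tau>')"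
    using p by (intro val_restrict[OF psi]) simp
  also have "\<dots> = val \<psi> \<tau> * val \<psi> \<tau>'"
    using linear_charsD(1)[of \<psi>] psi p by (simp add: level_char_def value_at_def)
  finally show ?thesis .
qed

lemma val_nz: "level_char \<psi> \<Longrightarrow> \<tau> \<in> carrier G \<Longrightarrow> val \<psi> \<tau> \<noteq> 0"
  using linear_charsD(2)[of \<psi>] Gab_prolong(1)[OF K_sub] by (simp add: level_char_def value_at_def)

lemma val_one: "level_char \<psi> \<Longrightarrow> val \<psi> \<one>\<^bsub>G\<^esub> = 1"
  using val_mult[of \<psi> "\<one>\<^bsub>G\<^esub>" "\<one>\<^bsub>G\<^esub>"] val_nz[of \<psi> "\<one>\<^bsub>G\<^esub>"] by simp

lemma val_pow: "level_char \<psi> \<Longrightarrow> \<tau> \<in> carrier G \<Longrightarrow> val \<psi> (\<tau> [^]\<^bsub>G\<^esub> (i :: nat)) = val \<psi> \<tau> ^ i"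
  by (induction i) (simp_all add: val_one val_mult mult.commute)

lemma val_inv: "level_char \<psi> \<Longrightarrow> \<tau> \<in> carrier G \<Longrightarrow> val \<psi> (inv\<^bsub>G\<^esub> \<tau>) = inverse (val \<psi> \<tau>)"
  using val_mult[of \<psi> \<tau> "inv\<^bsub>G\<^esub> \<tau>"] val_one[of \<psi>] by (simp add: inverse_unique)

lemma level_char_ext:
  assumes "level_char \<psi>" "level_char \<psi>'" "\<And>\<tau>. \<tau> \<in> carrier G \<Longrightarrow> val \<psi> \<tau> = val \<psi>' \<tau>"
  shows "\<psi> = \<psi>'"
proof (rule linear_char_ext)
  fix \<tau> assume t: "\<tau> \<in> carrier Gab"
  show "\<psi> \<tau> = \<psi>' \<tau>"
    using val_restrict[OF assms(1) t] val_restrict[OF assms(2) t] assms(3)[OF Gab_restrict[OF K_sub t]] by simp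
qed (use assms in \<open>auto simp: level_char_def\<close>)

lemma level_char_ext_sigma:
  assumes "level_char \<psi>" "level_char \<psi>'" "val \<psi> \<sigma> = val \<psi>' \<sigma>"
  shows "\<psi> = \<psi>'"
proof (rule level_char_ext[OF assms(1,2)])
  fix \<tau> assume "\<tau> \<in> carrier G"
  then obtain i :: nat where "\<tau> = \<sigma> [^]\<^bsub>G\<^esub> i" using G_powers by blast
  then show "val \<psi> \<tau> = val \<psi>' \<tau>" using val_pow[OF assms(1) sigma(1), of i] val_pow[OF assms(2) sigma(1), of i] assms(3) by simp
qed

lemma level_char_values: "level_char \<psi> \<Longrightarrow> \<tau> \<in> carrier Gab \<Longrightarrow> \<exists>i :: nat. restrict \<tau> K = \<sigma> [^]\<^bsub>G\<^esub> i \<and> \<psi> \<tau> = val \<psi> \<sigma> ^ i"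
proof -
  assume L: "level_char \<psi>" and t: "\<tau> \<in> carrier Gab"
  obtain i :: nat where i: "restrict \<tau> K = \<sigma> [^]\<^bsub>G\<^esub> i" using G_powers[OF Gab_restrict[OF K_sub t]] by blast
  then have "\<psi> \<tau> = val \<psi> \<sigma> ^ i" using val_restrict[OF L t] val_pow[OF L sigma(1), of i] by simp
  then show ?thesis using i by blast
qed

text \<open>The characters which are faithful on \<open>G_chi\<close>. They turn out to be the terms of \<open>chi\<close>.\<close>

definition faithful :: "'p gal_char set"
  where "faithful = {\<psi> \<in> linear_chars. char_kernel \<psi> = char_kernel \<psi>1}"

lemma faithful_level: "\<psi> \<in> faithful \<Longrightarrow> level_char \<psi>" "\<psi> \<in> faithful \<Longrightarrow> \<psi> \<in> linear_chars"
  by (simp_all add: faithful_def level_char_def)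

lemma psi1_faithful: "\<psi>1 \<in> faithful"
  using psi1 by (simp add: faithful_def)

lemma rat_order: "g > 0" "\<tau> \<in> carrier Gab \<Longrightarrow> \<psi>1 \<tau> ^ g = 1"
  "0 < m \<Longrightarrow> m < g \<Longrightarrow> \<exists>\<tau>\<in>carrier Gab. \<psi>1 \<tau> ^ m \<noteq> 1"
proof -
  have e: "g = (LEAST n. n > 0 \<and> (\<forall>\<sigma>\<in>carrier Gab. \<psi>1 \<sigma> ^ n = 1))"
    by (simp add: rat_order_def char_order_def \<psi>1_def)
  obtain n where "n > 0 \<and> (\<forall>\<sigma>\<in>carrier Gab. \<psi>1 \<sigma> ^ n = 1)" using linear_charsD(4)[OF psi1(1)] by blast
  then have "g > 0 \<and> (\<forall>\<sigma>\<in>carrier Gab. \<psi>1 \<sigma> ^ g = 1)" unfolding e by (rule LeastI)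
  then show "g > 0" "\<tau> \<in> carrier Gab \<Longrightarrow> \<psi>1 \<tau> ^ g = 1" by auto
  show "0 < m \<Longrightarrow> m < g \<Longrightarrow> \<exists>\<tau>\<in>carrier Gab. \<psi>1 \<tau> ^ m \<noteq> 1"
    using not_less_Least[of m "\<lambda>n. n > 0 \<and> (\<forall>\<sigma>\<in>carrier Gab. \<psi>1 \<sigma> ^ n = 1)"] by (auto simp: e)
qed

lemma val_psi1: "prim_root g (val \<psi>1 \<sigma>)"
  unfolding prim_root_def
proof (intro conjI allI impI)
  note L = faithful_level(1)[OF psi1_faithful]
  show "g > 0" by (rule rat_order)
  show "val \<psi>1 \<sigma> ^ g = 1"
    using rat_order(2) Gab_prolong(1)[OF K_sub sigma(1)] by (simp add: value_at_def)
  fix m assume m: "0 < m \<and> m < g"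
  then obtain \<tau> where t: "\<tau> \<in> carrier Gab" "\<psi>1 \<tau> ^ m \<noteq> 1" using rat_order(3) by blast
  obtain i where "\<psi>1 \<tau> = val \<psi>1 \<sigma> ^ i" using level_char_values[OF L t(1)] by blast
  then show "val \<psi>1 \<sigma> ^ m \<noteq> 1" using t(2) by (metis mult.commute power_mult power_one)
qed

lemma sigma_pow_eq_1: "\<sigma> [^]\<^bsub>G\<^esub> i = \<one>\<^bsub>G\<^esub> \<longleftrightarrow> g dvd i"
proof -
  note L = faithful_level(1)[OF psi1_faithful]
  interpret Gab: comm_group Gab by (rule comm_group_Gab)
  have "val \<psi>1 \<tau> = 1 \<longleftrightarrow> \<tau> = \<one>\<^bsub>G\<^esub>" if t: "\<tau> \<in> carrier G" for \<tau>
  proof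
    note p = Gab_prolong[OF K_sub t]
    assume "val \<psi>1 \<tau> = 1"
    then have "prolong K \<tau> \<in> char_kernel \<psi>1" using p(1) by (simp add: value_at_def char_kernel_iff)
    then have "prolong K \<tau> \<in> carrier (galois_group Qab K)" unfolding rat_field(2) .
    then have "restrict (prolong K \<tau>) K = (\<lambda>x\<in>K. x)" by (auto simp: carrier_Gab fun_eq_iff)
    then show "\<tau> = \<one>\<^bsub>G\<^esub>" using p(2) galois_group_simps(3)[OF K_sub(1)] by simp
  qed (use val_one[OF L] in simp)
  from this[of "\<sigma> [^]\<^bsub>G\<^esub> i"] show ?thesis
    using sigma(1) val_pow[OF L sigma(1)] prim_root_eq_1_iff[OF val_psi1] by simp
qed

lemma val_faithful:
  assumes "level_char \<psi>"
  shows "\<psi> \<in> faithful \<longleftrightarrow> prim_root g (val \<psi> \<sigma>)"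
proof -
  note L = faithful_level(1)[OF psi1_faithful]
  have lin: "\<psi> \<in> linear_chars" using assms by (simp add: level_char_def)
  have vg: "val \<psi> \<sigma> ^ g = 1"
    using val_pow[OF assms sigma(1), of g] sigma_pow_eq_1[of g] val_one[OF assms] by simp
  have iff: "\<psi> \<tau> = 1 \<longleftrightarrow> \<psi>1 \<tau> = 1" if pr: "\<forall>i. val \<psi> \<sigma> ^ i = 1 \<longleftrightarrow> g dvd i" and t: "\<tau> \<in> carrier Gab" for \<tau>
  proof -
    obtain i :: nat where i: "restrict \<tau> K = \<sigma> [^]\<^bsub>G\<^esub> i" "\<psi> \<tau> = val \<psi> \<sigma> ^ i" using level_char_values[OF assms t] by blast
    have "\<psi>1 \<tau> = val \<psi>1 \<sigma> ^ i" using val_restrict[OF L t] val_pow[OF L sigma(1)] i(1) by simp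
    then show ?thesis using i(2) pr prim_root_eq_1_iff[OF val_psi1] by simp
  qed
  have "prim_root g (val \<psi> \<sigma>)" if f: "\<psi> \<in> faithful"
    unfolding prim_root_def
  proof (intro conjI allI impI)
    show "g > 0" by (rule rat_order)
    show "val \<psi> \<sigma> ^ g = 1" by fact
    fix m assume m: "0 < m \<and> m < g"
    define s where "s = prolong K (\<sigma> [^]\<^bsub>G\<^esub> m)"
    have s: "s \<in> carrier Gab" using Gab_prolong(1)[OF K_sub] sigma(1) by (simp add: s_def)
    have "val \<psi> \<sigma> ^ m = 1 \<longleftrightarrow> s \<in> char_kernel \<psi>"
      using val_pow[OF assms sigma(1), of m] s by (simp add: value_at_def s_def char_kernel_iff)
    also have "\<dots> \<longleftrightarrow> s \<in> char_kernel \<psi>1" using f by (simp add: faithful_def)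
    also have "\<dots> \<longleftrightarrow> val \<psi>1 \<sigma> ^ m = 1"
      using val_pow[OF L sigma(1), of m] s by (simp add: value_at_def s_def char_kernel_iff)
    also have "\<dots> \<longleftrightarrow> False" using val_psi1 m by (simp add: prim_root_def)
    finally show "val \<psi> \<sigma> ^ m \<noteq> 1" by simp
  qed
  moreover have "\<psi> \<in> faithful" if "prim_root g (val \<psi> \<sigma>)"
  proof -
    have "char_kernel \<psi> = char_kernel \<psi>1"
      using iff prim_root_eq_1_iff[OF that] by (auto simp: char_kernel_iff)
    then show ?thesis using lin by (simp add: faithful_def)
  qed
  ultimately show ?thesis by blast
qed

lemma faithful_surj:
  assumes w: "prim_root g w"
  obtains \<psi> where "\<psi> \<in> faithful" "val \<psi> \<sigma> = w"
proof -
  obtain i where i: "w = val \<psi>1 \<sigma> ^ i" using prim_root_coprime[OF val_psi1 w] by blast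
  define \<psi> where "\<psi> = (\<lambda>\<tau>\<in>carrier Gab. \<psi>1 \<tau> ^ i)"
  have lin: "\<psi> \<in> linear_chars"
    unfolding \<psi>_def by (rule linear_char_image[OF psi1(1)]) (simp_all add: power_mult_distrib)
  have lev: "level_char \<psi>"
    using lin by (auto simp: level_char_def char_kernel_iff \<psi>_def)
  have "val \<psi> \<sigma> = w"
    using Gab_prolong(1)[OF K_sub sigma(1)] by (simp add: value_at_def i \<psi>_def)
  then show ?thesis using that val_faithful[OF lev] w by blast
qed

text \<open>The values of two faithful characters at \<open>\<sigma>\<close> are powers of each other with exponents prime to \<open>g\<close>.
  By irreducibility of the cyclotomic polynomial one can be mapped to the other, and this determines the
  characters.\<close>

lemma conjugates_rat:
  assumes psi: "\<psi> \<in> faithful"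
  shows "conjugates \<rat> \<psi> = faithful"
proof
  have lin: "\<psi> \<in> linear_chars" using faithful_level(2)[OF psi] .
  show "conjugates \<rat> \<psi> \<subseteq> faithful"
    using conjugates_kernel(1)[OF subfield_on_Rats lin] psi by (auto simp: faithful_def conjugates_def)
  show "faithful \<subseteq> conjugates \<rat> \<psi>"
  proof
    fix \<psi>' assume psi': "\<psi>' \<in> faithful"
    note F = conjugates_value_field[OF subfield_on_Rats, where \<psi> = \<psi>]
    let ?z = "val \<psi> \<sigma>" let ?z' = "val \<psi>' \<sigma>"
    note L = faithful_level(1)[OF psi] faithful_level(1)[OF psi']
    have pr: "prim_root g ?z" "prim_root g ?z'" using val_faithful[OF L(1)] val_faithful[OF L(2)] psi psi' by auto
    obtain i where i: "coprime i g" "?z' = ?z ^ i" "i > 0" using prim_root_coprime[OF pr] .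
    interpret Q: subfield_on "\<rat> :: 'p padic_closure set" by (rule subfield_on_Rats)
    have id: "ring_hom_on (\<rat> :: 'p padic_closure set) (\<lambda>x. x)" by (simp add: ring_hom_on_def)
    have w: "poly (map_poly (\<lambda>x. x) f) ?z' = 0" if "f \<in> polys \<rat>" "poly f ?z = 0" for f
      using cyclotomic_conjugates[OF pr(1) i(1,3) that] i(2) by simp
    obtain h where h: "ring_hom_on (adjoin \<rat> ?z) h" "\<And>x. x \<in> \<rat> \<Longrightarrow> h x = x" "h ?z = ?z'"
      using simple_extension_hom[OF subfield_on_Rats id w] by blast
    have "monom 1 g - 1 \<in> polys (\<rat> :: 'p padic_closure set)" by auto
    moreover have "poly (monom 1 g - 1) ?z = 0" using prim_rootD(2)[OF pr(1)] by (simp add: poly_monom)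
    ultimately have "algebraic_over \<rat> ?z"
      using monom_minus_1_nz[OF rat_order(1)] unfolding algebraic_over_def by blast
    then have A: "subfield_on (adjoin \<rat> ?z)" by (rule subfield_on_adjoin[OF subfield_on_Rats])
    then interpret A: subfield_on "adjoin \<rat> ?z" .
    interpret h: field_hom_on "adjoin \<rat> ?z" h
      using A h(1) A.subring_on_axioms by (simp add: field_hom_on_def hom_on_def hom_on_axioms_def)
    have zA: "?z \<in> adjoin \<rat> ?z" by (rule adjoin_self) (rule Q.subring_on_axioms)
    have val: "\<psi> \<tau> \<in> adjoin \<rat> ?z \<and> \<psi>' \<tau> = h (\<psi> \<tau>)" if t: "\<tau> \<in> carrier Gab" for \<tau>
    proof -
      obtain j :: nat where j: "restrict \<tau> K = \<sigma> [^]\<^bsub>G\<^esub> j" "\<psi> \<tau> = ?z ^ j" using level_char_values[OF L(1) t] by blast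
      have "\<psi>' \<tau> = ?z' ^ j" using val_restrict[OF L(2) t] val_pow[OF L(2) sigma(1)] j(1) by simp
      then show ?thesis using j(2) h.hom_power[OF zA] h(3) A.power_in[OF zA] by simp
    qed
    have "generate_field \<Omega> (\<rat> \<union> \<psi> ` carrier Gab) \<subseteq> adjoin \<rat> ?z"
      using val Rats_subset[OF A] by (intro F(5)[OF A]) auto
    then have "ring_hom_on (generate_field \<Omega> (\<rat> \<union> \<psi> ` carrier Gab)) h"
      using h(1) ring_hom_on_subset by blast
    then show "\<psi>' \<in> conjugates \<rat> \<psi>"
      unfolding F(4) using faithful_level(2)[OF psi'] h(2) val by blast
  qed
qed

lemma char_terms_rat: "char_terms \<rat> chi = faithful"
proof
  show "char_terms \<rat> chi \<subseteq> faithful"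
  proof
    fix \<psi> assume "\<psi> \<in> char_terms \<rat> chi"
    then have psi: "\<psi> \<in> linear_chars" "conj_sum \<rat> \<psi> = conj_sum \<rat> \<psi>1" using psi1 by (simp_all add: char_terms_def)
    then have "conjugates \<rat> \<psi> = conjugates \<rat> \<psi>1"
      using conj_sum_eq_iff[OF subfield_on_Rats psi(1) psi1(1)] by simp
    then show "\<psi> \<in> faithful"
      using conjugates_refl[OF subfield_on_Rats psi(1)] conjugates_rat[OF psi1_faithful] by simp
  qed
  show "faithful \<subseteq> char_terms \<rat> chi"
    using conjugates_rat conjugates_rat[OF psi1_faithful] psi1(2) faithful_level(2)
    by (auto simp: char_terms_def conj_sum_def)
qed

lemma finite_faithful: "finite faithful"
  using finite_conjugates[OF subfield_on_Rats psi1(1)] conjugates_rat[OF psi1_faithful] by simp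

lemma padic_component:
  assumes "phi \<in> padic_components chi"
  obtains \<psi> where "\<psi> \<in> faithful" "phi = conj_sum padic_field \<psi>"
  using assms unfolding padic_components_def char_terms_rat by (auto simp: char_terms_def)

lemma padic_component_of: "\<psi> \<in> faithful \<Longrightarrow> conj_sum padic_field \<psi> \<in> padic_components chi"
  unfolding padic_components_def char_terms_rat
  using faithful_level(2) by (auto simp: char_terms_def irr_chars_def)

lemma finite_padic_components: "finite (padic_components chi)"
  by (rule finite_subset[of _ "conj_sum padic_field ` faithful"]) (auto intro: finite_faithful elim: padic_component)

lemma val_conj:
  assumes psi: "level_char \<psi>" "level_char \<psi>'"
  shows "\<psi>' \<in> conjugates padic_field \<psi> \<longleftrightarrow> padic_conj (val \<psi> \<sigma>) (val \<psi>' \<sigma>)"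
proof -
  have lin: "\<psi> \<in> linear_chars" "\<psi>' \<in> linear_chars" using psi by (simp_all add: level_char_def)
  have "(\<forall>\<tau>\<in>carrier Gab. \<psi>' \<tau> = h (\<psi> \<tau>)) \<longleftrightarrow> h (val \<psi> \<sigma>) = val \<psi>' \<sigma>" if h: "h \<in> padic_auts" for h
  proof
    assume "\<forall>\<tau>\<in>carrier Gab. \<psi>' \<tau> = h (\<psi> \<tau>)"
    then show "h (val \<psi> \<sigma>) = val \<psi>' \<sigma>" using Gab_prolong(1)[OF K_sub sigma(1)] by (simp add: value_at_def)
  next
    assume hv: "h (val \<psi> \<sigma>) = val \<psi>' \<sigma>"
    show "\<forall>\<tau>\<in>carrier Gab. \<psi>' \<tau> = h (\<psi> \<tau>)"
    proof
      fix \<tau> assume t: "\<tau> \<in> carrier Gab"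
      obtain j :: nat where j: "restrict \<tau> K = \<sigma> [^]\<^bsub>G\<^esub> j" "\<psi> \<tau> = val \<psi> \<sigma> ^ j" using level_char_values[OF psi(1) t] by blast
      have "\<psi>' \<tau> = val \<psi>' \<sigma> ^ j" using val_restrict[OF psi(2) t] val_pow[OF psi(2) sigma(1)] j(1) by simp
      then show "\<psi>' \<tau> = h (\<psi> \<tau>)" using j(2) hv padic_aut_simps(7)[OF h] by simp
    qed
  qed
  then show ?thesis
    unfolding conjugates_padic[OF lin(1)] padic_conj_def using lin(2) by auto
qed

definition roots_of :: "'p gal_char \<Rightarrow> 'p padic_closure set"
  where "roots_of phi = (\<lambda>\<psi>. val \<psi> \<sigma>) ` char_terms padic_field phi"

text \<open>Each component corresponds to one orbit of primitive \<open>g\<close>-th roots of unity under the automorphisms over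
  \<open>Q_p\<close>.\<close>

lemma component_terms:
  assumes phi: "phi \<in> padic_components chi" and psi: "\<psi> \<in> char_terms padic_field phi"
  shows "\<psi> \<in> faithful" "phi = conj_sum padic_field \<psi>" "char_terms padic_field phi = conjugates padic_field \<psi>"
    "roots_of phi = orbit (val \<psi> \<sigma>)"
proof -
  obtain \<psi>' where psi': "\<psi>' \<in> faithful" "phi = conj_sum padic_field \<psi>'" using padic_component[OF phi] .
  have T: "char_terms padic_field phi = conjugates padic_field \<psi>'"
    using char_terms_padic faithful_level(2)[OF psi'(1)] psi'(2) by simp
  have conj: "\<theta> \<in> faithful" if "\<theta> \<in> conjugates padic_field \<psi>'" for \<theta>
    using conjugates_kernel(1)[OF subfield_on_padic_field faithful_level(2)[OF psi'(1)] that] that psi'(1)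
    by (auto simp: faithful_def conjugates_def)
  show psiF: "\<psi> \<in> faithful" using conj psi T by blast
  show phi2: "phi = conj_sum padic_field \<psi>" using psi by (simp add: char_terms_def)
  show T': "char_terms padic_field phi = conjugates padic_field \<psi>"
    using char_terms_padic faithful_level(2)[OF psiF] phi2 by simp
  show "roots_of phi = orbit (val \<psi> \<sigma>)"
  proof (intro equalityI subsetI)
    fix y assume "y \<in> roots_of phi"
    then obtain \<theta> where \<theta>: "\<theta> \<in> conjugates padic_field \<psi>" "y = val \<theta> \<sigma>" by (auto simp: roots_of_def T')
    then have "\<theta> \<in> faithful" using conj T T' by blast
    then show "y \<in> orbit (val \<psi> \<sigma>)"
      using val_conj[OF faithful_level(1)[OF psiF] faithful_level(1)] \<theta> by (simp add: orbit_def)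
  next
    fix y assume "y \<in> orbit (val \<psi> \<sigma>)"
    then have c: "padic_conj (val \<psi> \<sigma>) y" by (simp add: orbit_def)
    have "prim_root g y"
      using padic_conj_prim_root[OF c] val_faithful[OF faithful_level(1)[OF psiF]] psiF by blast
    then obtain \<theta> where \<theta>: "\<theta> \<in> faithful" "val \<theta> \<sigma> = y" by (rule faithful_surj)
    then have "\<theta> \<in> conjugates padic_field \<psi>"
      using val_conj[OF faithful_level(1)[OF psiF] faithful_level(1)] c by simp
    then show "y \<in> roots_of phi" using \<theta> by (auto simp: roots_of_def T')
  qed
qed

lemma component_nonempty: "phi \<in> padic_components chi \<Longrightarrow> char_terms padic_field phi \<noteq> {}"
  unfolding padic_components_def by blast

lemma roots_of_prim: "phi \<in> padic_components chi \<Longrightarrow> y \<in> roots_of phi \<Longrightarrow> prim_root g y"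
  unfolding roots_of_def using component_terms(1) val_faithful faithful_level(1) by blast

lemma roots_of_cover: "prim_root g y \<Longrightarrow> \<exists>phi\<in>padic_components chi. y \<in> roots_of phi"
proof -
  assume "prim_root g y"
  then obtain \<psi> where psi: "\<psi> \<in> faithful" "val \<psi> \<sigma> = y" by (rule faithful_surj)
  then have "\<psi> \<in> char_terms padic_field (conj_sum padic_field \<psi>)"
    using faithful_level(2) by (simp add: char_terms_def)
  then show ?thesis using psi padic_component_of by (auto simp: roots_of_def)
qed

lemma roots_of_disjoint:
  assumes "phi \<in> padic_components chi" "phi2 \<in> padic_components chi" "y \<in> roots_of phi" "y \<in> roots_of phi2"
  shows "phi = phi2"
proof -
  obtain \<psi> \<psi>' where p: "\<psi> \<in> char_terms padic_field phi" "\<psi>' \<in> char_terms padic_field phi2"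
    "y = val \<psi> \<sigma>" "y = val \<psi>' \<sigma>"
    using assms(3,4) by (auto simp: roots_of_def)
  note c = component_terms[OF assms(1) p(1)] component_terms[OF assms(2) p(2)]
  have "\<psi> = \<psi>'" using level_char_ext_sigma faithful_level(1) c(1,5) p(3,4) by blast
  then show ?thesis using c(2,6) by simp
qed

lemma padic_poly_eq:
  assumes phi: "phi \<in> padic_components chi"
  shows "map_poly of_padic_int (padic_poly chi \<sigma> phi) = (\<Prod>y\<in>roots_of phi. [:- y, 1:])"
proof -
  obtain \<psi> where psi: "\<psi> \<in> char_terms padic_field phi" using component_nonempty[OF phi] by blast
  note c = component_terms[OF phi psi]
  have "inj_on (\<lambda>\<psi>. val \<psi> \<sigma>) (char_terms padic_field phi)"
    using level_char_ext_sigma faithful_level(1) component_terms(1)[OF phi] by (auto simp: inj_on_def)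
  then have e: "(\<Prod>\<psi>\<in>char_terms padic_field phi. [:- val \<psi> \<sigma>, 1:]) = (\<Prod>y\<in>roots_of phi. [:- y, 1:])"
    unfolding roots_of_def by (simp add: prod.reindex)
  have "prim_root g (val \<psi> \<sigma>)" using val_faithful[OF faithful_level(1)[OF c(1)]] c(1) by blast
  then have P: "(\<Prod>y\<in>roots_of phi. [:- y, 1:]) \<in> polys padic_ints"
    unfolding c(4) by (rule orbit_poly_integral)
  have t0: "to_padic_int (0 :: 'p padic_closure) = 0" using to_padic_of_padic[of 0] by simp
  show ?thesis
    unfolding padic_poly_def e
    by (rule poly_eqI) (simp add: coeff_map_poly t0 of_padic_to_padic[OF polysD[OF P]])
qed

lemma rat_poly_eq: "map_poly of_padic_int (rat_poly chi :: 'p padic_int poly) = cyc g"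
proof -
  have "map_poly of_padic_int (rat_poly chi :: 'p padic_int poly) = map_poly of_int (cyclotomic g)"
    unfolding rat_poly_def by (rule poly_eqI) (simp add: coeff_map_poly)
  then show ?thesis using cyclotomic_alg_closed[OF rat_order(1), where 'a = "'p padic_closure"] by simp
qed

end

lemma char_orderD:
  assumes "\<psi> \<in> linear_chars"
  shows "char_order \<psi> > 0" "\<tau> \<in> carrier Gab \<Longrightarrow> \<psi> \<tau> ^ char_order \<psi> = 1"
proof -
  obtain n where "n > 0 \<and> (\<forall>\<sigma>\<in>carrier Gab. \<psi> \<sigma> ^ n = 1)" using linear_charsD(4)[OF assms] by blast
  then have "char_order \<psi> > 0 \<and> (\<forall>\<sigma>\<in>carrier Gab. \<psi> \<sigma> ^ char_order \<psi> = 1)"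
    unfolding char_order_def by (rule LeastI)
  then show "char_order \<psi> > 0" "\<tau> \<in> carrier Gab \<Longrightarrow> \<psi> \<tau> ^ char_order \<psi> = 1" by auto
qed

lemma (in group) subgroup_pow_card:
  assumes "subgroup H G" "x \<in> H"
  shows "x [^] card H = \<one>"
proof -
  interpret H: group "G\<lparr>carrier := H\<rparr>" by (rule subgroup_imp_group) fact
  have "x [^]\<^bsub>G\<lparr>carrier := H\<rparr>\<^esub> (n :: nat) = x [^] n" for n
    by (induction n) simp_all
  then show ?thesis using H.pow_order_eq_1[of x] assms(2) by (simp add: Coset.order_def)
qed

context rational_character
begin

lemma val_in_subgroup: "level_char \<psi> \<Longrightarrow> subgroup U G \<Longrightarrow> \<tau> \<in> U \<Longrightarrow> val \<psi> \<tau> ^ card U = 1"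
  using val_pow[of \<psi> \<tau> "card U"] G.subgroup_pow_card[of U \<tau>] val_one[of \<psi>] subgroup.subset by fastforce

lemma val_root: "level_char \<psi> \<Longrightarrow> \<tau> \<in> carrier G \<Longrightarrow> val \<psi> \<tau> ^ g = 1"
proof -
  assume L: "level_char \<psi>" and t: "\<tau> \<in> carrier G"
  obtain i :: nat where "\<tau> = \<sigma> [^]\<^bsub>G\<^esub> i" using G_powers[OF t] by blast
  then have "\<tau> [^]\<^bsub>G\<^esub> g = \<sigma> [^]\<^bsub>G\<^esub> (i * g)" using sigma(1) by (simp add: G.nat_pow_pow)
  also have "\<dots> = \<one>\<^bsub>G\<^esub>" using sigma_pow_eq_1 by simp
  finally show ?thesis using val_pow[OF L t, of g] val_one[OF L] by simp
qed

text \<open>If the two characters differ at \<open>\<rho> \<in> U\<close>, translation by \<open>\<rho>\<close> multiplies the sum by a factor other than 1.\<close>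

lemma orthogonality:
  assumes L: "level_char \<psi>" "level_char \<psi>'" and U: "subgroup U G"
  shows "(\<Sum>\<tau>\<in>U. val \<psi> (inv\<^bsub>G\<^esub> \<tau>) * val \<psi>' \<tau>) = (if \<forall>\<tau>\<in>U. val \<psi> \<tau> = val \<psi>' \<tau> then of_nat (card U) else 0)"
proof -
  interpret U: subgroup U G by fact
  define t where "t = (\<lambda>\<tau>. inverse (val \<psi> \<tau>) * val \<psi>' \<tau>)"
  have e: "(\<Sum>\<tau>\<in>U. val \<psi> (inv\<^bsub>G\<^esub> \<tau>) * val \<psi>' \<tau>) = (\<Sum>\<tau>\<in>U. t \<tau>)"
    unfolding t_def by (intro sum.cong refl) (simp add: val_inv[OF L(1)])
  show ?thesis
  proof (cases "\<forall>\<tau>\<in>U. val \<psi> \<tau> = val \<psi>' \<tau>")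
    case True
    then have "(\<Sum>\<tau>\<in>U. t \<tau>) = (\<Sum>\<tau>\<in>U. 1)"
      unfolding t_def using val_nz[OF L(2)] by (intro sum.cong refl) auto
    then show ?thesis using True e by simp
  next
    case False
    then obtain \<rho> where \<rho>: "\<rho> \<in> U" "val \<psi> \<rho> \<noteq> val \<psi>' \<rho>" by blast
    have "bij_betw (\<lambda>\<tau>. \<rho> \<otimes>\<^bsub>G\<^esub> \<tau>) U U"
      by (rule bij_betw_byWitness[of _ "\<lambda>\<tau>. inv\<^bsub>G\<^esub> \<rho> \<otimes>\<^bsub>G\<^esub> \<tau>"]) (use \<rho> in \<open>auto simp: G.m_assoc[symmetric]\<close>)
    then have "(\<Sum>\<tau>\<in>U. t \<tau>) = (\<Sum>\<tau>\<in>U. t (\<rho> \<otimes>\<^bsub>G\<^esub> \<tau>))"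
      by (rule sum.reindex_bij_betw[symmetric])
    also have "\<dots> = t \<rho> * (\<Sum>\<tau>\<in>U. t \<tau>)"
      unfolding sum_distrib_left using \<rho> by (intro sum.cong refl) (simp add: t_def val_mult[OF L(1)] val_mult[OF L(2)])
    finally have "(t \<rho> - 1) * (\<Sum>\<tau>\<in>U. t \<tau>) = 0" by (simp add: algebra_simps)
    moreover have "t \<rho> \<noteq> 1"
    proof
      assume "t \<rho> = 1"
      then have "val \<psi> \<rho> * (inverse (val \<psi> \<rho>) * val \<psi>' \<rho>) = val \<psi> \<rho>" by (simp add: t_def)
      then show False using \<rho> val_nz[OF L(1), of \<rho>] by (simp add: mult.assoc[symmetric])
    qed
    ultimately have "(\<Sum>\<tau>\<in>U. t \<tau>) = 0" by simp
    then show ?thesis unfolding e if_not_P[OF False] .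
  qed
qed

text \<open>Throughout, \<open>\<psi> = \<psi>0 * \<psi>p\<close> is a term of \<open>phi\<close>, decomposed together with \<open>G_chi\<close> into parts of
  prime-to-\<open>p\<close> and of \<open>p\<close>-power order. The aim is to evaluate the semi-simple idempotent at the
  terms of \<open>chi\<close>.\<close>

context
  fixes phi \<psi> \<psi>0 \<psi>p phi0 :: "'p gal_char" and G0 H and l
  assumes phi: "phi \<in> padic_components chi" and psi: "\<psi> \<in> char_terms padic_field phi"
    and psi0: "\<psi>0 \<in> linear_chars" and psip: "\<psi>p \<in> linear_chars"
    and decomp: "\<And>\<tau>. \<tau> \<in> carrier Gab \<Longrightarrow> \<psi> \<tau> = \<psi>0 \<tau> * \<psi>p \<tau>"
    and ord0: "coprime (char_order \<psi>0) CARD('p)" and ordp: "char_order \<psi>p = CARD('p) ^ l"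
    and phi0: "\<psi>0 \<in> char_terms padic_field phi0"
    and G0: "subgroup G0 G" and H: "subgroup H G" and prod: "G0 <#>\<^bsub>G\<^esub> H = carrier G"
    and card0: "coprime (card G0) CARD('p)" and cardH: "\<exists>k. card H = CARD('p) ^ k"
begin

text \<open>Where \<open>\<psi>\<close> is trivial, \<open>\<psi>0\<close> and \<open>\<psi>p\<close> are inverse to each other; their orders being coprime, both
  are trivial.\<close>

lemma components_level: "level_char \<psi>0" "level_char \<psi>p"
proof -
  have one: "\<psi>0 \<tau> = 1 \<and> \<psi>p \<tau> = 1" if t: "\<tau> \<in> char_kernel \<psi>1" for \<tau>
  proof -
    have tG: "\<tau> \<in> carrier Gab" using t by (simp add: char_kernel_iff)
    have "\<tau> \<in> char_kernel \<psi>" using t component_terms(1)[OF phi psi] by (simp add: faithful_def)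
    then have p: "\<psi>0 \<tau> * \<psi>p \<tau> = 1" using decomp[OF tG] by (simp add: char_kernel_iff)
    have "(\<psi>0 \<tau> * \<psi>p \<tau>) ^ (CARD('p) ^ l) = 1" using p by simp
    then have "\<psi>0 \<tau> ^ (CARD('p) ^ l) = 1"
      using char_orderD(2)[OF psip tG] ordp by (simp add: power_mult_distrib)
    then have "\<psi>0 \<tau> = 1"
      using coprime_powers_eq_1[OF char_orderD(2)[OF psi0 tG] _ _ char_orderD(1)[OF psi0], of "CARD('p) ^ l"] ord0
      by simp
    then show ?thesis using p by simp
  qed
  then show "level_char \<psi>0" "level_char \<psi>p"
    using psi0 psip by (auto simp: level_char_def char_kernel_iff)
qed

lemma conj0_level: "\<theta> \<in> conjugates padic_field \<psi>0 \<Longrightarrow> level_char \<theta>"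
  using conjugates_kernel(1)[OF subfield_on_padic_field psi0, of \<theta>] components_level(1)
  by (auto simp: level_char_def conjugates_def)

lemma val_decomp: "\<tau> \<in> carrier G \<Longrightarrow> val \<psi> \<tau> = val \<psi>0 \<tau> * val \<psi>p \<tau>"
  using decomp Gab_prolong(1)[OF K_sub] by (simp add: value_at_def)

lemma val_psip_G0:
  assumes "\<tau> \<in> G0" shows "val \<psi>p \<tau> = 1"
proof -
  have t: "\<tau> \<in> carrier G" using subgroup.subset[OF G0] assms by blast
  have "val \<psi>p \<tau> ^ (CARD('p) ^ l) = 1"
    using char_orderD(2)[OF psip Gab_prolong(1)[OF K_sub t]] ordp by (simp add: value_at_def)
  then show ?thesis
    using coprime_powers_eq_1[OF _ val_in_subgroup[OF components_level(2) G0 assms], of "CARD('p) ^ l"] card0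
    by (simp add: coprime_commute)
qed

lemma val_conj0_H:
  assumes th: "\<theta> \<in> conjugates padic_field \<psi>0" and "\<tau> \<in> H" shows "val \<theta> \<tau> = 1"
proof -
  have t: "\<tau> \<in> carrier G" using subgroup.subset[OF H] assms(2) by blast
  obtain k where k: "card H = CARD('p) ^ k" using cardH by blast
  have "val \<theta> \<tau> ^ char_order \<psi>0 = 1"
    using conjugates_kernel(2)[OF subfield_on_padic_field psi0 th, of "char_order \<psi>0"] char_orderD(2)[OF psi0]
      Gab_prolong(1)[OF K_sub t] by (simp add: value_at_def)
  then show ?thesis
    using coprime_powers_eq_1[OF _ val_in_subgroup[OF conj0_level[OF th] H assms(2)] _ char_orderD(1)[OF psi0]] ord0 k
    by simp
qed

lemma conj0_ext:
  assumes th: "\<theta> \<in> conjugates padic_field \<psi>0" "\<theta>' \<in> conjugates padic_field \<psi>0"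
    and eq: "\<And>\<tau>. \<tau> \<in> G0 \<Longrightarrow> val \<theta> \<tau> = val \<theta>' \<tau>"
  shows "\<theta> = \<theta>'"
proof (rule level_char_ext[OF conj0_level[OF th(1)] conj0_level[OF th(2)]])
  fix \<tau> assume "\<tau> \<in> carrier G"
  then have "\<tau> \<in> G0 <#>\<^bsub>G\<^esub> H" using prod by simp
  then obtain a b where ab: "a \<in> G0" "b \<in> H" "\<tau> = a \<otimes>\<^bsub>G\<^esub> b" unfolding set_mult_def by blast
  then have "a \<in> carrier G" "b \<in> carrier G" using subgroup.subset[OF G0] subgroup.subset[OF H] by blast+
  then show "val \<theta> \<tau> = val \<theta>' \<tau>"
    using ab val_mult[OF conj0_level[OF th(1)]] val_mult[OF conj0_level[OF th(2)]] eq val_conj0_H[OF th(1)] val_conj0_H[OF th(2)]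
    by simp
qed

lemma conj0_member:
  assumes h: "h \<in> padic_auts"
  obtains \<theta> where "\<theta> \<in> conjugates padic_field \<psi>0" "\<And>\<tau>. \<tau> \<in> carrier Gab \<Longrightarrow> \<theta> \<tau> = h (\<psi>0 \<tau>)"
proof -
  define \<theta> where "\<theta> = (\<lambda>\<tau>\<in>carrier Gab. h (\<psi>0 \<tau>))"
  have "\<theta> \<in> linear_chars"
    unfolding \<theta>_def by (rule linear_char_image[OF psi0]) (simp_all add: padic_aut_simps[OF h])
  then have "\<theta> \<in> conjugates padic_field \<psi>0"
    unfolding conjugates_padic[OF psi0] using h by (auto simp: \<theta>_def)
  then show ?thesis using that by (simp add: \<theta>_def)
qed

text \<open>The \<open>H\<close>-component of \<open>\<sigma>\<close> has an order which divides \<open>g\<close> and is a power of \<open>p\<close>, and is killed by \<open>p^k\<close>.\<close>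

lemma sigma_power_G0:
  assumes "g = m * CARD('p) ^ k" "coprime m CARD('p)"
  shows "\<sigma> [^]\<^bsub>G\<^esub> (CARD('p) ^ k) \<in> G0"
proof -
  let ?q = "CARD('p) ^ k"
  have "\<sigma> \<in> G0 <#>\<^bsub>G\<^esub> H" using prod sigma(1) by simp
  then obtain a b where ab: "a \<in> G0" "b \<in> H" "\<sigma> = a \<otimes>\<^bsub>G\<^esub> b" unfolding set_mult_def by blast
  then have abG: "a \<in> carrier G" "b \<in> carrier G" using subgroup.subset[OF G0] subgroup.subset[OF H] by blast+
  obtain j where j: "card H = CARD('p) ^ j" using cardH by blast
  have "b [^]\<^bsub>G\<^esub> card H = \<one>\<^bsub>G\<^esub>" using G.subgroup_pow_card[OF H ab(2)] .
  then have d1: "G.ord b dvd CARD('p) ^ j" using G.pow_eq_id[OF abG(2)] j by simp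
  obtain i :: nat where i: "b = \<sigma> [^]\<^bsub>G\<^esub> i" using G_powers[OF abG(2)] by blast
  have "b [^]\<^bsub>G\<^esub> g = \<sigma> [^]\<^bsub>G\<^esub> (i * g)" unfolding i using sigma(1) by (rule G.nat_pow_pow)
  also have "\<dots> = \<one>\<^bsub>G\<^esub>" using sigma_pow_eq_1 by simp
  finally have d2: "G.ord b dvd m * ?q" using G.pow_eq_id[OF abG(2)] assms(1) by simp
  have "coprime (CARD('p) ^ j) m" using assms(2) by (simp add: coprime_commute)
  then have "coprime (G.ord b) m" using d1 by (rule coprime_divisors[OF _ dvd_refl, rotated])
  then have "G.ord b dvd ?q" using d2 by (simp add: coprime_dvd_mult_right_iff)
  then have "b [^]\<^bsub>G\<^esub> ?q = \<one>\<^bsub>G\<^esub>" using G.pow_eq_id[OF abG(2)] by simp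
  then have "\<sigma> [^]\<^bsub>G\<^esub> ?q = a [^]\<^bsub>G\<^esub> ?q" using ab abG by (simp add: G.pow_mult_distrib G.m_comm)
  moreover have "a [^]\<^bsub>G\<^esub> (n :: nat) \<in> G0" for n
    by (induction n) (simp_all add: subgroup.one_closed[OF G0] subgroup.m_closed[OF G0] ab(1))
  ultimately show ?thesis by simp
qed

text \<open>Agreement on \<open>G0\<close> with a conjugate of \<open>\<psi>0\<close> means that the values at \<open>\<sigma>^(p^k) \<in> G0\<close>, which are the
  prime-to-\<open>p\<close> parts of \<open>\<psi>'(\<sigma>)\<close> and \<open>\<psi>(\<sigma>)\<close>, are conjugate. By total ramification the values at \<open>\<sigma>\<close> are
  then conjugate as well.\<close>

lemma conj0_agree:
  assumes psi': "\<psi>' \<in> faithful"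
  shows "(\<exists>\<theta>\<in>conjugates padic_field \<psi>0. \<forall>\<tau>\<in>G0. val \<theta> \<tau> = val \<psi>' \<tau>) \<longleftrightarrow> \<psi>' \<in> char_terms padic_field phi"
proof
  note c = component_terms[OF phi psi]
  have transport: "val \<theta> \<tau> = h (val \<psi> \<tau>)"
    if "h \<in> padic_auts" "\<And>\<tau>. \<tau> \<in> carrier Gab \<Longrightarrow> \<theta> \<tau> = h (\<psi>0 \<tau>)" "\<tau> \<in> G0" for h \<theta> \<tau>
  proof -
    have t: "\<tau> \<in> carrier G" using subgroup.subset[OF G0] that(3) by blast
    have "val \<theta> \<tau> = h (val \<psi>0 \<tau>)" using that(2) Gab_prolong(1)[OF K_sub t] by (simp add: value_at_def)
    then show ?thesis using val_decomp[OF t] val_psip_G0[OF that(3)] by simp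
  qed
  {
    assume "\<psi>' \<in> char_terms padic_field phi"
    then obtain h where h: "h \<in> padic_auts" "\<And>\<tau>. \<tau> \<in> carrier Gab \<Longrightarrow> \<psi>' \<tau> = h (\<psi> \<tau>)"
      using c(3) conjugates_padic[OF faithful_level(2)[OF c(1)]] by auto
    obtain \<theta> where \<theta>: "\<theta> \<in> conjugates padic_field \<psi>0" "\<And>\<tau>. \<tau> \<in> carrier Gab \<Longrightarrow> \<theta> \<tau> = h (\<psi>0 \<tau>)"
      using conj0_member[OF h(1)] by blast
    have "val \<theta> \<tau> = val \<psi>' \<tau>" if t: "\<tau> \<in> G0" for \<tau>
    proof -
      have "\<tau> \<in> carrier G" using subgroup.subset[OF G0] t by blast
      then have "val \<psi>' \<tau> = h (val \<psi> \<tau>)" using h(2) Gab_prolong(1)[OF K_sub] by (simp add: value_at_def)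
      then show ?thesis using transport[OF h(1) \<theta>(2) t] by simp
    qed
    then show "\<exists>\<theta>\<in>conjugates padic_field \<psi>0. \<forall>\<tau>\<in>G0. val \<theta> \<tau> = val \<psi>' \<tau>" using \<theta>(1) by blast
  }
  {
    assume "\<exists>\<theta>\<in>conjugates padic_field \<psi>0. \<forall>\<tau>\<in>G0. val \<theta> \<tau> = val \<psi>' \<tau>"
    then obtain \<theta> where \<theta>: "\<theta> \<in> conjugates padic_field \<psi>0" "\<And>\<tau>. \<tau> \<in> G0 \<Longrightarrow> val \<theta> \<tau> = val \<psi>' \<tau>" by blast
    then obtain h where h: "h \<in> padic_auts" "\<And>\<tau>. \<tau> \<in> carrier Gab \<Longrightarrow> \<theta> \<tau> = h (\<psi>0 \<tau>)"
      by (auto simp: conjugates_padic[OF psi0])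
    obtain m k where mk: "g = m * CARD('p) ^ k" "coprime m CARD('p)"
      using nat_prime_power_split[OF rat_order(1) prime_CARD] .
    let ?q = "CARD('p) ^ k"
    have s: "\<sigma> [^]\<^bsub>G\<^esub> ?q \<in> G0" by (rule sigma_power_G0[OF mk])
    note L = faithful_level(1)[OF c(1)] faithful_level(1)[OF psi']
    have "h (val \<psi> \<sigma> ^ ?q) = val \<psi>' \<sigma> ^ ?q"
      using transport[OF h s] \<theta>(2)[OF s] val_pow[OF L(1) sigma(1)] val_pow[OF L(2) sigma(1)] by simp
    then have "padic_conj (val \<psi> \<sigma> ^ ?q) (val \<psi>' \<sigma> ^ ?q)" using h(1) by (auto simp: padic_conj_def)
    moreover have "prim_root (m * ?q) (val \<psi> \<sigma>)" "prim_root (m * ?q) (val \<psi>' \<sigma>)"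
      using val_faithful[OF L(1)] val_faithful[OF L(2)] c(1) psi' mk(1) by simp_all
    ultimately have "padic_conj (val \<psi> \<sigma>) (val \<psi>' \<sigma>)"
      using padic_conj_iff_prime_to_p_part mk(2) by blast
    then show "\<psi>' \<in> char_terms padic_field phi" using val_conj[OF L] c(3) by simp
  }
qed

lemma val_phi0: "val phi0 \<tau> = (\<Sum>\<theta>\<in>conjugates padic_field \<psi>0. val \<theta> \<tau>)" if "\<tau> \<in> carrier G"
proof -
  have "phi0 = conj_sum padic_field \<psi>0" using phi0 by (simp add: char_terms_def)
  then show ?thesis using Gab_prolong(1)[OF K_sub that] by (simp add: value_at_def conj_sum_def)
qed

text \<open>The trace character takes values in \<open>Q_p\<close>, and they are sums of roots of unity.\<close>

lemma val_phi0_integral: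
  assumes t: "\<tau> \<in> carrier G" shows "val phi0 \<tau> \<in> padic_ints"
proof -
  note I = adjoin_padic[OF val_psi1]
  interpret I: subring_on "adjoin padic_ints (val \<psi>1 \<sigma>)" by (rule I)
  note fin = finite_conjugates[OF subfield_on_padic_field psi0]
  show ?thesis
  proof (rule I(5))
    show "val phi0 \<tau> \<in> adjoin padic_ints (val \<psi>1 \<sigma>)"
      unfolding val_phi0[OF t] using val_root[OF conj0_level t] by (intro I.sum_in I(3))
    show "val phi0 \<tau> \<in> padic_field"
    proof (rule padic_fixed)
      fix h :: "'p padic_closure \<Rightarrow> 'p padic_closure" assume h: "h \<in> padic_auts"
      define f where "f = (\<lambda>\<theta> :: 'p gal_char. \<lambda>\<tau>\<in>carrier Gab. h (\<theta> \<tau>))"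
      have sub: "f ` conjugates padic_field \<psi>0 \<subseteq> conjugates padic_field \<psi>0"
      proof
        fix x assume "x \<in> f ` conjugates padic_field \<psi>0"
        then obtain \<theta> where \<theta>: "\<theta> \<in> conjugates padic_field \<psi>0" "x = f \<theta>" by blast
        then obtain a where a: "a \<in> padic_auts" "\<And>\<tau>. \<tau> \<in> carrier Gab \<Longrightarrow> \<theta> \<tau> = a (\<psi>0 \<tau>)"
          by (auto simp: conjugates_padic[OF psi0])
        have "\<theta> \<in> linear_chars" using \<theta>(1) by (simp add: conjugates_def)
        then have "x \<in> linear_chars"
          unfolding \<theta>(2) f_def by (rule linear_char_image) (simp_all add: padic_aut_simps[OF h])
        then show "x \<in> conjugates padic_field \<psi>0"
          unfolding conjugates_padic[OF psi0] using padic_aut_comp[OF h a(1)] a(2) \<theta>(2) by (auto simp: f_def)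
      qed
      have inj: "inj_on f (conjugates padic_field \<psi>0)"
      proof (rule inj_onI)
        fix \<theta> \<theta>' assume *: "\<theta> \<in> conjugates padic_field \<psi>0" "\<theta>' \<in> conjugates padic_field \<psi>0" "f \<theta> = f \<theta>'"
        show "\<theta> = \<theta>'"
        proof (rule linear_char_ext)
          fix \<tau> assume "\<tau> \<in> carrier Gab"
          then show "\<theta> \<tau> = \<theta>' \<tau>" using fun_cong[OF *(3), of \<tau>] padic_aut_simps(12)[OF h] by (simp add: f_def)
        qed (use * in \<open>auto simp: conjugates_def\<close>)
      qed
      have b: "bij_betw f (conjugates padic_field \<psi>0) (conjugates padic_field \<psi>0)"
        using sub inj fin by (simp add: bij_betw_def endo_inj_surj)
      have "h (val phi0 \<tau>) = (\<Sum>\<theta>\<in>conjugates padic_field \<psi>0. val (f \<theta>) \<tau>)"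
        unfolding val_phi0[OF t] using Gab_prolong(1)[OF K_sub t] by (simp add: padic_aut_simps[OF h] value_at_def f_def)
      also have "\<dots> = (\<Sum>\<theta>\<in>conjugates padic_field \<psi>0. val \<theta> \<tau>)" using b by (rule sum.reindex_bij_betw)
      finally show "h (val phi0 \<tau>) = val phi0 \<tau>" using val_phi0[OF t] by simp
    qed
  qed
qed

lemma semisimple_coeff:
  assumes "\<tau> \<in> G0"
  shows "of_padic_int (semisimple_idempotent chi G0 phi0 \<tau>) = val phi0 (inv\<^bsub>G\<^esub> \<tau>) * inverse (of_nat (card G0))"
proof -
  have "inv\<^bsub>G\<^esub> \<tau> \<in> carrier G" using subgroup.subset[OF G0] assms by blast
  then have "val phi0 (inv\<^bsub>G\<^esub> \<tau>) * inverse (of_nat (card G0)) \<in> padic_ints"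
    by (intro padic.mult_in val_phi0_integral padic.inverse_of_nat_in[OF card0])
  then show ?thesis
    using assms by (simp add: semisimple_idempotent_def divide_inverse of_padic_to_padic)
qed

lemma semisimple_value:
  assumes psi': "\<psi>' \<in> faithful"
  shows "(\<Sum>\<tau>\<in>G0. of_padic_int (semisimple_idempotent chi G0 phi0 \<tau>) * val \<psi>' \<tau>) =
    (if \<psi>' \<in> char_terms padic_field phi then 1 else 0)"
proof -
  let ?C = "conjugates padic_field \<psi>0"
  note fin = finite_conjugates[OF subfield_on_padic_field psi0]
  have G0fin: "finite G0" using subgroup.subset[OF G0] finite_G by (rule finite_subset)
  then have c0: "(of_nat (card G0) :: 'p padic_closure) \<noteq> 0" using subgroup.one_closed[OF G0] by auto
  have inG: "\<tau> \<in> G0 \<Longrightarrow> inv\<^bsub>G\<^esub> \<tau> \<in> carrier G" for \<tau> using subgroup.subset[OF G0] by blast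
  have "(\<Sum>\<tau>\<in>G0. of_padic_int (semisimple_idempotent chi G0 phi0 \<tau>) * val \<psi>' \<tau>) =
      (\<Sum>\<tau>\<in>G0. \<Sum>\<theta>\<in>?C. inverse (of_nat (card G0)) * (val \<theta> (inv\<^bsub>G\<^esub> \<tau>) * val \<psi>' \<tau>))"
    by (intro sum.cong refl) (simp add: semisimple_coeff val_phi0[OF inG] sum_distrib_left sum_distrib_right mult_ac)
  also have "\<dots> = (\<Sum>\<theta>\<in>?C. inverse (of_nat (card G0)) * (\<Sum>\<tau>\<in>G0. val \<theta> (inv\<^bsub>G\<^esub> \<tau>) * val \<psi>' \<tau>))"
    by (subst sum.swap) (simp add: sum_distrib_left)
  also have "\<dots> = (\<Sum>\<theta>\<in>?C. if \<forall>\<tau>\<in>G0. val \<theta> \<tau> = val \<psi>' \<tau> then 1 else 0)"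
    using c0 by (intro sum.cong refl) (simp add: orthogonality[OF conj0_level faithful_level(1)[OF psi'] G0])
  also have "\<dots> = of_nat (card {\<theta> \<in> ?C. \<forall>\<tau>\<in>G0. val \<theta> \<tau> = val \<psi>' \<tau>})"
    using fin by (simp add: sum.If_cases Int_def)
  also have "card {\<theta> \<in> ?C. \<forall>\<tau>\<in>G0. val \<theta> \<tau> = val \<psi>' \<tau>} = (if \<psi>' \<in> char_terms padic_field phi then 1 else 0)"
  proof (cases "\<psi>' \<in> char_terms padic_field phi")
    case True
    then obtain \<theta> where \<theta>: "\<theta> \<in> ?C" "\<forall>\<tau>\<in>G0. val \<theta> \<tau> = val \<psi>' \<tau>" using conj0_agree[OF psi'] by blast
    then have "{\<theta> \<in> ?C. \<forall>\<tau>\<in>G0. val \<theta> \<tau> = val \<psi>' \<tau>} = {\<theta>}" using conj0_ext by fastforce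
    then show ?thesis using True by simp
  next
    case False
    then have "{\<theta> \<in> ?C. \<forall>\<tau>\<in>G0. val \<theta> \<tau> = val \<psi>' \<tau>} = {}" using conj0_agree[OF psi'] by blast
    then show ?thesis unfolding if_not_P[OF False] by (simp only: card.empty)
  qed
  finally show ?thesis by simp
qed

end

end

section \<open>Group rings, their modules, and idempotents\<close>

lemma group_ring_simps:
  "f \<in> carrier (group_ring G) \<longleftrightarrow> finite {x. f x \<noteq> 0} \<and> {x. f x \<noteq> 0} \<subseteq> carrier G"
  "f \<oplus>\<^bsub>group_ring G\<^esub> h = (\<lambda>x. f x + h x)"
  "\<zero>\<^bsub>group_ring G\<^esub> = (\<lambda>_. 0)"
  "\<one>\<^bsub>group_ring G\<^esub> = gr_single \<one>\<^bsub>G\<^esub> 1"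
  by (simp_all add: group_ring_def)

lemma gr_single_closed: "x \<in> carrier G \<Longrightarrow> gr_single x a \<in> carrier (group_ring G)"
  by (auto simp: group_ring_simps gr_single_def)

lemma gr_single_add: "gr_single x (a + b) = gr_single x a \<oplus>\<^bsub>group_ring G\<^esub> gr_single x b"
  by (auto simp: group_ring_simps gr_single_def)

lemma gr_single_0: "gr_single x 0 = \<zero>\<^bsub>group_ring G\<^esub>"
  by (auto simp: group_ring_simps gr_single_def)

lemma gr_single_mult:
  "gr_single x a \<otimes>\<^bsub>group_ring G\<^esub> gr_single y b = gr_single (x \<otimes>\<^bsub>G\<^esub> y) (a * b)"
proof
  fix z
  show "(gr_single x a \<otimes>\<^bsub>group_ring G\<^esub> gr_single y b) z = gr_single (x \<otimes>\<^bsub>G\<^esub> y) (a * b) z"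
    by (subst group_ring_mult[of "{x}" "{y}"]) (auto simp: gr_single_def)
qed

lemma group_ring_induct [consumes 1, case_names zero single add]:
  assumes a: "a \<in> carrier (group_ring G :: ('g \<Rightarrow> 'r :: comm_ring_1) ring)"
    and zero: "P \<zero>\<^bsub>group_ring G\<^esub>"
    and single: "\<And>x c. x \<in> carrier G \<Longrightarrow> P (gr_single x c)"
    and add: "\<And>a b. a \<in> carrier (group_ring G) \<Longrightarrow> b \<in> carrier (group_ring G) \<Longrightarrow> P a \<Longrightarrow> P b \<Longrightarrow> P (a \<oplus>\<^bsub>group_ring G\<^esub> b)"
  shows "P a"
proof -
  have "P a" if "finite S" "{x. a x \<noteq> 0} \<subseteq> S" "S \<subseteq> carrier G" for S and a :: "'g \<Rightarrow> 'r"
    using that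
  proof (induction S arbitrary: a rule: finite_induct)
    case empty
    then have "a = \<zero>\<^bsub>group_ring G\<^esub>" by (auto simp: group_ring_simps)
    then show ?case using zero by simp
  next
    case (insert y S)
    define b where "b = a(y := 0)"
    have "P b" using insert by (intro insert.IH) (auto simp: b_def)
    moreover have "b \<in> carrier (group_ring G)"
      unfolding group_ring_simps using insert.prems insert.hyps
      by (auto simp: b_def intro: finite_subset[of _ S])
    moreover have "a = gr_single y (a y) \<oplus>\<^bsub>group_ring G\<^esub> b"
      by (auto simp: group_ring_simps gr_single_def b_def)
    moreover have "y \<in> carrier G" using insert.prems by simp
    ultimately show ?case using add[of "gr_single y (a y)" b] single gr_single_closed by metis
  qed
  then show ?thesis using a by (auto simp: group_ring_simps)
qed

lemma group_ring_finsum: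
  assumes G: "comm_group G" and "finite A"
    and "\<And>i. i \<in> A \<Longrightarrow> f i \<in> carrier (group_ring G :: ('g \<Rightarrow> 'r :: comm_ring_1) ring)"
  shows "(\<Oplus>\<^bsub>group_ring G\<^esub>i\<in>A. f i) = (\<lambda>x. \<Sum>i\<in>A. f i x)"
  using assms(2,3)
proof (induction A rule: finite_induct)
  interpret R: cring "group_ring G :: ('g \<Rightarrow> 'r) ring" by (rule cring_group_ring[OF G])
  {
    case empty
    show ?case by (simp add: group_ring_simps)
  next
    case (insert i A)
    then show ?case by (simp add: R.finsum_insert Pi_def group_ring_simps(2))
  }
qed

lemma poly_monom_induct [case_names zero monom add]:
  assumes "P 0" "\<And>c n. P (Polynomial.monom c n)" "\<And>p q. P p \<Longrightarrow> P q \<Longrightarrow> P (p + q)"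
  shows "P (p :: 'a :: comm_ring_1 poly)"
proof -
  have "P (\<Sum>i\<in>A. Polynomial.monom (poly.coeff p i) i)" if "finite A" for A
    using that by induction (auto intro: assms)
  from this[of "{..degree p}"] show ?thesis by (simp add: poly_as_sum_of_monoms)
qed

text \<open>Any upper bound \<open>n\<close> for the degree may be used, so that polynomials of different degrees can be
  compared. Distinct exponents may give the same group element, and their coefficients are added.\<close>

lemma gr_poly_apply:
  fixes f :: "'r :: comm_ring_1 poly"
  assumes G: "comm_group G" and s: "s \<in> carrier G" and n: "degree f \<le> n"
  shows "gr_poly G f s = (\<lambda>x. \<Sum>i\<le>n. if x = s [^]\<^bsub>G\<^esub> i then poly.coeff f i else 0)"
proof
  interpret G: comm_group G by fact
  fix x
  have "gr_poly G f s x = (\<Sum>i\<le>degree f. gr_single (s [^]\<^bsub>G\<^esub> i) (poly.coeff f i) x)"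
    unfolding gr_poly_def using s by (subst group_ring_finsum[OF G]) (auto intro: gr_single_closed)
  also have "\<dots> = (\<Sum>i\<le>n. gr_single (s [^]\<^bsub>G\<^esub> i) (poly.coeff f i) x)"
    using n by (intro sum.mono_neutral_left) (auto simp: gr_single_def coeff_eq_0)
  finally show "gr_poly G f s x = (\<Sum>i\<le>n. if x = s [^]\<^bsub>G\<^esub> i then poly.coeff f i else 0)"
    by (simp add: gr_single_def)
qed

context
  fixes G :: "('g, 'b) monoid_scheme" and s :: 'g
  assumes G: "comm_group G" and s: "s \<in> carrier G"
begin

interpretation G: comm_group G by (rule G)

lemma gr_poly_closed: "gr_poly G f s \<in> carrier (group_ring G :: ('g \<Rightarrow> 'r :: comm_ring_1) ring)"
proof -
  interpret R: cring "group_ring G :: ('g \<Rightarrow> 'r) ring" by (rule cring_group_ring[OF G])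
  show ?thesis unfolding gr_poly_def using s by (intro R.finsum_closed) (auto intro: gr_single_closed)
qed

lemma gr_poly_add: "gr_poly G (f + h :: 'r :: comm_ring_1 poly) s = gr_poly G f s \<oplus>\<^bsub>group_ring G\<^esub> gr_poly G h s"
proof -
  define n where "n = max (degree f) (degree h)"
  have d: "degree (f + h) \<le> n" "degree f \<le> n" "degree h \<le> n"
    using degree_add_le_max[of f h] by (auto simp: n_def)
  show ?thesis
    unfolding gr_poly_apply[OF G s d(1)] gr_poly_apply[OF G s d(2)] gr_poly_apply[OF G s d(3)] group_ring_simps(2)
    by (auto simp: sum.distrib[symmetric] fun_eq_iff intro!: sum.cong)
qed

lemma gr_poly_monom: "gr_poly G (Polynomial.monom c n :: 'r :: comm_ring_1 poly) s = gr_single (s [^]\<^bsub>G\<^esub> n) c"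
proof
  fix x
  have "gr_poly G (Polynomial.monom c n) s x = (\<Sum>i\<le>n. if i = n then (if x = s [^]\<^bsub>G\<^esub> i then c else 0) else 0)"
    unfolding gr_poly_apply[OF G s degree_monom_le] by (intro sum.cong refl) auto
  then show "gr_poly G (Polynomial.monom c n) s x = gr_single (s [^]\<^bsub>G\<^esub> n) c x"
    by (simp add: gr_single_def)
qed

lemma gr_poly_0: "gr_poly G (0 :: 'r :: comm_ring_1 poly) s = \<zero>\<^bsub>group_ring G\<^esub>"
  using gr_poly_monom[of "0 :: 'r" 0] by (simp add: gr_single_0[of _ G])

lemma gr_poly_mult: "gr_poly G (f * h :: 'r :: comm_ring_1 poly) s = gr_poly G f s \<otimes>\<^bsub>group_ring G\<^esub> gr_poly G h s"
proof -
  interpret R: cring "group_ring G :: ('g \<Rightarrow> 'r) ring" by (rule cring_group_ring[OF G])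
  show ?thesis
  proof (induction f rule: poly_monom_induct)
    case zero
    show ?case by (simp add: gr_poly_0 gr_poly_closed)
  next
    case (monom c n)
    show ?case
    proof (induction h rule: poly_monom_induct)
      case zero
      show ?case by (simp add: gr_poly_0 gr_poly_closed)
    next
      case (monom d m)
      show ?case using s by (simp add: mult_monom gr_poly_monom gr_single_mult G.nat_pow_mult)
    next
      case (add p q)
      then show ?case by (simp add: distrib_left gr_poly_add gr_poly_closed R.r_distr)
    qed
  next
    case (add p q)
    then show ?case by (simp add: distrib_right gr_poly_add gr_poly_closed R.l_distr)
  qed
qed

lemma gr_poly_1: "gr_poly G (1 :: 'r :: comm_ring_1 poly) s = \<one>\<^bsub>group_ring G\<^esub>"
  using gr_poly_monom[of 1 0] by (simp add: group_ring_simps(4))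

lemma gr_poly_sum:
  "gr_poly G (\<Sum>i\<in>A. f i :: 'r :: comm_ring_1 poly) s = (\<Oplus>\<^bsub>group_ring G\<^esub>i\<in>A. gr_poly G (f i) s)" if "finite A"
proof -
  interpret R: cring "group_ring G :: ('g \<Rightarrow> 'r) ring" by (rule cring_group_ring[OF G])
  show ?thesis using that by induction (simp_all add: gr_poly_0 gr_poly_add R.finsum_insert Pi_def gr_poly_closed)
qed

end

text \<open>An automorphism of \<open>K\<close> acts on \<open>M K\<close> through a chosen prolongation. Prolongation is not a homomorphism,
  but two choices differ by an element of \<open>Gal(Qab/K)\<close>, which acts trivially; this makes \<open>M K\<close> a
  module over the group ring of \<open>Gal(K/Q)\<close>.\<close>

locale family_level =
  fixes M :: "complex set \<Rightarrow> ('p :: prime_card, 'm) gal_module" and K :: "complex set"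
  assumes family: "galois_family M" and K: "K \<in> abelian_number_fields"
begin

abbreviation N where "N \<equiv> level_module M K"
abbreviation G where "G \<equiv> galois_group K \<rat>"

lemmas K_sub = abelian_number_fieldsD(1,2)[OF K]

sublocale MK: Module.module "group_ring Gab" "M K"
  using family K by (simp add: galois_family_def)

sublocale G: comm_group G by (rule comm_group_level[OF K_sub])

lemma trivial_action: "\<tau> \<in> carrier (galois_group Qab K) \<Longrightarrow> x \<in> carrier (M K) \<Longrightarrow> gr_single \<tau> 1 \<odot>\<^bsub>M K\<^esub> x = x"
  using family K by (auto simp: galois_family_def)

lemma level_simps:
  "carrier N = carrier (M K)" "x \<oplus>\<^bsub>N\<^esub> y = x \<oplus>\<^bsub>M K\<^esub> y" "\<zero>\<^bsub>N\<^esub> = \<zero>\<^bsub>M K\<^esub>"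
  "a \<odot>\<^bsub>N\<^esub> x = (\<Oplus>\<^bsub>M K\<^esub>\<sigma>\<in>carrier G. gr_single (prolong K \<sigma>) (a \<sigma>) \<odot>\<^bsub>M K\<^esub> x)"
  by (simp_all add: level_module_def with_scalars_def)

lemma single_closed: "\<sigma> \<in> carrier G \<Longrightarrow> gr_single (prolong K \<sigma>) (c :: 'p padic_int) \<in> carrier (group_ring Gab)"
  using Gab_prolong(1)[OF K_sub] by (rule gr_single_closed)

lemma smult_single:
  assumes "\<sigma> \<in> carrier G" "x \<in> carrier (M K)"
  shows "gr_single \<sigma> c \<odot>\<^bsub>N\<^esub> x = gr_single (prolong K \<sigma>) c \<odot>\<^bsub>M K\<^esub> x"
proof -
  have "gr_single \<sigma> c \<odot>\<^bsub>N\<^esub> x = (\<Oplus>\<^bsub>M K\<^esub>\<tau>\<in>carrier G. if \<sigma> = \<tau> then gr_single (prolong K \<tau>) c \<odot>\<^bsub>M K\<^esub> x else \<zero>\<^bsub>M K\<^esub>)"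
    unfolding level_simps using assms single_closed
    by (intro MK.M.finsum_cong') (auto simp: gr_single_def[of \<sigma>] gr_single_0[of _ Gab])
  also have "\<dots> = gr_single (prolong K \<sigma>) c \<odot>\<^bsub>M K\<^esub> x"
    using assms finite_level[OF K] single_closed
    by (intro MK.M.add.finprod_singleton) auto
  finally show ?thesis .
qed

lemma level_add: "a \<in> carrier (group_ring G) \<Longrightarrow> b \<in> carrier (group_ring G) \<Longrightarrow> x \<in> carrier N \<Longrightarrow>
    (a \<oplus>\<^bsub>group_ring G\<^esub> b) \<odot>\<^bsub>N\<^esub> x = a \<odot>\<^bsub>N\<^esub> x \<oplus>\<^bsub>N\<^esub> b \<odot>\<^bsub>N\<^esub> x"
proof -
  assume x: "x \<in> carrier N"
  have "(a \<oplus>\<^bsub>group_ring G\<^esub> b) \<odot>\<^bsub>N\<^esub> x = (\<Oplus>\<^bsub>M K\<^esub>\<sigma>\<in>carrier G.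
      gr_single (prolong K \<sigma>) (a \<sigma>) \<odot>\<^bsub>M K\<^esub> x \<oplus>\<^bsub>M K\<^esub> gr_single (prolong K \<sigma>) (b \<sigma>) \<odot>\<^bsub>M K\<^esub> x)"
    unfolding level_simps group_ring_simps(2) using x single_closed
    by (intro MK.M.finsum_cong') (auto simp: gr_single_add[of _ _ _ Gab] MK.smult_l_distr level_simps)
  also have "\<dots> = a \<odot>\<^bsub>N\<^esub> x \<oplus>\<^bsub>N\<^esub> b \<odot>\<^bsub>N\<^esub> x"
    unfolding level_simps using x single_closed by (intro MK.M.finsum_addf) (auto simp: level_simps)
  finally show ?thesis .
qed

lemma level_closed: "a \<in> carrier (group_ring G) \<Longrightarrow> x \<in> carrier N \<Longrightarrow> a \<odot>\<^bsub>N\<^esub> x \<in> carrier N"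
  using single_closed unfolding level_simps by (intro MK.M.finsum_closed) auto

lemma level_right_add: "x \<in> carrier N \<Longrightarrow> y \<in> carrier N \<Longrightarrow> a \<odot>\<^bsub>N\<^esub> (x \<oplus>\<^bsub>N\<^esub> y) = a \<odot>\<^bsub>N\<^esub> x \<oplus>\<^bsub>N\<^esub> a \<odot>\<^bsub>N\<^esub> y"
proof -
  assume x: "x \<in> carrier N" "y \<in> carrier N"
  have "a \<odot>\<^bsub>N\<^esub> (x \<oplus>\<^bsub>N\<^esub> y) = (\<Oplus>\<^bsub>M K\<^esub>\<sigma>\<in>carrier G.
      gr_single (prolong K \<sigma>) (a \<sigma>) \<odot>\<^bsub>M K\<^esub> x \<oplus>\<^bsub>M K\<^esub> gr_single (prolong K \<sigma>) (a \<sigma>) \<odot>\<^bsub>M K\<^esub> y)"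
    unfolding level_simps using x single_closed
    by (intro MK.M.finsum_cong') (auto simp: MK.smult_r_distr level_simps)
  also have "\<dots> = a \<odot>\<^bsub>N\<^esub> x \<oplus>\<^bsub>N\<^esub> a \<odot>\<^bsub>N\<^esub> y"
    unfolding level_simps using x single_closed by (intro MK.M.finsum_addf) (auto simp: level_simps)
  finally show ?thesis .
qed

lemma level_zero: "x \<in> carrier N \<Longrightarrow> \<zero>\<^bsub>group_ring G\<^esub> \<odot>\<^bsub>N\<^esub> x = \<zero>\<^bsub>N\<^esub>"
  unfolding level_simps group_ring_simps(3)
  by (intro MK.M.add.finprod_one_eqI) (simp add: gr_single_0[of _ Gab])

lemma abelian_group_N: "abelian_group N"
proof (rule abelian_groupI)
  show "\<exists>y\<in>carrier N. y \<oplus>\<^bsub>N\<^esub> x = \<zero>\<^bsub>N\<^esub>" if "x \<in> carrier N" for x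
    using that by (intro bexI[of _ "\<ominus>\<^bsub>M K\<^esub> x"]) (auto simp: level_simps MK.M.l_neg)
qed (auto simp: level_simps MK.M.a_ac)

lemma level_zero_right: "a \<in> carrier (group_ring G) \<Longrightarrow> a \<odot>\<^bsub>N\<^esub> \<zero>\<^bsub>N\<^esub> = \<zero>\<^bsub>N\<^esub>"
  unfolding level_simps
  by (intro MK.M.add.finprod_one_eqI) (auto intro: MK.smult_r_null single_closed)

lemma prolong_mult_action:
  assumes st: "\<sigma> \<in> carrier G" "\<tau> \<in> carrier G" and x: "x \<in> carrier (M K)"
  shows "gr_single (prolong K \<sigma> \<otimes>\<^bsub>Gab\<^esub> prolong K \<tau>) c \<odot>\<^bsub>M K\<^esub> x = gr_single (prolong K (\<sigma> \<otimes>\<^bsub>G\<^esub> \<tau>)) c \<odot>\<^bsub>M K\<^esub> x"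
proof -
  interpret Gab: comm_group Gab by (rule comm_group_Gab)
  define u where "u = prolong K \<sigma> \<otimes>\<^bsub>Gab\<^esub> prolong K \<tau>"
  define v where "v = prolong K (\<sigma> \<otimes>\<^bsub>G\<^esub> \<tau>)"
  note p = Gab_prolong[OF K_sub st(1)] Gab_prolong[OF K_sub st(2)] Gab_prolong[OF K_sub G.m_closed[OF st]]
  have uv: "u \<in> carrier Gab" "v \<in> carrier Gab" using p by (simp_all add: u_def v_def)
  have eq: "restrict u K = restrict v K"
    unfolding u_def v_def restrict_mult[OF K_sub p(1,3)] using p by simp
  have "v y = u y" if "y \<in> K" for y using fun_cong[OF eq, of y] that by simp
  then have k: "inv\<^bsub>Gab\<^esub> v \<otimes>\<^bsub>Gab\<^esub> u \<in> carrier (galois_group Qab K)" by (rule restrict_eq_imp[OF K_sub uv(2,1)])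
  then have kG: "inv\<^bsub>Gab\<^esub> v \<otimes>\<^bsub>Gab\<^esub> u \<in> carrier Gab" using uv by simp
  have "gr_single u c = gr_single v c \<otimes>\<^bsub>group_ring Gab\<^esub> gr_single (inv\<^bsub>Gab\<^esub> v \<otimes>\<^bsub>Gab\<^esub> u) 1"
    using uv by (simp add: gr_single_mult Gab.m_assoc[symmetric])
  then have "gr_single u c \<odot>\<^bsub>M K\<^esub> x = gr_single v c \<odot>\<^bsub>M K\<^esub> (gr_single (inv\<^bsub>Gab\<^esub> v \<otimes>\<^bsub>Gab\<^esub> u) 1 \<odot>\<^bsub>M K\<^esub> x)"
    using MK.smult_assoc1[OF gr_single_closed[OF uv(2)] gr_single_closed[OF kG] x] by simp
  then show ?thesis using trivial_action[OF k x] by (simp add: u_def v_def)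
qed

lemma level_assoc:
  assumes a: "a \<in> carrier (group_ring G)" and b: "b \<in> carrier (group_ring G)" and x: "x \<in> carrier N"
  shows "(a \<otimes>\<^bsub>group_ring G\<^esub> b) \<odot>\<^bsub>N\<^esub> x = a \<odot>\<^bsub>N\<^esub> (b \<odot>\<^bsub>N\<^esub> x)"
proof -
  interpret R: cring "group_ring G :: (_ \<Rightarrow> 'p padic_int) ring" by (rule cring_group_ring[OF G.comm_group_axioms])
  interpret A: abelian_group N by (rule abelian_group_N)
  show ?thesis
    using a
  proof (induction a rule: group_ring_induct)
    case zero
    show ?case using level_zero[OF level_closed[OF b x]] level_zero[OF x] b by simp
  next
    case (add a1 a2)
    then show ?case
      using b x by (simp add: R.l_distr level_add level_closed)
  next
    case (single \<sigma> c)
    note sc = gr_single_closed[OF single, of c]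
    show ?case
      using b
    proof (induction b rule: group_ring_induct)
      case zero
      show ?case using sc by (simp add: level_zero[OF x] level_zero_right[OF sc])
    next
      case (add b1 b2)
      then show ?case
        using sc x by (simp add: R.r_distr level_add level_closed level_right_add)
    next
      case (single \<tau> d)
      have x': "x \<in> carrier (M K)" using x by (simp add: level_simps)
      have y: "gr_single (prolong K \<tau>) d \<odot>\<^bsub>M K\<^esub> x \<in> carrier (M K)"
        using single_closed[OF single] x' by simp
      have "(gr_single \<sigma> c \<otimes>\<^bsub>group_ring G\<^esub> gr_single \<tau> d) \<odot>\<^bsub>N\<^esub> x = gr_single (prolong K (\<sigma> \<otimes>\<^bsub>G\<^esub> \<tau>)) (c * d) \<odot>\<^bsub>M K\<^esub> x"
        using \<open>\<sigma> \<in> carrier G\<close> single x' by (simp add: gr_single_mult smult_single)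
      also have "\<dots> = gr_single (prolong K \<sigma> \<otimes>\<^bsub>Gab\<^esub> prolong K \<tau>) (c * d) \<odot>\<^bsub>M K\<^esub> x"
        using prolong_mult_action[OF \<open>\<sigma> \<in> carrier G\<close> single x'] by simp
      also have "\<dots> = gr_single (prolong K \<sigma>) c \<odot>\<^bsub>M K\<^esub> (gr_single (prolong K \<tau>) d \<odot>\<^bsub>M K\<^esub> x)"
        unfolding gr_single_mult[symmetric]
        using MK.smult_assoc1[OF single_closed[OF \<open>\<sigma> \<in> carrier G\<close>] single_closed[OF single] x'] .
      also have "\<dots> = gr_single \<sigma> c \<odot>\<^bsub>N\<^esub> (gr_single \<tau> d \<odot>\<^bsub>N\<^esub> x)"
        using smult_single[OF \<open>\<sigma> \<in> carrier G\<close> y] smult_single[OF single x'] by simp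
      finally show ?case .
    qed
  qed
qed

lemma level_one: "x \<in> carrier N \<Longrightarrow> \<one>\<^bsub>group_ring G\<^esub> \<odot>\<^bsub>N\<^esub> x = x"
proof -
  assume "x \<in> carrier N"
  then have x: "x \<in> carrier (M K)" by (simp add: level_simps)
  note p = Gab_prolong[OF K_sub G.one_closed]
  have "prolong K \<one>\<^bsub>G\<^esub> y = y" if "y \<in> K" for y
    using fun_cong[OF p(2), of y] that galois_group_simps(3)[OF K_sub(1), of \<rat>] by simp
  then have "prolong K \<one>\<^bsub>G\<^esub> \<in> carrier (galois_group Qab K)" using p(1) by (simp add: carrier_Gab)
  then show ?thesis
    unfolding group_ring_simps(4) using smult_single[OF G.one_closed x] trivial_action x by simp
qed

theorem level_module: "Module.module (group_ring G) N"
  using level_closed level_add level_right_add level_assoc level_one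
  by (intro Module.moduleI cring_group_ring[OF G.comm_group_axioms] abelian_group_N) auto

end

text \<open>The inverse of the summation map sends \<open>x\<close> to the family of its images under the projections
  \<open>e i\<close>.\<close>

lemma direct_sum_idempotents:
  assumes Q: "abelian_group Q" and I: "finite I"
    and S: "\<And>i. i \<in> I \<Longrightarrow> S i \<subseteq> carrier Q"
    and e: "\<And>i x. i \<in> I \<Longrightarrow> x \<in> carrier Q \<Longrightarrow> e i x \<in> S i"
      "\<And>i x y. i \<in> I \<Longrightarrow> x \<in> carrier Q \<Longrightarrow> y \<in> carrier Q \<Longrightarrow> e i (x \<oplus>\<^bsub>Q\<^esub> y) = e i x \<oplus>\<^bsub>Q\<^esub> e i y"
      "\<And>i x. i \<in> I \<Longrightarrow> x \<in> S i \<Longrightarrow> e i x = x"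
      "\<And>i j x. i \<in> I \<Longrightarrow> j \<in> I \<Longrightarrow> i \<noteq> j \<Longrightarrow> x \<in> S j \<Longrightarrow> e i x = \<zero>\<^bsub>Q\<^esub>"
      "\<And>x. x \<in> carrier Q \<Longrightarrow> (\<Oplus>\<^bsub>Q\<^esub>i\<in>I. e i x) = x"
  shows "bij_betw (\<lambda>f. \<Oplus>\<^bsub>Q\<^esub>i\<in>I. f i) (\<Pi>\<^sub>E i\<in>I. S i) (carrier Q)"
proof -
  interpret Q: abelian_group Q by fact
  have e0: "e i \<zero>\<^bsub>Q\<^esub> = \<zero>\<^bsub>Q\<^esub>" if "i \<in> I" for i
  proof -
    have c: "e i \<zero>\<^bsub>Q\<^esub> \<in> carrier Q" using e(1)[OF that Q.zero_closed] S[OF that] by blast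
    have "e i (\<zero>\<^bsub>Q\<^esub> \<oplus>\<^bsub>Q\<^esub> \<zero>\<^bsub>Q\<^esub>) = e i \<zero>\<^bsub>Q\<^esub> \<oplus>\<^bsub>Q\<^esub> e i \<zero>\<^bsub>Q\<^esub>"
      by (rule e(2)[OF that Q.zero_closed Q.zero_closed])
    then have d: "e i \<zero>\<^bsub>Q\<^esub> \<oplus>\<^bsub>Q\<^esub> e i \<zero>\<^bsub>Q\<^esub> = e i \<zero>\<^bsub>Q\<^esub>"
      by (simp only: Q.l_zero[OF Q.zero_closed])
    show ?thesis by (rule iffD1[OF Q.add.l_cancel_one[OF c c] d])
  qed
  have hom: "e i (\<Oplus>\<^bsub>Q\<^esub>j\<in>J. f j) = (\<Oplus>\<^bsub>Q\<^esub>j\<in>J. e i (f j))"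
    if i: "i \<in> I" and J: "finite J" "\<And>j. j \<in> J \<Longrightarrow> f j \<in> carrier Q" for i J f
    using J
  proof (induction J rule: finite_induct)
    case empty
    then show ?case using e0[OF i] by simp
  next
    case (insert j J)
    have fc: "f k \<in> carrier Q" "e i (f k) \<in> carrier Q" if "k \<in> insert j J" for k
      using subsetD[OF S[OF i] e(1)[OF i]] insert.prems[OF that] by auto
    have sc: "(\<Oplus>\<^bsub>Q\<^esub>k\<in>J. f k) \<in> carrier Q" using fc by (intro Q.finsum_closed) auto
    have IH: "e i (\<Oplus>\<^bsub>Q\<^esub>k\<in>J. f k) = (\<Oplus>\<^bsub>Q\<^esub>k\<in>J. e i (f k))" using insert by simp
    have "(\<Oplus>\<^bsub>Q\<^esub>k\<in>insert j J. f k) = f j \<oplus>\<^bsub>Q\<^esub> (\<Oplus>\<^bsub>Q\<^esub>k\<in>J. f k)"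
      "(\<Oplus>\<^bsub>Q\<^esub>k\<in>insert j J. e i (f k)) = e i (f j) \<oplus>\<^bsub>Q\<^esub> (\<Oplus>\<^bsub>Q\<^esub>k\<in>J. e i (f k))"
      using insert.hyps fc by (auto intro!: Q.finsum_insert)
    then show ?case using e(2)[OF i fc(1) sc] IH by simp
  qed
  have comp: "e i (\<Oplus>\<^bsub>Q\<^esub>j\<in>I. f j) = f i" if f: "f \<in> (\<Pi>\<^sub>E i\<in>I. S i)" and i: "i \<in> I" for f i
  proof -
    have fc: "f j \<in> S j" "f j \<in> carrier Q" if "j \<in> I" for j using f S that by auto
    have "e i (\<Oplus>\<^bsub>Q\<^esub>j\<in>I. f j) = (\<Oplus>\<^bsub>Q\<^esub>j\<in>I. e i (f j))" by (rule hom[OF i I fc(2)])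
    also have "\<dots> = (\<Oplus>\<^bsub>Q\<^esub>j\<in>I. if i = j then f j else \<zero>\<^bsub>Q\<^esub>)"
      using e(3)[OF i] e(4)[OF i] fc by (intro Q.finsum_cong') auto
    also have "\<dots> = f i" using i I fc by (intro Q.add.finprod_singleton) auto
    finally show ?thesis .
  qed
  show ?thesis
  proof (rule bij_betw_byWitness[of _ "\<lambda>x. \<lambda>i\<in>I. e i x"])
    show "\<forall>f\<in>\<Pi>\<^sub>E i\<in>I. S i. (\<lambda>i\<in>I. e i (\<Oplus>\<^bsub>Q\<^esub>j\<in>I. f j)) = f"
      using comp by (auto simp: fun_eq_iff PiE_def extensional_def)
    show "\<forall>x\<in>carrier Q. (\<Oplus>\<^bsub>Q\<^esub>i\<in>I. (\<lambda>i\<in>I. e i x) i) = x"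
    proof
      fix x assume x: "x \<in> carrier Q"
      have "(\<Oplus>\<^bsub>Q\<^esub>i\<in>I. (\<lambda>i\<in>I. e i x) i) = (\<Oplus>\<^bsub>Q\<^esub>i\<in>I. e i x)"
        using e(1) S x by (intro Q.finsum_cong') auto
      then show "(\<Oplus>\<^bsub>Q\<^esub>i\<in>I. (\<lambda>i\<in>I. e i x) i) = x" using e(5)[OF x] by simp
    qed
    show "(\<lambda>f. \<Oplus>\<^bsub>Q\<^esub>i\<in>I. f i) ` (\<Pi>\<^sub>E i\<in>I. S i) \<subseteq> carrier Q"
    proof (rule image_subsetI)
      fix f assume "f \<in> (\<Pi>\<^sub>E i\<in>I. S i)"
      then show "(\<Oplus>\<^bsub>Q\<^esub>i\<in>I. f i) \<in> carrier Q" using S by (intro Q.finsum_closed) auto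
    qed
    show "(\<lambda>x. \<lambda>i\<in>I. e i x) ` carrier Q \<subseteq> (\<Pi>\<^sub>E i\<in>I. S i)"
      using e(1) by auto
  qed
qed

section \<open>Evaluation of p-adic integral polynomials\<close>

definition ev :: "'p :: prime_card padic_int poly \<Rightarrow> 'p padic_closure \<Rightarrow> 'p padic_closure"
  where "ev f z = poly (map_poly of_padic_int f) z"

lemma map_of_padic_simps:
  "map_poly of_padic_int (f + h) = map_poly of_padic_int f + map_poly of_padic_int h"
  "map_poly of_padic_int (f - h) = map_poly of_padic_int f - map_poly of_padic_int h"
  "map_poly of_padic_int (f * h) = map_poly of_padic_int f * map_poly of_padic_int h"
  by (rule poly_eqI, simp add: coeff_map_poly coeff_mult of_padic_sum)+

lemma ev_simps:
  "ev (f + h) z = ev f z + ev h z" "ev (f - h) z = ev f z - ev h z" "ev (f * h) z = ev f z * ev h z"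
  "ev (Polynomial.monom c n) z = of_padic_int c * z ^ n" "ev 0 z = 0" "ev 1 z = 1"
  by (simp_all add: ev_def map_of_padic_simps map_poly_monom poly_monom)

lemma ev_sum: "ev (\<Sum>i\<in>A. f i) z = (\<Sum>i\<in>A. ev (f i) z)"
  by (induction A rule: infinite_finite_induct) (simp_all add: ev_simps)

lemma map_of_padic_inj: "map_poly of_padic_int f = map_poly of_padic_int h \<Longrightarrow> f = h"
  by (simp add: poly_eq_iff coeff_map_poly)

lemma map_of_padic_polys: "map_poly of_padic_int f \<in> polys padic_ints"
  by (simp add: polys_def coeff_map_poly)

lemma polys_padic_lift:
  assumes "f \<in> polys padic_ints"
  obtains h where "map_poly of_padic_int h = f"
proof -
  have "to_padic_int (0 :: 'a padic_closure) = 0" using to_padic_of_padic[of 0] by simp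
  then have "map_poly of_padic_int (map_poly to_padic_int f) = f"
    by (intro poly_eqI) (simp add: coeff_map_poly of_padic_to_padic[OF polysD[OF assms]])
  then show ?thesis by (rule that)
qed

lemma adjoin_ev: "adjoin padic_ints z = range (\<lambda>f. ev f z)"
proof (intro equalityI subsetI)
  fix x assume "x \<in> adjoin padic_ints z"
  then obtain f where f: "f \<in> polys padic_ints" "x = poly f z" by (auto simp: adjoin_def)
  obtain h where "map_poly of_padic_int h = f" using polys_padic_lift[OF f(1)] .
  then have "x = ev h z" by (simp add: f(2) ev_def)
  then show "x \<in> range (\<lambda>f. ev f z)" by blast
next
  fix x assume "x \<in> range (\<lambda>f. ev f z)"
  then obtain h where "x = poly (map_poly of_padic_int h) z" by (auto simp: ev_def)
  then show "x \<in> adjoin padic_ints z" using map_of_padic_polys[of h] by (auto simp: adjoin_def)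
qed

text \<open>Divide by the monic polynomial \<open>P\<close> over the \<open>p\<close>-adic integers. The remainder vanishes at all elements
  of \<open>S\<close> and has degree less than their number.\<close>

lemma vanishing_dvd:
  assumes S: "finite S" and P: "map_poly of_padic_int P = (\<Prod>y\<in>S. [:- y, 1:])"
    and f: "\<And>y. y \<in> S \<Longrightarrow> ev f y = 0"
  shows "P dvd f"
proof -
  let ?P = "\<Prod>y\<in>S. [:- y, 1:]"
  have PR: "?P \<in> polys padic_ints" using map_of_padic_polys[of P] P by simp
  have lc: "lead_coeff ?P = 1" by (simp add: lead_coeff_prod)
  obtain d r where dr: "d \<in> polys padic_ints" "r \<in> polys padic_ints" "map_poly of_padic_int f = ?P * d + r"
    "r = 0 \<or> degree r < degree ?P"
    using padic.polys_monic_division[OF PR lc map_of_padic_polys] .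
  have deg: "degree ?P = card S" by (subst degree_prod_eq_sum_degree) auto
  have "r = 0"
  proof (rule ccontr)
    assume r: "r \<noteq> 0"
    have "poly r y = 0" if "y \<in> S" for y
      using f[OF that] poly_prod_roots[OF S, of y] that unfolding ev_def dr(3) by simp
    then have "card S \<le> card {y. poly r y = 0}"
      using poly_roots_finite[OF r] by (intro card_mono) auto
    also have "\<dots> \<le> degree r" using card_poly_roots_bound[OF r] .
    finally show False using dr(4) r deg by simp
  qed
  obtain h where h: "map_poly of_padic_int h = d" using polys_padic_lift[OF dr(1)] .
  have "f = P * h" by (rule map_of_padic_inj) (simp add: map_of_padic_simps P h dr(3) \<open>r = 0\<close>)
  then show ?thesis by simp
qed

context rational_character
begin

lemma finite_roots_of: "phi \<in> padic_components chi \<Longrightarrow> finite (roots_of phi)"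
  using finite_subset[OF _ finite_prim_roots[OF rat_order(1)]] roots_of_prim by blast

lemma vanishing_dvd_rat: "(\<And>y. prim_root g y \<Longrightarrow> ev f y = 0) \<Longrightarrow> rat_poly chi dvd f"
  using vanishing_dvd[OF finite_prim_roots[OF rat_order(1)], of "rat_poly chi" f] rat_poly_eq
  unfolding cyc_def by simp

lemma vanishing_dvd_padic:
  "phi \<in> padic_components chi \<Longrightarrow> (\<And>y. y \<in> roots_of phi \<Longrightarrow> ev f y = 0) \<Longrightarrow> padic_poly chi \<sigma> phi dvd f"
  using vanishing_dvd[OF finite_roots_of padic_poly_eq] by blast

lemma ev_padic_poly: "phi \<in> padic_components chi \<Longrightarrow> y \<in> roots_of phi \<Longrightarrow> ev (padic_poly chi \<sigma> phi) y = 0"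
  unfolding ev_def padic_poly_eq using poly_prod_roots[OF finite_roots_of] by blast

lemma ev_rat_poly: "prim_root g y \<Longrightarrow> ev (rat_poly chi) y = 0"
  unfolding ev_def rat_poly_eq cyc_def using poly_prod_roots[OF finite_prim_roots[OF rat_order(1)], of y] by simp

lemma padic_dvd_rat: "phi \<in> padic_components chi \<Longrightarrow> padic_poly chi \<sigma> phi dvd rat_poly chi"
  by (rule vanishing_dvd_padic) (auto intro: ev_rat_poly roots_of_prim)

text \<open>Vanishing at a single root of \<open>P_phi\<close> is inherited by its conjugates.\<close>

lemma vanishing_conj:
  assumes "phi \<in> padic_components chi" "\<psi> \<in> char_terms padic_field phi" "ev f (val \<psi> \<sigma>) = 0"
  shows "padic_poly chi \<sigma> phi dvd f"
proof (rule vanishing_dvd_padic[OF assms(1)])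
  fix y assume "y \<in> roots_of phi"
  then obtain h where h: "h \<in> padic_auts" "y = h (val \<psi> \<sigma>)"
    using component_terms(4)[OF assms(1,2)] by (auto simp: orbit_def padic_conj_def)
  have "map_poly of_padic_int f \<in> polys padic_field"
    using map_of_padic_polys polys_mono[OF padic.RK] by blast
  then have "ev f y = h (ev f (val \<psi> \<sigma>))"
    unfolding ev_def h(2) by (rule padic_aut_poly[OF h(1), symmetric])
  then show "ev f y = 0" using assms(3) padic_aut_simps(1)[OF h(1)] by simp
qed

text \<open>Such a polynomial in \<open>\<sigma>\<close> acts on a module killed by \<open>P_chi(\<sigma>)\<close> as the projection to the
  \<open>phi\<close>-part. It is not unique: only its values at the primitive roots matter.\<close>

definition projector :: "'p gal_char \<Rightarrow> 'p padic_int poly \<Rightarrow> bool"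
  where "projector phi f \<longleftrightarrow> (\<forall>y. prim_root g y \<longrightarrow> ev f y = (if y \<in> roots_of phi then 1 else 0))"

lemma projector_exists:
  assumes phi: "phi \<in> padic_components chi"
  obtains f where "projector phi f"
proof -
  obtain \<psi> where psi: "\<psi> \<in> char_terms padic_field phi" using component_nonempty[OF phi] by blast
  note c = component_terms[OF phi psi]
  have z: "prim_root g (val \<psi> \<sigma>)" using val_faithful[OF faithful_level(1)[OF c(1)]] c(1) by blast
  obtain f where f: "f \<in> polys padic_ints"
    "\<And>y. prim_root g y \<Longrightarrow> poly f y = (if padic_conj (val \<psi> \<sigma>) y then 1 else 0)"
    using idempotent_polynomial[OF z] by blast
  obtain h where "map_poly of_padic_int h = f" using polys_padic_lift[OF f(1)] .
  then have "projector phi h"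
    using f(2) by (simp add: projector_def ev_def c(4) orbit_def)
  then show ?thesis by (rule that)
qed

text \<open>Since \<open>G_chi\<close> is cyclic, every element of its group ring is a polynomial in \<open>\<sigma>\<close>. This replaces the group
  ring by \<open>Z_p[X]\<close> in all that follows.\<close>

definition lift :: "((complex \<Rightarrow> complex) \<Rightarrow> 'p padic_int) \<Rightarrow> 'p padic_int poly"
  where "lift a = (\<Sum>\<tau>\<in>carrier G. Polynomial.monom (a \<tau>) (SOME i. \<tau> = \<sigma> [^]\<^bsub>G\<^esub> (i :: nat)))"

lemma idx: "\<tau> \<in> carrier G \<Longrightarrow> \<sigma> [^]\<^bsub>G\<^esub> (SOME i :: nat. \<tau> = \<sigma> [^]\<^bsub>G\<^esub> i) = \<tau>"
  using someI_ex[OF G_powers[of \<tau>]] by simp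

abbreviation \<gamma> where "\<gamma> f \<equiv> gr_poly G f \<sigma>"

lemma lift_gr_poly:
  assumes "a \<in> carrier (group_ring G)"
  shows "\<gamma> (lift a) = a"
proof -
  have c: "gr_single \<tau> (a \<tau>) \<in> carrier (group_ring G)" if "\<tau> \<in> carrier G" for \<tau>
    by (rule gr_single_closed[OF that])
  have "\<gamma> (lift a) = (\<Oplus>\<^bsub>group_ring G\<^esub>\<tau>\<in>carrier G. gr_single \<tau> (a \<tau>))"
  proof -
    interpret R: cring "group_ring G :: (_ \<Rightarrow> 'p padic_int) ring" by (rule cring_group_ring[OF comm_group_G])
    have "\<gamma> (lift a) = (\<Oplus>\<^bsub>group_ring G\<^esub>\<tau>\<in>carrier G. \<gamma> (Polynomial.monom (a \<tau>) (SOME i. \<tau> = \<sigma> [^]\<^bsub>G\<^esub> (i :: nat))))"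
      unfolding lift_def by (rule gr_poly_sum[OF comm_group_G sigma(1) finite_G])
    also have "\<dots> = (\<Oplus>\<^bsub>group_ring G\<^esub>\<tau>\<in>carrier G. gr_single \<tau> (a \<tau>))"
      using c by (intro R.finsum_cong') (auto simp: gr_poly_monom[OF comm_group_G sigma(1)] idx)
    finally show ?thesis .
  qed
  also have "\<dots> = (\<lambda>x. \<Sum>\<tau>\<in>carrier G. gr_single \<tau> (a \<tau>) x)"
    by (rule group_ring_finsum[OF comm_group_G finite_G c])
  also have "\<dots> = a"
  proof
    fix x
    show "(\<Sum>\<tau>\<in>carrier G. gr_single \<tau> (a \<tau>) x) = a x"
      using assms finite_G by (auto simp: gr_single_def group_ring_simps(1))
  qed
  finally show ?thesis .
qed

lemma ev_lift:
  assumes "level_char \<psi>"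
  shows "ev (lift a) (val \<psi> \<sigma>) = (\<Sum>\<tau>\<in>carrier G. of_padic_int (a \<tau>) * val \<psi> \<tau>)"
  unfolding lift_def ev_sum
proof (intro sum.cong refl)
  fix \<tau> assume t: "\<tau> \<in> carrier G"
  show "ev (Polynomial.monom (a \<tau>) (SOME i. \<tau> = \<sigma> [^]\<^bsub>G\<^esub> (i :: nat))) (val \<psi> \<sigma>) = of_padic_int (a \<tau>) * val \<psi> \<tau>"
    unfolding ev_simps val_pow[OF assms sigma(1), symmetric] idx[OF t] ..
qed

end

section \<open>The modules attached to a rational character\<close>

lemma subring_iff_subring_on: "subring S (ring_of_type_algebra :: 'a :: field ring) \<longleftrightarrow> subring_on S"
proof
  interpret field "ring_of_type_algebra :: 'a ring" ..
  show "subring_on S" if "subring S (ring_of_type_algebra :: 'a ring)"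
    using subringE[OF that] by unfold_locales auto
  show "subring S (ring_of_type_algebra :: 'a ring)" if "subring_on S"
  proof -
    interpret S: subring_on S by fact
    show ?thesis by (intro subringI) auto
  qed
qed

locale character_module = rational_character chi \<sigma>
  for chi :: "'p :: prime_card gal_char" and \<sigma> +
  fixes M :: "complex set \<Rightarrow> ('p, 'm) gal_module"
  assumes family: "galois_family M"
begin

abbreviation N where "N \<equiv> char_module M chi"
abbreviation \<Phi> where "\<Phi> \<equiv> (rat_poly chi :: 'p padic_int poly)"
abbreviation P where "P \<equiv> padic_poly chi \<sigma>"
abbreviation act where "act f x \<equiv> \<gamma> f \<odot>\<^bsub>N\<^esub> x"

lemma module_N: "Module.module (group_ring G) N"
  by (rule family_level.level_module[OF family_level.intro[OF family rat_field(1)]])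

sublocale N: Module.module "group_ring G" N by (rule module_N)

lemmas gr = gr_poly_closed[OF comm_group_G sigma(1)] gr_poly_add[OF comm_group_G sigma(1)]
  gr_poly_mult[OF comm_group_G sigma(1)] gr_poly_1[OF comm_group_G sigma(1)] gr_poly_0[OF comm_group_G sigma(1)]
  gr_poly_monom[OF comm_group_G sigma(1)]

lemma act_closed: "x \<in> carrier N \<Longrightarrow> act f x \<in> carrier N"
  by (rule N.smult_closed[OF gr(1)])

lemma act_add: "x \<in> carrier N \<Longrightarrow> act (f + h) x = act f x \<oplus>\<^bsub>N\<^esub> act h x"
  unfolding gr(2) by (rule N.smult_l_distr[OF gr(1) gr(1)])

lemma act_right_add: "x \<in> carrier N \<Longrightarrow> y \<in> carrier N \<Longrightarrow> act f (x \<oplus>\<^bsub>N\<^esub> y) = act f x \<oplus>\<^bsub>N\<^esub> act f y"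
  by (rule N.smult_r_distr[OF gr(1)])

lemma act_mult: "x \<in> carrier N \<Longrightarrow> act (f * h) x = act f (act h x)"
  unfolding gr(3) by (rule N.smult_assoc1[OF gr(1) gr(1)])

lemma act_1: "x \<in> carrier N \<Longrightarrow> act 1 x = x"
  unfolding gr(4) by (rule N.smult_one)

lemma act_0: "x \<in> carrier N \<Longrightarrow> act 0 x = \<zero>\<^bsub>N\<^esub>"
  unfolding gr(5) by (rule N.smult_l_null)

lemma act_zero: "act f \<zero>\<^bsub>N\<^esub> = \<zero>\<^bsub>N\<^esub>"
  by (rule N.smult_r_null[OF gr(1)])

lemma act_uminus: "x \<in> carrier N \<Longrightarrow> act (- 1) x = \<ominus>\<^bsub>N\<^esub> x"
proof -
  assume x: "x \<in> carrier N"
  have "act (- 1) x \<oplus>\<^bsub>N\<^esub> x = act (- 1 + 1) x" using act_add[OF x, of "- 1" 1] act_1[OF x] by simp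
  then have "act (- 1) x \<oplus>\<^bsub>N\<^esub> x = \<zero>\<^bsub>N\<^esub>" using act_0[OF x] by simp
  then show ?thesis using N.M.minus_equality[OF _ x act_closed[OF x]] by simp
qed

lemma act_dvd: "h dvd f \<Longrightarrow> x \<in> carrier N \<Longrightarrow> act h x = \<zero>\<^bsub>N\<^esub> \<Longrightarrow> act f x = \<zero>\<^bsub>N\<^esub>"
  by (auto simp: mult.commute[of h] act_mult act_zero elim!: dvdE)

lemma act_cong:
  assumes "h dvd f - f'" "x \<in> carrier N" "act h x = \<zero>\<^bsub>N\<^esub>"
  shows "act f x = act f' x"
proof -
  have "act f x = act ((f - f') + f') x" by simp
  also have "\<dots> = act (f - f') x \<oplus>\<^bsub>N\<^esub> act f' x" by (rule act_add[OF assms(2)])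
  also have "\<dots> = act f' x" using act_dvd[OF assms] act_closed[OF assms(2)] by simp
  finally show ?thesis .
qed

text \<open>The sets that are submodules for the action of \<open>Z_p[X]\<close> through \<open>\<sigma>\<close>. Those killed by
  \<open>P_chi(\<sigma>)\<close> correspond to modules over the quotient ring (\<open>submodule_iff\<close>).\<close>

definition stable :: "'m set \<Rightarrow> bool"
  where "stable S \<longleftrightarrow> S \<subseteq> carrier N \<and> \<zero>\<^bsub>N\<^esub> \<in> S \<and> (\<forall>x\<in>S. \<forall>y\<in>S. x \<oplus>\<^bsub>N\<^esub> y \<in> S) \<and> (\<forall>f. \<forall>x\<in>S. act f x \<in> S)"

lemma stableD:
  assumes "stable S"
  shows "x \<in> S \<Longrightarrow> x \<in> carrier N" "\<zero>\<^bsub>N\<^esub> \<in> S" "x \<in> S \<Longrightarrow> y \<in> S \<Longrightarrow> x \<oplus>\<^bsub>N\<^esub> y \<in> S" "x \<in> S \<Longrightarrow> act f x \<in> S"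
    "x \<in> S \<Longrightarrow> \<ominus>\<^bsub>N\<^esub> x \<in> S"
proof -
  show 1: "x \<in> S \<Longrightarrow> x \<in> carrier N" for x using assms by (auto simp: stable_def)
  show "\<zero>\<^bsub>N\<^esub> \<in> S" "x \<in> S \<Longrightarrow> y \<in> S \<Longrightarrow> x \<oplus>\<^bsub>N\<^esub> y \<in> S" using assms by (auto simp: stable_def)
  show 2: "x \<in> S \<Longrightarrow> act f x \<in> S" for f using assms by (auto simp: stable_def)
  show "x \<in> S \<Longrightarrow> \<ominus>\<^bsub>N\<^esub> x \<in> S" using 2[of "- 1"] act_uminus[OF 1] by simp
qed

lemma stable_annihilated:
  assumes "stable A" shows "stable {x \<in> A. act h x = \<zero>\<^bsub>N\<^esub>}"
proof -
  have "act h (act f x) = \<zero>\<^bsub>N\<^esub>" if "x \<in> A" "act h x = \<zero>\<^bsub>N\<^esub>" for f x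
    using act_mult[of x h f] act_mult[of x f h] that stableD(1)[OF assms] by (simp add: mult.commute act_zero)
  then show ?thesis
    unfolding stable_def using stableD[OF assms] by (auto simp: act_zero act_right_add)
qed

lemma stable_carrier: "stable (carrier N)"
  by (auto simp: stable_def act_closed)

lemma with_scalars_simps:
  "carrier (with_scalars N A s) = A" "\<zero>\<^bsub>with_scalars N A s\<^esub> = \<zero>\<^bsub>N\<^esub>"
  "x \<oplus>\<^bsub>with_scalars N A s\<^esub> y = x \<oplus>\<^bsub>N\<^esub> y" "a \<odot>\<^bsub>with_scalars N A s\<^esub> x = s a x"
  by (simp_all add: with_scalars_def)

lemma abelian_group_stable:
  assumes A: "stable A" shows "abelian_group (with_scalars N A s)"
proof (rule abelian_groupI)
  show "\<exists>y\<in>carrier (with_scalars N A s). y \<oplus>\<^bsub>with_scalars N A s\<^esub> x = \<zero>\<^bsub>with_scalars N A s\<^esub>"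
    if "x \<in> carrier (with_scalars N A s)" for x
    using that stableD[OF A] by (intro bexI[of _ "\<ominus>\<^bsub>N\<^esub> x"]) (auto simp: with_scalars_simps N.M.l_neg)
qed (use stableD[OF A] in \<open>auto simp: with_scalars_simps N.M.a_ac\<close>)

abbreviation I where "I \<equiv> PIdl\<^bsub>group_ring G\<^esub> (\<gamma> \<Phi>)"
abbreviation cls where "cls f \<equiv> I +>\<^bsub>group_ring G\<^esub> \<gamma> f"

lemma ideal_I: "ideal I (group_ring G)"
  by (rule N.R.cgenideal_ideal[OF gr(1)])

lemma carrier_A: "carrier (A_ring chi \<sigma>) = range cls"
proof -
  have "carrier (A_ring chi \<sigma>) = (\<lambda>a. I +>\<^bsub>group_ring G\<^esub> a) ` carrier (group_ring G)"
    by (auto simp: A_ring_def FactRing_def A_RCOSETS_def')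
  also have "carrier (group_ring G :: (_ \<Rightarrow> 'p padic_int) ring) = range \<gamma>"
    using lift_gr_poly gr(1) by (auto simp: image_iff) metis
  finally show ?thesis by (simp add: image_image)
qed

lemma cring_A: "cring (A_ring chi \<sigma>)"
  unfolding A_ring_def by (rule ideal.quotient_is_cring[OF ideal_I N.R.is_cring])

lemma cls_simps:
  "cls f \<oplus>\<^bsub>A_ring chi \<sigma>\<^esub> cls h = cls (f + h)" "cls f \<otimes>\<^bsub>A_ring chi \<sigma>\<^esub> cls h = cls (f * h)"
  "\<one>\<^bsub>A_ring chi \<sigma>\<^esub> = cls 1"
  using ring_hom_add[OF ideal.rcos_ring_hom[OF ideal_I] gr(1) gr(1), of f h]
    ring_hom_mult[OF ideal.rcos_ring_hom[OF ideal_I] gr(1) gr(1), of f h]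
    ring_hom_one[OF ideal.rcos_ring_hom[OF ideal_I]]
  by (simp_all add: A_ring_def gr)

text \<open>A residue class acts through a representative picked by choice. On elements killed by the
  cyclotomic polynomial any other representative, in particular \<open>\<gamma> f\<close>, gives the same result.\<close>

lemma quot_act:
  assumes x: "x \<in> carrier N" "act \<Phi> x = \<zero>\<^bsub>N\<^esub>"
  shows "cls f \<odot>\<^bsub>quot_module N A\<^esub> x = act f x"
proof -
  have "\<gamma> f \<in> cls f"
  proof -
    have z: "\<zero>\<^bsub>group_ring G\<^esub> \<in> I" by (rule additive_subgroup.zero_closed[OF ideal.axioms(1)[OF ideal_I]])
    have "\<gamma> f \<in> {\<zero>\<^bsub>group_ring G\<^esub> \<oplus>\<^bsub>group_ring G\<^esub> \<gamma> f}" unfolding N.R.l_zero[OF gr(1)] by (rule singletonI)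
    then show ?thesis unfolding a_r_coset_def' by (rule UN_I[OF z])
  qed
  then have "(SOME a. a \<in> cls f) \<in> cls f" by (rule someI[of "\<lambda>a. a \<in> cls f"])
  then obtain i where i: "i \<in> I" "(SOME a. a \<in> cls f) = i \<oplus>\<^bsub>group_ring G\<^esub> \<gamma> f"
    by (auto simp: a_r_coset_def')
  obtain a where a: "a \<in> carrier (group_ring G)" "i = a \<otimes>\<^bsub>group_ring G\<^esub> \<gamma> \<Phi>"
    using i(1) by (auto simp: cgenideal_def)
  have "i \<oplus>\<^bsub>group_ring G\<^esub> \<gamma> f = \<gamma> (lift a * \<Phi> + f)"
    unfolding a(2) gr(2,3) lift_gr_poly[OF a(1)] ..
  then have "cls f \<odot>\<^bsub>quot_module N A\<^esub> x = act (lift a * \<Phi> + f) x"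
    using i(2) by (simp add: quot_module_def with_scalars_def)
  also have "\<dots> = act f x"
    using x by (intro act_cong[of \<Phi>]) auto
  finally show ?thesis .
qed

lemma quot_simps:
  "carrier (quot_module N A) = A" "\<zero>\<^bsub>quot_module N A\<^esub> = \<zero>\<^bsub>N\<^esub>"
  "x \<oplus>\<^bsub>quot_module N A\<^esub> y = x \<oplus>\<^bsub>N\<^esub> y"
  by (simp_all add: quot_module_def with_scalars_def)

definition killed :: "'m set \<Rightarrow> bool"
  where "killed A \<longleftrightarrow> stable A \<and> (\<forall>x\<in>A. act \<Phi> x = \<zero>\<^bsub>N\<^esub>)"

lemma killedD:
  assumes "killed A"
  shows "stable A" "x \<in> A \<Longrightarrow> x \<in> carrier N" "x \<in> A \<Longrightarrow> act \<Phi> x = \<zero>\<^bsub>N\<^esub>"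
  using assms stableD(1) by (auto simp: killed_def)

lemma quot_module_module:
  assumes A: "killed A" shows "Module.module (A_ring chi \<sigma>) (quot_module N A)"
proof (rule Module.moduleI)
  note S = stableD[OF killedD(1)[OF A]]
  have q: "cls f \<odot>\<^bsub>quot_module N A\<^esub> x = act f x" if "x \<in> A" for f x
    using quot_act killedD(2,3)[OF A that] by blast
  show "cring (A_ring chi \<sigma>)" by (rule cring_A)
  show "abelian_group (quot_module N A)"
    unfolding quot_module_def by (rule abelian_group_stable[OF killedD(1)[OF A]])
  show "a \<odot>\<^bsub>quot_module N A\<^esub> x \<in> carrier (quot_module N A)"
    if "a \<in> carrier (A_ring chi \<sigma>)" "x \<in> carrier (quot_module N A)" for a x
    using that q S by (auto simp: carrier_A quot_simps)
  show "(a \<oplus>\<^bsub>A_ring chi \<sigma>\<^esub> b) \<odot>\<^bsub>quot_module N A\<^esub> x = a \<odot>\<^bsub>quot_module N A\<^esub> x \<oplus>\<^bsub>quot_module N A\<^esub> b \<odot>\<^bsub>quot_module N A\<^esub> x"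
    if "a \<in> carrier (A_ring chi \<sigma>)" "b \<in> carrier (A_ring chi \<sigma>)" "x \<in> carrier (quot_module N A)" for a b x
    using that q S by (auto simp: carrier_A quot_simps cls_simps act_add)
  show "a \<odot>\<^bsub>quot_module N A\<^esub> (x \<oplus>\<^bsub>quot_module N A\<^esub> y) = a \<odot>\<^bsub>quot_module N A\<^esub> x \<oplus>\<^bsub>quot_module N A\<^esub> a \<odot>\<^bsub>quot_module N A\<^esub> y"
    if "a \<in> carrier (A_ring chi \<sigma>)" "x \<in> carrier (quot_module N A)" "y \<in> carrier (quot_module N A)" for a x y
    using that q S by (auto simp: carrier_A quot_simps act_right_add)
  show "(a \<otimes>\<^bsub>A_ring chi \<sigma>\<^esub> b) \<odot>\<^bsub>quot_module N A\<^esub> x = a \<odot>\<^bsub>quot_module N A\<^esub> (b \<odot>\<^bsub>quot_module N A\<^esub> x)"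
    if "a \<in> carrier (A_ring chi \<sigma>)" "b \<in> carrier (A_ring chi \<sigma>)" "x \<in> carrier (quot_module N A)" for a b x
    using that q S by (auto simp: carrier_A quot_simps cls_simps act_mult)
  show "\<one>\<^bsub>A_ring chi \<sigma>\<^esub> \<odot>\<^bsub>quot_module N A\<^esub> x = x" if "x \<in> carrier (quot_module N A)" for x
    using that q S by (auto simp: quot_simps cls_simps act_1)
qed

lemma submodule_iff:
  assumes A: "killed A"
  shows "submodule S (A_ring chi \<sigma>) (quot_module N A) \<longleftrightarrow> stable S \<and> S \<subseteq> A"
proof
  note SA = stableD[OF killedD(1)[OF A]]
  interpret Q: Module.module "A_ring chi \<sigma>" "quot_module N A" by (rule quot_module_module[OF A])
  have q: "cls f \<odot>\<^bsub>quot_module N A\<^esub> x = act f x" if "x \<in> A" for f x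
    using quot_act killedD(2,3)[OF A that] by blast
  {
    assume sub: "submodule S (A_ring chi \<sigma>) (quot_module N A)"
    note E = Q.submoduleE[OF sub]
    have SA': "S \<subseteq> A" using E(1) by (simp add: quot_simps)
    have act: "act f x \<in> S" if "x \<in> S" for f x
      using E(4)[of "cls f" x] that q[of x f] SA' carrier_A by auto
    obtain x where x: "x \<in> S" using E(2) by blast
    have "act 0 x \<in> S" by (rule act[OF x])
    then have "\<zero>\<^bsub>N\<^esub> \<in> S" using act_0 x SA' SA(1) by auto
    then show "stable S \<and> S \<subseteq> A"
      unfolding stable_def using act E(5) SA' SA(1) by (auto simp: quot_simps)
  }
  {
    assume S: "stable S \<and> S \<subseteq> A"
    then have st: "stable S" and sub: "S \<subseteq> A" by auto
    have inv: "\<ominus>\<^bsub>quot_module N A\<^esub> x = \<ominus>\<^bsub>N\<^esub> x" if "x \<in> S" for x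
    proof -
      have xA: "x \<in> A" using that sub by blast
      have "\<ominus>\<^bsub>N\<^esub> x \<oplus>\<^bsub>quot_module N A\<^esub> x = \<zero>\<^bsub>quot_module N A\<^esub>"
        using SA(1)[OF xA] by (simp add: quot_simps N.M.l_neg)
      then show ?thesis
        using Q.M.minus_equality[of "\<ominus>\<^bsub>N\<^esub> x" x] xA SA(5)[OF xA] by (simp add: quot_simps)
    qed
    show "submodule S (A_ring chi \<sigma>) (quot_module N A)"
    proof (rule Q.submoduleI)
      show "a \<odot>\<^bsub>quot_module N A\<^esub> x \<in> S" if "a \<in> carrier (A_ring chi \<sigma>)" "x \<in> S" for a x
        using that q sub stableD(4)[OF st] by (auto simp: carrier_A)
    qed (use stableD[OF st] sub inv in \<open>auto simp: quot_simps\<close>)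
  }
qed

end

section \<open>The decomposition\<close>

context character_module
begin

lemma alg_rat_eq: "alg_rat M chi \<sigma> = {x \<in> carrier N. act \<Phi> x = \<zero>\<^bsub>N\<^esub>}"
  by (simp add: alg_rat_def annihilated_def)

lemma padic_part_eq: "padic_part M chi \<sigma> A phi = {x \<in> A. act (P phi) x = \<zero>\<^bsub>N\<^esub>}"
  by (simp add: padic_part_def annihilated_def)

lemma killed_alg_rat: "killed (alg_rat M chi \<sigma>)"
  unfolding killed_def alg_rat_eq using stable_annihilated[OF stable_carrier] by auto

text \<open>Each divisibility is read off from values at roots of unity.\<close>

lemma projector_dvd:
  assumes phi: "phi \<in> padic_components chi" and E: "projector phi E"
  shows "P phi dvd E - 1" "\<Phi> dvd P phi * E"
    "phi2 \<in> padic_components chi \<Longrightarrow> phi \<noteq> phi2 \<Longrightarrow> P phi2 dvd E"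
proof -
  have E': "ev E y = (if y \<in> roots_of phi then 1 else 0)" if "prim_root g y" for y :: "'p padic_closure"
    using E that by (simp add: projector_def)
  show "P phi dvd E - 1"
    using E' roots_of_prim[OF phi] by (intro vanishing_dvd_padic[OF phi]) (simp add: ev_simps)
  show "\<Phi> dvd P phi * E"
  proof (rule vanishing_dvd_rat)
    fix y :: "'p padic_closure" assume "prim_root g y"
    then show "ev (P phi * E) y = 0"
      using E'[of y] ev_padic_poly[OF phi, of y] by (cases "y \<in> roots_of phi") (simp_all add: ev_simps)
  qed
  assume phi2: "phi2 \<in> padic_components chi" "phi \<noteq> phi2"
  show "P phi2 dvd E"
  proof (rule vanishing_dvd_padic[OF phi2(1)])
    fix y assume y: "y \<in> roots_of phi2"
    then have "y \<notin> roots_of phi" using roots_of_disjoint[OF phi phi2(1)] phi2(2) by blast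
    then show "ev E y = 0" using E'[OF roots_of_prim[OF phi2(1) y]] by simp
  qed
qed

lemma projector_sum:
  assumes E: "\<And>phi. phi \<in> padic_components chi \<Longrightarrow> projector phi (E phi)"
  shows "\<Phi> dvd (\<Sum>phi\<in>padic_components chi. E phi) - 1"
proof (rule vanishing_dvd_rat)
  fix y :: "'p padic_closure" assume y: "prim_root g y"
  obtain phi where phi: "phi \<in> padic_components chi" "y \<in> roots_of phi" using roots_of_cover[OF y] by blast
  have "ev (E phi2) y = (if phi2 = phi then 1 else 0)" if p: "phi2 \<in> padic_components chi" for phi2
  proof -
    have "y \<in> roots_of phi2 \<longleftrightarrow> phi2 = phi" using roots_of_disjoint[OF p phi(1) _ phi(2)] phi(2) by blast
    moreover have "ev (E phi2) y = (if y \<in> roots_of phi2 then 1 else 0)" using E[OF p] y unfolding projector_def by blast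
    ultimately show ?thesis by (simp only:)
  qed
  then have "(\<Sum>phi2\<in>padic_components chi. ev (E phi2) y) = (\<Sum>phi2\<in>padic_components chi. if phi2 = phi then 1 else 0)"
    by (rule sum.cong[OF refl])
  also have "\<dots> = 1" using phi(1) finite_padic_components by simp
  finally show "ev ((\<Sum>phi\<in>padic_components chi. E phi) - 1) y = 0" by (simp add: ev_simps ev_sum)
qed

lemma padic_part_carrier:
  assumes phi: "phi \<in> padic_components chi"
  shows "padic_part M chi \<sigma> (carrier N) phi = padic_part M chi \<sigma> (alg_rat M chi \<sigma>) phi"
  using act_dvd[OF padic_dvd_rat[OF phi]] by (auto simp: padic_part_eq alg_rat_eq)

text \<open>A projector acts as the identity on the \<open>phi\<close>-part, because \<open>P_phi\<close> divides \<open>E - 1\<close>, and maps everything killed by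
  \<open>P_chi(\<sigma>)\<close> into it.\<close>

lemma projector_image:
  assumes phi: "phi \<in> padic_components chi" and E: "projector phi E"
  shows "padic_part M chi \<sigma> (carrier N) phi = act E ` alg_rat M chi \<sigma>"
proof (intro equalityI subsetI)
  fix x assume x: "x \<in> padic_part M chi \<sigma> (carrier N) phi"
  then have "x \<in> alg_rat M chi \<sigma>" unfolding padic_part_carrier[OF phi] by (simp add: padic_part_eq)
  moreover have "act E x = act 1 x"
    using x projector_dvd(1)[OF phi E] by (intro act_cong) (auto simp: padic_part_eq)
  then have "act E x = x" using x act_1[of x] by (simp add: padic_part_eq)
  ultimately show "x \<in> act E ` alg_rat M chi \<sigma>" by force
next
  fix x assume "x \<in> act E ` alg_rat M chi \<sigma>"
  then obtain y where y: "y \<in> carrier N" "act \<Phi> y = \<zero>\<^bsub>N\<^esub>" "x = act E y" by (auto simp: alg_rat_eq)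
  have "act (P phi) x = act (P phi * E) y" unfolding y(3) by (rule act_mult[OF y(1), symmetric])
  also have "\<dots> = \<zero>\<^bsub>N\<^esub>" by (rule act_dvd[OF projector_dvd(2)[OF phi E] y(1,2)])
  finally show "x \<in> padic_part M chi \<sigma> (carrier N) phi" using y act_closed by (simp add: padic_part_eq)
qed

theorem decomposition:
  assumes A: "killed A"
  shows "internal_direct_sum (A_ring chi \<sigma>) (quot_module N A) (padic_components chi) (padic_part M chi \<sigma> A)"
proof -
  let ?Q = "quot_module N A"
  interpret Q: Module.module "A_ring chi \<sigma>" ?Q by (rule quot_module_module[OF A])
  note S = stableD[OF killedD(1)[OF A]]
  define E where "E phi = (SOME f. projector phi f)" for phi
  have E: "projector phi (E phi)" if "phi \<in> padic_components chi" for phi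
  proof -
    have "\<exists>f. projector phi f" by (rule projector_exists[OF \<open>phi \<in> padic_components chi\<close>]) (rule exI)
    then show ?thesis unfolding E_def by (rule someI_ex)
  qed
  have fs: "(\<Oplus>\<^bsub>?Q\<^esub>i\<in>J. act (E i) x) = act (\<Sum>i\<in>J. E i) x" if J: "finite J" and x: "x \<in> A" for J x
    using J
  proof (induction J rule: finite_induct)
    case empty
    then show ?case using act_0[OF S(1)[OF x]] by (simp add: quot_simps)
  next
    case (insert j J)
    have c: "act (E i) x \<in> carrier ?Q" for i using S(4)[OF x] by (simp add: quot_simps)
    have "(\<Oplus>\<^bsub>?Q\<^esub>i\<in>insert j J. act (E i) x) = act (E j) x \<oplus>\<^bsub>?Q\<^esub> (\<Oplus>\<^bsub>?Q\<^esub>i\<in>J. act (E i) x)"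
      using insert.hyps c by (intro Q.M.finsum_insert) auto
    then show ?case
      using insert act_add[OF S(1)[OF x]] by (simp add: quot_simps)
  qed
  have "bij_betw (\<lambda>f. \<Oplus>\<^bsub>?Q\<^esub>i\<in>padic_components chi. f i)
      (\<Pi>\<^sub>E i\<in>padic_components chi. padic_part M chi \<sigma> A i) (carrier ?Q)"
  proof (rule direct_sum_idempotents[OF Q.abelian_group_axioms finite_padic_components, where e = "\<lambda>i. act (E i)"])
    show "padic_part M chi \<sigma> A i \<subseteq> carrier ?Q" for i by (auto simp: padic_part_eq quot_simps)
    show "act (E i) x \<in> padic_part M chi \<sigma> A i" if "i \<in> padic_components chi" "x \<in> carrier ?Q" for i x
    proof -
      have x: "x \<in> A" using that(2) by (simp add: quot_simps)
      have "act (P i) (act (E i) x) = \<zero>\<^bsub>N\<^esub>"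
        unfolding act_mult[OF S(1)[OF x], symmetric]
        by (rule act_dvd[OF projector_dvd(2)[OF that(1) E[OF that(1)]] S(1)[OF x] killedD(3)[OF A x]])
      then show ?thesis using S(4)[OF x] by (simp add: padic_part_eq)
    qed
    show "act (E i) (x \<oplus>\<^bsub>?Q\<^esub> y) = act (E i) x \<oplus>\<^bsub>?Q\<^esub> act (E i) y" if "x \<in> carrier ?Q" "y \<in> carrier ?Q" for i x y
      using that S(1) by (simp add: quot_simps act_right_add)
    show "act (E i) x = x" if "i \<in> padic_components chi" "x \<in> padic_part M chi \<sigma> A i" for i x
    proof -
      have x: "x \<in> carrier N" "act (P i) x = \<zero>\<^bsub>N\<^esub>" using that(2) S(1) by (auto simp: padic_part_eq)
      show ?thesis using act_cong[OF projector_dvd(1)[OF that(1) E[OF that(1)]] x] act_1[OF x(1)] by simp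
    qed
    show "act (E i) x = \<zero>\<^bsub>?Q\<^esub>" if "i \<in> padic_components chi" "j \<in> padic_components chi" "i \<noteq> j"
      "x \<in> padic_part M chi \<sigma> A j" for i j x
    proof -
      have x: "x \<in> carrier N" "act (P j) x = \<zero>\<^bsub>N\<^esub>" using that(4) S(1) by (auto simp: padic_part_eq)
      show ?thesis
        unfolding quot_simps by (rule act_dvd[OF projector_dvd(3)[OF that(1) E[OF that(1)] that(2,3)] x])
    qed
    show "(\<Oplus>\<^bsub>?Q\<^esub>i\<in>padic_components chi. act (E i) x) = x" if "x \<in> carrier ?Q" for x
    proof -
      have x: "x \<in> A" using that by (simp add: quot_simps)
      have "act (\<Sum>i\<in>padic_components chi. E i) x = act 1 x"
        by (rule act_cong[OF projector_sum[OF E] S(1)[OF x] killedD(3)[OF A x]])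
      then show ?thesis using fs[OF finite_padic_components x] act_1[OF S(1)[OF x]] by simp
    qed
  qed
  moreover have "submodule (padic_part M chi \<sigma> A i) (A_ring chi \<sigma>) ?Q" for i
    unfolding submodule_iff[OF A] padic_part_eq using stable_annihilated[OF killedD(1)[OF A]] by auto
  ultimately show ?thesis using finite_padic_components by (simp add: internal_direct_sum_def)
qed

lemma submodule_killed:
  assumes "submodule S (A_ring chi \<sigma>) (quot_module N (alg_rat M chi \<sigma>))"
  shows "killed S" "S \<subseteq> carrier N"
  using assms submodule_iff[OF killed_alg_rat] killedD(3)[OF killed_alg_rat] stableD(1)
  by (auto simp: killed_def)

section \<open>The semi-simple idempotent\<close>

text \<open>Written as a polynomial in \<open>\<sigma>\<close>, the semi-simple idempotent is a projector for \<open>phi\<close>.\<close>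

theorem semisimple_image:
  assumes phi: "phi \<in> padic_components chi" and psi: "\<psi> \<in> char_terms padic_field phi"
    and psi0: "\<psi>0 \<in> linear_chars" and psip: "\<psi>p \<in> linear_chars"
    and decomp: "\<And>\<tau>. \<tau> \<in> carrier Gab \<Longrightarrow> \<psi> \<tau> = \<psi>0 \<tau> * \<psi>p \<tau>"
    and ord0: "coprime (char_order \<psi>0) CARD('p)" and ordp: "char_order \<psi>p = CARD('p) ^ l"
    and phi0: "\<psi>0 \<in> char_terms padic_field phi0"
    and G0: "subgroup G0 G" and H: "subgroup H G" and prod: "G0 <#>\<^bsub>G\<^esub> H = carrier G"
    and card0: "coprime (card G0) CARD('p)" and cardH: "\<exists>k. card H = CARD('p) ^ k"
  shows "padic_part M chi \<sigma> (carrier N) phi = (\<lambda>x. semisimple_idempotent chi G0 phi0 \<odot>\<^bsub>N\<^esub> x) ` alg_rat M chi \<sigma>"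
proof -
  let ?e = "semisimple_idempotent chi G0 phi0"
  have sub: "G0 \<subseteq> carrier G" by (rule subgroup.subset[OF G0])
  have supp: "?e \<tau> = 0" if "\<tau> \<notin> G0" for \<tau> using that by (simp add: semisimple_idempotent_def)
  then have "{x. ?e x \<noteq> 0} \<subseteq> G0" by blast
  then have e: "?e \<in> carrier (group_ring G)"
    unfolding group_ring_simps(1) using sub finite_subset[OF _ finite_G] by blast
  have "projector phi (lift ?e)"
    unfolding projector_def
  proof (intro allI impI)
    fix y :: "'p padic_closure" assume y: "prim_root g y"
    obtain \<psi>' where p: "\<psi>' \<in> faithful" "val \<psi>' \<sigma> = y" by (rule faithful_surj[OF y])
    have "ev (lift ?e) y = (\<Sum>\<tau>\<in>carrier G. of_padic_int (?e \<tau>) * val \<psi>' \<tau>)"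
      using ev_lift[OF faithful_level(1)[OF p(1)]] p(2) by simp
    also have "\<dots> = (\<Sum>\<tau>\<in>G0. of_padic_int (?e \<tau>) * val \<psi>' \<tau>)"
      by (rule sum.mono_neutral_right[OF finite_G sub]) (simp add: supp)
    also have "\<dots> = (if \<psi>' \<in> char_terms padic_field phi then 1 else 0)"
      by (rule semisimple_value[OF phi psi psi0 psip decomp ord0 ordp phi0 G0 H prod card0 cardH p(1)])
    also have "\<psi>' \<in> char_terms padic_field phi \<longleftrightarrow> y \<in> roots_of phi"
    proof
      assume "\<psi>' \<in> char_terms padic_field phi"
      then show "y \<in> roots_of phi" using p(2) by (auto simp: roots_of_def)
    next
      assume "y \<in> roots_of phi"
      then obtain \<psi>2 where q: "\<psi>2 \<in> char_terms padic_field phi" "y = val \<psi>2 \<sigma>" by (auto simp: roots_of_def)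
      have "\<psi>' = \<psi>2"
        using level_char_ext_sigma faithful_level(1)[OF p(1)]
          faithful_level(1)[OF component_terms(1)[OF phi q(1)]] p(2) q(2) by blast
      then show "\<psi>' \<in> char_terms padic_field phi" using q(1) by simp
    qed
    finally show "ev (lift ?e) y = (if y \<in> roots_of phi then 1 else 0)" .
  qed
  from projector_image[OF phi this] show ?thesis unfolding lift_gr_poly[OF e] .
qed

section \<open>Modules over the ring generated by the roots of unity\<close>

text \<open>All \<open>g\<close>-th roots of unity are powers of \<open>z\<close>.\<close>

lemma carrier_padic_int_mu:
  assumes z: "prim_root g z"
  shows "carrier (padic_int_mu g :: 'p padic_closure ring) = range (\<lambda>f. ev f z)"
    "subring_on (range (\<lambda>f. ev f z))"
proof -
  note a = adjoin_padic[OF z]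
  show s: "subring_on (range (\<lambda>f. ev f z))" using a(1) unfolding adjoin_ev .
  interpret O: field "\<Omega> :: 'p padic_closure ring" ..
  let ?H = "padic_ints \<union> {y :: 'p padic_closure. y ^ g = 1}"
  let ?S = "generate_ring \<Omega> ?H"
  have "?S \<subseteq> range (\<lambda>f. ev f z)"
    using a(2,3) s by (intro O.generate_ring_min_subring1) (auto simp: subring_iff_subring_on adjoin_ev)
  moreover have "range (\<lambda>f. ev f z) \<subseteq> ?S"
  proof (intro image_subsetI)
    interpret S: subring_on ?S
      using O.generate_ring_is_subring[of ?H] by (simp add: subring_iff_subring_on)
    have zS: "z \<in> ?S" using prim_rootD(2)[OF z] by (intro generate_ring.incl) simp
    have cS: "of_padic_int c \<in> ?S" for c by (intro generate_ring.incl) simp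
    show "ev f z \<in> ?S" for f
    proof (induction f rule: poly_monom_induct)
      case (monom c n)
      then show ?case unfolding ev_simps using cS zS by (intro S.mult_in S.power_in)
    qed (auto simp: ev_simps)
  qed
  ultimately show "carrier (padic_int_mu g :: 'p padic_closure ring) = range (\<lambda>f. ev f z)"
    by (auto simp: padic_int_mu_def)
qed

lemma padic_int_mu_simps:
  "a \<oplus>\<^bsub>padic_int_mu n\<^esub> b = a + b" "a \<otimes>\<^bsub>padic_int_mu n\<^esub> b = a * b" "\<one>\<^bsub>padic_int_mu n\<^esub> = 1" "\<zero>\<^bsub>padic_int_mu n\<^esub> = 0"
  by (simp_all add: padic_int_mu_def)

lemma cring_padic_int_mu: "cring (padic_int_mu n :: 'p padic_closure ring)"
proof -
  interpret O: field "\<Omega> :: 'p padic_closure ring" ..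
  have "subcring (generate_ring \<Omega> (padic_ints \<union> {y :: 'p padic_closure. y ^ n = 1})) \<Omega>"
    by (intro O.subcringI' O.generate_ring_is_subring) simp
  then show ?thesis unfolding padic_int_mu_def by (intro O.subcring_iff[THEN iffD1]) (auto dest: subcringE(1))
qed

text \<open>An element \<open>f(\<psi>(\<sigma>))\<close> of the ring has to act as \<open>f(\<sigma>)\<close>, since it is a combination of scalars and
  values of \<open>\<psi>\<close>. This is well defined, because a polynomial vanishing at \<open>\<psi>(\<sigma>)\<close> is a multiple of \<open>P_phi\<close>, and
  \<open>P_phi(\<sigma>)\<close> kills the module.\<close>

theorem unique_mu_structure:
  assumes phi: "phi \<in> padic_components chi" and psi: "\<psi> \<in> char_terms padic_field phi"
    and A: "stable A" "\<And>x. x \<in> A \<Longrightarrow> act (P phi) x = \<zero>\<^bsub>N\<^esub>"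
  shows "\<exists>!s. mu_structure M chi \<psi> A s"
proof -
  let ?R = "padic_int_mu g :: 'p padic_closure ring"
  let ?z = "val \<psi> \<sigma>"
  let ?m = "\<lambda>c n. Polynomial.monom (c :: 'p padic_int) n"
  note S = stableD[OF A(1)]
  have fa: "\<psi> \<in> faithful" by (rule component_terms(1)[OF phi psi])
  note L = faithful_level(1)[OF fa]
  have z: "prim_root g ?z" using val_faithful[OF L] fa by blast
  note car = carrier_padic_int_mu(1)[OF z]
  have wd: "act f x = act h x" if "ev f ?z = ev h ?z" "x \<in> A" for f h x
  proof (rule act_cong)
    show "P phi dvd f - h" using that(1) by (intro vanishing_conj[OF phi psi]) (simp add: ev_simps)
  qed (use S(1) A(2) that(2) in auto)
  have scalar: "of_padic_int a = ev (?m a 0) ?z" "\<gamma> (?m a 0) = gr_single \<one>\<^bsub>G\<^esub> a" for a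
    by (simp_all add: ev_simps gr)
  have group: "val \<psi> (\<sigma> [^]\<^bsub>G\<^esub> i) = ev (?m 1 i) ?z" "\<gamma> (?m 1 i) = gr_single (\<sigma> [^]\<^bsub>G\<^esub> i) 1" for i :: nat
    by (simp_all add: ev_simps gr val_pow[OF L sigma(1)])
  define s where "s = (\<lambda>r\<in>carrier ?R. \<lambda>x\<in>A. act (SOME f. ev f ?z = r) x)"
  have s: "s (ev f ?z) x = act f x" if "x \<in> A" for f x
  proof -
    have "ev (SOME h. ev h ?z = ev f ?z) ?z = ev f ?z" by (rule someI[of "\<lambda>h. ev h ?z = ev f ?z" f]) simp
    then have "act (SOME h. ev h ?z = ev f ?z) x = act f x" by (rule wd[OF _ that])
    moreover have "ev f ?z \<in> carrier ?R" unfolding car by blast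
    ultimately show ?thesis unfolding s_def using that by (simp only: restrict_apply' if_True)
  qed
  have "mu_structure M chi \<psi> A s"
    unfolding mu_structure_def
  proof (intro conjI allI ballI)
    show "s \<in> carrier ?R \<rightarrow>\<^sub>E (A \<rightarrow>\<^sub>E A)"
      unfolding s_def by (intro restrict_PiE_iff[THEN iffD2] ballI S(4))
    show "s (of_padic_int a) x = gr_single \<one>\<^bsub>G\<^esub> a \<odot>\<^bsub>N\<^esub> x" if "x \<in> A" for a x
      unfolding scalar(1) s[OF that] scalar(2) ..
    show "s (val \<psi> \<tau>) x = gr_single \<tau> 1 \<odot>\<^bsub>N\<^esub> x" if t: "\<tau> \<in> carrier G" and x: "x \<in> A" for \<tau> x
    proof -
      obtain i :: nat where i: "\<tau> = \<sigma> [^]\<^bsub>G\<^esub> i" using G_powers[OF t] by blast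
      show ?thesis unfolding i group(1) s[OF x] group(2) ..
    qed
    let ?W = "with_scalars N A s"
    show "Module.module ?R ?W"
    proof (rule Module.moduleI)
      show "cring ?R" by (rule cring_padic_int_mu)
      show "abelian_group ?W" by (rule abelian_group_stable[OF A(1)])
      show "a \<odot>\<^bsub>?W\<^esub> x \<in> carrier ?W" if "a \<in> carrier ?R" "x \<in> carrier ?W" for a x
        using that S(4) by (auto simp: with_scalars_simps car s)
      show "(a \<oplus>\<^bsub>?R\<^esub> b) \<odot>\<^bsub>?W\<^esub> x = a \<odot>\<^bsub>?W\<^esub> x \<oplus>\<^bsub>?W\<^esub> b \<odot>\<^bsub>?W\<^esub> x"
        if "a \<in> carrier ?R" "b \<in> carrier ?R" "x \<in> carrier ?W" for a b x
        using that S by (auto simp: with_scalars_simps padic_int_mu_simps car s act_add ev_simps(1)[symmetric])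
      show "a \<odot>\<^bsub>?W\<^esub> (x \<oplus>\<^bsub>?W\<^esub> y) = a \<odot>\<^bsub>?W\<^esub> x \<oplus>\<^bsub>?W\<^esub> a \<odot>\<^bsub>?W\<^esub> y"
        if "a \<in> carrier ?R" "x \<in> carrier ?W" "y \<in> carrier ?W" for a x y
        using that S by (auto simp: with_scalars_simps car s act_right_add)
      show "(a \<otimes>\<^bsub>?R\<^esub> b) \<odot>\<^bsub>?W\<^esub> x = a \<odot>\<^bsub>?W\<^esub> (b \<odot>\<^bsub>?W\<^esub> x)"
        if "a \<in> carrier ?R" "b \<in> carrier ?R" "x \<in> carrier ?W" for a b x
        using that S by (auto simp: with_scalars_simps padic_int_mu_simps car s act_mult ev_simps(3)[symmetric])
      show "\<one>\<^bsub>?R\<^esub> \<odot>\<^bsub>?W\<^esub> x = x" if "x \<in> carrier ?W" for x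
        using that s[of x 1] S(1) act_1 by (simp add: with_scalars_simps padic_int_mu_simps ev_simps)
    qed
  qed
  moreover have "t = s" if t: "mu_structure M chi \<psi> A t" for t
  proof -
    have dom: "t \<in> carrier ?R \<rightarrow>\<^sub>E (A \<rightarrow>\<^sub>E A)" and mod: "Module.module ?R (with_scalars N A t)"
      and ta: "\<And>a x. x \<in> A \<Longrightarrow> t (of_padic_int a) x = gr_single \<one>\<^bsub>G\<^esub> a \<odot>\<^bsub>N\<^esub> x"
      and tg: "\<And>\<tau> x. \<tau> \<in> carrier G \<Longrightarrow> x \<in> A \<Longrightarrow> t (val \<psi> \<tau>) x = gr_single \<tau> 1 \<odot>\<^bsub>N\<^esub> x"
      using t by (simp_all add: mu_structure_def)
    interpret W: Module.module ?R "with_scalars N A t" by (rule mod)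
    have evc: "ev f ?z \<in> carrier ?R" for f by (simp add: car)
    have val: "t (ev f ?z) x = act f x" if x: "x \<in> A" for f x
    proof (induction f rule: poly_monom_induct)
      case zero
      show ?case
        using W.smult_l_null[of x] x act_0[OF S(1)[OF x]] by (simp add: with_scalars_simps padic_int_mu_simps ev_simps)
    next
      case (monom c n)
      have sn: "\<sigma> [^]\<^bsub>G\<^esub> n \<in> carrier G" by (rule G.nat_pow_closed[OF sigma(1)])
      have tn: "t (ev (?m 1 n) ?z) y = act (?m 1 n) y" if "y \<in> A" for y
        using tg[OF sn that] unfolding group .
      have tc: "t (ev (?m c 0) ?z) y = act (?m c 0) y" if "y \<in> A" for y
        using ta[OF that, of c] unfolding scalar .
      have m: "?m c n = ?m c 0 * ?m 1 n" by (simp add: mult_monom)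
      have "t (ev (?m c n) ?z) x = t (ev (?m c 0) ?z) (t (ev (?m 1 n) ?z) x)"
        unfolding m ev_simps(3) using W.smult_assoc1[OF evc[of "?m c 0"] evc[of "?m 1 n"], of x] x
        by (simp add: with_scalars_simps padic_int_mu_simps)
      also have "\<dots> = act (?m c 0) (act (?m 1 n) x)" unfolding tn[OF x] by (rule tc[OF S(4)[OF x]])
      also have "\<dots> = act (?m c n) x" unfolding m by (rule act_mult[OF S(1)[OF x], symmetric])
      finally show ?case .
    next
      case (add f h)
      have "t (ev (f + h) ?z) x = t (ev f ?z) x \<oplus>\<^bsub>N\<^esub> t (ev h ?z) x"
        unfolding ev_simps(1) using W.smult_l_distr[OF evc[of f] evc[of h], of x] x
        by (simp add: with_scalars_simps padic_int_mu_simps)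
      then show ?case using add act_add[OF S(1)[OF x]] by simp
    qed
    have dom': "s \<in> carrier ?R \<rightarrow>\<^sub>E (A \<rightarrow>\<^sub>E A)"
      using \<open>mu_structure M chi \<psi> A s\<close> by (simp add: mu_structure_def)
    show "t = s"
    proof (rule PiE_ext[OF dom dom'])
      fix r assume r: "r \<in> carrier ?R"
      then obtain f where f: "r = ev f ?z" by (auto simp: car)
      show "t r = s r"
      proof (rule PiE_ext[OF PiE_mem[OF dom r] PiE_mem[OF dom' r]])
        show "t r x = s r x" if "x \<in> A" for x unfolding f val[OF that] s[OF that] ..
      qed
    qed
  qed
  ultimately show ?thesis by (rule ex1I)
qed

end

section \<open>Decomposition of the modules attached to a rational character\<close>

theorem theorem4p1:
  fixes M :: "complex set \<Rightarrow> ('p :: prime_card, 'm) gal_module"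
    and chi :: "'p gal_char"
    and \<sigma> :: "complex \<Rightarrow> complex"
  assumes family: "galois_family M"
    and chi: "chi \<in> irr_chars \<rat>"
    and sigma: "\<sigma> \<in> carrier (rat_group chi)" "carrier (rat_group chi) = generate (rat_group chi) {\<sigma>}"
  shows "Module.module (A_ring chi \<sigma>) (quot_module (char_module M chi) (alg_rat M chi \<sigma>)) \<and>
    internal_direct_sum (A_ring chi \<sigma>) (quot_module (char_module M chi) (alg_rat M chi \<sigma>))
      (padic_components chi) (alg_padic M chi \<sigma>) \<and>
    (\<forall>M'. submodule M' (A_ring chi \<sigma>) (quot_module (char_module M chi) (alg_rat M chi \<sigma>)) \<longrightarrow>
      (\<forall>phi\<in>padic_components chi. padic_part M chi \<sigma> M' phi \<subseteq> alg_padic M chi \<sigma> phi) \<and>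
      internal_direct_sum (A_ring chi \<sigma>) (quot_module (char_module M chi) M')
        (padic_components chi) (padic_part M chi \<sigma> M')) \<and>
    (\<forall>phi\<in>padic_components chi. \<forall>\<psi>\<in>char_terms padic_field phi.
      \<forall>\<psi>\<^sub>0\<in>linear_chars. \<forall>\<psi>\<^sub>p\<in>linear_chars. \<forall>phi\<^sub>0\<in>irr_chars padic_field. \<forall>G\<^sub>0 H.
        (\<forall>\<tau>\<in>carrier Gab. \<psi> \<tau> = \<psi>\<^sub>0 \<tau> * \<psi>\<^sub>p \<tau>) \<and>
        coprime (char_order \<psi>\<^sub>0) CARD('p) \<and> (\<exists>k. char_order \<psi>\<^sub>p = CARD('p) ^ k) \<and>
        \<psi>\<^sub>0 \<in> char_terms padic_field phi\<^sub>0 \<and>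
        subgroup G\<^sub>0 (rat_group chi) \<and> subgroup H (rat_group chi) \<and>
        G\<^sub>0 \<inter> H = {\<one>\<^bsub>rat_group chi\<^esub>} \<and> G\<^sub>0 <#>\<^bsub>rat_group chi\<^esub> H = carrier (rat_group chi) \<and>
        coprime (card G\<^sub>0) CARD('p) \<and> (\<exists>k. card H = CARD('p) ^ k) \<longrightarrow>
        alg_padic M chi \<sigma> phi =
          (\<lambda>x. semisimple_idempotent chi G\<^sub>0 phi\<^sub>0 \<odot>\<^bsub>char_module M chi\<^esub> x) ` alg_rat M chi \<sigma>) \<and>
    (\<forall>phi\<in>padic_components chi. \<forall>\<psi>\<in>char_terms padic_field phi.
      (\<exists>!s. mu_structure M chi \<psi> (alg_padic M chi \<sigma> phi) s) \<and>
      (\<forall>M'. submodule M' (A_ring chi \<sigma>) (quot_module (char_module M chi) (alg_rat M chi \<sigma>)) \<longrightarrow>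
        (\<exists>!s. mu_structure M chi \<psi> (padic_part M chi \<sigma> M' phi) s)))"
proof -
  interpret character_module chi \<sigma> M
    using family chi sigma by unfold_locales auto
  have 1: "internal_direct_sum (A_ring chi \<sigma>) (quot_module N (alg_rat M chi \<sigma>)) (padic_components chi) (alg_padic M chi \<sigma>)"
  proof -
    have "(\<Pi>\<^sub>E i\<in>padic_components chi. padic_part M chi \<sigma> (alg_rat M chi \<sigma>) i) = (\<Pi>\<^sub>E i\<in>padic_components chi. alg_padic M chi \<sigma> i)"
      using padic_part_carrier by (intro PiE_cong) simp
    then show ?thesis
      using decomposition[OF killed_alg_rat] padic_part_carrier by (simp add: internal_direct_sum_def)
  qed
  show ?thesis
  proof (intro conjI allI ballI impI)
    show "Module.module (A_ring chi \<sigma>) (quot_module N (alg_rat M chi \<sigma>))"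
      by (rule quot_module_module[OF killed_alg_rat])
    show "internal_direct_sum (A_ring chi \<sigma>) (quot_module N (alg_rat M chi \<sigma>)) (padic_components chi) (alg_padic M chi \<sigma>)"
      by (rule 1)
  next
    fix M' phi assume "submodule M' (A_ring chi \<sigma>) (quot_module N (alg_rat M chi \<sigma>))"
    from submodule_killed(2)[OF this] show "padic_part M chi \<sigma> M' phi \<subseteq> alg_padic M chi \<sigma> phi"
      by (auto simp: padic_part_eq)
  next
    fix M' assume "submodule M' (A_ring chi \<sigma>) (quot_module N (alg_rat M chi \<sigma>))"
    from decomposition[OF submodule_killed(1)[OF this]]
    show "internal_direct_sum (A_ring chi \<sigma>) (quot_module N M') (padic_components chi) (padic_part M chi \<sigma> M')" .
  next
    fix phi \<psi> \<psi>0 \<psi>p phi0 :: "'p gal_char" and G0 H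
    assume p: "phi \<in> padic_components chi" "\<psi> \<in> char_terms padic_field phi" "\<psi>0 \<in> linear_chars" "\<psi>p \<in> linear_chars"
    assume "(\<forall>\<tau>\<in>carrier Gab. \<psi> \<tau> = \<psi>0 \<tau> * \<psi>p \<tau>) \<and>
        coprime (char_order \<psi>0) CARD('p) \<and> (\<exists>k. char_order \<psi>p = CARD('p) ^ k) \<and>
        \<psi>0 \<in> char_terms padic_field phi0 \<and>
        subgroup G0 (rat_group chi) \<and> subgroup H (rat_group chi) \<and>
        G0 \<inter> H = {\<one>\<^bsub>rat_group chi\<^esub>} \<and> G0 <#>\<^bsub>rat_group chi\<^esub> H = carrier (rat_group chi) \<and>
        coprime (card G0) CARD('p) \<and> (\<exists>k. card H = CARD('p) ^ k)"
    then obtain l where q: "\<forall>\<tau>\<in>carrier Gab. \<psi> \<tau> = \<psi>0 \<tau> * \<psi>p \<tau>"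
      "coprime (char_order \<psi>0) CARD('p)" "char_order \<psi>p = CARD('p) ^ l" "\<psi>0 \<in> char_terms padic_field phi0"
      "subgroup G0 G" "subgroup H G" "G0 <#>\<^bsub>G\<^esub> H = carrier G" "coprime (card G0) CARD('p)" "\<exists>k. card H = CARD('p) ^ k"
      by blast
    show "alg_padic M chi \<sigma> phi = (\<lambda>x. semisimple_idempotent chi G0 phi0 \<odot>\<^bsub>N\<^esub> x) ` alg_rat M chi \<sigma>"
      by (rule semisimple_image[OF p bspec[OF q(1)] q(2-)])
  next
    fix phi \<psi> assume p: "phi \<in> padic_components chi" "\<psi> \<in> char_terms padic_field phi"
    show "\<exists>!s. mu_structure M chi \<psi> (alg_padic M chi \<sigma> phi) s"
      using stable_annihilated[OF stable_carrier, of "P phi"]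
      by (intro unique_mu_structure[OF p]) (auto simp: padic_part_eq)
    fix M' assume "submodule M' (A_ring chi \<sigma>) (quot_module N (alg_rat M chi \<sigma>))"
    note k = killedD(1)[OF submodule_killed(1)[OF this]]
    show "\<exists>!s. mu_structure M chi \<psi> (padic_part M chi \<sigma> M' phi) s"
      using stable_annihilated[OF k, of "P phi"]
      by (intro unique_mu_structure[OF p]) (auto simp: padic_part_eq)
  qed
qed

end
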